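(* Let $k$ be an algebraically closed field of characteristic zero, $G$ a finite group, $a\in Z(G)$, $\chi:G\to k^{\times}$ a linear character with $q:=\chi(a)\neq1$ and $|q|=|\chi|=s$, and let $H=kG(\chi^{-1},a,0)$. Let $i,j\in I$ and $n,t\in\mathbb Z$ with $n\ge t\ge1$. Write $n=r's+p'$ and $t=rs+p$ with $0\le p',p\le s-1$. (1) Suppose $p+p'\le s$. If $p\le p'$, then $$\begin{array}{rl} &V_n(i)\otimes V_t(j)\cong V_t(j)\otimes V_n(i)\\ \cong&\big(\bigoplus_{l\in I}\bigoplus_{m=0}^{r}\bigoplus_{0\le u\le p-1}N_{i,j}^lV_{n+t-1-2ms-2u}(\sigma^{u}(l))\big)\\ &\oplus\big(\bigoplus_{l\in I}\bigoplus_{0\le m\le r-1}\bigoplus_{p\le u\le p'-1}N_{i,j}^lV_{(r+r'-2m)s}(\sigma^{u}(l))\big)\\ &\oplus\big(\bigoplus_{l\in I}\bigoplus_{0\le m\le r-1}\bigoplus_{p'\le u\le p+p'-1}N_{i,j}^lV_{n+t-1-2ms-2u}(\sigma^{u}(l))\big)\\ &\oplus\big(\bigoplus_{l\in I}\bigoplus_{0\le m\le r-1}\bigoplus_{p+p'\le u\le s-1}N_{i,j}^lV_{(r+r'-1-2m)s}(\sigma^{u}(l))\big), \end{array}$$ and if $p\ge p'$, then $$\begin{array}{rl} &V_n(i)\otimes V_t(j)\cong V_t(j)\otimes V_n(i)\\ \cong&\big(\bigoplus_{l\in I}\bigoplus_{m=0}^{r}\bigoplus_{0\le u\le p'-1}N_{i,j}^lV_{n+t-1-2ms-2u}(\sigma^{u}(l))\big)\\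 &\oplus\big(\bigoplus_{l\in I}\bigoplus_{m=0}^{r}\bigoplus_{p'\le u\le p-1}N_{i,j}^lV_{(r+r'-2m)s}(\sigma^{u}(l))\big)\\ &\oplus\big(\bigoplus_{l\in I}\bigoplus_{0\le m\le r-1}\bigoplus_{p\le u\le p+p'-1}N_{i,j}^lV_{n+t-1-2ms-2u}(\sigma^{u}(l))\big)\\ &\oplus\big(\bigoplus_{l\in I}\bigoplus_{0\le m\le r-1}\bigoplus_{p+p'\le u\le s-1}N_{i,j}^lV_{(r+r'-1-2m)s}(\sigma^{u}(l))\big). \end{array}$$ (2) Suppose $p+p'\ge s+1$ and let $\overline m=p+p'-s-1$. If $p\le p'$, then $$\begin{array}{rl} &V_n(i)\otimes V_t(j)\cong V_t(j)\otimes V_n(i)\\ \cong&\big(\bigoplus_{l\in I}\bigoplus_{m=0}^{r}\bigoplus_{u=0}^{\overline m}N_{i,j}^lV_{(r+r'+1-2m)s}(\sigma^{u}(l))\big)\\ &\oplus\big(\bigoplus_{l\in I}\bigoplus_{m=0}^{r}\bigoplus_{u=\overline m+1}^{p-1}N_{i,j}^lV_{n+t-1-2ms-2u}(\sigma^{u}(l))\big)\\ &\oplus\big(\bigoplus_{l\in I}\bigoplus_{0\le m\le r-1}\bigoplus_{p\le u\le p'-1}N_{i,j}^lV_{(r+r'-2m)s}(\sigma^{u}(l))\big)\\ &\oplus\big(\bigoplus_{l\in I}\bigoplus_{0\le m\le r-1}\bigoplus_{u=p'}^{s-1}N_{i,j}^lV_{n+t-1-2ms-2u}(\sigma^{u}(l))\big),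 \end{array}$$ and if $p\ge p'$, then $$\begin{array}{rl} &V_n(i)\otimes V_t(j)\cong V_t(j)\otimes V_n(i)\\ \cong&\big(\bigoplus_{l\in I}\bigoplus_{m=0}^{r}\bigoplus_{u=0}^{\overline m}N_{i,j}^lV_{(r+r'+1-2m)s}(\sigma^{u}(l))\big)\\ &\oplus\big(\bigoplus_{l\in I}\bigoplus_{m=0}^{r}\bigoplus_{u=\overline m+1}^{p'-1}N_{i,j}^lV_{n+t-1-2ms-2u}(\sigma^{u}(l))\big)\\ &\oplus\big(\bigoplus_{l\in I}\bigoplus_{m=0}^{r}\bigoplus_{p'\le u\le p-1}N_{i,j}^lV_{(r+r'-2m)s}(\sigma^{u}(l))\big)\\ &\oplus\big(\bigoplus_{l\in I}\bigoplus_{0\le m\le r-1}\bigoplus_{u=p}^{s-1}N_{i,j}^lV_{n+t-1-2ms-2u}(\sigma^{u}(l))\big). \end{array}$$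
   Context: $k^{\times}=k\setminus\{0\}$; $\hat G$ is the group of linear characters $G\to k^{\times}$; $|\chi|$ is the order of $\chi$ in $\hat G$ and $|q|$ the order of $q$ in $k^{\times}$. For $n\in\mathbb N$ and a module $M$, $nM$ is the direct sum of $n$ copies of $M$ ($0M=0$); direct sums over empty ranges are $0$. $H=kG(\chi^{-1},a,0)$ is the Hopf algebra generated as an algebra by $G$ and $x$ with relations $xg=\chi^{-1}(g)gx$ ($g\in G$) in addition to those of $kG$; it has $k$-basis $\{gx^i\mid g\in G, i\ge 0\}$, and $\Delta(x)=x\otimes a+1\otimes x$, $\varepsilon(x)=0$, $S(x)=-xa^{-1}$, $\Delta(g)=g\otimes g$, $\varepsilon(g)=1$, $S(g)=g^{-1}$. Tensor products of $H$-modules are over $k$, with action through $\Delta$. $\{V_i\mid i\in I\}$ is a complete set of representatives of isomorphism classes of simple $kG$-modules. For $\lambda\in\hat G$, $V_\lambda$ is the corresponding one-dimensional module. $\sigma$ is the permutation of $I$ with $V_\chi\otimes V_i\cong V_{\sigma(i)}$. $N_{i,j}^l$ is the multiplicity of $V_l$ in $V_i\otimes V_j$. For $i\in I$ put $M(V_i)=H\otimes_{kG}V_i$, and for a positive integer $t$ put $V_t(i)=M(V_i)/x^tM(V_i)$ (where $x^tM(V_i)$ is the submodule generated by $x^t\otimes V_i$). *)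

theory Defs
  imports
    "HOL-Computational_Algebra.Polynomial"
    "HOL-Algebra.Module"
    "HOL-Algebra.QuotRing"
    "HOL-Algebra.Multiplicative_Group"
    "HOL-Algebra.Free_Abelian_Groups"
begin

section \<open>Left modules over a ring\<close>

text \<open>
  The locale \<^locale>\<open>module\<close> of HOL-Algebra requires a commutative ring.  The following is its
  analogue for left modules over an arbitrary ring, on the same record type; the fields
  \<^const>\<open>mult\<close> and \<^const>\<open>one\<close> of that record are irrelevant for modules.
\<close>

locale left_module = R?: ring R + M?: abelian_group M
  for R :: "('r, 'e) ring_scheme" (structure) and M :: "('r, 'm, 'f) module_scheme" (structure) +
  assumes smult_closed: "\<lbrakk>r \<in> carrier R; x \<in> carrier M\<rbrakk> \<Longrightarrow> r \<odot>\<^bsub>M\<^esub> x \<in> carrier M"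
    and smult_l_distr: "\<lbrakk>r \<in> carrier R; s \<in> carrier R; x \<in> carrier M\<rbrakk> \<Longrightarrow>
          (r \<oplus>\<^bsub>R\<^esub> s) \<odot>\<^bsub>M\<^esub> x = (r \<odot>\<^bsub>M\<^esub> x) \<oplus>\<^bsub>M\<^esub> (s \<odot>\<^bsub>M\<^esub> x)"
    and smult_r_distr: "\<lbrakk>r \<in> carrier R; x \<in> carrier M; y \<in> carrier M\<rbrakk> \<Longrightarrow>
          r \<odot>\<^bsub>M\<^esub> (x \<oplus>\<^bsub>M\<^esub> y) = (r \<odot>\<^bsub>M\<^esub> x) \<oplus>\<^bsub>M\<^esub> (r \<odot>\<^bsub>M\<^esub> y)"
    and smult_assoc: "\<lbrakk>r \<in> carrier R; s \<in> carrier R; x \<in> carrier M\<rbrakk> \<Longrightarrow>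
          (r \<otimes>\<^bsub>R\<^esub> s) \<odot>\<^bsub>M\<^esub> x = r \<odot>\<^bsub>M\<^esub> (s \<odot>\<^bsub>M\<^esub> x)"
    and smult_one: "x \<in> carrier M \<Longrightarrow> \<one>\<^bsub>R\<^esub> \<odot>\<^bsub>M\<^esub> x = x"

definition module_iso ::
  "('r, 'e) ring_scheme \<Rightarrow> ('r, 'm, 'f) module_scheme \<Rightarrow> ('r, 'n, 'g) module_scheme \<Rightarrow> bool" where
  "module_iso R M N \<longleftrightarrow> (\<exists>\<phi>. bij_betw \<phi> (carrier M) (carrier N) \<and>
     (\<forall>x\<in>carrier M. \<forall>y\<in>carrier M. \<phi> (x \<oplus>\<^bsub>M\<^esub> y) = \<phi> x \<oplus>\<^bsub>N\<^esub> \<phi> y) \<and>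
     (\<forall>r\<in>carrier R. \<forall>x\<in>carrier M. \<phi> (r \<odot>\<^bsub>M\<^esub> x) = r \<odot>\<^bsub>N\<^esub> \<phi> x))"

definition simple_module ::
  "('r, 'e) ring_scheme \<Rightarrow> ('r, 'm, 'f) module_scheme \<Rightarrow> bool" where
  "simple_module R M \<longleftrightarrow> left_module R M \<and> carrier M \<noteq> {\<zero>\<^bsub>M\<^esub>} \<and>
     (\<forall>U. submodule U R M \<longrightarrow> U = {\<zero>\<^bsub>M\<^esub>} \<or> U = carrier M)"

definition submodule_generated ::
  "('r, 'e) ring_scheme \<Rightarrow> ('r, 'm, 'f) module_scheme \<Rightarrow> 'm set \<Rightarrow> 'm set" where
  "submodule_generated R M S = \<Inter>{U. submodule U R M \<and> S \<subseteq> U}"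

definition quotient_module ::
  "('r, 'm, 'f) module_scheme \<Rightarrow> 'm set \<Rightarrow> ('r, 'm set) module" where
  "quotient_module M U =
     \<lparr>carrier = a_rcosets\<^bsub>M\<^esub> U, mult = undefined, one = undefined,
      ring.zero = U, add = (<+>\<^bsub>M\<^esub>),
      smult = (\<lambda>r X. \<Union>x\<in>X. U +>\<^bsub>M\<^esub> (r \<odot>\<^bsub>M\<^esub> x))\<rparr>"

definition direct_sum ::
  "'i set \<Rightarrow> ('i \<Rightarrow> ('r, 'm, 'f) module_scheme) \<Rightarrow> ('r, 'i \<Rightarrow> 'm) module" where
  "direct_sum I M =
     \<lparr>carrier = {f \<in> \<Pi>\<^sub>E i\<in>I. carrier (M i). finite {i \<in> I. f i \<noteq> \<zero>\<^bsub>M i\<^esub>}},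
      mult = undefined, one = undefined,
      ring.zero = (\<lambda>i\<in>I. \<zero>\<^bsub>M i\<^esub>),
      add = (\<lambda>f g. \<lambda>i\<in>I. f i \<oplus>\<^bsub>M i\<^esub> g i),
      smult = (\<lambda>r f. \<lambda>i\<in>I. r \<odot>\<^bsub>M i\<^esub> f i)\<rparr>"

definition direct_sum2 (infixr "\<oplus>\<^sub>M" 65) where
  "(M :: ('r, 'm, 'f) module_scheme) \<oplus>\<^sub>M (N :: ('r, 'n, 'g) module_scheme) =
     \<lparr>carrier = carrier M \<times> carrier N, mult = undefined, one = undefined,
      ring.zero = (\<zero>\<^bsub>M\<^esub>, \<zero>\<^bsub>N\<^esub>),
      add = (\<lambda>(x, y) (x', y'). (x \<oplus>\<^bsub>M\<^esub> x', y \<oplus>\<^bsub>N\<^esub> y')),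
      smult = (\<lambda>r (x, y). (r \<odot>\<^bsub>M\<^esub> x, r \<odot>\<^bsub>N\<^esub> y))\<rparr>"

definition copies :: "nat \<Rightarrow> ('r, 'm, 'f) module_scheme \<Rightarrow> ('r, nat \<Rightarrow> 'm) module" where
  "copies n M = direct_sum {..<n} (\<lambda>_. M)"

lemma simple_module_on_subsets:
  fixes R :: "('r, 'e) ring_scheme" and M :: "('r, 'm, 'f) module_scheme"
  assumes simple: "simple_module R M"
  shows "\<exists>S :: ('r, 'r set) module. simple_module R S \<and> module_iso R M S"
proof -
  interpret left_module R M using simple by (simp add: simple_module_def)
  obtain v where v: "v \<in> carrier M" "v \<noteq> \<zero>\<^bsub>M\<^esub>"
    using simple M.zero_closed by (auto simp: simple_module_def)
  have smult_zero: "r \<odot>\<^bsub>M\<^esub> \<zero>\<^bsub>M\<^esub> = \<zero>\<^bsub>M\<^esub>" if "r \<in> carrier R" for r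
    using smult_r_distr[OF that M.zero_closed M.zero_closed] smult_closed[OF that M.zero_closed]
    by (metis M.add.l_cancel_one M.l_zero M.zero_closed)
  have zero_smult: "\<zero>\<^bsub>R\<^esub> \<odot>\<^bsub>M\<^esub> x = \<zero>\<^bsub>M\<^esub>" if "x \<in> carrier M" for x
    using smult_l_distr[OF R.zero_closed R.zero_closed that] smult_closed[OF R.zero_closed that]
    by (metis M.add.l_cancel_one R.l_zero R.zero_closed)
  have smult_inv: "(\<ominus>\<^bsub>R\<^esub> r) \<odot>\<^bsub>M\<^esub> x = \<ominus>\<^bsub>M\<^esub> (r \<odot>\<^bsub>M\<^esub> x)" if "r \<in> carrier R" "x \<in> carrier M" for r x
    using smult_l_distr[of "\<ominus>\<^bsub>R\<^esub> r" r x] that zero_smult[OF that(2)] smult_closed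
    by (metis M.minus_equality R.a_inv_closed R.l_neg)
  define U where "U = (\<lambda>r. r \<odot>\<^bsub>M\<^esub> v) ` carrier R"
  have "submodule U R M"
  proof (intro submodule.intro subgroup.intro submodule_axioms.intro)
    show "U \<subseteq> carrier (add_monoid M)" using v by (auto simp: U_def smult_closed)
    show "x \<otimes>\<^bsub>add_monoid M\<^esub> y \<in> U" if "x \<in> U" "y \<in> U" for x y
      using that v by (auto simp: U_def smult_l_distr[symmetric])
    show "\<one>\<^bsub>add_monoid M\<^esub> \<in> U" using zero_smult[OF v(1)] by (force simp: U_def)
    show "inv\<^bsub>add_monoid M\<^esub> x \<in> U" if "x \<in> U" for x
      using that v by (auto simp: U_def smult_inv[symmetric] a_inv_def[symmetric])
    show "r \<odot>\<^bsub>M\<^esub> x \<in> U" if "r \<in> carrier R" "x \<in> U" for r x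
      using that v by (auto simp: U_def smult_assoc[symmetric])
  qed
  moreover have "v \<in> U" using v smult_one[OF v(1)] by (force simp: U_def)
  ultimately have U: "U = carrier M" using simple v by (auto simp: simple_module_def)
  define \<phi> where "\<phi> x = {r \<in> carrier R. r \<odot>\<^bsub>M\<^esub> v = x}" for x
  have inj: "inj_on \<phi> (carrier M)"
  proof (rule inj_onI)
    fix x y assume *: "x \<in> carrier M" "\<phi> x = \<phi> y"
    then obtain r where "r \<in> \<phi> x" unfolding U[symmetric] U_def \<phi>_def by auto
    then show "x = y" using * by (auto simp: \<phi>_def)
  qed
  define \<psi> where "\<psi> = inv_into (carrier M) \<phi>"
  have \<psi>[simp]: "\<psi> (\<phi> x) = x" if "x \<in> carrier M" for x
    using inj that by (simp add: \<psi>_def)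
  define S :: "('r, 'r set) module" where
    "S = \<lparr>carrier = \<phi> ` carrier M, mult = undefined, one = undefined, ring.zero = \<phi> \<zero>\<^bsub>M\<^esub>,
          add = (\<lambda>X Y. \<phi> (\<psi> X \<oplus>\<^bsub>M\<^esub> \<psi> Y)), smult = (\<lambda>r X. \<phi> (r \<odot>\<^bsub>M\<^esub> \<psi> X))\<rparr>"
  have S: "carrier S = \<phi> ` carrier M" "\<zero>\<^bsub>S\<^esub> = \<phi> \<zero>\<^bsub>M\<^esub>"
    "\<And>x y. x \<in> carrier M \<Longrightarrow> y \<in> carrier M \<Longrightarrow> \<phi> x \<oplus>\<^bsub>S\<^esub> \<phi> y = \<phi> (x \<oplus>\<^bsub>M\<^esub> y)"
    "\<And>r x. x \<in> carrier M \<Longrightarrow> r \<odot>\<^bsub>S\<^esub> \<phi> x = \<phi> (r \<odot>\<^bsub>M\<^esub> x)"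
    by (simp_all add: S_def)
  have ab: "abelian_group S"
  proof (rule abelian_groupI)
    show "\<exists>Y\<in>carrier S. Y \<oplus>\<^bsub>S\<^esub> X = \<zero>\<^bsub>S\<^esub>" if "X \<in> carrier S" for X
      using that by (auto simp: S M.l_neg intro!: bexI[of _ "\<ominus>\<^bsub>M\<^esub> x" for x])
  qed (auto simp: S M.a_ac)
  have mod: "left_module R S"
    by (intro left_module.intro left_module_axioms.intro ab R.ring_axioms)
      (auto simp: S smult_closed smult_l_distr smult_r_distr smult_assoc smult_one)
  have invS: "\<ominus>\<^bsub>S\<^esub> \<phi> x = \<phi> (\<ominus>\<^bsub>M\<^esub> x)" if "x \<in> carrier M" for x
    using abelian_group.minus_equality[OF ab, of "\<phi> (\<ominus>\<^bsub>M\<^esub> x)" "\<phi> x"] that by (simp add: S M.l_neg)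
  have "W = {\<zero>\<^bsub>S\<^esub>} \<or> W = carrier S" if W: "submodule W R S" for W
  proof -
    interpret W: submodule W R S by (rule W)
    define W' where "W' = {x \<in> carrier M. \<phi> x \<in> W}"
    have "submodule W' R M"
    proof (intro submodule.intro subgroup.intro submodule_axioms.intro)
      show "x \<otimes>\<^bsub>add_monoid M\<^esub> y \<in> W'" if "x \<in> W'" "y \<in> W'" for x y
        using that W.m_closed[of "\<phi> x" "\<phi> y"] by (auto simp: W'_def S)
      show "\<one>\<^bsub>add_monoid M\<^esub> \<in> W'" using W.one_closed by (auto simp: W'_def S)
      show "inv\<^bsub>add_monoid M\<^esub> x \<in> W'" if "x \<in> W'" for x
        using that W.m_inv_closed[of "\<phi> x"]
        by (auto simp: W'_def a_inv_def[symmetric] invS)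
      show "r \<odot>\<^bsub>M\<^esub> x \<in> W'" if "r \<in> carrier R" "x \<in> W'" for r x
        using that W.smult_closed[of r "\<phi> x"] by (auto simp: W'_def S smult_closed)
    qed (auto simp: W'_def)
    then have "W' = {\<zero>\<^bsub>M\<^esub>} \<or> W' = carrier M" using simple by (auto simp: simple_module_def)
    moreover have "W = \<phi> ` W'" using W.subset by (auto simp: W'_def S)
    ultimately show ?thesis by (auto simp: S)
  qed
  moreover have "carrier S \<noteq> {\<zero>\<^bsub>S\<^esub>}"
    using v inj_onD[OF inj _ v(1) M.zero_closed] by (auto simp: S)
  ultimately have "simple_module R S" using mod by (auto simp: simple_module_def)
  moreover have "module_iso R M S"
    unfolding module_iso_def using inj by (intro exI[of _ \<phi>]) (auto simp: S bij_betw_def)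
  ultimately show ?thesis by blast
qed

text \<open>
  Since one cannot quantify over types inside a formula, completeness is stated for the simple
  modules whose elements are subsets of the ring.  By \<open>simple_module_on_subsets\<close> this covers the
  simple modules on every type, up to isomorphism.
\<close>

definition simple_representatives ::
  "('r, 'e) ring_scheme \<Rightarrow> 'i set \<Rightarrow> ('i \<Rightarrow> ('r, 'v) module) \<Rightarrow> bool" where
  "simple_representatives R I V \<longleftrightarrow>
     (\<forall>i\<in>I. simple_module R (V i)) \<and>
     (\<forall>i\<in>I. \<forall>j\<in>I. module_iso R (V i) (V j) \<longrightarrow> i = j) \<and>
     (\<forall>S :: ('r, 'r set) module. simple_module R S \<longrightarrow> (\<exists>i\<in>I. module_iso R S (V i)))"

text \<open>\<open>N l\<close> is the multiplicity of \<open>V l\<close> in the semisimple module \<open>M\<close>, for every \<open>l \<in> I\<close>.\<close>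

definition multiplicities ::
  "('r, 'e) ring_scheme \<Rightarrow> 'i set \<Rightarrow> ('i \<Rightarrow> ('r, 'v) module) \<Rightarrow> ('r, 'm, 'f) module_scheme \<Rightarrow>
   ('i \<Rightarrow> nat) \<Rightarrow> bool" where
  "multiplicities R I V M N \<longleftrightarrow> module_iso R M (direct_sum I (\<lambda>l. copies (N l) (V l)))"


section \<open>Tensor products\<close>

text \<open>
  \<open>M \<otimes>\<^sub>K N\<close> is the free abelian group on \<open>M \<times> N\<close> modulo the usual relators, where the scalars
  \<open>K\<close> act on \<open>M\<close> from the right by \<open>ra\<close> and on \<open>N\<close> from the left by \<open>la\<close>.
\<close>

definition tensor_relators ::
  "'s set \<Rightarrow> ('m \<Rightarrow> 's \<Rightarrow> 'm) \<Rightarrow> ('m, 'e) ring_scheme \<Rightarrow> ('s \<Rightarrow> 'n \<Rightarrow> 'n) \<Rightarrow> ('n, 'f) ring_scheme \<Rightarrow>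
   ('m \<times> 'n \<Rightarrow>\<^sub>0 int) set" where
  "tensor_relators K ra M la N =
     {frag_of (x \<oplus>\<^bsub>M\<^esub> x', y) - frag_of (x, y) - frag_of (x', y) | x x' y.
        x \<in> carrier M \<and> x' \<in> carrier M \<and> y \<in> carrier N} \<union>
     {frag_of (x, y \<oplus>\<^bsub>N\<^esub> y') - frag_of (x, y) - frag_of (x, y') | x y y'.
        x \<in> carrier M \<and> y \<in> carrier N \<and> y' \<in> carrier N} \<union>
     {frag_of (ra x c, y) - frag_of (x, la c y) | x c y.
        x \<in> carrier M \<and> c \<in> K \<and> y \<in> carrier N}"

definition tensor_kernel ::
  "'s set \<Rightarrow> ('m \<Rightarrow> 's \<Rightarrow> 'm) \<Rightarrow> ('m, 'e) ring_scheme \<Rightarrow> ('s \<Rightarrow> 'n \<Rightarrow> 'n) \<Rightarrow> ('n, 'f) ring_scheme \<Rightarrow>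
   ('m \<times> 'n \<Rightarrow>\<^sub>0 int) set" where
  "tensor_kernel K ra M la N =
     generate (free_Abelian_group (carrier M \<times> carrier N)) (tensor_relators K ra M la N)"

definition tensor_group ::
  "'s set \<Rightarrow> ('m \<Rightarrow> 's \<Rightarrow> 'm) \<Rightarrow> ('m, 'e) ring_scheme \<Rightarrow> ('s \<Rightarrow> 'n \<Rightarrow> 'n) \<Rightarrow> ('n, 'f) ring_scheme \<Rightarrow>
   ('m \<times> 'n \<Rightarrow>\<^sub>0 int) set monoid" where
  "tensor_group K ra M la N =
     free_Abelian_group (carrier M \<times> carrier N) Mod tensor_kernel K ra M la N"

definition tensor_class ::
  "'s set \<Rightarrow> ('m \<Rightarrow> 's \<Rightarrow> 'm) \<Rightarrow> ('m, 'e) ring_scheme \<Rightarrow> ('s \<Rightarrow> 'n \<Rightarrow> 'n) \<Rightarrow> ('n, 'f) ring_scheme \<Rightarrow>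
   ('m \<times> 'n \<Rightarrow>\<^sub>0 int) \<Rightarrow> ('m \<times> 'n \<Rightarrow>\<^sub>0 int) set" where
  "tensor_class K ra M la N w =
     tensor_kernel K ra M la N #>\<^bsub>free_Abelian_group (carrier M \<times> carrier N)\<^esub> w"

text \<open>
  On representatives: \<open>(\<Sum> h \<otimes> h') \<cdot> (\<Sum> x \<otimes> y) = \<Sum> (f h x) \<otimes> (g h' y)\<close>.  As for \<^const>\<open>rcoset_mult\<close>,
  operations on classes are obtained below as unions over all representatives.
\<close>

definition tensor_action ::
  "('h \<Rightarrow> 'm \<Rightarrow> 'm) \<Rightarrow> ('h \<Rightarrow> 'n \<Rightarrow> 'n) \<Rightarrow> ('h \<times> 'h \<Rightarrow>\<^sub>0 int) \<Rightarrow> ('m \<times> 'n \<Rightarrow>\<^sub>0 int) \<Rightarrow>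
   ('m \<times> 'n \<Rightarrow>\<^sub>0 int)" where
  "tensor_action f g c w =
     frag_extend (\<lambda>(h, h'). frag_extend (\<lambda>(x, y). frag_of (f h x, g h' y)) w) c"

text \<open>
  An algebra over the field \<open>'k\<close> is a record of type \<^typ>\<open>('k, 'h) module\<close>, whose ring part gives
  the multiplication and whose \<^const>\<open>smult\<close> the scalar multiplication.  The following is the
  algebra \<open>A \<otimes>\<^sub>k A\<close>.
\<close>

abbreviation algebra_tensor_class ::
  "('k, 'h, 'e) module_scheme \<Rightarrow> ('h \<times> 'h \<Rightarrow>\<^sub>0 int) \<Rightarrow> ('h \<times> 'h \<Rightarrow>\<^sub>0 int) set" where
  "algebra_tensor_class A \<equiv> tensor_class (UNIV :: 'k set) (\<lambda>x c. c \<odot>\<^bsub>A\<^esub> x) A (smult A) A"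

definition tensor_algebra ::
  "('k, 'h, 'e) module_scheme \<Rightarrow> ('h \<times> 'h \<Rightarrow>\<^sub>0 int) set ring" where
  "tensor_algebra A =
     (let T = tensor_group (UNIV :: 'k set) (\<lambda>x c. c \<odot>\<^bsub>A\<^esub> x) A (smult A) A
      in \<lparr>carrier = carrier T,
          mult = (\<lambda>X Y. \<Union>c\<in>X. \<Union>d\<in>Y.
                     algebra_tensor_class A (tensor_action (mult A) (mult A) c d)),
          one = algebra_tensor_class A (frag_of (\<one>\<^bsub>A\<^esub>, \<one>\<^bsub>A\<^esub>)),
          ring.zero = \<one>\<^bsub>T\<^esub>,
          add = mult T\<rparr>)"

definition pure_tensor ::
  "('k, 'h, 'e) module_scheme \<Rightarrow> 'h \<Rightarrow> 'h \<Rightarrow> ('h \<times> 'h \<Rightarrow>\<^sub>0 int) set" where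
  "pure_tensor A x y = algebra_tensor_class A (frag_of (x, y))"

record ('k, 'h) hopf_algebra = "('k, 'h) module" +
  comult :: "'h \<Rightarrow> ('h \<times> 'h \<Rightarrow>\<^sub>0 int) set"
  counit :: "'h \<Rightarrow> 'k"
  antipode :: "'h \<Rightarrow> 'h"

text \<open>The \<open>k\<close>-vector space structure of a module over the \<open>k\<close>-algebra \<open>A\<close>.\<close>

definition scalar_mult ::
  "('k, 'h, 'e) module_scheme \<Rightarrow> ('h, 'm, 'f) module_scheme \<Rightarrow> 'k \<Rightarrow> 'm \<Rightarrow> 'm" where
  "scalar_mult A M c x = (c \<odot>\<^bsub>A\<^esub> \<one>\<^bsub>A\<^esub>) \<odot>\<^bsub>M\<^esub> x"

definition tensor_module ::
  "('k, 'h, 'e) hopf_algebra_scheme \<Rightarrow> ('h, 'm, 'f) module_scheme \<Rightarrow> ('h, 'n, 'g) module_scheme \<Rightarrow>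
   ('h, ('m \<times> 'n \<Rightarrow>\<^sub>0 int) set) module" where
  "tensor_module A M N =
     (let ra = (\<lambda>x c. scalar_mult A M c x); la = scalar_mult A N;
          T = tensor_group (UNIV :: 'k set) ra M la N
      in \<lparr>carrier = carrier T, mult = undefined, one = undefined,
          ring.zero = \<one>\<^bsub>T\<^esub>,
          add = mult T,
          smult = (\<lambda>h X. \<Union>c\<in>comult A h. \<Union>w\<in>X.
                     tensor_class UNIV ra M la N (tensor_action (smult M) (smult N) c w))\<rparr>)"

text \<open>The induced module \<open>A \<otimes>\<^sub>B V\<close>, where \<open>B\<close> acts on \<open>A\<close> from the right through \<open>\<iota> : B \<rightarrow> A\<close>.\<close>

definition induced_module ::
  "('h, 'e) ring_scheme \<Rightarrow> ('b, 'f) ring_scheme \<Rightarrow> ('b \<Rightarrow> 'h) \<Rightarrow> ('b, 'v, 'g) module_scheme \<Rightarrow>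
   ('h, ('h \<times> 'v \<Rightarrow>\<^sub>0 int) set) module" where
  "induced_module A B \<iota> V =
     (let ra = (\<lambda>h b. h \<otimes>\<^bsub>A\<^esub> \<iota> b); T = tensor_group (carrier B) ra A (smult V) V
      in \<lparr>carrier = carrier T, mult = undefined, one = undefined,
          ring.zero = \<one>\<^bsub>T\<^esub>,
          add = mult T,
          smult = (\<lambda>h X. \<Union>w\<in>X. tensor_class (carrier B) ra A (smult V) V
                     (frag_extend (\<lambda>(h', v). frag_of (h \<otimes>\<^bsub>A\<^esub> h', v)) w))\<rparr>)"


section \<open>Characters and the group algebra\<close>

definition field_units :: "'k::field monoid" where
  "field_units = \<lparr>carrier = UNIV - {0}, mult = (*), one = 1\<rparr>"

definition character_group :: "('g, 'e) monoid_scheme \<Rightarrow> ('g \<Rightarrow> 'k::field) monoid" where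
  "character_group G =
     \<lparr>carrier = hom G field_units \<inter> extensional (carrier G),
      mult = (\<lambda>\<phi> \<psi>. \<lambda>g\<in>carrier G. \<phi> g * \<psi> g),
      one = (\<lambda>g\<in>carrier G. 1)\<rparr>"

definition group_algebra ::
  "('g, 'e) monoid_scheme \<Rightarrow> ('k::field, 'g \<Rightarrow>\<^sub>0 'k) module" where
  "group_algebra G =
     \<lparr>carrier = {f. Poly_Mapping.keys f \<subseteq> carrier G},
      mult = (\<lambda>f f'. \<Sum>g\<in>Poly_Mapping.keys f. \<Sum>h\<in>Poly_Mapping.keys f'.
                Poly_Mapping.single (g \<otimes>\<^bsub>G\<^esub> h) (Poly_Mapping.lookup f g * Poly_Mapping.lookup f' h)),
      one = Poly_Mapping.single \<one>\<^bsub>G\<^esub> 1,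
      ring.zero = 0, add = (+),
      smult = (\<lambda>c. Poly_Mapping.map ((*) c))\<rparr>"

definition group_hopf_algebra ::
  "('g, 'e) monoid_scheme \<Rightarrow> ('k::field, 'g \<Rightarrow>\<^sub>0 'k) hopf_algebra" where
  "group_hopf_algebra G =
     module.extend (group_algebra G) (hopf_algebra.fields
       (\<lambda>f. \<Oplus>\<^bsub>tensor_algebra (group_algebra G)\<^esub>g\<in>Poly_Mapping.keys f.
          pure_tensor (group_algebra G) (Poly_Mapping.single g (Poly_Mapping.lookup f g))
            (Poly_Mapping.single g 1))
       (\<lambda>f. \<Sum>g\<in>Poly_Mapping.keys f. Poly_Mapping.lookup f g)
       (\<lambda>f. \<Sum>g\<in>Poly_Mapping.keys f. Poly_Mapping.single (inv\<^bsub>G\<^esub> g) (Poly_Mapping.lookup f g)))"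

definition character_module :: "('g \<Rightarrow> 'k::field) \<Rightarrow> ('g \<Rightarrow>\<^sub>0 'k, 'k) module" where
  "character_module \<phi> =
     \<lparr>carrier = UNIV, mult = undefined, one = undefined, ring.zero = 0, add = (+),
      smult = (\<lambda>f c. (\<Sum>g\<in>Poly_Mapping.keys f. Poly_Mapping.lookup f g * \<phi> g) * c)\<rparr>"


section \<open>The Hopf algebra $kG(\chi^{-1}, a, 0)$ and its modules $V_t(i)$\<close>

text \<open>
  The basis element \<open>g x\<^sup>i\<close> is represented by \<open>single (g, i) 1\<close>.  The relation
  \<open>x h = \<chi>\<^sup>-\<^sup>1(h) h x\<close> gives \<open>(g x\<^sup>i) (h x\<^sup>j) = \<chi>\<^sup>-\<^sup>1(h)\<^sup>i (g h) x\<^sup>i\<^sup>+\<^sup>j\<close>.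
\<close>

definition ore_algebra ::
  "('g, 'e) monoid_scheme \<Rightarrow> ('g \<Rightarrow> 'k::field) \<Rightarrow> ('k, 'g \<times> nat \<Rightarrow>\<^sub>0 'k) module" where
  "ore_algebra G \<chi> =
     \<lparr>carrier = {f. Poly_Mapping.keys f \<subseteq> carrier G \<times> UNIV},
      mult = (\<lambda>f f'. \<Sum>(g, i)\<in>Poly_Mapping.keys f. \<Sum>(h, j)\<in>Poly_Mapping.keys f'.
                Poly_Mapping.single (g \<otimes>\<^bsub>G\<^esub> h, i + j)
                  (Poly_Mapping.lookup f (g, i) * Poly_Mapping.lookup f' (h, j) * inverse (\<chi> h) ^ i)),
      one = Poly_Mapping.single (\<one>\<^bsub>G\<^esub>, 0) 1,
      ring.zero = 0, add = (+),
      smult = (\<lambda>c. Poly_Mapping.map ((*) c))\<rparr>"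

text \<open>
  \<open>\<Delta>\<close>, \<open>\<epsilon>\<close> and \<open>S\<close> are given on the basis by \<open>\<Delta>(g x\<^sup>i) = (g \<otimes> g) (x \<otimes> a + 1 \<otimes> x)\<^sup>i\<close>,
  \<open>\<epsilon>(g x\<^sup>i) = 0\<^sup>i\<close> and \<open>S(g x\<^sup>i) = (- x a\<^sup>-\<^sup>1)\<^sup>i g\<^sup>-\<^sup>1\<close>.
\<close>

definition hopf_ore ::
  "('g, 'e) monoid_scheme \<Rightarrow> ('g \<Rightarrow> 'k::field) \<Rightarrow> 'g \<Rightarrow> ('k, 'g \<times> nat \<Rightarrow>\<^sub>0 'k) hopf_algebra" where
  "hopf_ore G \<chi> a =
     (let A = ore_algebra G \<chi>; T = tensor_algebra A;
          el = (\<lambda>g. Poly_Mapping.single (g, 0) 1);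
          x = Poly_Mapping.single (\<one>\<^bsub>G\<^esub>, 1) 1;
          \<Delta>x = pure_tensor A x (el a) \<oplus>\<^bsub>T\<^esub> pure_tensor A \<one>\<^bsub>A\<^esub> x;
          Sx = \<ominus>\<^bsub>A\<^esub> (x \<otimes>\<^bsub>A\<^esub> el (inv\<^bsub>G\<^esub> a))
      in module.extend A (hopf_algebra.fields
           (\<lambda>f. \<Oplus>\<^bsub>T\<^esub>b\<in>Poly_Mapping.keys f.
              pure_tensor A (Poly_Mapping.lookup f b \<odot>\<^bsub>A\<^esub> el (fst b)) (el (fst b))
                \<otimes>\<^bsub>T\<^esub> (\<Delta>x [^]\<^bsub>T\<^esub> snd b))
           (\<lambda>f. \<Sum>b\<in>Poly_Mapping.keys f. Poly_Mapping.lookup f b * 0 ^ snd b)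
           (\<lambda>f. \<Sum>b\<in>Poly_Mapping.keys f.
              Poly_Mapping.lookup f b \<odot>\<^bsub>A\<^esub> ((Sx [^]\<^bsub>A\<^esub> snd b) \<otimes>\<^bsub>A\<^esub> el (inv\<^bsub>G\<^esub> (fst b))))))"

definition group_algebra_incl :: "('g \<Rightarrow>\<^sub>0 'k::field) \<Rightarrow> ('g \<times> nat \<Rightarrow>\<^sub>0 'k)" where
  "group_algebra_incl f =
     (\<Sum>g\<in>Poly_Mapping.keys f. Poly_Mapping.single (g, 0) (Poly_Mapping.lookup f g))"

text \<open>\<open>M(V) = H \<otimes>\<^bsub>kG\<^esub> V\<close>, its subset \<open>x\<^sup>t \<otimes> V\<close>, and \<open>M(V) / x\<^sup>t M(V)\<close>.\<close>

definition verma_module ::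
  "('g, 'e) monoid_scheme \<Rightarrow> ('g \<Rightarrow> 'k::field) \<Rightarrow> 'g \<Rightarrow> ('g \<Rightarrow>\<^sub>0 'k, 'v, 'f) module_scheme \<Rightarrow>
   ('g \<times> nat \<Rightarrow>\<^sub>0 'k, (('g \<times> nat \<Rightarrow>\<^sub>0 'k) \<times> 'v \<Rightarrow>\<^sub>0 int) set) module" where
  "verma_module G \<chi> a V = induced_module (hopf_ore G \<chi> a) (group_algebra G) group_algebra_incl V"

definition x_power_tensors ::
  "('g, 'e) monoid_scheme \<Rightarrow> ('g \<Rightarrow> 'k::field) \<Rightarrow> 'g \<Rightarrow> ('g \<Rightarrow>\<^sub>0 'k, 'v, 'f) module_scheme \<Rightarrow>
   nat \<Rightarrow> (('g \<times> nat \<Rightarrow>\<^sub>0 'k) \<times> 'v \<Rightarrow>\<^sub>0 int) set set" where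
  "x_power_tensors G \<chi> a V t =
     {tensor_class (carrier (group_algebra G :: ('k, 'g \<Rightarrow>\<^sub>0 'k) module))
        (\<lambda>h b. h \<otimes>\<^bsub>hopf_ore G \<chi> a\<^esub> group_algebra_incl b) (hopf_ore G \<chi> a) (smult V) V
        (frag_of (Poly_Mapping.single (\<one>\<^bsub>G\<^esub>, 1) 1 [^]\<^bsub>hopf_ore G \<chi> a\<^esub> t, v)) | v. v \<in> carrier V}"

definition truncated_verma ::
  "('g, 'e) monoid_scheme \<Rightarrow> ('g \<Rightarrow> 'k::field) \<Rightarrow> 'g \<Rightarrow> nat \<Rightarrow>
   ('g \<Rightarrow>\<^sub>0 'k, 'v, 'f) module_scheme \<Rightarrow>
   ('g \<times> nat \<Rightarrow>\<^sub>0 'k, (('g \<times> nat \<Rightarrow>\<^sub>0 'k) \<times> 'v \<Rightarrow>\<^sub>0 int) set set) module" where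
  "truncated_verma G \<chi> a t V =
     quotient_module (verma_module G \<chi> a V)
       (submodule_generated (hopf_ore G \<chi> a) (verma_module G \<chi> a V) (x_power_tensors G \<chi> a V t))"

end

theory Submission
  imports Defs
begin

text \<open>
  The module \<open>V\<^sub>n(i) \<otimes> V\<^sub>t(j)\<close> is an \<open>n \<times> t\<close> box of copies of the \<open>kG\<close>-module \<open>P = V\<^sub>i \<otimes> V\<^sub>j\<close>, spanned by
  \<open>x\<^sup>k V\<^sub>i \<otimes> x\<^sup>l V\<^sub>j\<close>.  Once these copies are identified with \<open>P\<close> through suitable powers of the central element
  \<open>a\<close>, the generator \<open>x\<close> acts by scalars only, namely as multiplication by \<open>y + z\<close> on the quantum plane modulo
  \<open>y\<^sup>n\<close> and \<open>z\<^sup>t\<close>.  This operator has a homogeneous Jordan basis with exactly one string starting in each degree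
  \<open>d < t\<close>; its length depends on \<open>d div s\<close> and \<open>d mod s\<close> only, and is the same for \<open>q\<close> and \<open>q\<^sup>-\<^sup>1\<close>, that is for both
  orders of the tensor factors.  A string of length \<open>L\<close> starting in degree \<open>d\<close> contributes a copy of \<open>V\<^sub>L(\<sigma>\<^sup>d(l))\<close> for
  every summand \<open>V\<^sub>l\<close> of \<open>P\<close>, and \<open>\<chi>\<^sup>s = 1\<close> reduces \<open>\<sigma>\<^sup>d\<close> to \<open>\<sigma>\<^bsup>d mod s\<^esup>\<close>.
\<close>

text \<open>The obstacle is that q is a root of unity: Gaussian binomials vanish, and lowest weight
  vectors can be found directly only while the degrees involved stay below s. The way out is (y +
  z)^s = y^s + z^s. On commutative forms in Y = y^s and Z = z^s the power (y + z)^s is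
  multiplication by Y + Z, which is the case q = 1 and is settled by linear algebra in
  characteristic zero. The degree is therefore written as ms + u, with a form of degree m
  responsible for ms. For some residues u a form times one monomial suffices, and the string length
  is a multiple of s. The other residues come in pairs u, p + p' - 1 - u, where the two halves of a
  power of y + z need different forms, reconciled by adding multiples of y + z. Such corrections are
  harmless because a generator is only required to have a nonzero coordinate modulo y + z, where
  each degree is a line spanned by z^d. This already makes the strings span the box; independence is
  obtained by counting, since their lengths add up to nt.\<close>

lemma underdetermined_system:
  fixes M :: "'a => 'b => 'k::field"
  assumes "finite E" "finite J" "card E < card J"
  shows "\<exists>x. (\<exists>j\<in>J. x j \<noteq> 0) \<and> (\<forall>e\<in>E. (\<Sum>j\<in>J. M e j * x j) = 0)"
  using assms
proof (induction E arbitrary: M J rule: finite_induct)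
  case empty
  then have "J \<noteq> {}" by auto
  then show ?case by (intro exI[of _ "\<lambda>_. 1"]) auto
next
  case (insert e E)
  show ?case
  proof (cases "\<forall>j\<in>J. M e j = 0")
    case True
    have "card E < card J" using insert by simp
    from insert.IH[OF insert.prems(1) this, of M] True show ?thesis by auto
  next
    case False
    then obtain j0 where j0: "j0 \<in> J" "M e j0 \<noteq> 0" by auto
    \<comment> \<open>Elimination of the unknown j0, with row e as pivot row.\<close>
    define M' where "M' f j = M f j - M f j0 * M e j / M e j0" for f j
    have "card E < card (J - {j0})" using insert j0 by simp
    from insert.IH[OF _ this, of M'] insert.prems obtain x where
      x: "\<exists>j\<in>J - {j0}. x j \<noteq> 0" "\<forall>f\<in>E. (\<Sum>j\<in>J - {j0}. M' f j * x j) = 0" by auto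
    define c where "c = - (\<Sum>j\<in>J - {j0}. M e j * x j) / M e j0"
    define y where "y = x(j0 := c)"
    have S: "(\<Sum>j\<in>J. M f j * y j) = M f j0 * c + (\<Sum>j\<in>J - {j0}. M f j * x j)" for f
      using j0 insert.prems by (subst sum.remove[of _ j0]) (auto simp: y_def intro!: sum.cong)
    have "(\<Sum>j\<in>J. M e j * y j) = 0"
      using j0 by (simp add: S c_def)
    moreover have "(\<Sum>j\<in>J. M f j * y j) = 0" if "f \<in> E" for f
    proof -
      have "(\<Sum>j\<in>J - {j0}. M' f j * x j) =
        (\<Sum>j\<in>J - {j0}. M f j * x j) - M f j0 / M e j0 * (\<Sum>j\<in>J - {j0}. M e j * x j)"
        by (simp add: M'_def algebra_simps sum_subtractf sum_distrib_left)
      then show ?thesis using x(2) that unfolding S c_def by (simp add: algebra_simps)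
    qed
    ultimately show ?thesis using x(1) by (intro exI[of _ y]) (auto simp: y_def)
  qed
qed

section \<open>The quantum plane\<close>

text \<open>
  \<open>f k l\<close> is the coefficient of \<open>y\<^sup>k z\<^sup>l\<close> in the quantum plane \<open>z y = q y z\<close>;
  \<open>xop q\<close> is left multiplication by \<open>y + z\<close>.
\<close>

datatype 'k plane = Plane (coef: "nat => nat => 'k")

instantiation plane :: (field) ab_group_add
begin

definition zero_plane where "0 = Plane (\<lambda>k l. 0)"
definition plus_plane where "f + g = Plane (\<lambda>k l. coef f k l + coef g k l)"
definition minus_plane where "f - g = Plane (\<lambda>k l. coef f k l - coef g k l)"
definition uminus_plane where "- f = Plane (\<lambda>k l. - coef f k l)"

instance
  by standard (simp_all add: zero_plane_def plus_plane_def minus_plane_def uminus_plane_def algebra_simps)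

end

lemma coef_simps [simp]:
  "coef 0 k l = 0" "coef (f + g) k l = coef f k l + coef g k l"
  "coef (f - g) k l = coef f k l - coef g k l"
  by (simp_all add: zero_plane_def plus_plane_def minus_plane_def)

lemma planeI: "(\<And>k l. coef f k l = coef g k l) ==> f = g"
  by (cases f, cases g) (auto simp: fun_eq_iff)

lemma sum_plane_apply: "coef (\<Sum>i\<in>A. f i) k l = (\<Sum>i\<in>A. coef (f i) k l)"
  by (induction A rule: infinite_finite_induct) auto

definition scl :: "'k::field => 'k plane => 'k plane" where
  "scl c f = Plane (\<lambda>k l. c * coef f k l)"

definition pmono :: "nat => nat => 'k::field plane" where
  "pmono a b = Plane (\<lambda>k l. if k = a \<and> l = b then 1 else 0)"

definition yop :: "'k::field plane => 'k plane" where
  "yop f = Plane (\<lambda>k l. if k = 0 then 0 else coef f (k - 1) l)"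

text \<open>The factor q^k arises from moving z past y^k, so that the result is again normally
  ordered.\<close>

definition zop :: "'k::field => 'k plane => 'k plane" where
  "zop q f = Plane (\<lambda>k l. if l = 0 then 0 else q ^ k * coef f k (l - 1))"

definition xop :: "'k::field => 'k plane => 'k plane" where
  "xop q f = yop f + zop q f"

definition homog :: "nat => 'k::field plane => bool" where
  "homog d f \<longleftrightarrow> (\<forall>k l. coef f k l \<noteq> 0 \<longrightarrow> k + l = d)"

text \<open>Homogeneous of degree \<open>d - 1\<close>, which for \<open>d = 0\<close> means zero.\<close>

definition homog_pred :: "nat => 'k::field plane => bool" where
  "homog_pred d f \<longleftrightarrow> (\<forall>k l. coef f k l \<noteq> 0 \<longrightarrow> Suc (k + l) = d)"

text \<open>Zero modulo y^A and z^B. The plane itself is never truncated, so that y + z acts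
  injectively on it; only this predicate knows about a box.\<close>

definition vanishes :: "nat => nat => 'k::field plane => bool" where
  "vanishes A B f \<longleftrightarrow> (\<forall>k<A. \<forall>l<B. coef f k l = 0)"

lemmas plane_defs = scl_def pmono_def yop_def zop_def xop_def homog_def homog_pred_def vanishes_def

lemma xop_add: "xop q (f + g) = xop q f + xop q g"
  by (rule planeI) (simp add: plane_defs algebra_simps)
lemma xop_diff: "xop q (f - g) = xop q f - xop q g"
  by (rule planeI) (simp add: plane_defs algebra_simps)
lemma xop_scl: "xop q (scl c f) = scl c (xop q f)"
  by (rule planeI) (simp add: plane_defs algebra_simps)
lemma xop_0 [simp]: "xop q 0 = 0"
  by (rule planeI) (simp add: plane_defs)
lemma xop_sum: "xop q (\<Sum>i\<in>A. f i) = (\<Sum>i\<in>A. xop q (f i))"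
  by (induction A rule: infinite_finite_induct) (simp_all add: xop_add)

lemma xpow_add: "(xop q ^^ n) (f + g) = (xop q ^^ n) f + (xop q ^^ n) g"
  by (induction n) (simp_all add: xop_add)
lemma xpow_diff: "(xop q ^^ n) (f - g) = (xop q ^^ n) f - (xop q ^^ n) g"
  by (induction n) (simp_all add: xop_diff)
lemma xpow_scl: "(xop q ^^ n) (scl c f) = scl c ((xop q ^^ n) f)"
  by (induction n) (simp_all add: xop_scl)
lemma xpow_0 [simp]: "(xop q ^^ n) 0 = 0"
  by (induction n) simp_all
lemma xpow_sum: "(xop q ^^ n) (\<Sum>i\<in>A. f i) = (\<Sum>i\<in>A. (xop q ^^ n) (f i))"
  by (induction A rule: infinite_finite_induct) (simp_all add: xpow_add)

lemma homog_xop: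
  assumes "homog d f"
  shows "homog (Suc d) (xop q f)"
  unfolding homog_def
proof (intro allI impI)
  fix k l assume "coef (xop q f) k l \<noteq> 0"
  then consider "k > 0" "coef f (k - 1) l \<noteq> 0" | "l > 0" "coef f k (l - 1) \<noteq> 0"
    by (cases "coef f (k - 1) l = 0"; cases "coef f k (l - 1) = 0")
      (auto simp: xop_def yop_def zop_def split: if_splits)
  then show "k + l = Suc d"
  proof cases
    case 1
    then have "k - 1 + l = d" using assms unfolding homog_def by blast
    then show ?thesis using 1 by simp
  next
    case 2
    then have "k + (l - 1) = d" using assms unfolding homog_def by blast
    then show ?thesis using 2 by simp
  qed
qed

lemma homog_xpow: "homog d f ==> homog (n + d) ((xop q ^^ n) f)"
  by (induction n) (auto intro: homog_xop)

lemma homog_pred_xop: "homog_pred d f ==> homog d (xop q f)"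
proof -
  assume *: "homog_pred d f"
  show ?thesis
  proof (cases d)
    case 0
    then have "f = 0" using * by (auto simp: homog_pred_def intro: planeI)
    then show ?thesis by (simp add: homog_def)
  next
    case (Suc d')
    then have "homog d' f" using * by (auto simp: homog_pred_def homog_def)
    then show ?thesis using homog_xop Suc by blast
  qed
qed

lemma homog_pred_Suc: "homog_pred (Suc d) f \<longleftrightarrow> homog d f"
  by (auto simp: homog_def homog_pred_def)
lemma homog_pred_0: "homog_pred 0 f \<longleftrightarrow> f = 0"
  by (auto simp: homog_pred_def intro: planeI)

lemma homog_add: "homog d f ==> homog d g ==> homog d (f + g)"
  unfolding homog_def by (metis add.right_neutral coef_simps(2))
lemma homog_diff: "homog d f ==> homog d g ==> homog d (f - g)"
  unfolding homog_def by (metis diff_zero coef_simps(3))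
lemma homog_scl: "homog d f ==> homog d (scl c f)"
  by (auto simp: homog_def scl_def)
lemma homog_pred_add: "homog_pred d f ==> homog_pred d g ==> homog_pred d (f + g)"
  unfolding homog_pred_def by (metis add.right_neutral coef_simps(2))
lemma homog_pred_diff: "homog_pred d f ==> homog_pred d g ==> homog_pred d (f - g)"
  unfolding homog_pred_def by (metis diff_zero coef_simps(3))
lemma homog_pred_scl: "homog_pred d f ==> homog_pred d (scl c f)"
  by (auto simp: homog_pred_def scl_def)
lemma homog_pmono: "homog (a + b) (pmono a b)"
  by (auto simp: homog_def pmono_def)

lemma homog_0 [simp]: "homog d 0" "homog_pred d 0"
  by (auto simp: homog_def homog_pred_def)

lemma homog_sum: "(\<And>i. i \<in> A ==> homog d (f i)) ==> homog d (\<Sum>i\<in>A. f i)"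
  by (induction A rule: infinite_finite_induct) (auto intro: homog_add)
lemma homog_pred_sum: "(\<And>i. i \<in> A ==> homog_pred d (f i)) ==> homog_pred d (\<Sum>i\<in>A. f i)"
  by (induction A rule: infinite_finite_induct) (auto intro: homog_pred_add)

text \<open>In the coefficient of y^(k+1) z^l the y-part contributes the coefficient at (k, l)
  itself, while the z-part involves only a smaller exponent of z.\<close>

lemma xop_inject0: "xop q f = 0 ==> f = 0"
proof -
  assume *: "xop q f = 0"
  have c: "coef f k l = 0" for k l
  proof (induction l arbitrary: k)
    case 0
    from arg_cong[OF *, of "\<lambda>f. coef f (Suc k) 0"] show ?case by (simp add: plane_defs)
  next
    case (Suc l)
    from arg_cong[OF *, of "\<lambda>f. coef f (Suc k) (Suc l)"] Suc show ?case by (simp add: plane_defs)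
  qed
  then show ?thesis by (intro planeI) simp
qed

lemma xpow_inject0: "(xop q ^^ n) f = 0 ==> f = 0"
  by (induction n) (auto dest: xop_inject0)

subsection \<open>Division by \<open>y + z\<close>\<close>

text \<open>c is the coordinate of w modulo multiples of y + z: in degree d this quotient is the
  line spanned by z^d. That c is determined by w comes from \<open>leads_0\<close>.\<close>

definition leads :: "'k::field => nat => 'k => 'k plane => bool" where
  "leads q d c w \<longleftrightarrow> (\<exists>g. w = scl c (pmono 0 d) + xop q g \<and> homog_pred d g)"

lemma leadsI: "w = scl c (pmono 0 d) + xop q g ==> homog_pred d g ==> leads q d c w"
  unfolding leads_def by (rule exI, rule conjI)

lemma leadsE:
  assumes "leads q d c w"
  obtains g where "w = scl c (pmono 0 d) + xop q g" "homog_pred d g"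
  using assms unfolding leads_def by (elim exE conjE)

text \<open>y^(k+1) z^l = (y + z) y^k z^l - q^k y^k z^(l+1), so one y is traded for one z at the
  cost of the factor -q^k.\<close>

lemma pmono_division: "leads q (k + l) (\<Prod>i<k. - (q ^ i)) (pmono k l)"
proof (induction k arbitrary: l)
  case 0
  have "pmono 0 l = scl 1 (pmono 0 l) + xop q 0" by (rule planeI) (simp add: plane_defs)
  then show ?case by (intro leadsI[of _ _ _ _ 0]) simp_all
next
  case (Suc k)
  obtain g where g: "pmono k (Suc l) = scl (\<Prod>i<k. - (q ^ i)) (pmono 0 (k + Suc l)) + xop q g"
    "homog_pred (k + Suc l) g" by (rule leadsE[OF Suc[of "Suc l"]])
  have "xop q (pmono k l) = pmono (Suc k) l + scl (q ^ k) (pmono k (Suc l))"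
    by (rule planeI) (auto simp: plane_defs)
  then have "pmono (Suc k) l = xop q (pmono k l) - scl (q ^ k) (pmono k (Suc l))"
    by (simp add: algebra_simps)
  also have "\<dots> = scl (\<Prod>i<Suc k. - (q ^ i)) (pmono 0 (Suc k + l)) + xop q (pmono k l - scl (q ^ k) g)"
    by (subst g(1), simp only: xop_diff xop_scl, rule planeI) (simp add: scl_def algebra_simps)
  finally have "pmono (Suc k) l = scl (\<Prod>i<Suc k. - (q ^ i)) (pmono 0 (Suc k + l)) + xop q (pmono k l - scl (q ^ k) g)" .
  moreover have "homog (k + l) g" using g(2) by (simp add: homog_pred_Suc)
  then have "homog_pred (Suc k + l) (pmono k l - scl (q ^ k) g)"
    unfolding add_Suc homog_pred_Suc by (intro homog_diff homog_scl homog_pmono)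
  ultimately show ?case by (rule leadsI)
qed

lemma homog_expand: "homog d w ==> w = (\<Sum>k\<le>d. scl (coef w k (d - k)) (pmono k (d - k)))"
proof (rule planeI)
  fix k l assume "homog d w"
  then have *: "coef w k l \<noteq> 0 ==> k + l = d" by (auto simp: homog_def)
  have "coef (\<Sum>k\<le>d. scl (coef w k (d - k)) (pmono k (d - k))) k l =
     (\<Sum>i\<le>d. if i = k \<and> k + l = d then coef w k l else 0)"
    unfolding sum_plane_apply by (rule sum.cong) (auto simp: scl_def pmono_def)
  also have "\<dots> = coef w k l"
  proof (cases "k + l = d")
    case True
    then show ?thesis by simp
  next
    case False
    then show ?thesis using * by auto
  qed
  finally show "coef w k l = coef (\<Sum>k\<le>d. scl (coef w k (d - k)) (pmono k (d - k))) k l" ..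
qed

lemma division:
  assumes "homog d w"
  shows "\<exists>c. leads q d c w"
proof -
  have "\<forall>k. \<exists>g. k \<le> d \<longrightarrow> pmono k (d - k) = scl (\<Prod>i<k. - (q ^ i)) (pmono 0 d) + xop q g \<and> homog_pred d g"
  proof
    fix k show "\<exists>g. k \<le> d \<longrightarrow> pmono k (d - k) = scl (\<Prod>i<k. - (q ^ i)) (pmono 0 d) + xop q g \<and> homog_pred d g"
      using pmono_division[of q k "d - k"] by (cases "k \<le> d") (auto simp: leads_def)
  qed
  then obtain g where g: "\<And>k. k \<le> d ==> pmono k (d - k) = scl (\<Prod>i<k. - (q ^ i)) (pmono 0 d) + xop q (g k)"
     "\<And>k. k \<le> d ==> homog_pred d (g k)" by metis
  have "w = (\<Sum>k\<le>d. scl (coef w k (d - k)) (pmono k (d - k)))" using homog_expand assms .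
  also have "\<dots> = (\<Sum>k\<le>d. scl (coef w k (d - k)) (scl (\<Prod>i<k. - (q ^ i)) (pmono 0 d)) + xop q (scl (coef w k (d - k)) (g k)))"
    using g(1) by (intro sum.cong refl) (simp add: xop_scl, rule planeI, simp add: scl_def algebra_simps)
  also have "\<dots> = scl (\<Sum>k\<le>d. coef w k (d - k) * (\<Prod>i<k. - (q ^ i))) (pmono 0 d) + xop q (\<Sum>k\<le>d. scl (coef w k (d - k)) (g k))"
    unfolding sum.distrib xop_sum
    by (rule planeI) (simp add: sum_plane_apply scl_def sum_distrib_right mult.assoc)
  finally have w: "w = scl (\<Sum>k\<le>d. coef w k (d - k) * (\<Prod>i<k. - (q ^ i))) (pmono 0 d) +
    xop q (\<Sum>k\<le>d. scl (coef w k (d - k)) (g k))" .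
  have "homog_pred d (\<Sum>k\<le>d. scl (coef w k (d - k)) (g k))"
    using g(2) by (auto intro: homog_pred_sum homog_pred_scl)
  from exI[where P="\<lambda>c. leads q d c w", OF leadsI[OF w this]] show ?thesis .
qed

subsection \<open>Multiples of \<open>(y + z)\<^sup>N\<close> have many terms\<close>

text \<open>The coordinate of y^k z^l modulo y + z, as found in
  \<open>pmono_division\<close>.\<close>

definition eps :: "'k::field => nat => 'k" where
  "eps q k = (\<Prod>i<k. - (q ^ i))"

text \<open>Functionals on the part of degree d, indexed by weights p; for p = 1 it is the
  coordinate modulo y + z. The normalisation by \<open>eps\<close> turns the transpose of
  multiplication by y + z into a difference operator on weights, see \<open>psi_xop\<close>.\<close>

definition psi :: "'k::field => nat => (nat => 'k) => 'k plane => 'k" where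
  "psi q d p f = (\<Sum>k\<le>d. eps q k * p k * coef f k (d - k))"

definition qdelta :: "'k::field => (nat => 'k) => nat => 'k" where
  "qdelta q p = (\<lambda>j. q ^ j * (p j - p (Suc j)))"

text \<open>The quantum integer [k], written as a sum so that q = 1 is included.\<close>

definition qnum :: "'k::field => nat => 'k" where
  "qnum q k = (\<Sum>i<k. q ^ i)"

text \<open>\<open>qpoly q N p\<close>: \<open>p k\<close> is a polynomial of degree less than \<open>N\<close> in \<open>qnum (inverse q) k\<close>.\<close>

definition qpoly :: "'k::field => nat => (nat => 'k) => bool" where
  "qpoly q N p \<longleftrightarrow> (qdelta q ^^ N) p = (\<lambda>_. 0)"

lemma psi_xop: "psi q (Suc d) p (xop q f) = psi q d (qdelta q p) f"
proof -
  have "psi q (Suc d) p (xop q f) =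
    (\<Sum>k\<le>Suc d. eps q k * p k * (if k = 0 then 0 else coef f (k - 1) (Suc d - k))) +
    (\<Sum>k\<le>Suc d. eps q k * p k * (if Suc d - k = 0 then 0 else q ^ k * coef f k (Suc d - k - 1)))"
    unfolding psi_def sum.distrib[symmetric]
    by (intro sum.cong refl) (simp add: xop_def yop_def zop_def algebra_simps)
  also have "(\<Sum>k\<le>Suc d. eps q k * p k * (if k = 0 then 0 else coef f (k - 1) (Suc d - k))) =
     (\<Sum>k\<le>d. eps q (Suc k) * p (Suc k) * coef f k (d - k))"
    by (subst sum.atMost_Suc_shift) simp
  also have "(\<Sum>k\<le>Suc d. eps q k * p k * (if Suc d - k = 0 then 0 else q ^ k * coef f k (Suc d - k - 1))) =
     (\<Sum>k\<le>d. eps q k * p k * (q ^ k * coef f k (d - k)))"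
    by (auto intro!: sum.cong simp: Suc_diff_le)
  finally show ?thesis
    unfolding psi_def sum.distrib[symmetric]
    by (auto intro!: sum.cong simp: eps_def qdelta_def algebra_simps)
qed

lemma psi_xpow: "psi q (N + d) p ((xop q ^^ N) f) = psi q d ((qdelta q ^^ N) p) f"
proof (induction N arbitrary: p)
  case (Suc N)
  show ?case using psi_xop[of q "N + d" p "(xop q ^^ N) f"] Suc[of "qdelta q p"] funpow_Suc_right[of N "qdelta q"] by simp
qed simp

text \<open>Transposing N multiplications by y + z gives N differences, and these annihilate a
  polynomial of degree less than N.\<close>

lemma psi_qpoly: "qpoly q N p ==> psi q (N + d) p ((xop q ^^ N) f) = 0"
  by (simp add: psi_xpow qpoly_def) (simp add: psi_def)

lemma qdelta_diff: "qdelta q (\<lambda>k. f k - g k) = (\<lambda>k. qdelta q f k - qdelta q g k)"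
  by (auto simp: qdelta_def fun_eq_iff algebra_simps)
lemma qdelta_pow_diff: "(qdelta q ^^ n) (\<lambda>k. f k - g k) = (\<lambda>k. (qdelta q ^^ n) f k - (qdelta q ^^ n) g k)"
  by (induction n) (simp_all add: qdelta_diff)
lemma qdelta_scale: "qdelta q (\<lambda>k. c * f k) = (\<lambda>k. c * qdelta q f k)"
  by (auto simp: qdelta_def fun_eq_iff algebra_simps)
lemma qdelta_pow_scale: "(qdelta q ^^ n) (\<lambda>k. c * f k) = (\<lambda>k. c * (qdelta q ^^ n) f k)"
  by (induction n) (auto simp: qdelta_scale)
lemma qdelta_pow_0: "(qdelta q ^^ n) (\<lambda>_. 0) = (\<lambda>_. 0)"
  by (induction n) (auto simp: qdelta_def)

lemma qpoly_Suc: "qpoly q (Suc N) p \<longleftrightarrow> qpoly q N (qdelta q p)"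
  by (simp add: qpoly_def funpow_swap1)
lemma qpoly_diff: "qpoly q N f ==> qpoly q N g ==> qpoly q N (\<lambda>k. f k - g k)"
  by (simp add: qpoly_def qdelta_pow_diff)
lemma qpoly_scale: "qpoly q N f ==> qpoly q N (\<lambda>k. c * f k)"
  by (simp add: qpoly_def qdelta_pow_scale)
lemma qpoly_mono1: "qpoly q N f ==> qpoly q (Suc N) f"
  unfolding qpoly_def using qdelta_pow_0[of 1 q] by simp
lemma qpoly_mono: "N \<le> M ==> qpoly q N f ==> qpoly q M f"
  by (induction rule: dec_induct) (auto intro: qpoly_mono1)

lemma qnum_inverse: "q \<noteq> 0 ==> inverse (q ^ k) = 1 + (inverse q - 1) * qnum (inverse q) k"
proof (induction k)
  case (Suc k)
  have "inverse (q ^ Suc k) = (inverse q - 1) * inverse (q ^ k) + inverse (q ^ k)"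
    by (simp add: algebra_simps)
  also have "\<dots> = (inverse q - 1) * inverse (q ^ k) + (1 + (inverse q - 1) * qnum (inverse q) k)"
    using Suc by simp
  also have "\<dots> = 1 + (inverse q - 1) * qnum (inverse q) (Suc k)"
    by (simp add: qnum_def power_inverse algebra_simps)
  finally show ?case .
qed (simp add: qnum_def)

text \<open>A Leibniz rule: the difference of the product is an affine factor times the difference
  of p, minus a multiple of p. The affine factor changes on the way, because the step from one node
  to the next is itself affine in the node; hence the induction over arbitrary \<alpha> and
  \<beta>.\<close>

lemma qpoly_mult:
  assumes q: "q \<noteq> 0"
  shows "qpoly q N p ==> qpoly q (Suc N) (\<lambda>k. (\<alpha> + \<beta> * qnum (inverse q) k) * p k)"
proof (induction N arbitrary: p \<alpha> \<beta>)
  case 0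
  then show ?case using qdelta_pow_0[of 1 q] by (simp add: qpoly_def)
next
  case (Suc N)
  let ?x = "qnum (inverse q)"
  have "qdelta q (\<lambda>k. (\<alpha> + \<beta> * ?x k) * p k) =
    (\<lambda>k. (\<alpha> + \<beta> + \<beta> * (inverse q - 1 + 1) * ?x k) * qdelta q p k - \<beta> * p k)"
  proof
    fix k
    have x: "?x (Suc k) = ?x k + inverse (q ^ k)" by (simp add: qnum_def power_inverse)
    have e: "inverse (q ^ k) * q ^ k = 1" using q by simp
    have "qdelta q (\<lambda>k. (\<alpha> + \<beta> * ?x k) * p k) k =
      (\<alpha> + \<beta> * ?x k + \<beta> * inverse (q ^ k)) * qdelta q p k - \<beta> * p k * (inverse (q ^ k) * q ^ k)"
      unfolding qdelta_def x by (simp add: algebra_simps)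
    also have "\<dots> = (\<alpha> + \<beta> * ?x k + \<beta> * inverse (q ^ k)) * qdelta q p k - \<beta> * p k" unfolding e by simp
    also have "\<alpha> + \<beta> * ?x k + \<beta> * inverse (q ^ k) = \<alpha> + \<beta> + \<beta> * (inverse q - 1 + 1) * ?x k"
      unfolding qnum_inverse[OF q] by (simp add: algebra_simps)
    finally show "qdelta q (\<lambda>k. (\<alpha> + \<beta> * ?x k) * p k) k =
      (\<alpha> + \<beta> + \<beta> * (inverse q - 1 + 1) * ?x k) * qdelta q p k - \<beta> * p k" by simp
  qed
  moreover have "qpoly q N (qdelta q p)" using Suc.prems by (simp add: qpoly_Suc)
  ultimately show ?case using Suc qpoly_scale[OF Suc.prems]
    by (subst qpoly_Suc) (simp add: qpoly_diff)
qed

lemma qpoly_prod: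
  assumes "q \<noteq> 0" "finite S"
  shows "qpoly q (Suc (card S)) (\<lambda>k. \<Prod>c\<in>S. qnum (inverse q) k - qnum (inverse q) c)"
  using assms(2)
proof (induction S rule: finite_induct)
  case empty
  then show ?case by (simp add: qpoly_def qdelta_def fun_eq_iff)
next
  case (insert c S)
  from qpoly_mult[OF assms(1) insert.IH, of "- qnum (inverse q) c" 1] insert.hyps
  show ?case by simp
qed

text \<open>Distinctness of the nodes [0], ..., [D] taken at q^-1, the condition for Lagrange
  interpolation at them.\<close>

definition qdistinct :: "'k::field => nat => bool" where
  "qdistinct q D \<longleftrightarrow> inj_on (qnum (inverse q)) {..D}"

text \<open>Quantum version of the fact that, in characteristic zero, a nonzero polynomial with an
  N-fold root away from 0 has more than N terms. For k in S, the Lagrange polynomial with zeros on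
  the rest of S has degree below N; its functional kills (y + z)^N f and isolates the coefficient at
  k.\<close>

lemma xpow_few_terms:
  assumes q: "q \<noteq> 0" and D: "qdistinct q (N + d)" and f: "homog d f"
    and S: "S \<subseteq> {..N + d}" "card S \<le> N"
    and z: "\<And>k. k \<le> N + d ==> k \<notin> S ==> coef ((xop q ^^ N) f) k (N + d - k) = 0"
  shows "f = 0"
proof -
  have fin: "finite S" using S finite_subset by blast
  have e0: "eps q k \<noteq> 0" for k using q by (auto simp: eps_def)
  have "coef ((xop q ^^ N) f) k (N + d - k) = 0" if k: "k \<in> S" for k
  proof -
    let ?p = "\<lambda>j. \<Prod>c\<in>S - {k}. qnum (inverse q) j - qnum (inverse q) c"
    have "Suc (card (S - {k})) \<le> N" using S fin k
      by (metis card_Suc_Diff1)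
    then have "qpoly q N ?p" using qpoly_prod[OF q, of "S - {k}"] fin qpoly_mono by blast
    then have "0 = psi q (N + d) ?p ((xop q ^^ N) f)" by (simp add: psi_qpoly)
    also have "\<dots> = (\<Sum>j\<le>N + d. if j = k then eps q k * ?p k * coef ((xop q ^^ N) f) k (N + d - k) else 0)"
      unfolding psi_def using fin z by (intro sum.cong refl) (auto simp: prod_zero_iff)
    also have "\<dots> = eps q k * ?p k * coef ((xop q ^^ N) f) k (N + d - k)" using k S by auto
    finally have "eps q k * ?p k * coef ((xop q ^^ N) f) k (N + d - k) = 0" ..
    moreover have "?p k \<noteq> 0" using D k S fin
      by (auto simp: prod_zero_iff qdistinct_def inj_on_def)
    ultimately show ?thesis using e0 by simp
  qed
  then have *: "k \<le> N + d ==> coef ((xop q ^^ N) f) k (N + d - k) = 0" for k using z by blast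
  have "(xop q ^^ N) f = 0"
  proof (rule planeI)
    fix k l show "coef ((xop q ^^ N) f) k l = coef 0 k l"
    proof (cases "k + l = N + d")
      case True
      then have "l = N + d - k" "k \<le> N + d" by auto
      then show ?thesis using *[of k] by simp
    next
      case False
      then show ?thesis using homog_xpow[OF f, of N q] by (auto simp: homog_def)
    qed
  qed
  then show ?thesis by (rule xpow_inject0)
qed

text \<open>
  The lowest weight vectors: the conditions on the coefficients of \<open>(y + z)\<^sup>A\<^sup>+\<^sup>B\<^sup>-\<^sup>1\<^sup>-\<^sup>2\<^sup>m w\<close> are \<open>m\<close>
  linear equations for the \<open>m + 1\<close> coefficients of \<open>w\<close>.
\<close>

lemma lowest_weight_vector:
  assumes q: "q \<noteq> (0::'k::field)" and m: "m \<le> A" "m \<le> B" "2 * m + 1 \<le> A + B"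
    and D: "qdistinct q (A + B - 1 - m)"
  shows "\<exists>w. homog m w \<and> leads q m 1 w \<and> vanishes A B ((xop q ^^ (A + B - 1 - 2 * m)) w)"
proof -
  define L where "L = A + B - 1 - 2 * m"
  have LD: "L + m = A + B - 1 - m" using m by (auto simp: L_def)
  \<comment> \<open>In degree L + m = A + B - 1 - m the monomials y^k z^l inside the A by B box are
    exactly those with A - m <= k < A. There are m of them, one fewer than the coefficients of
    w.\<close>
  define E where "E = {k. k < A \<and> A - m \<le> k}"
  have E: "finite E" "card E = m"
  proof -
    have "E = {A - m..<A}" by (auto simp: E_def)
    then show "finite E" "card E = m" using m by auto
  qed
  have inE: "k \<in> E" if "k < A" "l < B" "k + l = L + m" for k l
    using that LD m by (auto simp: E_def)
  obtain x where x: "\<exists>j\<in>{..m}. x j \<noteq> 0"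
    "\<forall>k\<in>E. (\<Sum>j\<le>m. coef ((xop q ^^ L) (pmono j (m - j))) k (L + m - k) * x j) = 0"
    using underdetermined_system[of E "{..m}" "\<lambda>k j. coef ((xop q ^^ L) (pmono j (m - j))) k (L + m - k)"] E
    by auto
  define w where "w = (\<Sum>j\<le>m. scl (x j) (pmono j (m - j)))"
  have wj: "coef w j (m - j) = x j" if "j \<le> m" for j
  proof -
    have "coef w j (m - j) = (\<Sum>i\<le>m. if i = j then x j else 0)"
      unfolding w_def sum_plane_apply by (rule sum.cong) (auto simp: scl_def pmono_def)
    then show ?thesis using that by simp
  qed
  have w0: "w \<noteq> 0" using x(1) wj by auto
  have wh: "homog m w" unfolding w_def
    by (intro homog_sum homog_scl) (metis atMost_iff homog_pmono le_add_diff_inverse)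
  have wE: "coef ((xop q ^^ L) w) k (L + m - k) = 0" if "k \<in> E" for k
  proof -
    have "(xop q ^^ L) w = (\<Sum>j\<le>m. scl (x j) ((xop q ^^ L) (pmono j (m - j))))"
      by (simp add: w_def xpow_sum xpow_scl)
    then show ?thesis using x(2) that by (simp add: sum_plane_apply scl_def mult.commute)
  qed
  have van: "vanishes A B ((xop q ^^ L) w)"
    unfolding vanishes_def
  proof (intro allI impI)
    fix k l assume kl: "k < A" "l < B"
    show "coef ((xop q ^^ L) w) k l = 0"
    proof (cases "k + l = L + m")
      case True
      then have "l = L + m - k" by simp
      then show ?thesis using wE inE[OF kl True] by simp
    next
      case False then show ?thesis using homog_xpow[OF wh, of L q] by (auto simp: homog_def)
    qed
  qed
  obtain c g where cg: "w = scl c (pmono 0 m) + xop q g" "homog_pred m g"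
    using division[OF wh] by (metis leads_def)
  \<comment> \<open>If c = 0 then w = (y + z) g. All terms of (y + z)^(L+1) g, which has degree L +
    m, lie outside E, so there are at most L + 1 of them, and \<open>xpow_few_terms\<close> gives g
    = 0.\<close>
  have "c \<noteq> 0"
  proof
    assume "c = 0"
    then have wg: "w = xop q g" using cg by (intro planeI) (simp add: scl_def)
    show False
    proof (cases m)
      case 0 then show ?thesis using wg cg w0 by (simp add: homog_pred_0)
    next
      case (Suc d)
      have Dd: "Suc L + d = L + m" using Suc by simp
      have "g = 0"
      proof (rule xpow_few_terms[OF q])
        show "qdistinct q (Suc L + d)" using D LD Dd by simp
        show "homog d g" using cg Suc by (simp add: homog_pred_Suc)
        show "{..Suc L + d} - E \<subseteq> {..Suc L + d}" by auto
        have "E \<subseteq> {..Suc L + d}" using LD m Dd by (auto simp: E_def)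
        then show "card ({..Suc L + d} - E) \<le> Suc L" using E Dd Suc by (simp add: card_Diff_subset)
        show "coef ((xop q ^^ Suc L) g) k (Suc L + d - k) = 0" if "k \<notin> {..Suc L + d} - E" "k \<le> Suc L + d" for k
          using that wE[of k] by (simp only: funpow_Suc_right o_apply wg[symmetric] Dd) auto
      qed
      then show False using wg w0 by simp
    qed
  qed
  have "scl (inverse c) w = scl 1 (pmono 0 m) + xop q (scl (inverse c) g)"
    unfolding xop_scl by (subst cg(1), rule planeI) (use \<open>c \<noteq> 0\<close> in \<open>simp add: scl_def algebra_simps\<close>)
  then have "leads q m 1 (scl (inverse c) w)" by (rule leadsI) (rule homog_pred_scl[OF cg(2)])
  moreover have "vanishes A B ((xop q ^^ L) (scl (inverse c) w))"
    using van unfolding xpow_scl by (simp add: vanishes_def scl_def)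
  ultimately show ?thesis using wh unfolding L_def by (blast intro: homog_scl)
qed

lemma leads_homog: "leads q d c w ==> homog d w"
proof (elim leadsE)
  fix g assume w: "w = scl c (pmono 0 d) + xop q g" "homog_pred d g"
  show "homog d w" unfolding w(1)
    using homog_pmono[of 0 d] homog_pred_xop[OF w(2)] by (auto intro: homog_add homog_scl)
qed

lemma leads_add_xop: "leads q d c w ==> homog_pred d g ==> leads q d c (w + xop q g)"
proof (elim leadsE)
  fix h assume "homog_pred d g" and w: "w = scl c (pmono 0 d) + xop q h" "homog_pred d h"
  then have "w + xop q g = scl c (pmono 0 d) + xop q (h + g)" "homog_pred d (h + g)"
    by (simp_all add: xop_add add.assoc homog_pred_add)
  then show ?thesis by (rule leadsI)
qed

text \<open>The functional with weights 1 kills every multiple of y + z, since differences of a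
  constant vanish, and it takes c z^d to c.\<close>

lemma leads_0:
  assumes "leads q d c 0"
  shows "c = 0"
proof -
  obtain g where g: "0 = scl c (pmono 0 d) + xop q g" "homog_pred d g" using assms by (rule leadsE)
  have x: "psi q d (\<lambda>_. 1) (xop q g) = 0"
  proof (cases d)
    case 0
    then show ?thesis using g by (simp add: homog_pred_0 psi_def)
  next
    case (Suc d')
    show ?thesis unfolding Suc psi_xop by (simp add: psi_def qdelta_def)
  qed
  have p: "psi q d (\<lambda>_. 1) (scl c (pmono 0 d)) = c"
  proof -
    have "psi q d (\<lambda>_. 1) (scl c (pmono 0 d)) = (\<Sum>k\<le>d. if k = 0 then c else 0)"
      unfolding psi_def by (intro sum.cong) (auto simp: scl_def pmono_def eps_def)
    then show ?thesis by simp
  qed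
  have "psi q d (\<lambda>_. 1) (scl c (pmono 0 d) + xop q g) =
    psi q d (\<lambda>_. 1) (scl c (pmono 0 d)) + psi q d (\<lambda>_. 1) (xop q g)"
    by (simp add: psi_def sum.distrib algebra_simps)
  then show ?thesis unfolding g(1)[symmetric] x p by (simp add: psi_def)
qed

subsection \<open>Gaussian binomials at a root of unity\<close>

text \<open>Gaussian binomials by Pascal's rule. No division occurs, because the quantum factorials
  in the usual quotient vanish at a root of unity; for the same reason \<open>qbinom_fact\<close> is
  multiplied out.\<close>

fun qbinom :: "'k::field => nat => nat => 'k" where
  "qbinom q 0 0 = 1"
| "qbinom q 0 (Suc i) = 0"
| "qbinom q (Suc n) 0 = 1"
| "qbinom q (Suc n) (Suc i) = qbinom q n i + q ^ Suc i * qbinom q n (Suc i)"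

lemma qbinom_0 [simp]: "qbinom q n 0 = 1"
  by (cases n) auto
lemma qbinom_eq_0: "n < i ==> qbinom q n i = 0"
  by (induction q n i rule: qbinom.induct) auto
lemma qbinom_self [simp]: "qbinom q n n = 1"
  by (induction n) (auto simp: qbinom_eq_0)

definition qfact :: "'k::field => nat => 'k" where
  "qfact q n = (\<Prod>i<n. qnum q (Suc i))"

lemma qfact_Suc: "qfact q (Suc n) = qfact q n * qnum q (Suc n)"
  by (simp add: qfact_def)
lemma qfact_0 [simp]: "qfact q 0 = 1"
  by (simp add: qfact_def)

lemma qnum_add: "qnum q (a + b) = qnum q a + q ^ a * qnum q b"
  by (induction b) (simp_all add: qnum_def algebra_simps power_add)

lemma qnum_mult: "(q - 1) * qnum q n = q ^ n - 1"
  by (induction n) (simp_all add: qnum_def algebra_simps)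

lemma qbinom_fact: "i \<le> n ==> qbinom q n i * qfact q i * qfact q (n - i) = qfact q n"
proof (induction n arbitrary: i)
  case (Suc n)
  show ?case
  proof (cases "i = 0 \<or> i = Suc n")
    case True
    then show ?thesis by (auto simp del: qbinom.simps)
  next
    case False
    then obtain j where j: "i = Suc j" "j < n" using Suc.prems by (cases i) auto
    then have nj: "Suc (n - Suc j) = n - j" by simp
    have 1: "qbinom q n j * qfact q j * qfact q (n - j) = qfact q n" using Suc.IH j by simp
    have 2: "qbinom q n (Suc j) * qfact q (Suc j) * qfact q (n - Suc j) = qfact q n"
      using Suc.IH[of "Suc j"] j by simp
    have 3: "qfact q (n - j) = qfact q (n - Suc j) * qnum q (n - j)"
      using qfact_Suc[of q "n - Suc j"] unfolding nj .
    have "qbinom q (Suc n) i * qfact q i * qfact q (Suc n - i) =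
       (qbinom q n j * qfact q j * qfact q (n - j)) * qnum q (Suc j) +
       q ^ Suc j * (qbinom q n (Suc j) * qfact q (Suc j) * (qfact q (n - Suc j) * qnum q (n - j)))"
      unfolding j 3[symmetric] by (simp add: qfact_Suc algebra_simps)
    also have "\<dots> = qfact q n * (qnum q (Suc j) + q ^ Suc j * qnum q (n - j))"
      unfolding 1 mult.assoc[symmetric, of _ _ "qnum q (n - j)"] 2 by (simp add: algebra_simps)
    also have "qnum q (Suc j) + q ^ Suc j * qnum q (n - j) = qnum q (Suc n)"
      unfolding qnum_add[symmetric] using j by simp
    finally show ?thesis by (simp add: qfact_Suc)
  qed
qed simp

lemma yop_add: "yop (f + g) = yop f + yop g"
  by (rule planeI) (simp add: yop_def)
lemma yop_scl: "yop (scl c f) = scl c (yop f)"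
  by (rule planeI) (simp add: yop_def scl_def)
lemma yop_sum: "yop (\<Sum>i\<in>A. f i) = (\<Sum>i\<in>A. yop (f i))"
  by (induction A rule: infinite_finite_induct) (simp_all add: yop_add, (rule planeI, simp add: yop_def)+)
lemma zop_add: "zop q (f + g) = zop q f + zop q g"
  by (rule planeI) (simp add: zop_def algebra_simps)
lemma zop_scl: "zop q (scl c f) = scl c (zop q f)"
  by (rule planeI) (simp add: zop_def scl_def)
lemma zop_sum: "zop q (\<Sum>i\<in>A. f i) = (\<Sum>i\<in>A. zop q (f i))"
  by (induction A rule: infinite_finite_induct) (simp_all add: zop_add, (rule planeI, simp add: zop_def)+)
lemma scl_scl [simp]: "scl a (scl b f) = scl (a * b) f"
  by (rule planeI) (simp add: scl_def)
lemma scl_1 [simp]: "scl 1 f = f"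
  by (rule planeI) (simp add: scl_def)
lemma scl_0 [simp]: "scl 0 f = 0" "scl c 0 = 0"
  by (rule planeI, simp add: scl_def)+
lemma scl_add: "scl c (f + g) = scl c f + scl c g"
  by (rule planeI) (simp add: scl_def algebra_simps)
lemma scl_diff: "scl c (f - g) = scl c f - scl c g"
  by (rule planeI) (simp add: scl_def algebra_simps)
lemma scl_add_left: "scl (a + b) f = scl a f + scl b f"
  by (rule planeI) (simp add: scl_def algebra_simps)
lemma scl_sum: "scl c (\<Sum>i\<in>A. f i) = (\<Sum>i\<in>A. scl c (f i))"
  by (induction A rule: infinite_finite_induct) (simp_all add: scl_add)

lemma zop_yop: "zop q (yop f) = scl q (yop (zop q f))"
proof (rule planeI)
  fix k l show "coef (zop q (yop f)) k l = coef (scl q (yop (zop q f))) k l"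
    by (cases k) (auto simp: zop_def yop_def scl_def)
qed

lemma zop_ypow: "zop q ((yop ^^ i) f) = scl (q ^ i) ((yop ^^ i) (zop q f))"
  by (induction i) (simp_all add: zop_yop yop_scl)

text \<open>The quantum binomial theorem for operators; the induction rests on z y^i = q^i y^i
  z.\<close>

lemma xpow_qbinom: "(xop q ^^ N) f = (\<Sum>i\<le>N. scl (qbinom q N i) ((yop ^^ i) ((zop q ^^ (N - i)) f)))"
proof (induction N)
  case (Suc N)
  define T where "T i = (yop ^^ i) ((zop q ^^ (Suc N - i)) f)" for i
  have y: "yop ((yop ^^ i) ((zop q ^^ (N - i)) f)) = T (Suc i)" for i
    by (simp add: T_def)
  have z: "zop q ((yop ^^ i) ((zop q ^^ (N - i)) f)) = scl (q ^ i) (T i)" if "i \<le> N" for i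
    unfolding zop_ypow T_def using that by (simp add: Suc_diff_le)
  have "(xop q ^^ Suc N) f = yop ((xop q ^^ N) f) + zop q ((xop q ^^ N) f)"
    by (simp add: xop_def)
  also have "\<dots> = (\<Sum>i\<le>N. scl (qbinom q N i) (T (Suc i))) + (\<Sum>i\<le>N. scl (qbinom q N i * q ^ i) (T i))"
    unfolding Suc yop_sum zop_sum yop_scl zop_scl y using z by simp
  also have "(\<Sum>i\<le>N. scl (qbinom q N i * q ^ i) (T i)) = (\<Sum>i\<le>Suc N. scl (qbinom q N i * q ^ i) (T i))"
    by (simp add: qbinom_eq_0)
  also have "\<dots> = T 0 + (\<Sum>i\<le>N. scl (qbinom q N (Suc i) * q ^ Suc i) (T (Suc i)))"
    by (subst sum.atMost_Suc_shift) simp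
  also have "(\<Sum>i\<le>N. scl (qbinom q N i) (T (Suc i))) + \<dots> =
    T 0 + (\<Sum>i\<le>N. scl (qbinom q (Suc N) (Suc i)) (T (Suc i)))"
    by (simp add: scl_add_left sum.distrib algebra_simps)
  also have "\<dots> = (\<Sum>i\<le>Suc N. scl (qbinom q (Suc N) i) (T i))"
    by (subst sum.atMost_Suc_shift) (simp del: qbinom.simps(4))
  finally show ?case unfolding T_def .
qed simp

text \<open>The product y^a f z^b, with z^b on the right so that no power of q appears. It commutes
  with left multiplication by y + z as soon as s divides a, see \<open>xop_shift\<close>.\<close>

definition shift :: "nat => nat => 'k::field plane => 'k plane" where
  "shift a b f = Plane (\<lambda>k l. if a \<le> k \<and> b \<le> l then coef f (k - a) (l - b) else 0)"

lemma ypow_shift: "(yop ^^ i) f = shift i 0 f"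
proof (induction i)
  case (Suc i)
  show ?case by (simp add: Suc, rule planeI) (auto simp: yop_def shift_def)
qed (rule planeI, simp add: shift_def)

lemma zpow_coef: "coef ((zop q ^^ j) f) k l = (if j \<le> l then (q ^ k) ^ j * coef f k (l - j) else 0)"
proof (induction j arbitrary: l)
  case (Suc j)
  have "coef (zop q g) k 0 = 0" "coef (zop q g) k (Suc l) = q ^ k * coef g k l" for g l
    by (simp_all add: zop_def)
  then show ?case by (cases l) (simp_all add: Suc)
qed simp

text \<open>The bound 2 <= s excludes q = 1, for which [s] would not vanish.\<close>

definition prim_root :: "'k::field => nat => bool" where
  "prim_root q s \<longleftrightarrow> 2 \<le> s \<and> q ^ s = 1 \<and> (\<forall>k. 0 < k \<and> k < s \<longrightarrow> q ^ k \<noteq> 1)"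

lemma prim_root_nz: "prim_root q s ==> q \<noteq> 0"
  unfolding prim_root_def by (metis less_le_trans pos2 power_0_left not_gr_zero zero_neq_one)

lemma prim_root_qnum:
  assumes "prim_root q s"
  shows "qnum q s = 0" "0 < k ==> k < s ==> qnum q k \<noteq> 0"
proof -
  have "q ^ 1 \<noteq> 1" using assms unfolding prim_root_def by (metis less_le_trans one_less_numeral_iff semiring_norm(76) zero_less_one)
  then have "q - 1 \<noteq> 0" by simp
  then show "qnum q s = 0" using qnum_mult[of q s] assms by (auto simp: prim_root_def)
  show "qnum q k \<noteq> 0" if "0 < k" "k < s"
    using qnum_mult[of q k] assms that by (auto simp: prim_root_def)
qed

text \<open>The inner Gaussian binomials vanish, since [s]! is zero while [i]! and [s-i]! are not
  for 0 < i < s. Moving z^s past y^k costs q^(ks) = 1.\<close>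

lemma xpow_prim_root:
  assumes "prim_root q s"
  shows "(xop q ^^ s) f = shift s 0 f + shift 0 s f"
proof -
  have s: "2 \<le> s" "q ^ s = 1" using assms by (auto simp: prim_root_def)
  have nz: "qfact q i \<noteq> 0" if "i < s" for i
    using prim_root_qnum(2)[OF assms] that by (auto simp: qfact_def)
  have z: "qbinom q s i = 0" if "0 < i" "i < s" for i
  proof -
    have "qfact q s = 0" using prim_root_qnum(1)[OF assms] s qfact_Suc[of q "s - 1"] by simp
    then show ?thesis using qbinom_fact[of i s q] nz[of i] nz[of "s - i"] that by auto
  qed
  obtain s' where s': "s = Suc s'" using s by (cases s) auto
  have "(xop q ^^ s) f = (\<Sum>i\<le>s. if i = 0 \<or> i = s then (yop ^^ i) ((zop q ^^ (s - i)) f) else 0)"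
    unfolding xpow_qbinom using z by (intro sum.cong) auto
  also have "\<dots> = (zop q ^^ s) f + (yop ^^ s) f"
    unfolding s' by (simp add: sum.atMost_Suc_shift)
  also have "(zop q ^^ s) f = shift 0 s f"
  proof (rule planeI)
    fix k l
    have "(q ^ k) ^ s = 1" by (metis s(2) power_mult mult.commute power_one)
    then show "coef ((zop q ^^ s) f) k l = coef (shift 0 s f) k l"
      by (simp add: zpow_coef shift_def)
  qed
  finally show ?thesis by (simp add: ypow_shift add.commute)
qed

text \<open>The nodes repeat with period s, so interpolation works only below degree s; higher
  degrees are reached through the central subalgebra.\<close>

lemma prim_root_qdistinct:
  assumes "prim_root q s" "D < s"
  shows "qdistinct q D"
  unfolding qdistinct_def
proof (rule inj_onI)
  have q: "q \<noteq> 0" using prim_root_nz assms by blast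
  have *: "a = b" if "a \<le> b" "b \<le> D" "qnum (inverse q) a = qnum (inverse q) b" for a b
  proof (rule ccontr)
    assume "a \<noteq> b"
    have "inverse (q ^ a) = inverse (q ^ b)" using qnum_inverse[OF q] that by metis
    then have "q ^ (b - a) = 1" using that(1) q by (simp add: power_diff)
    then show False using assms that \<open>a \<noteq> b\<close> by (auto simp: prim_root_def)
  qed
  show "x = y" if "x \<in> {..D}" "y \<in> {..D}" "qnum (inverse q) x = qnum (inverse q) y" for x y
    using *[of x y] *[of y x] that by (metis atMost_iff nle_le)
qed

text \<open>Characteristic zero enters here: for q = 1 the nodes are the integers 0, ..., D.\<close>

lemma qdistinct_1: "qdistinct (1 :: 'k::field_char_0) D"
  by (auto simp: qdistinct_def inj_on_def qnum_def)

subsection \<open>The action of the central subalgebra generated by \<open>y\<^sup>s\<close> and \<open>z\<^sup>s\<close>\<close>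

lemma shift_add: "shift a b (f + g) = shift a b f + shift a b g"
  by (rule planeI) (simp add: shift_def)
lemma shift_scl: "shift a b (scl c f) = scl c (shift a b f)"
  by (rule planeI) (simp add: shift_def scl_def)
lemma shift_shift: "shift a b (shift c d f) = shift (a + c) (b + d) f"
  by (rule planeI) (auto simp: shift_def intro: arg_cong2[of _ _ _ _ "coef f"])
lemma shift_pmono: "shift a b (pmono c d) = pmono (a + c) (b + d)"
  by (rule planeI) (auto simp: shift_def pmono_def)
lemma homog_shift: "homog d f ==> homog (a + b + d) (shift a b f)"
  unfolding homog_def
proof (intro allI impI)
  fix k l assume *: "\<forall>k l. coef f k l \<noteq> 0 \<longrightarrow> k + l = d" "coef (shift a b f) k l \<noteq> 0"
  then have "a \<le> k" "b \<le> l" "coef f (k - a) (l - b) \<noteq> 0" by (auto simp: shift_def split: if_splits)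
  then show "k + l = a + b + d" using *(1) by fastforce
qed

lemma xop_shift:
  assumes "q ^ s = 1"
  shows "xop q (shift (a * s) b f) = shift (a * s) b (xop q f)"
proof (rule planeI)
  fix k l
  have "q ^ k = q ^ (k - a * s)" if "a * s \<le> k"
  proof -
    have "q ^ k = q ^ (k - a * s) * (q ^ s) ^ a" using that
      by (metis power_add power_mult mult.commute le_add_diff_inverse2)
    then show ?thesis using assms by simp
  qed
  then show "coef (xop q (shift (a * s) b f)) k l = coef (shift (a * s) b (xop q f)) k l"
    by (auto simp: xop_def yop_def zop_def shift_def)
qed

text \<open>The form c of degree m in Y = y^s and Z = z^s, applied to v; only the part of c of
  degree m is read. Forms live in the same type \<open>plane\<close>, where they are multiplied with
  q = 1.\<close>

definition act :: "nat => nat => 'k::field plane => 'k plane => 'k plane" where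
  "act s m c v = (\<Sum>b\<le>m. scl (coef c (m - b) b) (shift ((m - b) * s) (b * s) v))"

lemma act_add_left: "act s m (c + d) v = act s m c v + act s m d v"
  by (simp add: act_def scl_add_left sum.distrib)
lemma act_diff_left: "act s m (c - d) v = act s m c v - act s m d v"
proof -
  have "act s m (c - d) v + act s m d v = act s m c v" unfolding act_add_left[symmetric] by simp
  then show ?thesis by (simp add: algebra_simps)
qed
lemma act_add_right: "act s m c (v + w) = act s m c v + act s m c w"
  by (simp add: act_def shift_add scl_add sum.distrib)
lemma act_diff_right: "act s m c (v - w) = act s m c v - act s m c w"
proof -
  have "act s m c (v - w) + act s m c w = act s m c v" unfolding act_add_right[symmetric] by simp
  then show ?thesis by (simp add: algebra_simps)
qed
lemma act_0_left [simp]: "act s m 0 v = 0"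
  by (simp add: act_def)

lemma act_xop: "q ^ s = 1 ==> xop q (act s m c v) = act s m c (xop q v)"
  by (simp add: act_def xop_sum xop_scl xop_shift)
lemma act_xpow: "q ^ s = 1 ==> (xop q ^^ n) (act s m c v) = act s m c ((xop q ^^ n) v)"
  by (induction n) (simp_all add: act_xop)

lemma shift_sum: "shift a b (\<Sum>i\<in>A. f i) = (\<Sum>i\<in>A. shift a b (f i))"
  by (induction A rule: infinite_finite_induct) (simp_all add: shift_add, (rule planeI, simp add: shift_def)+)

lemma act_yop: "act s (Suc m) (yop c) v = shift s 0 (act s m c v)"
proof -
  have "act s (Suc m) (yop c) v = (\<Sum>b\<le>m. scl (coef c (m - b) b) (shift ((Suc m - b) * s) (b * s) v))"
    unfolding act_def by (auto simp: yop_def Suc_diff_le intro!: sum.cong)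
  also have "\<dots> = shift s 0 (act s m c v)"
    unfolding act_def shift_sum shift_scl shift_shift
    by (intro sum.cong refl) (simp add: Suc_diff_le)
  finally show ?thesis .
qed

lemma act_zop: "act s (Suc m) (zop 1 c) v = shift 0 s (act s m c v)"
proof -
  have "act s (Suc m) (zop 1 c) v = (\<Sum>b\<le>m. scl (coef c (m - b) b) (shift ((m - b) * s) (Suc b * s) v))"
    unfolding act_def by (subst sum.atMost_Suc_shift) (simp add: zop_def)
  also have "\<dots> = shift 0 s (act s m c v)"
    unfolding act_def shift_sum shift_scl shift_shift
    by (intro sum.cong refl) simp
  finally show ?thesis .
qed

lemma act_shift: "act s m c (shift a b v) = shift a b (act s m c v)"
  by (simp add: act_def shift_sum shift_scl shift_shift add.commute)

text \<open>The bridge between the two planes: Y + Z in the commutative one is (y + z)^s in the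
  quantum one.\<close>

lemma act_xop_1: "prim_root q s ==> act s (Suc m) (xop 1 c) v = (xop q ^^ s) (act s m c v)"
  by (simp add: xop_def[of 1] act_add_left act_yop act_zop xpow_prim_root)

lemma act_xpow_1: "prim_root q s ==> act s (M + m) ((xop 1 ^^ M) c) v = (xop q ^^ (M * s)) (act s m c v)"
  by (induction M) (simp_all add: act_xop_1 funpow_add)

lemma homog_act: "homog d v ==> homog (m * s + d) (act s m c v)"
  unfolding act_def
proof (intro homog_sum homog_scl)
  fix b assume "homog d v" "b \<in> {..m}"
  then show "homog (m * s + d) (shift ((m - b) * s) (b * s) v)"
    using homog_shift[of d v "(m - b) * s" "b * s"] by (simp add: add_mult_distrib[symmetric])
qed

definition supp_ge :: "nat => nat => 'k::field plane => bool" where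
  "supp_ge a b f \<longleftrightarrow> (\<forall>k l. coef f k l \<noteq> 0 \<longrightarrow> a \<le> k \<and> b \<le> l)"

text \<open>Every term carries Y^A or Z^B, and divisibility of v by y^a z^b raises this to y^(As+a)
  or z^(Bs+b). The exponents a and b are what reaches sides that are not multiples of s.\<close>

lemma act_vanishes:
  assumes "vanishes A B c" "supp_ge a b v" "n \<le> A * s + a" "t \<le> B * s + b"
  shows "vanishes n t (act s m c v)"
  unfolding vanishes_def
proof (intro allI impI)
  fix k l assume kl: "k < n" "l < t"
  show "coef (act s m c v) k l = 0"
    unfolding act_def sum_plane_apply
  proof (intro sum.neutral ballI, rule ccontr)
    fix i assume i: "i \<in> {..m}" "coef (scl (coef c (m - i) i) (shift ((m - i) * s) (i * s) v)) k l \<noteq> 0"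
    then have "coef c (m - i) i \<noteq> 0" "(m - i) * s \<le> k" "i * s \<le> l" "coef v (k - (m - i) * s) (l - i * s) \<noteq> 0"
      by (auto simp: scl_def shift_def split: if_splits)
    then have "a \<le> k - (m - i) * s" "b \<le> l - i * s" "A \<le> m - i \<or> B \<le> i"
      using assms by (auto simp: supp_ge_def vanishes_def not_le[symmetric])
    then have "A * s + a \<le> k \<or> B * s + b \<le> l"
      using mult_le_mono1[of A "m - i" s] mult_le_mono1[of B i s] \<open>(m - i) * s \<le> k\<close> \<open>i * s \<le> l\<close> by linarith
    then show False using kl assms by auto
  qed
qed

text \<open>Coordinates multiply: Z^m carries z^u to z^(ms+u), and the part of f that is a multiple
  of Y + Z yields a multiple of (y + z)^s, hence of y + z.\<close>

lemma leads_act: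
  assumes q: "prim_root q s" and f: "leads 1 m 1 f" and v: "leads q u c v"
  shows "leads q (m * s + u) c (act s m f v)"
proof -
  have qs: "q ^ s = 1" "2 \<le> s" using q by (auto simp: prim_root_def)
  obtain g where g: "f = scl 1 (pmono 0 m) + xop 1 g" "homog_pred m g" using f by (rule leadsE)
  obtain h where h: "v = scl c (pmono 0 u) + xop q h" "homog_pred u h" using v by (rule leadsE)
  have "act s m (pmono 0 m) v = shift 0 (m * s) v"
  proof -
    have "act s m (pmono 0 m) v = (\<Sum>b\<le>m. if b = m then shift 0 (m * s) v else 0)"
      unfolding act_def by (intro sum.cong) (auto simp: pmono_def)
    then show ?thesis by simp
  qed
  also have "\<dots> = scl c (pmono 0 (m * s + u)) + xop q (shift 0 (m * s) h)"
    unfolding h(1) using xop_shift[OF qs(1), of 0] by (simp add: shift_add shift_scl shift_pmono)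
  finally have 1: "act s m (pmono 0 m) v = scl c (pmono 0 (m * s + u)) + xop q (shift 0 (m * s) h)" .
  have "homog_pred (m * s + u) (shift 0 (m * s) h)"
  proof (cases u)
    case 0
    then have "shift 0 (m * s) h = 0" using h by (simp add: homog_pred_0) (rule planeI, simp add: shift_def)
    then show ?thesis by simp
  next
    case (Suc u')
    then show ?thesis using h homog_shift[of u' h 0 "m * s"] by (simp add: homog_pred_Suc)
  qed
  with 1 have L: "leads q (m * s + u) c (act s m (pmono 0 m) v)" by (rule leadsI)
  have "\<exists>G. act s m (xop 1 g) v = xop q G \<and> homog_pred (m * s + u) G"
  proof (cases m)
    case 0
    then show ?thesis using g by (intro exI[of _ 0]) (simp add: homog_pred_0)
  next
    case (Suc m')
    have "act s m (xop 1 g) v = xop q ((xop q ^^ (s - 1)) (act s m' g v))"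
      unfolding Suc act_xop_1[OF q] using qs(2) by (cases s) auto
    moreover have "homog (s - 1 + (m' * s + u)) ((xop q ^^ (s - 1)) (act s m' g v))"
      using leads_homog[OF v] by (intro homog_xpow homog_act)
    moreover have "m * s + u = Suc (s - 1 + (m' * s + u))" using Suc qs(2) by simp
    ultimately show ?thesis unfolding homog_pred_Suc[symmetric] by metis
  qed
  then obtain G where G: "act s m (xop 1 g) v = xop q G" "homog_pred (m * s + u) G" by blast
  have "act s m f v = act s m (pmono 0 m) v + xop q G"
    unfolding g(1) by (simp add: act_add_left G(1))
  then show ?thesis using leads_add_xop[OF L G(2)] by simp
qed

lemma supp_ge_xop: "supp_ge a b f ==> supp_ge a b (xop q f)"
  unfolding supp_ge_def
proof (intro allI impI)
  fix k l assume *: "\<forall>k l. coef f k l \<noteq> 0 \<longrightarrow> a \<le> k \<and> b \<le> l" and "coef (xop q f) k l \<noteq> 0"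
  then consider "k > 0" "coef f (k - 1) l \<noteq> 0" | "l > 0" "coef f k (l - 1) \<noteq> 0"
    by (cases "coef f (k - 1) l = 0"; cases "coef f k (l - 1) = 0")
      (auto simp: xop_def yop_def zop_def split: if_splits)
  then show "a \<le> k \<and> b \<le> l" using * by cases (meson diff_le_self le_trans)+
qed

lemma supp_ge_xpow: "supp_ge a b f ==> supp_ge a b ((xop q ^^ n) f)"
  by (induction n) (auto intro: supp_ge_xop)
lemma supp_ge_diff: "supp_ge a b f ==> supp_ge a b g ==> supp_ge a b (f - g)"
  unfolding supp_ge_def by (metis diff_zero coef_simps(3))
lemma supp_ge_0 [simp]: "supp_ge 0 0 f"
  by (simp add: supp_ge_def)
lemma supp_ge_pmono: "supp_ge a b (pmono a b)"
  by (simp add: supp_ge_def pmono_def)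

text \<open>Divisibility by y^a survives cancelling y + z: at the lowest power y^k of f only the
  z-part contributes to the product, with the invertible factor q^k.\<close>

lemma supp_ge_xop_y:
  assumes "supp_ge a 0 (xop q f)" "q \<noteq> 0"
  shows "supp_ge a 0 f"
proof -
  have "coef f k l = 0" if "k < a" for k l
    using that
  proof (induction k arbitrary: l)
    case 0
    then have "coef (xop q f) 0 (Suc l) = 0" using assms unfolding supp_ge_def by fastforce
    then show ?case by (simp add: xop_def yop_def zop_def)
  next
    case (Suc k)
    then have "coef (xop q f) (Suc k) (Suc l) = 0" using assms unfolding supp_ge_def by fastforce
    then show ?case using Suc assms by (simp add: xop_def yop_def zop_def)
  qed
  then show ?thesis unfolding supp_ge_def by (metis le0 not_le)
qed

lemma supp_ge_xop_z:
  assumes "supp_ge 0 b (xop q f)"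
  shows "supp_ge 0 b f"
proof -
  have "coef f k l = 0" if "l < b" for k l
    using that
  proof (induction l arbitrary: k)
    case 0
    then have "coef (xop q f) (Suc k) 0 = 0" using assms unfolding supp_ge_def by fastforce
    then show ?case by (simp add: xop_def yop_def zop_def)
  next
    case (Suc l)
    then have "coef (xop q f) (Suc k) (Suc l) = 0" using assms unfolding supp_ge_def by fastforce
    then show ?case using Suc by (simp add: xop_def yop_def zop_def)
  qed
  then show ?thesis unfolding supp_ge_def by (metis le0 not_le)
qed

subsection \<open>Generators of the Jordan strings\<close>

lemma leads_pmono:
  assumes "q \<noteq> (0::'k::field)"
  shows "\<exists>c. c \<noteq> 0 \<and> leads q (k + l) c (pmono k l)"
  using pmono_division[of q k l] assms by (intro exI[of _ "\<Prod>i<k. - (q ^ i)"]) simp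

lemma leads_nonzero: "leads q d 1 w ==> w \<noteq> 0"
  using leads_0 by fastforce

lemma lowest_weight_vector_1:
  assumes "m \<le> A" "m \<le> B" "2 * m + 1 \<le> A + B" "A + B - 1 - 2 * m = M"
  obtains w :: "'k::field_char_0 plane"
  where "homog m w" "leads 1 m 1 w" "vanishes A B ((xop 1 ^^ M) w)"
  using lowest_weight_vector[OF zero_neq_one[symmetric] assms(1-3) qdistinct_1] assms(4) by blast

locale truncated_plane =
  fixes q :: "'k::field_char_0" and s r r' p p' :: nat
  assumes q: "prim_root q s" and p: "p < s" "p' < s" and le: "r * s + p \<le> r' * s + p'"
begin

definition n where "n = r' * s + p'"
definition t where "t = r * s + p"

text \<open>The last case is the length n + t - 1 - 2d, for d = ms + u, of a string placed
  symmetrically about the middle degree of the box. The other three are multiples of s; they belong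
  to the residues u for which \<open>central_generator\<close> suffices.\<close>

definition strlen :: "nat => nat => nat" where
  "strlen m u =
    (if p + p' \<le> u then (r + r' - 1 - 2 * m) * s
     else if u + s < p + p' then (r + r' + 1 - 2 * m) * s
     else if min p p' \<le> u \<and> u < max p p' then (r + r' - 2 * m) * s
     else n + t - 1 - 2 * m * s - 2 * u)"

text \<open>L is only an upper bound for the length of the string of w in the box; that the bounds
  are attained is forced by the count \<open>sum_strlen\<close>.\<close>

definition generator :: "nat => nat => nat => 'k plane => bool" where
  "generator m u L w \<longleftrightarrow> (\<exists>c. c \<noteq> 0 \<and> leads q (m * s + u) c w) \<and> vanishes n t ((xop q ^^ L) w)"

lemma qs: "q ^ s = 1" "2 \<le> s" "q \<noteq> 0"
  using q prim_root_nz by (auto simp: prim_root_def)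

lemma r_le: "r \<le> r'"
proof (rule ccontr)
  assume "\<not> r \<le> r'"
  then have "Suc r' * s \<le> r * s" by (intro mult_le_mono1) simp
  then show False using le p by simp
qed

lemma r_less: "p' < p ==> r < r'"
  using r_le le by (cases "r = r'") auto

text \<open>A lowest weight form for the commutative A by B box is applied to a single monomial. The
  inequalities for n and t say that this monomial covers what the multiples As and Bs leave of the
  two sides.\<close>

lemma central_generator:
  assumes m: "m \<le> A" "m \<le> B" "2 * m + 1 \<le> A + B"
    and v: "k0 + l0 = u" "n \<le> A * s + k0" "t \<le> B * s + l0"
  shows "\<exists>w. generator m u ((A + B - 1 - 2 * m) * s) w"
proof -
  obtain f :: "'k plane" where f: "homog m f" "leads 1 m 1 f"
    "vanishes A B ((xop 1 ^^ (A + B - 1 - 2 * m)) f)"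
    using lowest_weight_vector_1[OF m refl] .
  obtain c where c: "c \<noteq> 0" "leads q u c (pmono k0 l0)" using leads_pmono[OF qs(3)] v(1) by metis
  have "vanishes n t ((xop q ^^ ((A + B - 1 - 2 * m) * s)) (act s m f (pmono k0 l0)))"
    unfolding act_xpow_1[OF q, symmetric] by (intro act_vanishes[OF f(3) supp_ge_pmono] v)
  then show ?thesis using leads_act[OF q f(2) c(2)] c(1) unfolding generator_def by blast
qed

text \<open>Both sides of the box are rounded down to multiples of s, and y^p' z^(u-p') makes up for
  both remainders.\<close>

lemma generator_top:
  assumes "p + p' \<le> u" "m < r"
  shows "\<exists>w. generator m u ((r + r' - 1 - 2 * m) * s) w"
  using central_generator[of m r' r p' "u - p'" u] assms r_le by (simp add: n_def t_def add.commute)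

text \<open>Both sides are rounded up, so any monomial of degree u serves.\<close>

lemma generator_bottom:
  assumes "m \<le> r"
  shows "\<exists>w. generator m u ((r + r' + 1 - 2 * m) * s) w"
proof -
  have "r' + 1 + (r + 1) - 1 - 2 * m = r + r' + 1 - 2 * m" by simp
  then show ?thesis
    using central_generator[of m "r' + 1" "r + 1" 0 u u] assms r_le p by (simp add: n_def t_def)
qed

text \<open>One side is rounded up and the other down. The side rounded down is the one whose
  remainder is at most u, and z^u or y^u covers that remainder.\<close>

lemma generator_middle:
  assumes "min p p' \<le> u" "u < max p p'" "if u < p then m \<le> r else m < r"
  shows "\<exists>w. generator m u ((r + r' - 2 * m) * s) w"
proof (cases "p \<le> u")
  case True
  have "r' + 1 + r - 1 - 2 * m = r + r' - 2 * m" by simp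
  then show ?thesis
    using central_generator[of m "r' + 1" r 0 u u] True assms r_le p by (simp add: n_def t_def)
next
  case False
  then have *: "p' \<le> u" "r < r'" using assms r_less by (auto simp: min_def max_def split: if_splits)
  have "r' + (r + 1) - 1 - 2 * m = r + r' - 2 * m" by simp
  then show ?thesis
    using central_generator[of m r' "r + 1" u 0 u] False * assms r_le p by (simp add: n_def t_def)
qed

end

text \<open>
  A pair \<open>u\<close>, \<open>u' = p + p' - 1 - u\<close>.  The vector \<open>v\<close> of degree \<open>u\<close> satisfies
  \<open>(y + z)\<^sup>e v = P + Q\<close> with \<open>P\<close> divisible by \<open>y\<^sup>p\<^sup>'\<close> and \<open>Q\<close> by \<open>z\<^sup>p\<close>.
\<close>

locale string_pair = truncated_plane q s r r' p p'
  for q :: "'k::field_char_0" and s r r' p p' +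
  fixes u u' :: nat
  assumes u: "u < p" "u < p'" and u': "u + u' + 1 = p + p'" "u' < s"
begin

text \<open>The difference equals p + p' - 1 - 2u, the height at which a lowest weight vector of
  degree u dies in the p' by p box.\<close>

definition e where "e = u' - u"

lemma e: "0 < e" "e < s" "u + e = u'" "p' + p - 1 - 2 * u = e"
  using u u' by (auto simp: e_def)

text \<open>Existence is \<open>lowest_weight_vector\<close>, which applies at the root of unity
  because the top degree u' is below s.\<close>

definition v where "v = (SOME v. homog u v \<and> leads q u 1 v \<and> vanishes p' p ((xop q ^^ e) v))"

lemma v: "homog u v" "leads q u 1 v" "vanishes p' p ((xop q ^^ e) v)"
proof -
  have "p' + p - 1 - u < s" using u u' by simp
  then have "\<exists>v. homog u v \<and> leads q u 1 v \<and> vanishes p' p ((xop q ^^ e) v)"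
    using lowest_weight_vector[OF qs(3), of u p' p] u prim_root_qdistinct[OF q] unfolding e(4) by simp
  then show "homog u v" "leads q u 1 v" "vanishes p' p ((xop q ^^ e) v)"
    unfolding v_def by (metis (mono_tags, lifting) someI_ex)+
qed

text \<open>The terms are sorted by the exponent of y. What remains for Q has z-exponent at least p,
  because (y + z)^e v vanishes in the p' by p box.\<close>

definition P where "P = Plane (\<lambda>k l. if p' \<le> k then coef ((xop q ^^ e) v) k l else 0)"
definition Q where "Q = (xop q ^^ e) v - P"

lemma PQ: "(xop q ^^ e) v = P + Q"
  by (simp add: Q_def)

lemma P: "supp_ge p' 0 P"
  by (auto simp: P_def supp_ge_def split: if_splits)

lemma Q: "supp_ge 0 p Q"
  using v(3) by (auto simp: P_def Q_def supp_ge_def vanishes_def not_le[symmetric] split: if_splits)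

lemma homog_Q: "homog u' Q"
proof -
  have 1: "homog u' ((xop q ^^ e) v)" using homog_xpow[OF v(1), of e q] e by (simp add: add.commute)
  then have "homog u' P" by (auto simp: P_def homog_def)
  then show ?thesis unfolding Q_def using 1 by (rule homog_diff[rotated])
qed

text \<open>The defect when (y + z)^s v = y^s v + z^s v is distributed over P and Q. It enters the
  two halves with opposite signs, so it inherits divisibility by y^p' from P and by z^p from
  Q.\<close>

definition \<kappa> where "\<kappa> = (xop q ^^ (s - e)) P - shift s 0 v"

lemma \<kappa>: "(xop q ^^ (s - e)) P = shift s 0 v + \<kappa>" "(xop q ^^ (s - e)) Q = shift 0 s v - \<kappa>"
proof -
  show "(xop q ^^ (s - e)) P = shift s 0 v + \<kappa>" by (simp add: \<kappa>_def)
  have "(xop q ^^ s) v = (xop q ^^ (s - e)) ((xop q ^^ e) v)"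
    using e by (metis funpow_add o_apply le_add_diff_inverse2 less_imp_le_nat)
  then have "shift s 0 v + shift 0 s v = (xop q ^^ (s - e)) P + (xop q ^^ (s - e)) Q"
    by (simp add: xpow_prim_root[OF q] PQ xpow_add)
  then show "(xop q ^^ (s - e)) Q = shift 0 s v - \<kappa>" by (simp add: \<kappa>_def algebra_simps)
qed

lemma supp_\<kappa>: "supp_ge p' p \<kappa>"
proof -
  have "supp_ge p' 0 (shift s 0 v)" "supp_ge 0 p (shift 0 s v)"
    using p by (auto simp: supp_ge_def shift_def split: if_splits)
  then have "supp_ge p' 0 \<kappa>" "supp_ge 0 p (shift 0 s v - (xop q ^^ (s - e)) Q)"
    using P Q unfolding \<kappa>_def by (auto intro!: supp_ge_diff supp_ge_xpow)
  moreover have "shift 0 s v - (xop q ^^ (s - e)) Q = \<kappa>" by (simp add: \<kappa>(2))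
  ultimately show ?thesis by (auto simp: supp_ge_def)
qed

text \<open>Otherwise Q, and with it P, is a multiple of y + z. Cancelling that factor keeps the
  divisibility by z^p and y^p', so (y + z)^(e-1) v already vanishes in the p' by p box, and then it
  has at most e - 1 terms.\<close>

lemma leads_Q: "\<exists>c. c \<noteq> 0 \<and> leads q u' c Q"
proof -
  obtain c where c: "leads q u' c Q" using division[OF homog_Q] by blast
  have "c \<noteq> 0"
  proof
    assume "c = 0"
    with c obtain Q' where Q': "Q = xop q Q'" by (auto elim: leadsE)
    define P' where "P' = (xop q ^^ (e - 1)) v - Q'"
    have "xop q ((xop q ^^ (e - 1)) v) = P + Q" using e(1) PQ by (cases e) auto
    then have P': "P = xop q P'" by (simp add: P'_def xop_diff Q')
    have PQ': "supp_ge p' 0 P'" "supp_ge 0 p Q'"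
      using supp_ge_xop_y[OF _ qs(3)] supp_ge_xop_z P Q unfolding P' Q' by blast+
    have z: "coef ((xop q ^^ (e - 1)) v) k l = 0" if "k < p'" "l < p" for k l
    proof -
      have "(xop q ^^ (e - 1)) v = P' + Q'" by (simp add: P'_def)
      moreover have "coef P' k l = 0" "coef Q' k l = 0"
        using PQ' that unfolding supp_ge_def by (meson not_le)+
      ultimately show ?thesis by simp
    qed
    \<comment> \<open>Exponents of y in degree e - 1 + u that fall outside the box: of e + u
      exponents, the u + 1 inside it are removed.\<close>
    define S where "S = {..e - 1 + u} - {p' - 1 - u..p' - 1}"
    have "v = 0"
    proof (rule xpow_few_terms[OF qs(3) _ v(1)])
      show "qdistinct q (e - 1 + u)" using e u' by (intro prim_root_qdistinct[OF q]) simp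
      show "S \<subseteq> {..e - 1 + u}" by (auto simp: S_def)
      have "{p' - 1 - u..p' - 1} \<subseteq> {..e - 1 + u}" using u u' e by auto
      then show "card S \<le> e - 1" using u e unfolding S_def by (simp add: card_Diff_subset)
      show "coef ((xop q ^^ (e - 1)) v) k (e - 1 + u - k) = 0" if "k \<le> e - 1 + u" "k \<notin> S" for k
      proof (rule z)
        show "k < p'" "e - 1 + u - k < p" using that u u' e by (auto simp: S_def)
      qed
    qed
    then show False using leads_nonzero[OF v(2)] by simp
  qed
  then show ?thesis using c by blast
qed

text \<open>P and Q call for different forms: f for the r' by r + 1 box suits P, and h for the r' +
  1 by r box suits Q. Both have coordinate 1, so h - f is a multiple of Y + Z and (h - f) Q = (y +
  z)^s G. Then w = f v + (y + z)^(s-e) G satisfies (y + z)^e w = f P + h Q.\<close>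

lemma generator_lower:
  assumes m: "m \<le> r"
  shows "\<exists>w. generator m u ((r + r' - 2 * m) * s + e) w"
proof -
  define M where "M = r + r' - 2 * m"
  obtain f :: "'k plane" where f: "homog m f" "leads 1 m 1 f" "vanishes r' (r + 1) ((xop 1 ^^ M) f)"
    by (rule lowest_weight_vector_1[of m r' "r + 1" M]) (use m r_le in \<open>simp_all add: M_def\<close>)
  obtain h :: "'k plane" where h: "homog m h" "leads 1 m 1 h" "vanishes (r' + 1) r ((xop 1 ^^ M) h)"
    by (rule lowest_weight_vector_1[of m "r' + 1" r M]) (use m r_le in \<open>simp_all add: M_def\<close>)
  obtain gf gh where gf: "f = scl 1 (pmono 0 m) + xop 1 gf" "homog_pred m gf"
    and gh: "h = scl 1 (pmono 0 m) + xop 1 gh" "homog_pred m gh"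
    using leadsE f(2) h(2) by metis
  have hf: "h - f = xop 1 (gh - gf)" by (simp add: gf(1) gh(1) xop_diff)
  \<comment> \<open>One factor y + z of (y + z)^(s-e) G is kept outside, so that adding this term to
    f v leaves the coordinate unchanged; this explains the exponent s - e - 1 in the degree
    condition.\<close>
  have "\<exists>G. (xop q ^^ s) G = act s m (h - f) Q \<and> homog_pred (m * s + u) ((xop q ^^ (s - e - 1)) G)"
  proof (cases m)
    case 0
    then have "h - f = 0" using gf gh by (simp add: homog_pred_0)
    then show ?thesis by (intro exI[of _ 0]) simp
  next
    case (Suc m')
    have "homog (s - e - 1 + (m' * s + u')) ((xop q ^^ (s - e - 1)) (act s m' (gh - gf) Q))"
      by (intro homog_xpow homog_act homog_Q)
    moreover have "Suc (s - e - 1 + (m' * s + u')) = m * s + u" using e Suc by simp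
    ultimately show ?thesis unfolding hf using act_xop_1[OF q, of m' "gh - gf" Q]
      by (intro exI[of _ "act s m' (gh - gf) Q"]) (metis Suc homog_pred_Suc)
  qed
  then obtain G where G: "(xop q ^^ s) G = act s m (h - f) Q"
    "homog_pred (m * s + u) ((xop q ^^ (s - e - 1)) G)" by blast
  define w where "w = act s m f v + xop q ((xop q ^^ (s - e - 1)) G)"
  have "leads q (m * s + u) 1 w"
    unfolding w_def by (intro leads_add_xop leads_act[OF q f(2) v(2)] G(2))
  moreover have "vanishes n t ((xop q ^^ (M * s + e)) w)"
  proof -
    have "xop q ((xop q ^^ (s - e - 1)) G) = (xop q ^^ (s - e)) G"
      using e(2) by (cases "s - e") auto
    then have "(xop q ^^ e) w = act s m f (P + Q) + (xop q ^^ e) ((xop q ^^ (s - e)) G)"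
      unfolding w_def by (simp add: xpow_add act_xpow[OF qs(1)] PQ)
    also have "(xop q ^^ e) ((xop q ^^ (s - e)) G) = (xop q ^^ s) G"
      using e(2) by (metis funpow_add o_apply le_add_diff_inverse less_imp_le_nat)
    finally have "(xop q ^^ e) w = act s m f P + act s m h Q"
      by (simp add: G(1) act_add_right act_diff_left)
    then have "(xop q ^^ (M * s + e)) w = act s (M + m) ((xop 1 ^^ M) f) P + act s (M + m) ((xop 1 ^^ M) h) Q"
      by (simp add: funpow_add xpow_add act_xpow_1[OF q])
    moreover have "vanishes n t (act s (M + m) ((xop 1 ^^ M) f) P)"
      using p by (intro act_vanishes[OF f(3) P]) (auto simp: n_def t_def)
    moreover have "vanishes n t (act s (M + m) ((xop 1 ^^ M) h) Q)"
      using p by (intro act_vanishes[OF h(3) Q]) (auto simp: n_def t_def)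
    ultimately show ?thesis by (simp add: vanishes_def)
  qed
  ultimately show ?thesis unfolding generator_def M_def by (metis zero_neq_one)
qed

lemma zop_xop_1: "zop 1 (xop 1 f) = xop 1 (zop 1 f)"
  by (simp add: xop_def zop_add zop_yop)

text \<open>The first candidate is f Q, with (y + z)^(s-e) f Q = Z f v - f \<kappa>. The term with
  \<kappa> dies together with f. In the other term Z f has to be replaced by the form W of degree m
  + 1 for the larger box; as W = Z f + (Y + Z) g, this is achieved by adding (y + z)^e g v to f
  Q.\<close>

lemma generator_upper:
  assumes m: "m < r"
  shows "\<exists>w. generator m u' ((r + r' - 1 - 2 * m) * s + (s - e)) w"
proof -
  define M where "M = r + r' - 1 - 2 * m"
  obtain f :: "'k plane" where f: "homog m f" "leads 1 m 1 f" "vanishes r' r ((xop 1 ^^ M) f)"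
    by (rule lowest_weight_vector_1[of m r' r M]) (use m r_le in \<open>simp_all add: M_def\<close>)
  obtain W :: "'k plane" where W: "homog (Suc m) W" "leads 1 (Suc m) 1 W"
      "vanishes (r' + 1) (r + 1) ((xop 1 ^^ M) W)"
    by (rule lowest_weight_vector_1[of "Suc m" "r' + 1" "r + 1" M]) (use m r_le in \<open>simp_all add: M_def\<close>)
  obtain g0 g1 where g0: "f = scl 1 (pmono 0 m) + xop 1 g0" "homog_pred m g0"
    and g1: "W = scl 1 (pmono 0 (Suc m)) + xop 1 g1" "homog_pred (Suc m) g1"
    using leadsE f(2) W(2) by metis
  \<comment> \<open>W and Z f have the same coordinate 1 in degree m + 1, so their difference is (Y
    + Z) g with this g.\<close>
  define g where "g = g1 - zop 1 g0"
  have "homog_pred (Suc m) (zop 1 g0)"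
    using g0(2) unfolding homog_pred_def zop_def by (auto split: if_splits) (metis Suc_pred add_Suc_right)
  then have g: "homog m g" unfolding g_def homog_pred_Suc[symmetric] using g1(2) by (rule homog_pred_diff[rotated])
  have "zop 1 (pmono 0 m) = (pmono 0 (Suc m) :: 'k plane)" by (rule planeI) (auto simp: zop_def pmono_def)
  then have W': "W = zop 1 f + xop 1 g"
    unfolding g_def g0(1) g1(1) by (simp add: zop_add zop_xop_1 xop_diff)
  obtain c where c: "c \<noteq> 0" "leads q u' c Q" using leads_Q by blast
  define w where "w = act s m f Q + xop q ((xop q ^^ (e - 1)) (act s m g v))"
  have "homog (e - 1 + (m * s + u)) ((xop q ^^ (e - 1)) (act s m g v))"
    by (intro homog_xpow homog_act v)
  moreover have "Suc (e - 1 + (m * s + u)) = m * s + u'" using e by simp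
  ultimately have "homog_pred (m * s + u') ((xop q ^^ (e - 1)) (act s m g v))"
    by (metis homog_pred_Suc)
  then have "leads q (m * s + u') c w"
    unfolding w_def by (intro leads_add_xop leads_act[OF q f(2) c(2)])
  moreover have "vanishes n t ((xop q ^^ (M * s + (s - e))) w)"
  proof -
    have "xop q ((xop q ^^ (e - 1)) (act s m g v)) = (xop q ^^ e) (act s m g v)"
      using e(1) by (cases e) auto
    then have "(xop q ^^ (s - e)) w = act s m f (shift 0 s v - \<kappa>) + (xop q ^^ (s - e)) ((xop q ^^ e) (act s m g v))"
      unfolding w_def by (simp add: xpow_add act_xpow[OF qs(1)] \<kappa>(2))
    also have "(xop q ^^ (s - e)) ((xop q ^^ e) (act s m g v)) = (xop q ^^ s) (act s m g v)"
      using e(2) by (metis funpow_add o_apply le_add_diff_inverse2 less_imp_le_nat)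
    also have "\<dots> = act s (Suc m) (xop 1 g) v" by (simp add: act_xop_1[OF q])
    also have "act s m f (shift 0 s v - \<kappa>) = act s (Suc m) (zop 1 f) v - act s m f \<kappa>"
      by (simp add: act_diff_right act_zop act_shift)
    finally have "(xop q ^^ (s - e)) w = act s (Suc m) W v - act s m f \<kappa>"
      unfolding W' by (simp add: act_add_left)
    then have "(xop q ^^ (M * s + (s - e))) w =
      act s (M + Suc m) ((xop 1 ^^ M) W) v - act s (M + m) ((xop 1 ^^ M) f) \<kappa>"
      unfolding act_xpow_1[OF q] by (simp add: funpow_add xpow_diff)
    moreover have "vanishes n t (act s (M + Suc m) ((xop 1 ^^ M) W) v)"
      using p by (intro act_vanishes[OF W(3) supp_ge_0]) (auto simp: n_def t_def)
    moreover have "vanishes n t (act s (M + m) ((xop 1 ^^ M) f) \<kappa>)"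
      by (intro act_vanishes[OF f(3) supp_\<kappa>]) (auto simp: n_def t_def)
    ultimately show ?thesis by (simp add: vanishes_def)
  qed
  ultimately show ?thesis using c(1) unfolding generator_def M_def by blast
qed

end

context truncated_plane
begin

lemma generator_exists:
  assumes "u < s" "m * s + u < t"
  shows "\<exists>w. generator m u (strlen m u) w"
proof -
  have m: "if u < p then m \<le> r else m < r"
  proof -
    have "m * s + u < r * s + p" using assms by (simp add: t_def)
    moreover have "Suc r * s \<le> m * s" if "r < m" using that by (intro mult_le_mono1) simp
    then have "m \<le> r" using calculation p assms by (cases "r < m") auto
    ultimately show ?thesis by (cases "m = r") auto
  qed
  \<comment> \<open>In the last two cases the residues u and p + p' - 1 - u form a pair; case 4 is
    its lower member and case 5 its upper one.\<close>
  consider (1) "p + p' \<le> u" | (2) "u + s < p + p'" | (3) "min p p' \<le> u" "u < max p p'" "u < p + p'" "p + p' \<le> u + s"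
    | (4) "u < min p p'" "p + p' \<le> u + s" | (5) "max p p' \<le> u" "u < p + p'" by linarith
  then show ?thesis
  proof cases
    case 1
    then have "m < r" using m by auto
    then show ?thesis using 1 generator_top by (simp add: strlen_def)
  next
    case 2
    then have "m \<le> r" using m by (auto split: if_splits)
    then show ?thesis using 2 p generator_bottom by (simp add: strlen_def)
  next
    case 3
    then show ?thesis using generator_middle m by (simp add: strlen_def)
  next
    case 4
    interpret string_pair q s r r' p p' u "p + p' - 1 - u"
      using 4 by unfold_locales auto
    have "m \<le> r" using m 4 by auto
    moreover have "strlen m u = (r + r' - 2 * m) * s + e"
    proof -
      have "strlen m u = n + t - 1 - 2 * m * s - 2 * u" using 4 by (auto simp: strlen_def)
      also have "n + t = (r + r' - 2 * m) * s + 2 * m * s + (p + p')"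
        unfolding add_mult_distrib[symmetric] using \<open>m \<le> r\<close> r_le by (simp add: n_def t_def add_mult_distrib)
      finally show ?thesis unfolding e_def using 4 by simp
    qed
    ultimately show ?thesis using generator_lower by simp
  next
    case 5
    interpret string_pair q s r r' p p' "p + p' - 1 - u" u
      using 5 assms by unfold_locales auto
    have "m < r" using m 5 by auto
    moreover have "strlen m u = (r + r' - 1 - 2 * m) * s + (s - e)"
    proof -
      have "strlen m u = n + t - 1 - 2 * m * s - 2 * u"
        using 5 assms p by (auto simp: strlen_def)
      also have "n + t = (r + r' - 1 - 2 * m) * s + s + 2 * m * s + (p + p')"
      proof -
        have "r + r' = (r + r' - 1 - 2 * m) + 1 + 2 * m" using \<open>m < r\<close> r_le by simp
        then have "(r + r') * s = (r + r' - 1 - 2 * m) * s + s + 2 * m * s"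
          by (metis add_mult_distrib mult_1)
        then show ?thesis by (simp add: n_def t_def algebra_simps)
      qed
      finally show ?thesis unfolding e_def using 5 assms by simp
    qed
    ultimately show ?thesis using generator_upper by simp
  qed
qed

end

section \<open>The string lengths add up to the dimension of the box\<close>

lemma sum_staircase:
  fixes G :: "nat => 'a::comm_monoid_add"
  assumes "p < s"
  shows "(\<Sum>d<r * s + p. G d) = (\<Sum>u<s. \<Sum>m<(if u < p then Suc r else r). G (m * s + u))"
proof -
  have "(\<Sum>u<s. \<Sum>m<(if u < p then Suc r else r). G (m * s + u)) =
    (\<Sum>(u, m)\<in>Sigma {..<s} (\<lambda>u. {..<if u < p then Suc r else r}). G (m * s + u))"
    by (subst sum.Sigma) auto
  also have "\<dots> = (\<Sum>d<r * s + p. G d)"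
  proof (rule sum.reindex_bij_witness[of _ "\<lambda>d. (d mod s, d div s)" "\<lambda>(u, m). m * s + u"])
    fix d assume d: "d \<in> {..<r * s + p}"
    have "d div s \<le> r"
    proof (rule ccontr)
      assume "\<not> d div s \<le> r"
      then have "Suc r * s \<le> d div s * s" by (intro mult_le_mono1) simp
      then show False using d assms div_times_less_eq_dividend[of d s] by simp
    qed
    moreover have "d mod s < p" if "d div s = r"
    proof -
      have "r * s + d mod s = d" using that div_mult_mod_eq[of d s] by simp
      then show ?thesis using d by simp
    qed
    ultimately show "(d mod s, d div s) \<in> Sigma {..<s} (\<lambda>u. {..<if u < p then Suc r else r})"
      using assms by (cases "d div s = r") auto
  next
    fix a assume a: "a \<in> Sigma {..<s} (\<lambda>u. {..<if u < p then Suc r else r})"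
    obtain u m where um: "a = (u, m)" by fastforce
    have "m * s + u < r * s + p"
    proof (cases "m < r")
      case True
      then have "Suc m * s \<le> r * s" by (intro mult_le_mono1) simp
      then show ?thesis using a um by simp
    next
      case False
      then show ?thesis using a um by (auto split: if_splits simp: less_Suc_eq)
    qed
    then show "(case a of (u, m) => m * s + u) \<in> {..<r * s + p}" using um by simp
  qed (auto simp: mult.commute)
  finally show ?thesis ..
qed

text \<open>Segments of constant length are the case e = 0; otherwise the values form an arithmetic
  progression.\<close>

lemma sum_segment:
  fixes K c e :: int
  assumes "a \<le> b" "\<And>u. a \<le> u ==> u < b ==> F u = c + e * (K - 2 * int u)"
  shows "(\<Sum>u=a..<b. F u) = (int b - int a) * (c + e * (K + 1 - int a - int b))"
proof -
  have "(\<Sum>u=a..<b. c + e * (K - 2 * int u)) = (int b - int a) * (c + e * (K + 1 - int a - int b))"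
    using assms(1) by (induction b rule: dec_induct) (simp_all add: algebra_simps)
  moreover have "(\<Sum>u=a..<b. F u) = (\<Sum>u=a..<b. c + e * (K - 2 * int u))"
    using assms(2) by (intro sum.cong) auto
  ultimately show ?thesis by simp
qed

lemma sum_arith: "(\<Sum>m<N. B - 2 * int m * C) = int N * (B - (int N - 1) * C)"
  by (induction N) (simp_all add: algebra_simps)

context truncated_plane
begin

definition total :: "nat => int" where
  "total u = (\<Sum>m<(if u < p then Suc r else r). int (strlen m u))"

text \<open>One formula for each segment of residues. The sums are taken over the integers, so each
  natural subtraction in \<open>strlen\<close> is first shown to be exact; this is where r <= r' is
  used, and r < r' when p' < p.\<close>

lemma total_eq:
  assumes "u < s"
  shows "p + p' \<le> u ==> total u = int r * int r' * int s"
    "u + s < p + p' ==> total u = (int r + 1) * (int r' + 1) * int s"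
    "p \<le> u ==> u < p' ==> total u = int r * (int r' + 1) * int s"
    "p' \<le> u ==> u < p ==> total u = (int r + 1) * int r' * int s"
    "u < min p p' ==> p + p' \<le> u + s ==> total u = (int r + 1) * (int r' * int s) + (int r + 1) * (int (p + p') - 1 - 2 * int u)"
    "max p p' \<le> u ==> u < p + p' ==> total u = int r * ((int r' + 1) * int s) + int r * (int (p + p') - 1 - 2 * int u)"
proof -
  have *: "total u = int (if u < p then Suc r else r) * (B - (int (if u < p then Suc r else r) - 1) * C)"
    if "\<And>m. m < (if u < p then Suc r else r) ==> int (strlen m u) = B - 2 * int m * C" for B C
    unfolding total_def sum_arith[symmetric] using that by (intro sum.cong) auto
  show "total u = int r * int r' * int s" if "p + p' \<le> u"
  proof (subst *[of "(int r + int r' - 1) * int s" "int s"])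
    fix m assume "m < (if u < p then Suc r else r)"
    then have "int (r + r' - 1 - 2 * m) = int r + int r' - 1 - 2 * int m" using that r_le by simp
    then show "int (strlen m u) = (int r + int r' - 1) * int s - 2 * int m * int s"
      using that by (simp add: strlen_def left_diff_distrib)
  qed (use that in \<open>auto simp: algebra_simps\<close>)
  show "total u = (int r + 1) * (int r' + 1) * int s" if "u + s < p + p'"
  proof (subst *[of "(int r + int r' + 1) * int s" "int s"])
    fix m assume "m < (if u < p then Suc r else r)"
    then have "int ((r + r' + 1) - 2 * m) = int r + int r' + 1 - 2 * int m" using that r_le r_less assms p by (auto split: if_splits)
    then show "int (strlen m u) = (int r + int r' + 1) * int s - 2 * int m * int s"
      using that assms p by (auto simp: strlen_def left_diff_distrib)
  qed (use that assms p in \<open>auto simp: algebra_simps\<close>)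
  show "total u = int r * (int r' + 1) * int s" if "p \<le> u" "u < p'"
  proof (subst *[of "(int r + int r') * int s" "int s"])
    fix m assume "m < (if u < p then Suc r else r)"
    then have "int ((r + r') - 2 * m) = int r + int r' - 2 * int m" using that r_le r_less assms p by (auto split: if_splits)
    then show "int (strlen m u) = (int r + int r') * int s - 2 * int m * int s"
      using that assms p by (auto simp: strlen_def left_diff_distrib)
  qed (use that assms p in \<open>auto simp: algebra_simps\<close>)
  show "total u = (int r + 1) * int r' * int s" if "p' \<le> u" "u < p"
  proof (subst *[of "(int r + int r') * int s" "int s"])
    fix m assume "m < (if u < p then Suc r else r)"
    then have "int ((r + r') - 2 * m) = int r + int r' - 2 * int m" using that r_le r_less assms p by (auto split: if_splits)
    then show "int (strlen m u) = (int r + int r') * int s - 2 * int m * int s"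
      using that assms p by (auto simp: strlen_def left_diff_distrib)
  qed (use that assms p in \<open>auto simp: algebra_simps\<close>)
  have nt: "int n + int t = (int r + int r') * int s + int (p + p')"
    by (simp add: n_def t_def algebra_simps)
  have pos: "int (n + t - 1 - 2 * m * s - 2 * u) = int n + int t - 1 - 2 * int m * int s - 2 * int u"
    if "2 * int m * int s + 2 * int u + 1 \<le> int n + int t" for m
  proof -
    have "int (2 * m * s + 2 * u + 1) \<le> int (n + t)" using that by simp
    then have "2 * m * s + 2 * u + 1 \<le> n + t" by linarith
    then show ?thesis by (simp add: of_nat_diff)
  qed
  show "total u = (int r + 1) * (int r' * int s) + (int r + 1) * (int (p + p') - 1 - 2 * int u)"
    if u: "u < min p p'" "p + p' \<le> u + s"
  proof -
    have "int (strlen m u) = (int n + int t - 1 - 2 * int u) - 2 * int m * int s" if "m < Suc r" for m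
    proof -
      have "2 * int m * int s \<le> (int r + int r') * int s"
        using that r_le by (intro mult_right_mono) auto
      have "int (n + t - 1 - 2 * m * s - 2 * u) = int n + int t - 1 - 2 * int m * int s - 2 * int u"
      proof (rule pos)
        have "u < p" "u < p'" using u by auto
        then show "2 * int m * int s + 2 * int u + 1 \<le> int n + int t"
          unfolding nt using \<open>2 * int m * int s \<le> (int r + int r') * int s\<close> by linarith
      qed
      then show ?thesis using u by (auto simp: strlen_def)
    qed
    then have "total u = int (Suc r) * ((int n + int t - 1 - 2 * int u) - (int (Suc r) - 1) * int s)"
      using u by (subst *[of "int n + int t - 1 - 2 * int u" "int s"]) auto
    then show ?thesis unfolding nt by (simp add: algebra_simps)
  qed
  show "total u = int r * ((int r' + 1) * int s) + int r * (int (p + p') - 1 - 2 * int u)"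
    if u: "max p p' \<le> u" "u < p + p'"
  proof -
    have "int (strlen m u) = (int n + int t - 1 - 2 * int u) - 2 * int m * int s" if "m < r" for m
    proof -
      have "(2 * int m + 2) * int s \<le> (int r + int r') * int s"
        using that r_le by (intro mult_right_mono) auto
      then have "int (n + t - 1 - 2 * m * s - 2 * u) = int n + int t - 1 - 2 * int m * int s - 2 * int u"
        using u assms by (intro pos) (simp add: nt algebra_simps)
      then show ?thesis using u assms by (auto simp: strlen_def)
    qed
    then have "total u = int r * ((int n + int t - 1 - 2 * int u) - (int r - 1) * int s)"
      using u by (subst *[of "int n + int t - 1 - 2 * int u" "int s"]) auto
    then show ?thesis unfolding nt by (simp add: algebra_simps)
  qed
qed

text \<open>Together with the spanning argument in \<open>string_basis\<close>, this count makes the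
  strings a basis. The residues are cut into four segments on which \<open>total\<close> is constant
  or linear in u.\<close>

lemma sum_strlen: "(\<Sum>d<t. strlen (d div s) (d mod s)) = n * t"
proof -
  let ?K = "int (p + p') - 1"
  have s: "s > 0" using p by simp
  have split: "(\<Sum>u<s. total u) = (\<Sum>u=0..<a. total u) + (\<Sum>u=a..<b. total u) + (\<Sum>u=b..<c. total u) + (\<Sum>u=c..<s. total u)"
    if "a \<le> b" "b \<le> c" "c \<le> s" for a b c
    using that by (simp add: sum.atLeastLessThan_concat lessThan_atLeast0)
  define lo hi where "lo = min p p'" and "hi = max p p'"
  have mid: "(\<Sum>u=lo..<hi. total u) = (if p \<le> p' then (int p' - int p) * (int r * (int r' + 1) * int s)
     else (int p - int p') * ((int r + 1) * int r' * int s))"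
  proof (cases "p \<le> p'")
    case True
    then show ?thesis using p sum_segment[of lo hi total "int r * (int r' + 1) * int s" 0 0] total_eq(3)
      by (simp add: lo_def hi_def)
  next
    case False
    then show ?thesis using p sum_segment[of lo hi total "(int r + 1) * int r' * int s" 0 0] total_eq(4)
      by (simp add: lo_def hi_def)
  qed
  have "(\<Sum>u<s. total u) = int n * int t"
  proof (cases "p + p' \<le> s")
    case True
    have 1: "(\<Sum>u=0..<lo. total u) = (int lo - int 0) * ((int r + 1) * (int r' * int s) + (int r + 1) * (?K + 1 - int 0 - int lo))"
      using True p total_eq(5) by (intro sum_segment) (auto simp: lo_def)
    have 2: "(\<Sum>u=hi..<p+p'. total u) = (int (p + p') - int hi) * (int r * ((int r' + 1) * int s) + int r * (?K + 1 - int hi - int (p + p')))"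
      using True p total_eq(6) by (intro sum_segment) (auto simp: hi_def)
    have 3: "(\<Sum>u=p+p'..<s. total u) = (int s - int (p + p')) * (int r * int r' * int s + 0 * (0 + 1 - int (p + p') - int s))"
      using True p total_eq(1) by (intro sum_segment) auto
    have S: "(\<Sum>u<s. total u) = (\<Sum>u=0..<lo. total u) + (\<Sum>u=lo..<hi. total u) + (\<Sum>u=hi..<p+p'. total u) + (\<Sum>u=p+p'..<s. total u)"
      using True by (intro split) (auto simp: lo_def hi_def)
    show ?thesis unfolding S 1 2 3 mid unfolding n_def t_def lo_def hi_def
      by (cases "p \<le> p'") (simp_all add: min_def max_def algebra_simps)
  next
    case False
    define x where "x = p + p' - s"
    have x: "p + p' = s + x" "x \<le> lo" using False p by (auto simp: x_def lo_def)
    have 1: "(\<Sum>u=0..<x. total u) = (int x - int 0) * ((int r + 1) * (int r' + 1) * int s + 0 * (0 + 1 - int 0 - int x))"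
      using x p total_eq(2) by (intro sum_segment) (auto simp: lo_def)
    have 2: "(\<Sum>u=x..<lo. total u) = (int lo - int x) * ((int r + 1) * (int r' * int s) + (int r + 1) * (?K + 1 - int x - int lo))"
      using x p total_eq(5) by (intro sum_segment) (auto simp: lo_def)
    have 3: "(\<Sum>u=hi..<s. total u) = (int s - int hi) * (int r * ((int r' + 1) * int s) + int r * (?K + 1 - int hi - int s))"
      using x p total_eq(6) by (intro sum_segment) (auto simp: hi_def)
    have S: "(\<Sum>u<s. total u) = (\<Sum>u=0..<x. total u) + (\<Sum>u=x..<lo. total u) + (\<Sum>u=lo..<hi. total u) + (\<Sum>u=hi..<s. total u)"
      using x p by (intro split) (auto simp: lo_def hi_def)
    have xs: "int x = int p + int p' - int s" using x(1) by linarith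
    show ?thesis unfolding S 1 2 3 mid unfolding n_def t_def lo_def hi_def
      by (cases "p \<le> p'") (simp_all add: min_def max_def xs algebra_simps)
  qed
  moreover have "(\<Sum>u<s. total u) = int (\<Sum>d<t. strlen (d div s) (d mod s))"
    unfolding total_def t_def sum_staircase[OF p(1)] by (simp add: sum.If_cases if_distrib)
  ultimately show ?thesis by (metis of_nat_eq_iff of_nat_mult)
qed

end

text \<open>First, M has trivial kernel: if M x = 0, the card B + 1 vectors x and N b in dimension
  card B satisfy a nontrivial relation, M kills the part with x and isolates the coefficients of the
  N b, so these vanish and x = 0. Then M (N M - 1) = 0 gives the claim.\<close>

lemma right_inverse_imp_left_inverse:
  fixes M N :: "'a => 'b => 'k::field"
  assumes B: "finite B" and J: "finite J" "card J = card B"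
    and MN: "\<And>b b'. b \<in> B ==> b' \<in> B ==> (\<Sum>j\<in>J. M b j * N b' j) = (if b = b' then 1 else 0)"
    and j: "j \<in> J" "j' \<in> J"
  shows "(\<Sum>b\<in>B. N b j * M b j') = (if j = j' then 1 else 0)"
proof -
  have inj: "\<forall>j\<in>J. x j = 0" if x: "\<And>b. b \<in> B ==> (\<Sum>j\<in>J. M b j * x j) = 0" for x
  proof (rule ccontr)
    assume nz: "\<not> (\<forall>j\<in>J. x j = 0)"
    have "card J < card (insert None (Some ` B))"
      using B J by (simp add: card_image)
    then obtain y where y: "\<exists>i\<in>insert None (Some ` B). y i \<noteq> 0"
      "\<forall>j\<in>J. (\<Sum>i\<in>insert None (Some ` B). (case i of None => x j | Some b => N b j) * y i) = 0"
      using underdetermined_system[OF J(1), of "insert None (Some ` B)" "\<lambda>j i. case i of None => x j | Some b => N b j"] B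
      by blast
    have *: "x j * y None + (\<Sum>b\<in>B. N b j * y (Some b)) = 0" if "j \<in> J" for j
      using y(2) that B by (simp add: sum.reindex)
    have "y (Some b) = 0" if b: "b \<in> B" for b
    proof -
      have "0 = (\<Sum>j\<in>J. M b j * (x j * y None + (\<Sum>b'\<in>B. N b' j * y (Some b'))))"
        using * by simp
      also have "\<dots> = (\<Sum>j\<in>J. M b j * x j) * y None + (\<Sum>j\<in>J. \<Sum>b'\<in>B. M b j * N b' j * y (Some b'))"
        by (simp add: algebra_simps sum.distrib sum_distrib_left sum_distrib_right)
      also have "(\<Sum>j\<in>J. \<Sum>b'\<in>B. M b j * N b' j * y (Some b')) = (\<Sum>b'\<in>B. \<Sum>j\<in>J. M b j * N b' j * y (Some b'))"
        by (rule sum.swap)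
      also have "\<dots> = (\<Sum>b'\<in>B. if b = b' then y (Some b') else 0)"
        using MN[OF b] by (intro sum.cong refl) (simp add: sum_distrib_right[symmetric])
      also have "\<dots> = y (Some b)" using b B by simp
      finally show ?thesis using x[OF b] by simp
    qed
    then have "\<forall>j\<in>J. x j * y None = 0" "y None \<noteq> 0" using * y(1) by auto
    then show False using nz by auto
  qed
  define x where "x i = (\<Sum>b\<in>B. N b i * M b j') - (if i = j' then 1 else 0)" for i
  have "(\<Sum>i\<in>J. M b i * x i) = 0" if b: "b \<in> B" for b
  proof -
    have "(\<Sum>i\<in>J. M b i * x i) = (\<Sum>i\<in>J. \<Sum>b'\<in>B. M b i * N b' i * M b' j') - (\<Sum>i\<in>J. if i = j' then M b j' else 0)"
      unfolding sum_subtractf[symmetric] x_def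
      by (intro sum.cong) (auto simp: algebra_simps sum_distrib_left)
    also have "(\<Sum>i\<in>J. if i = j' then M b j' else 0) = M b j'" using j J by simp
    also have "(\<Sum>i\<in>J. \<Sum>b'\<in>B. M b i * N b' i * M b' j') = (\<Sum>b'\<in>B. \<Sum>i\<in>J. M b i * N b' i * M b' j')"
      by (rule sum.swap)
    also have "\<dots> = (\<Sum>b'\<in>B. if b = b' then M b' j' else 0)"
      using MN[OF b] by (intro sum.cong refl) (simp add: sum_distrib_right[symmetric])
    also have "\<dots> = M b j'" using b B by simp
    finally show ?thesis by simp
  qed
  from inj[of x, OF this] j have "x j = 0" by blast
  then show ?thesis by (simp add: x_def)
qed

subsection \<open>The string basis\<close>

context truncated_plane
begin

lemma vanishes_xop: "vanishes a b f ==> vanishes a b (xop q f)"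
  by (auto simp: vanishes_def xop_def yop_def zop_def)
lemma vanishes_xpow: "vanishes a b f ==> vanishes a b ((xop q ^^ k) f)"
  by (induction k) (auto intro: vanishes_xop)

text \<open>The strings span the box by induction on the degree D: modulo y + z a homogeneous f is c
  z^D, and z^D can be replaced by w D if D < t, while it vanishes in the box if D >= t. Expanding
  the monomials gives a right inverse N of the matrix of the strings, and \<open>sum_strlen\<close>
  makes that matrix square.\<close>

lemma string_basis:
  obtains w N where
    "\<And>d. d < t ==> homog d (w d)"
    "\<And>d. d < t ==> vanishes n t ((xop q ^^ strlen (d div s) (d mod s)) (w d))"
    "\<And>b b'. b \<in> {..<n} \<times> {..<t} ==> b' \<in> {..<n} \<times> {..<t} ==>
       (\<Sum>j\<in>Sigma {..<t} (\<lambda>d. {..<strlen (d div s) (d mod s)}).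
          coef ((xop q ^^ snd j) (w (fst j))) (fst b) (snd b) * N b' j) = (if b = b' then 1 else 0)"
    "\<And>j j'. j \<in> Sigma {..<t} (\<lambda>d. {..<strlen (d div s) (d mod s)}) ==>
       j' \<in> Sigma {..<t} (\<lambda>d. {..<strlen (d div s) (d mod s)}) ==>
       (\<Sum>b\<in>{..<n} \<times> {..<t}. N b j * coef ((xop q ^^ snd j') (w (fst j'))) (fst b) (snd b)) =
         (if j = j' then 1 else 0)"
proof -
  define L where "L d = strlen (d div s) (d mod s)" for d
  have s: "s > 0" using p by simp
  have "\<forall>d. \<exists>w. d < t \<longrightarrow> generator (d div s) (d mod s) (L d) w"
    using generator_exists[of "d mod s" "d div s" for d] s by (auto simp: L_def)
  then obtain w where w: "\<And>d. d < t ==> generator (d div s) (d mod s) (L d) (w d)" by metis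
  have w1: "\<exists>c. c \<noteq> 0 \<and> leads q d c (w d)" "vanishes n t ((xop q ^^ L d) (w d))" if "d < t" for d
    using w[OF that] by (simp_all add: generator_def)
  have w2: "homog d (w d)" if "d < t" for d using w1(1)[OF that] leads_homog by blast
  define J where "J = Sigma {..<t} (\<lambda>d. {..<L d})"
  define X where "X j = (xop q ^^ snd j) (w (fst j))" for j
  define spanned where "spanned f \<longleftrightarrow> (\<exists>a. vanishes n t (f - (\<Sum>j\<in>J. scl (a j) (X j))))" for f
  have finJ: "finite J" by (simp add: J_def)
  have sp_van: "spanned f" if "vanishes n t f" for f
    unfolding spanned_def using that by (intro exI[of _ "\<lambda>_. 0"]) simp
  have sp_add: "spanned (f + g)" if fg: "spanned f" "spanned g" for f g
  proof -
    obtain a b where "vanishes n t (f - (\<Sum>j\<in>J. scl (a j) (X j)))" "vanishes n t (g - (\<Sum>j\<in>J. scl (b j) (X j)))"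
      using fg by (auto simp: spanned_def)
    then have "vanishes n t (f + g - (\<Sum>j\<in>J. scl (a j + b j) (X j)))"
      by (simp add: vanishes_def scl_add_left sum.distrib)
    then show ?thesis unfolding spanned_def by (rule exI[where x="\<lambda>j. a j + b j"])
  qed
  have sp_scl: "spanned (scl c f)" if sf: "spanned f" for f c
  proof -
    obtain a where "vanishes n t (f - (\<Sum>j\<in>J. scl (a j) (X j)))"
      using sf unfolding spanned_def by blast
    then have "vanishes n t (scl c (f - (\<Sum>j\<in>J. scl (a j) (X j))))"
      by (simp add: vanishes_def scl_def)
    then have "vanishes n t (scl c f - (\<Sum>j\<in>J. scl (c * a j) (X j)))"
      unfolding scl_diff scl_sum scl_scl .
    then show ?thesis unfolding spanned_def by (rule exI[where x="\<lambda>j. c * a j"])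
  qed
  have sp_sum: "spanned (\<Sum>i\<in>A. f i)" if "\<And>i. i \<in> A ==> spanned (f i)" for A :: "(nat \<times> nat) set" and f
    using that by (induction A rule: infinite_finite_induct) (auto intro: sp_add sp_van simp: vanishes_def)
  have sp_X: "spanned ((xop q ^^ e) (w d))" if d: "d < t" for d e
  proof (cases "e < L d")
    case True
    then have "(d, e) \<in> J" using d by (simp add: J_def)
    then have "(\<Sum>j\<in>J. scl (if j = (d, e) then 1 else 0) (X j)) = (\<Sum>j\<in>J. if j = (d, e) then X (d, e) else 0)"
      by (intro sum.cong) auto
    also have "\<dots> = X (d, e)" using \<open>(d, e) \<in> J\<close> finJ by simp
    finally have "(\<Sum>j\<in>J. scl (if j = (d, e) then 1 else 0) (X j)) = (xop q ^^ e) (w d)" by (simp add: X_def)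
    then show ?thesis unfolding spanned_def
      by (intro exI[of _ "\<lambda>j. if j = (d, e) then 1 else 0"]) (simp add: vanishes_def)
  next
    case False
    then have "(xop q ^^ e) (w d) = (xop q ^^ (e - L d)) ((xop q ^^ L d) (w d))"
      by (metis funpow_add o_apply le_add_diff_inverse2 not_less)
    then show ?thesis using vanishes_xpow[OF w1(2)[OF d]] by (auto intro: sp_van)
  qed
  have sp_xop: "spanned (xop q f)" if sf: "spanned f" for f
  proof -
    obtain a where a: "vanishes n t (f - (\<Sum>j\<in>J. scl (a j) (X j)))"
      using sf unfolding spanned_def by blast
    have "spanned (\<Sum>j\<in>J. scl (a j) (xop q (X j)))"
    proof (intro sp_sum sp_scl)
      fix j assume "j \<in> J"
      then show "spanned (xop q (X j))" using sp_X[of "fst j" "Suc (snd j)"] by (auto simp: X_def J_def)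
    qed
    moreover have "spanned (xop q (f - (\<Sum>j\<in>J. scl (a j) (X j))))" using vanishes_xop[OF a] by (rule sp_van)
    moreover have "xop q f = (\<Sum>j\<in>J. scl (a j) (xop q (X j))) + xop q (f - (\<Sum>j\<in>J. scl (a j) (X j)))"
      by (simp add: xop_diff xop_sum xop_scl)
    ultimately show ?thesis using sp_add by simp
  qed
  have sp_all: "spanned f" if "homog D f" for f D
    using that
  proof (induction D arbitrary: f rule: less_induct)
    case (less D)
    obtain c where "leads q D c f" using division[OF less.prems] by blast
    then obtain g where g: "f = scl c (pmono 0 D) + xop q g" "homog_pred D g" by (rule leadsE)
    have IH: "spanned h" if "homog_pred D h" for h
    proof (cases D)
      case 0
      then show ?thesis using that by (auto simp: homog_pred_0 vanishes_def intro: sp_van)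
    next
      case (Suc D')
      then show ?thesis using that less.IH[of D'] by (simp add: homog_pred_Suc)
    qed
    show ?case
    proof (cases "D < t")
      case True
      then obtain c' g' where c': "c' \<noteq> 0" "w D = scl c' (pmono 0 D) + xop q g'" "homog_pred D g'"
        using w1(1) by (metis leadsE)
      \<comment> \<open>The multiple of w D is chosen to have the same coordinate as f, so the
        difference is y + z times a vector of degree D - 1, to which the induction hypothesis
        applies.\<close>
      have "f = scl (c / c') (w D) + xop q (g - scl (c / c') g')"
        unfolding g(1) c'(2) xop_diff xop_scl scl_add using c'(1) by simp
      moreover have "spanned (w D)" using sp_X[OF True, of 0] by simp
      moreover have "homog_pred D (g - scl (c / c') g')" using g(2) c'(3)
        by (intro homog_pred_diff homog_pred_scl)
      ultimately show ?thesis using sp_add sp_scl sp_xop IH by metis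
    next
      case False
      then have "vanishes n t (scl c (pmono 0 D))" by (auto simp: vanishes_def scl_def pmono_def)
      then show ?thesis unfolding g(1) using sp_add sp_van sp_xop IH[OF g(2)] by metis
    qed
  qed
  have "\<forall>b. \<exists>a. vanishes n t (pmono (fst b) (snd b) - (\<Sum>j\<in>J. scl (a j) (X j)))"
    using sp_all[OF homog_pmono] unfolding spanned_def by blast
  then obtain N where N: "\<And>b. vanishes n t (pmono (fst b) (snd b) - (\<Sum>j\<in>J. scl (N b j) (X j)))" by metis
  define B where "B = {..<n} \<times> {..<t}"
  have MN: "(\<Sum>j\<in>J. coef (X j) (fst b) (snd b) * N b' j) = (if b = b' then 1 else 0)" if "b \<in> B" "b' \<in> B" for b b'
  proof -
    have "coef (pmono (fst b') (snd b') - (\<Sum>j\<in>J. scl (N b' j) (X j))) (fst b) (snd b) = 0"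
      using N[of b'] that by (auto simp: vanishes_def B_def)
    then have "(\<Sum>j\<in>J. coef (X j) (fst b) (snd b) * N b' j) = coef (pmono (fst b') (snd b')) (fst b) (snd b)"
      by (simp add: sum_plane_apply scl_def mult.commute)
    then show ?thesis by (auto simp: pmono_def prod_eq_iff)
  qed
  have card: "card J = card B"
    using sum_strlen by (simp add: J_def B_def L_def)
  have NM: "(\<Sum>b\<in>B. N b j * coef (X j') (fst b) (snd b)) = (if j = j' then 1 else 0)" if "j \<in> J" "j' \<in> J" for j j'
    using right_inverse_imp_left_inverse[of B J "\<lambda>b j. coef (X j) (fst b) (snd b)" N j j'] MN card finJ that
    by (simp add: B_def)
  show thesis
  proof (rule that[of w N])
    show "homog d (w d)" if "d < t" for d using w2[OF that] .
    show "vanishes n t ((xop q ^^ strlen (d div s) (d mod s)) (w d))" if "d < t" for d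
      using w1(2)[OF that] by (simp add: L_def)
  qed (fact MN[unfolded B_def J_def X_def L_def], fact NM[unfolded B_def J_def X_def L_def])
qed

end

section \<open>Twisted monoid algebras\<close>

abbreviation single where "single \<equiv> Poly_Mapping.single"
abbreviation keys where "keys \<equiv> Poly_Mapping.keys"
abbreviation lookup where "lookup \<equiv> Poly_Mapping.lookup"

lemma poly_mapping_expand:
  fixes f :: "'a \<Rightarrow>\<^sub>0 'b::comm_monoid_add"
  shows "finite A ==> keys f \<subseteq> A ==> f = (\<Sum>a\<in>A. single a (lookup f a))"
proof (rule poly_mapping_eqI)
  fix k assume A: "finite A" "keys f \<subseteq> A"
  have "lookup (\<Sum>a\<in>A. single a (lookup f a)) k = (\<Sum>a\<in>A. if a = k then lookup f k else 0)"
    unfolding lookup_sum by (intro sum.cong) (auto simp: lookup_single when_def)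
  also have "\<dots> = lookup f k" using A by (auto simp: in_keys_iff)
  finally show "lookup f k = lookup (\<Sum>a\<in>A. single a (lookup f a)) k" by simp
qed

text \<open>The base case 0 occurs as \<open>single a 0\<close>, which is why S has to be
  nonempty.\<close>

lemma poly_mapping_set_induct [consumes 1, case_names single add]:
  fixes f :: "'a \<Rightarrow>\<^sub>0 'b::comm_monoid_add"
  assumes "keys f \<subseteq> S"
    and "\<And>a c. a \<in> S ==> P (single a c)"
    and "\<And>f g. keys f \<subseteq> S ==> keys g \<subseteq> S ==> P f ==> P g ==> P (f + g)"
    and "S \<noteq> {}"
  shows "P f"
proof -
  have *: "finite A ==> A \<subseteq> S ==> P (\<Sum>a\<in>A. single a (lookup f a))" for A
  proof (induction A rule: finite_induct)
    case empty
    obtain a where "a \<in> S" using assms(4) by blast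
    then have "P (single a 0)" by (rule assms(2))
    then show ?case by simp
  next
    case (insert a A)
    have "keys (\<Sum>a\<in>A. single a (lookup f a)) \<subseteq> A"
      by (intro order_trans[OF keys_sum]) (auto split: if_splits)
    then show ?case using insert assms(2)[of a "lookup f a"]
      by (auto intro!: assms(3) split: if_splits)
  qed
  have "f = (\<Sum>a\<in>keys f. single a (lookup f a))" by (rule poly_mapping_expand) auto
  then show ?thesis using *[of "keys f"] assms(1) by simp
qed

lemma keys_add_subset: "keys f \<subseteq> S ==> keys g \<subseteq> S ==> keys (f + g) \<subseteq> S"
  using keys_add[of f g] by auto

text \<open>Common frame for kG, where c = 1, and for kG(\<chi>^-1, a, 0), the algebra of the monoid
  of pairs (g, i) twisted by the factor \<chi>(h)^-i for the product of (g, i) and (h, j). The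
  assumption \<open>c_assoc\<close> is the 2-cocycle identity.\<close>

locale twisted_monoid_algebra =
  fixes R :: "('k::field, 's \<Rightarrow>\<^sub>0 'k, 'e) module_scheme" (structure)
    and S :: "'s set" and m :: "'s => 's => 's" and e :: 's and c :: "'s => 's => 'k"
  assumes car: "carrier R = {f. keys f \<subseteq> S}"
    and mlt: "\<And>f g. f \<otimes>\<^bsub>R\<^esub> g = (\<Sum>a\<in>keys f. \<Sum>b\<in>keys g. single (m a b) (lookup f a * lookup g b * c a b))"
    and one: "\<one>\<^bsub>R\<^esub> = single e 1"
    and zero: "\<zero>\<^bsub>R\<^esub> = 0" and add: "add R = (+)"
    and sml: "smult R = (\<lambda>d. Poly_Mapping.map ((*) d))"
    and e: "e \<in> S" and m_closed: "\<And>a b. a \<in> S ==> b \<in> S ==> m a b \<in> S"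
    and m_assoc: "\<And>a b d. a \<in> S ==> b \<in> S ==> d \<in> S ==> m (m a b) d = m a (m b d)"
    and m_e: "\<And>a. a \<in> S ==> m e a = a" "\<And>a. a \<in> S ==> m a e = a"
    and c_assoc: "\<And>a b d. a \<in> S ==> b \<in> S ==> d \<in> S ==> c a b * c (m a b) d = c b d * c a (m b d)"
    and c_e: "\<And>a. a \<in> S ==> c e a = 1" "\<And>a. a \<in> S ==> c a e = 1"
begin

lemma mult_superset:
  assumes "finite A" "finite B" "keys f \<subseteq> A" "keys g \<subseteq> B"
  shows "f \<otimes> g = (\<Sum>a\<in>A. \<Sum>b\<in>B. single (m a b) (lookup f a * lookup g b * c a b))"
proof -
  have "f \<otimes> g = (\<Sum>a\<in>keys f. \<Sum>b\<in>B. single (m a b) (lookup f a * lookup g b * c a b))"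
    unfolding mlt using assms by (intro sum.cong refl sum.mono_neutral_left) (auto simp: in_keys_iff)
  also have "\<dots> = (\<Sum>a\<in>A. \<Sum>b\<in>B. single (m a b) (lookup f a * lookup g b * c a b))"
    using assms by (intro sum.mono_neutral_left) (auto simp: in_keys_iff)
  finally show ?thesis .
qed

lemma mult_add_left: "(f + g) \<otimes> h = f \<otimes> h + g \<otimes> h"
proof -
  let ?A = "keys f \<union> keys g"
  have "f \<otimes> h = (\<Sum>a\<in>?A. \<Sum>b\<in>keys h. single (m a b) (lookup f a * lookup h b * c a b))"
    by (rule mult_superset) auto
  moreover have "g \<otimes> h = (\<Sum>a\<in>?A. \<Sum>b\<in>keys h. single (m a b) (lookup g a * lookup h b * c a b))"
    by (rule mult_superset) auto
  moreover have "(f + g) \<otimes> h = (\<Sum>a\<in>?A. \<Sum>b\<in>keys h. single (m a b) (lookup (f + g) a * lookup h b * c a b))"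
    by (rule mult_superset) (auto dest: subsetD[OF keys_add])
  ultimately show ?thesis
    by (simp add: lookup_add single_add sum.distrib algebra_simps)
qed

lemma mult_add_right: "h \<otimes> (f + g) = h \<otimes> f + h \<otimes> g"
proof -
  let ?A = "keys f \<union> keys g"
  have "h \<otimes> f = (\<Sum>a\<in>keys h. \<Sum>b\<in>?A. single (m a b) (lookup h a * lookup f b * c a b))"
    by (rule mult_superset) auto
  moreover have "h \<otimes> g = (\<Sum>a\<in>keys h. \<Sum>b\<in>?A. single (m a b) (lookup h a * lookup g b * c a b))"
    by (rule mult_superset) auto
  moreover have "h \<otimes> (f + g) = (\<Sum>a\<in>keys h. \<Sum>b\<in>?A. single (m a b) (lookup h a * lookup (f + g) b * c a b))"
    by (rule mult_superset) (auto dest: subsetD[OF keys_add])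
  ultimately show ?thesis
    by (simp add: lookup_add single_add sum.distrib algebra_simps)
qed

lemma mult_single: "single a x \<otimes> single b y = single (m a b) (x * y * c a b)"
  by (subst mult_superset[of "{a}" "{b}"]) auto

lemma S_ne: "S \<noteq> {}" using e by auto

lemma single_closed: "a \<in> S ==> single a x \<in> carrier R"
  by (simp add: car)

lemma mult_closed: "f \<in> carrier R ==> g \<in> carrier R ==> f \<otimes> g \<in> carrier R"
  unfolding car mem_Collect_eq mlt
  by (intro order_trans[OF keys_sum] UN_least) (auto split: if_splits intro: m_closed)

lemma ring: "ring R"
proof (rule ringI)
  show "abelian_group R"
  proof (rule abelian_groupI)
    show "\<exists>y\<in>carrier R. y \<oplus> x = \<zero>" if "x \<in> carrier R" for x
      using that by (intro bexI[of _ "- x"]) (auto simp: add zero car)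
  qed (auto simp: add zero car algebra_simps keys_add_subset intro: subsetD[OF keys_add_subset])
  have assoc: "(f \<otimes> g) \<otimes> h = f \<otimes> (g \<otimes> h)"
    if "keys f \<subseteq> S" "keys g \<subseteq> S" "keys h \<subseteq> S" for f g h
    using that(1)
  proof (induction f rule: poly_mapping_set_induct)
    case (single a x)
    show ?case using that(2)
    proof (induction g rule: poly_mapping_set_induct)
      case (single b y)
      show ?case using that(3)
      proof (induction h rule: poly_mapping_set_induct)
        case (single d z)
        have "x * y * c a b * z * c (m a b) d = x * y * z * (c a b * c (m a b) d)" by simp
        also have "\<dots> = x * y * z * (c b d * c a (m b d))"
          using c_assoc \<open>a \<in> S\<close> \<open>b \<in> S\<close> \<open>d \<in> S\<close> by simp
        also have "\<dots> = x * (y * z * c b d) * c a (m b d)" by simp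
        finally show ?case using \<open>a \<in> S\<close> \<open>b \<in> S\<close> \<open>d \<in> S\<close> unfolding mult_single
          by (simp only: m_assoc)
      qed (simp_all add: mult_add_left mult_add_right S_ne)
    qed (simp_all add: mult_add_left mult_add_right S_ne)
  qed (simp_all add: mult_add_left mult_add_right S_ne)
  have id: "\<one> \<otimes> f = f" "f \<otimes> \<one> = f" if "keys f \<subseteq> S" for f
    using that
    by (induction f rule: poly_mapping_set_induct)
      (simp_all add: one mult_single m_e c_e mult_add_left mult_add_right S_ne)
  show "monoid R"
    by (rule monoidI) (use assoc id mult_closed single_closed e in \<open>auto simp: car one\<close>)
qed (auto simp: add mult_add_left mult_add_right)

lemma smult_single: "d \<odot> single a x = single a (d * x)"
  by (simp add: sml)

lemma lookup_smult: "lookup (d \<odot> f) k = d * lookup f k"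
  by (simp add: sml Poly_Mapping.map.rep_eq when_def)

lemma smult_closed: "f \<in> carrier R ==> d \<odot> f \<in> carrier R"
  by (auto simp: car in_keys_iff lookup_smult)

lemma smult_add: "d \<odot> (f + g) = d \<odot> f + d \<odot> g"
  by (rule poly_mapping_eqI) (simp add: lookup_smult lookup_add algebra_simps)

lemma smult_left:
  assumes "f \<in> carrier R"
  shows "d \<odot> f = (d \<odot> \<one>) \<otimes> f"
  using assms unfolding car mem_Collect_eq
  by (induction f rule: poly_mapping_set_induct)
    (simp_all add: smult_add one smult_single mult_single m_e c_e mult_add_right S_ne)

lemma smult_right:
  assumes "f \<in> carrier R"
  shows "d \<odot> f = f \<otimes> (d \<odot> \<one>)"
  using assms unfolding car mem_Collect_eq
  by (induction f rule: poly_mapping_set_induct)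
    (simp_all add: smult_add one smult_single mult_single m_e c_e mult_add_left S_ne mult.commute)

lemma smult_one: "d \<odot> \<one> = single e d"
  by (simp add: one smult_single)

end

section \<open>Left modules\<close>

lemma left_moduleI:
  assumes "ring R" "abelian_group M"
    "\<And>r x. r \<in> carrier R ==> x \<in> carrier M ==> r \<odot>\<^bsub>M\<^esub> x \<in> carrier M"
    "\<And>r s x. r \<in> carrier R ==> s \<in> carrier R ==> x \<in> carrier M ==>
       (r \<oplus>\<^bsub>R\<^esub> s) \<odot>\<^bsub>M\<^esub> x = (r \<odot>\<^bsub>M\<^esub> x) \<oplus>\<^bsub>M\<^esub> (s \<odot>\<^bsub>M\<^esub> x)"
    "\<And>r x y. r \<in> carrier R ==> x \<in> carrier M ==> y \<in> carrier M ==>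
       r \<odot>\<^bsub>M\<^esub> (x \<oplus>\<^bsub>M\<^esub> y) = (r \<odot>\<^bsub>M\<^esub> x) \<oplus>\<^bsub>M\<^esub> (r \<odot>\<^bsub>M\<^esub> y)"
    "\<And>r s x. r \<in> carrier R ==> s \<in> carrier R ==> x \<in> carrier M ==>
       (r \<otimes>\<^bsub>R\<^esub> s) \<odot>\<^bsub>M\<^esub> x = r \<odot>\<^bsub>M\<^esub> (s \<odot>\<^bsub>M\<^esub> x)"
    "\<And>x. x \<in> carrier M ==> \<one>\<^bsub>R\<^esub> \<odot>\<^bsub>M\<^esub> x = x"
  shows "left_module R M"
  using assms by (intro left_module.intro left_module_axioms.intro)

lemma additive_zero:
  assumes "abelian_group M" "abelian_group N" "\<And>x. x \<in> carrier M ==> f x \<in> carrier N"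
    "\<And>x y. x \<in> carrier M ==> y \<in> carrier M ==> f (x \<oplus>\<^bsub>M\<^esub> y) = f x \<oplus>\<^bsub>N\<^esub> f y"
  shows "f \<zero>\<^bsub>M\<^esub> = \<zero>\<^bsub>N\<^esub>"
proof -
  interpret M: abelian_group M by fact
  interpret N: abelian_group N by fact
  have "f \<zero>\<^bsub>M\<^esub> \<oplus>\<^bsub>N\<^esub> f \<zero>\<^bsub>M\<^esub> = f \<zero>\<^bsub>M\<^esub>" using assms(4)[of "\<zero>\<^bsub>M\<^esub>" "\<zero>\<^bsub>M\<^esub>"] by simp
  then show ?thesis using assms(3)[of "\<zero>\<^bsub>M\<^esub>"] by (metis M.zero_closed N.add.l_cancel_one)
qed

lemma additive_finsum:
  assumes MN: "abelian_group M" "abelian_group N" and f: "\<And>x. x \<in> carrier M ==> f x \<in> carrier N"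
    "\<And>x y. x \<in> carrier M ==> y \<in> carrier M ==> f (x \<oplus>\<^bsub>M\<^esub> y) = f x \<oplus>\<^bsub>N\<^esub> f y"
    and g: "\<And>a. a \<in> A ==> g a \<in> carrier M"
  shows "f (finsum M g A) = finsum N (\<lambda>a. f (g a)) A"
proof -
  interpret M: abelian_group M by fact
  interpret N: abelian_group N by fact
  note z = additive_zero[OF MN f]
  show ?thesis using g
  proof (induction A rule: infinite_finite_induct)
    case (insert a A)
    then show ?case using f by (simp add: Pi_def)
  qed (simp_all add: z)
qed

context left_module
begin

lemma smult_zero_right: "r \<in> carrier R ==> r \<odot>\<^bsub>M\<^esub> \<zero>\<^bsub>M\<^esub> = \<zero>\<^bsub>M\<^esub>"
  using additive_zero[OF M.abelian_group_axioms M.abelian_group_axioms, of "\<lambda>x. r \<odot>\<^bsub>M\<^esub> x"]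
  by (simp add: smult_closed smult_r_distr)

lemma smult_zero_left: "x \<in> carrier M ==> \<zero>\<^bsub>R\<^esub> \<odot>\<^bsub>M\<^esub> x = \<zero>\<^bsub>M\<^esub>"
  using additive_zero[OF R.abelian_group_axioms M.abelian_group_axioms, of "\<lambda>r. r \<odot>\<^bsub>M\<^esub> x"]
  by (simp add: smult_closed smult_l_distr)

lemma smult_finsum:
  "r \<in> carrier R ==> (\<And>a. a \<in> A ==> g a \<in> carrier M) ==> r \<odot>\<^bsub>M\<^esub> finsum M g A = finsum M (\<lambda>a. r \<odot>\<^bsub>M\<^esub> g a) A"
  using additive_finsum[OF M.abelian_group_axioms M.abelian_group_axioms, of "\<lambda>x. r \<odot>\<^bsub>M\<^esub> x" A g]
  by (simp add: smult_closed smult_r_distr)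

lemma finsum_smult:
  "x \<in> carrier M ==> (\<And>a. a \<in> A ==> g a \<in> carrier R) ==> finsum R g A \<odot>\<^bsub>M\<^esub> x = finsum M (\<lambda>a. g a \<odot>\<^bsub>M\<^esub> x) A"
  using additive_finsum[OF R.abelian_group_axioms M.abelian_group_axioms, of "\<lambda>r. r \<odot>\<^bsub>M\<^esub> x" A g]
  by (simp add: smult_closed smult_l_distr)

end

lemma finsum_superset:
  assumes "abelian_group M" "finite B" "A \<subseteq> B" "\<And>i. i \<in> B - A ==> f i = \<zero>\<^bsub>M\<^esub>" "\<And>i. i \<in> A ==> f i \<in> carrier M"
  shows "finsum M f A = finsum M f B"
proof -
  interpret abelian_group M by fact
  have "f x \<in> carrier M" if "x \<in> B" for x using assms(4,5)[of x] that by (cases "x \<in> A") auto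
  then show ?thesis using assms by (intro add.finprod_mono_neutral_cong_left) auto
qed

lemma finsum_single:
  assumes "abelian_group M" "finite B" "b \<in> B" "\<And>i. i \<in> B ==> i \<noteq> b ==> f i = \<zero>\<^bsub>M\<^esub>" "f b \<in> carrier M"
  shows "finsum M f B = f b"
proof -
  interpret abelian_group M by fact
  have "finsum M f B = finsum M f {b}" using assms by (intro finsum_superset[symmetric]) auto
  then show ?thesis using assms by (simp add: Pi_def)
qed

lemma finsum_swap:
  assumes "abelian_group M" "finite A" "finite B" "\<And>a b. a \<in> A ==> b \<in> B ==> f a b \<in> carrier M"
  shows "finsum M (\<lambda>a. finsum M (f a) B) A = finsum M (\<lambda>b. finsum M (\<lambda>a. f a b) A) B"
proof -
  interpret abelian_group M by fact
  show ?thesis using assms(2,4)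
  proof (induction A rule: finite_induct)
    case empty
    then show ?case by simp
  next
    case (insert x A)
    have "finsum M (\<lambda>b. finsum M (\<lambda>a. f a b) (insert x A)) B = finsum M (\<lambda>b. f x b \<oplus>\<^bsub>M\<^esub> finsum M (\<lambda>a. f a b) A) B"
      using insert by (intro finsum_cong') (auto simp: Pi_def)
    also have "\<dots> = finsum M (f x) B \<oplus>\<^bsub>M\<^esub> finsum M (\<lambda>b. finsum M (\<lambda>a. f a b) A) B"
      using insert by (intro finsum_addf) (auto simp: Pi_def)
    finally show ?case using insert by (simp add: Pi_def)
  qed
qed

text \<open>\<rho> is a projective representation of the monoid with cocycle c, on a vector space
  with scalar multiplication \<open>sc\<close>. Reducing to basis elements, associativity of the
  module action is the composition law of \<rho>.\<close>

lemma (in twisted_monoid_algebra) left_module_from_basis: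
  fixes M (structure)
  assumes M: "abelian_group M"
    and sc: "\<And>d x. x \<in> carrier M ==> sc d x \<in> carrier M"
      "\<And>d x y. x \<in> carrier M ==> y \<in> carrier M ==> sc d (x \<oplus>\<^bsub>M\<^esub> y) = sc d x \<oplus>\<^bsub>M\<^esub> sc d y"
      "\<And>d d' x. x \<in> carrier M ==> sc (d + d') x = sc d x \<oplus>\<^bsub>M\<^esub> sc d' x"
      "\<And>d d' x. x \<in> carrier M ==> sc (d * d') x = sc d (sc d' x)"
      "\<And>x. x \<in> carrier M ==> sc 1 x = x"
    and \<rho>: "\<And>a x. a \<in> S ==> x \<in> carrier M ==> \<rho> a x \<in> carrier M"
      "\<And>a x y. a \<in> S ==> x \<in> carrier M ==> y \<in> carrier M ==> \<rho> a (x \<oplus>\<^bsub>M\<^esub> y) = \<rho> a x \<oplus>\<^bsub>M\<^esub> \<rho> a y"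
      "\<And>a d x. a \<in> S ==> x \<in> carrier M ==> \<rho> a (sc d x) = sc d (\<rho> a x)"
      "\<And>a b x. a \<in> S ==> b \<in> S ==> x \<in> carrier M ==> \<rho> a (\<rho> b x) = sc (c a b) (\<rho> (m a b) x)"
      "\<And>x. x \<in> carrier M ==> \<rho> e x = x"
    and act: "\<And>f x. f \<in> carrier R ==> x \<in> carrier M ==> f \<odot>\<^bsub>M\<^esub> x = finsum M (\<lambda>a. sc (lookup f a) (\<rho> a x)) (keys f)"
  shows "left_module R M"
proof -
  interpret M: abelian_group M by fact
  have sc0: "sc 0 x = \<zero>\<^bsub>M\<^esub>" if "x \<in> carrier M" for x
    using sc(3)[OF that, of 0 0] sc(1)[OF that, of 0] by (metis M.add.l_cancel_one add.right_neutral)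
  have act': "f \<odot>\<^bsub>M\<^esub> x = finsum M (\<lambda>a. sc (lookup f a) (\<rho> a x)) A"
    if "finite A" "keys f \<subseteq> A" "A \<subseteq> S" "x \<in> carrier M" for f x A
  proof -
    have f: "f \<in> carrier R" using that by (auto simp: car)
    show ?thesis unfolding act[OF f that(4)]
    proof (intro finsum_superset[OF M])
      show "sc (lookup f i) (\<rho> i x) = \<zero>\<^bsub>M\<^esub>" if "i \<in> A - keys f" for i
        using that \<open>A \<subseteq> S\<close> \<open>x \<in> carrier M\<close> by (auto simp: in_keys_iff sc0 \<rho>)
      show "sc (lookup f i) (\<rho> i x) \<in> carrier M" if "i \<in> keys f" for i
        using that \<open>keys f \<subseteq> A\<close> \<open>A \<subseteq> S\<close> \<open>x \<in> carrier M\<close> by (intro sc(1) \<rho>(1)) auto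
    qed (use that in auto)
  qed
  have closed: "f \<odot>\<^bsub>M\<^esub> x \<in> carrier M" if "f \<in> carrier R" "x \<in> carrier M" for f x
    unfolding act[OF that] using that by (intro M.finsum_closed) (auto simp: car sc \<rho>)
  have addl: "(f + g) \<odot>\<^bsub>M\<^esub> x = f \<odot>\<^bsub>M\<^esub> x \<oplus>\<^bsub>M\<^esub> g \<odot>\<^bsub>M\<^esub> x"
    if "keys f \<subseteq> S" "keys g \<subseteq> S" "x \<in> carrier M" for f g x
  proof -
    let ?A = "keys f \<union> keys g"
    have "(f + g) \<odot>\<^bsub>M\<^esub> x = finsum M (\<lambda>a. sc (lookup (f + g) a) (\<rho> a x)) ?A"
      using that by (intro act') (auto dest: subsetD[OF keys_add])
    also have "\<dots> = finsum M (\<lambda>a. sc (lookup f a) (\<rho> a x) \<oplus>\<^bsub>M\<^esub> sc (lookup g a) (\<rho> a x)) ?A"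
      using that by (intro M.finsum_cong') (auto simp: lookup_add sc \<rho>)
    also have "\<dots> = finsum M (\<lambda>a. sc (lookup f a) (\<rho> a x)) ?A \<oplus>\<^bsub>M\<^esub> finsum M (\<lambda>a. sc (lookup g a) (\<rho> a x)) ?A"
      using that by (intro M.finsum_addf) (auto simp: sc \<rho>)
    also have "finsum M (\<lambda>a. sc (lookup f a) (\<rho> a x)) ?A = f \<odot>\<^bsub>M\<^esub> x"
      using that by (intro act'[symmetric]) auto
    also have "finsum M (\<lambda>a. sc (lookup g a) (\<rho> a x)) ?A = g \<odot>\<^bsub>M\<^esub> x"
      using that by (intro act'[symmetric]) auto
    finally show ?thesis .
  qed
  have addr: "f \<odot>\<^bsub>M\<^esub> (x \<oplus>\<^bsub>M\<^esub> y) = f \<odot>\<^bsub>M\<^esub> x \<oplus>\<^bsub>M\<^esub> f \<odot>\<^bsub>M\<^esub> y"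
    if "f \<in> carrier R" "x \<in> carrier M" "y \<in> carrier M" for f x y
  proof -
    have S: "a \<in> S" if "a \<in> keys f" for a using that \<open>f \<in> carrier R\<close> by (auto simp: car)
    have "f \<odot>\<^bsub>M\<^esub> (x \<oplus>\<^bsub>M\<^esub> y) = finsum M (\<lambda>a. sc (lookup f a) (\<rho> a x) \<oplus>\<^bsub>M\<^esub> sc (lookup f a) (\<rho> a y)) (keys f)"
      unfolding act[OF that(1) M.a_closed[OF that(2,3)]]
      using that S by (intro M.finsum_cong') (auto simp: sc \<rho>)
    also have "\<dots> = f \<odot>\<^bsub>M\<^esub> x \<oplus>\<^bsub>M\<^esub> f \<odot>\<^bsub>M\<^esub> y"
      unfolding act[OF that(1,2)] act[OF that(1,3)]
      using that S by (intro M.finsum_addf) (auto simp: sc \<rho>)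
    finally show ?thesis .
  qed
  have sing: "single a d \<odot>\<^bsub>M\<^esub> x = sc d (\<rho> a x)" if "a \<in> S" "x \<in> carrier M" for a d x
    using act'[of "{a}" "single a d" x] that by (simp add: sc \<rho> Pi_def)
  have assoc: "(f \<otimes> g) \<odot>\<^bsub>M\<^esub> x = f \<odot>\<^bsub>M\<^esub> (g \<odot>\<^bsub>M\<^esub> x)"
    if "keys f \<subseteq> S" "keys g \<subseteq> S" "x \<in> carrier M" for f g x
    using that(1)
  proof (induction f rule: poly_mapping_set_induct)
    case (single a y)
    show ?case using that(2)
    proof (induction g rule: poly_mapping_set_induct)
      case (single b z)
      have "(single a y \<otimes> single b z) \<odot>\<^bsub>M\<^esub> x = sc (y * z * c a b) (\<rho> (m a b) x)"
        using \<open>a \<in> S\<close> \<open>b \<in> S\<close> that(3) by (simp add: mult_single sing m_closed)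
      also have "\<dots> = sc y (sc z (\<rho> a (\<rho> b x)))"
        using \<open>a \<in> S\<close> \<open>b \<in> S\<close> that(3) by (simp add: sc \<rho> m_closed)
      also have "\<dots> = single a y \<odot>\<^bsub>M\<^esub> (single b z \<odot>\<^bsub>M\<^esub> x)"
        using \<open>a \<in> S\<close> \<open>b \<in> S\<close> that(3) by (simp add: sing sc \<rho>)
      finally show ?case .
    next
      case (add g h)
      have k: "keys (single a y \<otimes> g) \<subseteq> S" "keys (single a y \<otimes> h) \<subseteq> S"
        using mult_closed[of "single a y"] add \<open>a \<in> S\<close> by (auto simp: car)
      then show ?case using add \<open>a \<in> S\<close> that(3) closed single_closed
        by (simp add: mult_add_right addl addr car)
    qed (rule S_ne)
  next
    case (add f h)
    have k: "keys (f \<otimes> g) \<subseteq> S" "keys (h \<otimes> g) \<subseteq> S"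
      using mult_closed add that by (auto simp: car)
    then show ?case using add that closed by (simp add: mult_add_left addl car)
  qed (rule S_ne)
  show ?thesis
  proof (rule left_moduleI[OF ring M])
    show "\<one> \<odot>\<^bsub>M\<^esub> x = x" if "x \<in> carrier M" for x
      using that by (simp add: one sing e sc \<rho>)
  qed (use closed addl addr assoc in \<open>auto simp: add car\<close>)
qed

lemma (in twisted_monoid_algebra) module_expand:
  assumes "left_module R M" "f \<in> carrier R" "x \<in> carrier M"
  shows "f \<odot>\<^bsub>M\<^esub> x = finsum M (\<lambda>a. single e (lookup f a) \<odot>\<^bsub>M\<^esub> (single a 1 \<odot>\<^bsub>M\<^esub> x)) (keys f)"
proof -
  interpret M: left_module R M by fact
  have S: "keys f \<subseteq> S" using assms(2) by (simp add: car)
  have fs: "finsum R g A = sum g A" if "finite A" "\<And>a. a \<in> A ==> g a \<in> carrier R" for g A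
    using that by (induction A rule: finite_induct) (simp_all add: zero add Pi_def)
  have "f = (\<Sum>a\<in>keys f. single a (lookup f a))" by (rule poly_mapping_expand) auto
  also have "\<dots> = finsum R (\<lambda>a. single a (lookup f a)) (keys f)"
    using S single_closed by (intro fs[symmetric]) auto
  finally have f: "f = finsum R (\<lambda>a. single a (lookup f a)) (keys f)" .
  have "f \<odot>\<^bsub>M\<^esub> x = finsum M (\<lambda>a. single a (lookup f a) \<odot>\<^bsub>M\<^esub> x) (keys f)"
    by (subst f, rule M.finsum_smult) (use assms S single_closed in auto)
  also have "\<dots> = finsum M (\<lambda>a. single e (lookup f a) \<odot>\<^bsub>M\<^esub> (single a 1 \<odot>\<^bsub>M\<^esub> x)) (keys f)"
  proof (intro M.finsum_cong' refl)
    fix a assume a: "a \<in> keys f"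
    then have "single a (lookup f a) = single e (lookup f a) \<otimes> single a 1"
      using S e by (auto simp: mult_single m_e c_e)
    then show "single a (lookup f a) \<odot>\<^bsub>M\<^esub> x = single e (lookup f a) \<odot>\<^bsub>M\<^esub> (single a 1 \<odot>\<^bsub>M\<^esub> x)"
      using a S e assms single_closed by (auto simp: M.smult_assoc)
  qed (use S assms e single_closed in \<open>auto intro!: M.smult_closed\<close>)
  finally show ?thesis .
qed

lemma finsum_field:
  assumes "carrier M = (UNIV :: 'k::field set)" "add M = (+)" "\<zero>\<^bsub>M\<^esub> = 0"
  shows "abelian_group M" "finsum M g A = sum g A"
proof -
  show *: "abelian_group M"
    by (rule abelian_groupI) (auto simp: assms algebra_simps intro: exI[of _ "- x" for x])
  interpret abelian_group M by fact
  show "finsum M g A = sum g A"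
    by (induction A rule: infinite_finite_induct) (simp_all add: assms Pi_def)
qed

section \<open>Tensor products\<close>

definition additive :: "('a, 'e) ring_scheme => ('b, 'f) ring_scheme => ('a => 'b) => bool" where
  "additive M N f \<longleftrightarrow> (\<forall>x\<in>carrier M. f x \<in> carrier N) \<and>
     (\<forall>x\<in>carrier M. \<forall>y\<in>carrier M. f (x \<oplus>\<^bsub>M\<^esub> y) = f x \<oplus>\<^bsub>N\<^esub> f y)"

lemma additiveI:
  "(\<And>x. x \<in> carrier M ==> f x \<in> carrier N) ==>
   (\<And>x y. x \<in> carrier M ==> y \<in> carrier M ==> f (x \<oplus>\<^bsub>M\<^esub> y) = f x \<oplus>\<^bsub>N\<^esub> f y) ==> additive M N f"
  by (simp add: additive_def)

lemma additiveD:
  assumes "additive M N f"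
  shows "x \<in> carrier M ==> f x \<in> carrier N"
    "x \<in> carrier M ==> y \<in> carrier M ==> f (x \<oplus>\<^bsub>M\<^esub> y) = f x \<oplus>\<^bsub>N\<^esub> f y"
  using assms by (auto simp: additive_def)

lemma additive_0: "additive M N f ==> abelian_group M ==> abelian_group N ==> f \<zero>\<^bsub>M\<^esub> = \<zero>\<^bsub>N\<^esub>"
  using additive_zero[of M N f] unfolding additive_def by blast

lemma additive_minus:
  assumes "additive M N f" "abelian_group M" "abelian_group N" "x \<in> carrier M"
  shows "f (\<ominus>\<^bsub>M\<^esub> x) = \<ominus>\<^bsub>N\<^esub> f x"
proof -
  interpret M: abelian_group M by fact
  interpret N: abelian_group N by fact
  have "f (\<ominus>\<^bsub>M\<^esub> x) \<oplus>\<^bsub>N\<^esub> f x = \<zero>\<^bsub>N\<^esub>"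
    using additiveD(2)[OF assms(1), of "\<ominus>\<^bsub>M\<^esub> x" x] additive_0[OF assms(1-3)] assms(4) by (simp add: M.l_neg)
  from N.minus_equality[OF this] show ?thesis
    using additiveD(1)[OF assms(1)] assms(4) by simp
qed

definition balanced :: "'s set => ('m => 's => 'm) => ('m, 'e) ring_scheme => ('s => 'n => 'n) => ('n, 'f) ring_scheme =>
    ('a, 'g) ring_scheme => ('m => 'n => 'a) => bool" where
  "balanced K ra M la N A \<beta> \<longleftrightarrow>
     (\<forall>x\<in>carrier M. additive N A (\<beta> x)) \<and>
     (\<forall>y\<in>carrier N. additive M A (\<lambda>x. \<beta> x y)) \<and>
     (\<forall>x\<in>carrier M. \<forall>c\<in>K. \<forall>y\<in>carrier N. \<beta> (ra x c) y = \<beta> x (la c y))"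

lemma balancedI:
  assumes "\<And>x y. x \<in> carrier M ==> y \<in> carrier N ==> \<beta> x y \<in> carrier A"
    "\<And>x x' y. x \<in> carrier M ==> x' \<in> carrier M ==> y \<in> carrier N ==> \<beta> (x \<oplus>\<^bsub>M\<^esub> x') y = \<beta> x y \<oplus>\<^bsub>A\<^esub> \<beta> x' y"
    "\<And>x y y'. x \<in> carrier M ==> y \<in> carrier N ==> y' \<in> carrier N ==> \<beta> x (y \<oplus>\<^bsub>N\<^esub> y') = \<beta> x y \<oplus>\<^bsub>A\<^esub> \<beta> x y'"
    "\<And>x c y. x \<in> carrier M ==> c \<in> K ==> y \<in> carrier N ==> \<beta> (ra x c) y = \<beta> x (la c y)"
  shows "balanced K ra M la N A \<beta>"
  using assms unfolding balanced_def additive_def by simp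

lemma balancedD:
  assumes "balanced K ra M la N A \<beta>"
  shows "x \<in> carrier M ==> y \<in> carrier N ==> \<beta> x y \<in> carrier A"
    "x \<in> carrier M ==> x' \<in> carrier M ==> y \<in> carrier N ==> \<beta> (x \<oplus>\<^bsub>M\<^esub> x') y = \<beta> x y \<oplus>\<^bsub>A\<^esub> \<beta> x' y"
    "x \<in> carrier M ==> y \<in> carrier N ==> y' \<in> carrier N ==> \<beta> x (y \<oplus>\<^bsub>N\<^esub> y') = \<beta> x y \<oplus>\<^bsub>A\<^esub> \<beta> x y'"
    "x \<in> carrier M ==> c \<in> K ==> y \<in> carrier N ==> \<beta> (ra x c) y = \<beta> x (la c y)"
  using assms unfolding balanced_def additive_def by simp_all

lemma (in abelian_group) minus_eq_zero_iff:
  assumes "x \<in> carrier G" "y \<in> carrier G"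
  shows "x \<ominus> y = \<zero> \<longleftrightarrow> x = y"
proof
  assume "x \<ominus> y = \<zero>"
  then have "(x \<ominus> y) \<oplus> y = y" using assms by simp
  then show "x = y" using assms by (simp add: minus_eq a_assoc l_neg)
qed (use assms in \<open>simp add: minus_eq r_neg\<close>)

lemma frag_set_induct [consumes 1, case_names zero diff frag]:
  assumes "keys x \<subseteq> S" "P 0"
    "\<And>x y. keys x \<subseteq> S ==> keys y \<subseteq> S ==> P x ==> P y ==> P (x - y)"
    "\<And>a. a \<in> S ==> P (frag_of a)"
  shows "P x"
  using free_Abelian_group_induct[of x S P] assms by blast

lemma keys_diff_subset: "keys f \<subseteq> S ==> keys g \<subseteq> S ==> keys (f - g) \<subseteq> S"
  using keys_diff[of f g] by auto

text \<open>T is any record whose additive part is the tensor group. The same facts then serve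
  tensor algebras, tensor modules and induced modules, which differ only in their further
  operations.\<close>

locale tensor_product =
  fixes K :: "'s set" and ra and M :: "('m, 'e) ring_scheme" and la and N :: "('n, 'f) ring_scheme"
    and T :: "(('m \<times> 'n \<Rightarrow>\<^sub>0 int) set, 'g) ring_scheme"
  assumes M: "abelian_group M" and N: "abelian_group N"
    and ra: "\<And>x c. x \<in> carrier M ==> c \<in> K ==> ra x c \<in> carrier M"
    and la: "\<And>c y. c \<in> K ==> y \<in> carrier N ==> la c y \<in> carrier N"
    and T: "carrier T = carrier (tensor_group K ra M la N)" "add T = mult (tensor_group K ra M la N)"
      "\<zero>\<^bsub>T\<^esub> = \<one>\<^bsub>tensor_group K ra M la N\<^esub>"
begin

sublocale M: abelian_group M by (rule M)
sublocale N: abelian_group N by (rule N)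

abbreviation F where "F \<equiv> free_Abelian_group (carrier M \<times> carrier N)"
abbreviation ker where "ker \<equiv> tensor_kernel K ra M la N"
abbreviation cl where "cl \<equiv> tensor_class K ra M la N"
definition tens where "tens x y = cl (frag_of (x, y))"

lemma relators: "tensor_relators K ra M la N \<subseteq> carrier F"
proof
  fix w assume "w \<in> tensor_relators K ra M la N"
  then have "keys w \<subseteq> carrier M \<times> carrier N"
    unfolding tensor_relators_def
    by (elim UnE CollectE exE conjE) (simp_all add: keys_diff_subset keys_frag_of ra la)
  then show "w \<in> carrier F" by simp
qed

lemma ker: "subgroup ker F"
  unfolding tensor_kernel_def by (rule group.generate_is_subgroup[OF group_free_Abelian_group relators])

lemma comm: "comm_group (tensor_group K ra M la N)"
  unfolding tensor_group_def by (rule comm_group.abelian_FactGroup[OF abelian_free_Abelian_group ker])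

lemma normal: "ker \<lhd> F"
  by (rule comm_group.subgroup_imp_normal[OF abelian_free_Abelian_group ker])

lemma T_abelian: "abelian_group T"
proof -
  interpret TG: comm_group "tensor_group K ra M la N" by (rule comm)
  show ?thesis
    by (rule abelian_groupI) (simp_all add: T TG.m_ac TG.l_inv_ex)
qed

sublocale T: abelian_group T by (rule T_abelian)

lemma T_simps:
  "carrier T = carrier (tensor_group K ra M la N)" "X \<oplus>\<^bsub>T\<^esub> Y = X \<otimes>\<^bsub>tensor_group K ra M la N\<^esub> Y"
  "\<zero>\<^bsub>T\<^esub> = ker"
  by (simp_all add: T tensor_group_def)

lemma carrier_T: "carrier T = cl ` {w. keys w \<subseteq> carrier M \<times> carrier N}"
  unfolding T_simps tensor_group_def carrier_FactGroup tensor_class_def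
  by (simp add: free_Abelian_group_def)

lemma cl_add: "keys w \<subseteq> carrier M \<times> carrier N ==> keys w' \<subseteq> carrier M \<times> carrier N ==> cl (w + w') = cl w \<oplus>\<^bsub>T\<^esub> cl w'"
  using group_hom.hom_mult normal.rcos_sum[OF normal, of w w']
  by (simp add: T_simps tensor_group_def tensor_class_def)

lemma cl_closed: "keys w \<subseteq> carrier M \<times> carrier N ==> cl w \<in> carrier T"
  by (auto simp: carrier_T)

lemma cl_0: "cl 0 = \<zero>\<^bsub>T\<^esub>"
proof -
  have "cl 0 \<oplus>\<^bsub>T\<^esub> cl 0 = cl 0" "cl 0 \<in> carrier T" using cl_add[of 0 0] cl_closed[of 0] by auto
  then show ?thesis by (metis T.add.l_cancel_one)
qed

lemma cl_ker: "w \<in> ker ==> cl w = \<zero>\<^bsub>T\<^esub>"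
  unfolding tensor_class_def T_simps
  by (rule group.coset_join2[OF group_free_Abelian_group subgroup.mem_carrier[OF ker] ker])

lemma cl_diff:
  assumes "keys w \<subseteq> carrier M \<times> carrier N" "keys w' \<subseteq> carrier M \<times> carrier N"
  shows "cl (w - w') = cl w \<ominus>\<^bsub>T\<^esub> cl w'"
proof -
  have k: "keys (w - w') \<subseteq> carrier M \<times> carrier N" by (intro keys_diff_subset assms)
  have "cl w \<ominus>\<^bsub>T\<^esub> cl w' = (cl (w - w') \<oplus>\<^bsub>T\<^esub> cl w') \<ominus>\<^bsub>T\<^esub> cl w'"
    using cl_add[OF k assms(2)] by simp
  also have "\<dots> = cl (w - w')"
    using cl_closed[OF k] cl_closed[OF assms(2)] by (simp add: T.minus_eq T.a_assoc T.r_neg)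
  finally show ?thesis ..
qed

lemma in_cl:
  assumes "keys w \<subseteq> carrier M \<times> carrier N" "w' \<in> cl w"
  shows "keys w' \<subseteq> carrier M \<times> carrier N" "cl w' = cl w"
proof -
  have w: "w \<in> carrier F" using assms by simp
  have "cl w \<subseteq> carrier F" unfolding tensor_class_def
    by (rule monoid.r_coset_subset_G[OF group.is_monoid[OF group_free_Abelian_group] subgroup.subset[OF ker] w])
  then have "w' \<in> carrier F" using assms(2) by blast
  then show "keys w' \<subseteq> carrier M \<times> carrier N" by simp
  show "cl w' = cl w"
    using group.repr_independence[OF group_free_Abelian_group assms(2)[unfolded tensor_class_def] w ker]
    by (simp add: tensor_class_def)
qed

lemma self_in_cl: "keys w \<subseteq> carrier M \<times> carrier N ==> w \<in> cl w"
  unfolding tensor_class_def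
  by (rule group.rcos_self[OF group_free_Abelian_group _ ker]) simp

lemma relator_zero: "w \<in> tensor_relators K ra M la N ==> cl w = \<zero>\<^bsub>T\<^esub>"
  by (rule cl_ker) (auto simp: tensor_kernel_def intro: generate.incl)

lemma tens_closed: "x \<in> carrier M ==> y \<in> carrier N ==> tens x y \<in> carrier T"
  unfolding tens_def by (intro cl_closed) (simp add: keys_frag_of)

lemma cl_diff3:
  assumes "x \<in> carrier M" "y \<in> carrier N" "x' \<in> carrier M" "y' \<in> carrier N" "x'' \<in> carrier M" "y'' \<in> carrier N"
    and z: "cl (frag_of (x, y) - frag_of (x', y') - frag_of (x'', y'')) = \<zero>\<^bsub>T\<^esub>"
  shows "tens x y = tens x' y' \<oplus>\<^bsub>T\<^esub> tens x'' y''"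
proof -
  have k: "keys (frag_of (x', y') + frag_of (x'', y'')) \<subseteq> carrier M \<times> carrier N"
    using assms by (intro keys_add_subset) (auto simp: keys_frag_of)
  have "cl (frag_of (x, y) - (frag_of (x', y') + frag_of (x'', y''))) = tens x y \<ominus>\<^bsub>T\<^esub> (tens x' y' \<oplus>\<^bsub>T\<^esub> tens x'' y'')"
    using assms k by (subst cl_diff) (auto simp: cl_add keys_frag_of tens_def)
  then show ?thesis using z assms tens_closed by (simp add: diff_diff_eq T.minus_eq_zero_iff)
qed

lemma tens_balanced: "balanced K ra M la N T tens"
proof (rule balancedI)
  show "tens (x \<oplus>\<^bsub>M\<^esub> x') y = tens x y \<oplus>\<^bsub>T\<^esub> tens x' y" if "x \<in> carrier M" "x' \<in> carrier M" "y \<in> carrier N" for x x' y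
    using that by (intro cl_diff3 relator_zero) (auto simp: tensor_relators_def)
  show "tens x (y \<oplus>\<^bsub>N\<^esub> y') = tens x y \<oplus>\<^bsub>T\<^esub> tens x y'" if "x \<in> carrier M" "y \<in> carrier N" "y' \<in> carrier N" for x y y'
    using that by (intro cl_diff3 relator_zero) (auto simp: tensor_relators_def)
  show "tens (ra x c) y = tens x (la c y)" if "x \<in> carrier M" "c \<in> K" "y \<in> carrier N" for x c y
  proof -
    have "cl (frag_of (ra x c, y) - frag_of (x, la c y)) = \<zero>\<^bsub>T\<^esub>"
      using that by (intro relator_zero) (auto simp: tensor_relators_def)
    then have "tens (ra x c) y \<ominus>\<^bsub>T\<^esub> tens x (la c y) = \<zero>\<^bsub>T\<^esub>"
      using that ra la by (subst (asm) cl_diff) (auto simp: keys_frag_of tens_def)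
    then show ?thesis using that ra la tens_closed by (simp add: T.minus_eq_zero_iff)
  qed
qed (rule tens_closed)

lemmas tens_simps = balancedD[OF tens_balanced]

lemma tens_additive: "x \<in> carrier M ==> additive N T (tens x)" "y \<in> carrier N ==> additive M T (\<lambda>x. tens x y)"
  using tens_balanced by (auto simp: balanced_def)

lemma tens_induct [consumes 1, case_names zero tens add]:
  assumes "X \<in> carrier T" "P \<zero>\<^bsub>T\<^esub>" "\<And>x y. x \<in> carrier M ==> y \<in> carrier N ==> P (tens x y)"
    "\<And>X Y. X \<in> carrier T ==> Y \<in> carrier T ==> P X ==> P Y ==> P (X \<oplus>\<^bsub>T\<^esub> Y)"
  shows "P X"
proof -
  obtain w where w: "X = cl w" "keys w \<subseteq> carrier M \<times> carrier N" using assms(1) carrier_T by auto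
  \<comment> \<open>The negative is carried along because induction on the free abelian group
    proceeds through differences, whereas P is closed under sums only.\<close>
  have "P (cl w) \<and> P (\<ominus>\<^bsub>T\<^esub> cl w)" using w(2)
  proof (induction w rule: frag_set_induct)
    case zero
    have z: "\<ominus>\<^bsub>T\<^esub> \<zero>\<^bsub>T\<^esub> = \<zero>\<^bsub>T\<^esub>" by (rule T.minus_equality) simp_all
    show ?case unfolding cl_0 z by (intro conjI assms(2))
  next
    case (diff v w)
    then have c: "cl v \<in> carrier T" "cl w \<in> carrier T" using cl_closed by auto
    have "cl (v - w) = cl v \<oplus>\<^bsub>T\<^esub> \<ominus>\<^bsub>T\<^esub> cl w" using diff by (simp add: cl_diff T.minus_eq)
    moreover have "\<ominus>\<^bsub>T\<^esub> cl (v - w) = \<ominus>\<^bsub>T\<^esub> cl v \<oplus>\<^bsub>T\<^esub> cl w"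
      unfolding calculation using c by (simp add: T.minus_add)
    ultimately have e: "cl (v - w) = cl v \<oplus>\<^bsub>T\<^esub> \<ominus>\<^bsub>T\<^esub> cl w"
      "\<ominus>\<^bsub>T\<^esub> cl (v - w) = \<ominus>\<^bsub>T\<^esub> cl v \<oplus>\<^bsub>T\<^esub> cl w" by blast+
    show ?case unfolding e(2) unfolding e(1) using diff.IH c by (intro conjI assms(4)) auto
  next
    case (frag a)
    obtain x y where a: "a = (x, y)" "x \<in> carrier M" "y \<in> carrier N" using frag by auto
    have "\<ominus>\<^bsub>T\<^esub> tens x y = tens (\<ominus>\<^bsub>M\<^esub> x) y"
      using additive_minus[OF tens_additive(2)[OF a(3)] M T_abelian a(2)] by simp
    then show ?case using assms(3)[OF a(2,3)] assms(3)[OF M.a_inv_closed[OF a(2)] a(3)] a(1)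
      by (simp add: tens_def)
  qed
  then show ?thesis using w by simp
qed

lemma additive_eqI:
  assumes A: "abelian_group A" and h: "additive T A h" "additive T A h'"
    and "\<And>x y. x \<in> carrier M ==> y \<in> carrier N ==> h (tens x y) = h' (tens x y)" and X: "X \<in> carrier T"
  shows "h X = h' X"
  using X
proof (induction X rule: tens_induct)
  case zero
  show ?case using additive_0[OF h(1) T_abelian A] additive_0[OF h(2) T_abelian A] by simp
next
  case (tens x y)
  then show ?case by (rule assms(4))
next
  case (add X Y)
  then show ?case by (simp add: additiveD(2)[OF h(1)] additiveD(2)[OF h(2)])
qed

text \<open>The extension of \<beta> to the free abelian group sends every relator to zero and
  therefore factors through the tensor group.\<close>

lemma lift:
  assumes A: "abelian_group A" and \<beta>: "balanced K ra M la N A \<beta>"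
  obtains h where "additive T A h" "\<And>x y. x \<in> carrier M ==> y \<in> carrier N ==> h (tens x y) = \<beta> x y"
proof -
  interpret A: abelian_group A by fact
  note b = balancedD[OF \<beta>]
  have "(\<lambda>(x, y). \<beta> x y) ` (carrier M \<times> carrier N) \<subseteq> carrier (add_monoid A)"
    by (auto intro: b(1))
  then obtain h0 where h0: "h0 \<in> hom F (add_monoid A)"
    "\<And>x. x \<in> carrier M \<times> carrier N ==> h0 (frag_of x) = (case x of (x, y) => \<beta> x y)"
    using comm_group.free_Abelian_group_universal[OF A.a_comm_group] by metis
  interpret h0: group_hom F "add_monoid A" h0
    using h0(1) A.a_group by (auto simp: group_hom_def group_hom_axioms_def)
  have h0_diff: "h0 (v - w) = h0 v \<ominus>\<^bsub>A\<^esub> h0 w" if "keys v \<subseteq> carrier M \<times> carrier N" "keys w \<subseteq> carrier M \<times> carrier N" for v w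
    using h0.hom_mult[of v "- w"] h0.hom_inv[of w] that by (simp add: A.minus_eq a_inv_def)
  have ker0: "ker \<subseteq> kernel F (add_monoid A) h0"
    unfolding tensor_kernel_def
  proof (rule group.generate_subgroup_incl[OF group_free_Abelian_group _ h0.subgroup_kernel])
    show "tensor_relators K ra M la N \<subseteq> kernel F (add_monoid A) h0"
    proof
      fix w assume w: "w \<in> tensor_relators K ra M la N"
      then have wF: "w \<in> carrier F" using relators by blast
      have 3: "h0 (frag_of (x, y) - frag_of (x', y') - frag_of (x'', y'')) = \<zero>\<^bsub>A\<^esub>"
        if "x \<in> carrier M" "y \<in> carrier N" "x' \<in> carrier M" "y' \<in> carrier N" "x'' \<in> carrier M" "y'' \<in> carrier N"
          "\<beta> x y = \<beta> x' y' \<oplus>\<^bsub>A\<^esub> \<beta> x'' y''" for x y x' y' x'' y''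
      proof -
        have k: "keys (frag_of (x', y') + frag_of (x'', y'')) \<subseteq> carrier M \<times> carrier N"
          using that by (intro keys_add_subset) (auto simp: keys_frag_of)
        have "h0 (frag_of (x', y') + frag_of (x'', y'')) = \<beta> x' y' \<oplus>\<^bsub>A\<^esub> \<beta> x'' y''"
          using h0.hom_mult[of "frag_of (x', y')" "frag_of (x'', y'')"] that h0(2) by (simp add: keys_frag_of)
        then have "h0 (frag_of (x, y) - (frag_of (x', y') + frag_of (x'', y''))) = \<zero>\<^bsub>A\<^esub>"
          using k that b(1) h0(2) by (subst h0_diff) (auto simp: keys_frag_of A.minus_eq_zero_iff)
        then show ?thesis by (simp add: diff_diff_eq)
      qed
      have "h0 w = \<zero>\<^bsub>A\<^esub>"
        using w unfolding tensor_relators_def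
      proof (elim UnE)
        assume "w \<in> {frag_of (ra x c, y) - frag_of (x, la c y) | x c y.
          x \<in> carrier M \<and> c \<in> K \<and> y \<in> carrier N}"
        then show ?thesis using ra la h0(2) b(1,4) by (auto simp: h0_diff keys_frag_of A.minus_eq_zero_iff)
      qed (use b(2,3) 3 in auto)
      then show "w \<in> kernel F (add_monoid A) h0" using wF by (simp add: kernel_def)
    qed
  qed
  have cong: "h0 v = h0 w" if vw: "v \<in> carrier F" "w \<in> carrier F" "ker #>\<^bsub>F\<^esub> v = ker #>\<^bsub>F\<^esub> w" for v w
  proof -
    from vw have "cl v = cl w" by (simp add: tensor_class_def)
    then have "v \<in> cl w" using self_in_cl[of v] vw by simp
    then obtain k where k: "k \<in> ker" "v = k + w" unfolding tensor_class_def r_coset_def by auto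
    then have "h0 k = \<zero>\<^bsub>A\<^esub>" "k \<in> carrier F" using ker0 by (auto simp: kernel_def)
    then show ?thesis using h0.hom_mult[of k w] vw k(2) h0.hom_closed[of w] by simp
  qed
  obtain h where h: "h \<in> hom (F Mod ker) (add_monoid A)" "\<And>w. w \<in> carrier F ==> h (ker #>\<^bsub>F\<^esub> w) = h0 w"
    using FactGroup_universal[OF h0(1) normal cong] by metis
  show thesis
  proof (rule that[of h])
    show "additive T A h"
      using h(1) unfolding additive_def T_simps tensor_group_def hom_def by auto
    show "h (tens x y) = \<beta> x y" if "x \<in> carrier M" "y \<in> carrier N" for x y
      using h(2)[of "frag_of (x, y)"] h0(2)[of "(x, y)"] that by (simp add: tens_def tensor_class_def keys_frag_of)
  qed
qed

text \<open>For operations defined as unions over representatives: a formula g that respects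
  differences and is balanced on pairs is constant on every class, where it agrees with the additive
  map supplied by \<open>lift\<close>.\<close>

lemma union_over_representatives:
  assumes A: "abelian_group A"
    and g: "\<And>v w. keys v \<subseteq> carrier M \<times> carrier N ==> keys w \<subseteq> carrier M \<times> carrier N ==> g (v - w) = g v \<ominus>\<^bsub>A\<^esub> g w"
    and b: "balanced K ra M la N A (\<lambda>x y. g (frag_of (x, y)))"
  obtains h where "additive T A h" "\<And>x y. x \<in> carrier M ==> y \<in> carrier N ==> h (tens x y) = g (frag_of (x, y))"
    "\<And>w. keys w \<subseteq> carrier M \<times> carrier N ==> h (cl w) = g w"
    "\<And>X w. X \<in> carrier T ==> w \<in> X ==> g w = h X"
proof -
  interpret A: abelian_group A by fact
  obtain h where h: "additive T A h" "\<And>x y. x \<in> carrier M ==> y \<in> carrier N ==> h (tens x y) = g (frag_of (x, y))"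
    using lift[OF A b] by blast
  have *: "h (cl w) = g w \<and> g w \<in> carrier A" if "keys w \<subseteq> carrier M \<times> carrier N" for w
    using that
  proof (induction w rule: frag_set_induct)
    case zero
    have "frag_of z - frag_of z = (0 :: 'a \<Rightarrow>\<^sub>0 int)" for z :: 'a by simp
    have "g (0 - 0) = g 0 \<ominus>\<^bsub>A\<^esub> g 0" by (rule g) auto
    \<comment> \<open>Closure of g is known on single pairs only; 0 is reached as a difference of
      two equal ones.\<close>
    moreover have "g 0 \<in> carrier A"
    proof -
      have "g (frag_of (\<zero>\<^bsub>M\<^esub>, \<zero>\<^bsub>N\<^esub>) - frag_of (\<zero>\<^bsub>M\<^esub>, \<zero>\<^bsub>N\<^esub>)) =
        g (frag_of (\<zero>\<^bsub>M\<^esub>, \<zero>\<^bsub>N\<^esub>)) \<ominus>\<^bsub>A\<^esub> g (frag_of (\<zero>\<^bsub>M\<^esub>, \<zero>\<^bsub>N\<^esub>))"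
        by (rule g) (auto simp: keys_frag_of)
      then show ?thesis using balancedD(1)[OF b, of "\<zero>\<^bsub>M\<^esub>" "\<zero>\<^bsub>N\<^esub>"] by simp
    qed
    ultimately show ?case using additive_0[OF h(1) T_abelian A] by (simp add: cl_0 A.minus_eq A.r_neg)
  next
    case (diff v w)
    have "h (cl (v - w)) = h (cl v) \<ominus>\<^bsub>A\<^esub> h (cl w)"
      using additiveD[OF h(1)] additive_minus[OF h(1) T_abelian A] cl_closed diff
      by (simp add: cl_diff T.minus_eq A.minus_eq)
    then show ?case using diff g by simp
  next
    case (frag a)
    then show ?case using h(2) balancedD(1)[OF b] by (cases a) (auto simp: tens_def)
  qed
  show thesis
  proof (rule that[OF h])
    show "g w = h X" if "X \<in> carrier T" "w \<in> X" for X w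
    proof -
      obtain w0 where w0: "X = cl w0" "keys w0 \<subseteq> carrier M \<times> carrier N" using \<open>X \<in> carrier T\<close> carrier_T by auto
      then show ?thesis using in_cl[of w0 w] that(2) *[of w] by simp
    qed
  qed (use * in auto)
qed

lemma class_nonempty: "X \<in> carrier T ==> \<exists>w. w \<in> X"
  unfolding carrier_T using self_in_cl by blast

end

subsection \<open>The action of \<open>A \<otimes> A\<close> on \<open>M \<otimes> N\<close>\<close>

lemma frag_extend_fun_diff: "frag_extend (\<lambda>i. f i - g i) c = frag_extend f c - frag_extend g c"
proof (rule frag_induction[of c UNIV])
  show "frag_extend (\<lambda>i. f i - g i) (a - b) = frag_extend f (a - b) - frag_extend g (a - b)"
    if "frag_extend (\<lambda>i. f i - g i) a = frag_extend f a - frag_extend g a"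
      "frag_extend (\<lambda>i. f i - g i) b = frag_extend f b - frag_extend g b" for a b
    unfolding frag_extend_diff that by (simp add: algebra_simps)
qed auto

lemma tensor_action_diff_left: "tensor_action f g (c - d) w = tensor_action f g c w - tensor_action f g d w"
  by (simp add: tensor_action_def frag_extend_diff)

lemma tensor_action_diff_right: "tensor_action f g c (v - w) = tensor_action f g c v - tensor_action f g c w"
  by (simp add: tensor_action_def frag_extend_diff case_prod_unfold frag_extend_fun_diff)

lemma tensor_action_of: "tensor_action f g (frag_of (h, h')) (frag_of (x, y)) = frag_of (f h x, g h' y)"
  by (simp add: tensor_action_def)

text \<open>The last two assumptions say that a scalar c acts as multiplication by the central
  element c 1.\<close>

locale k_algebra = ring A for A :: "('k::field, 'h, 'e) module_scheme" (structure) +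
  assumes scalar_closed: "x \<in> carrier A ==> c \<odot>\<^bsub>A\<^esub> x \<in> carrier A"
    and scalar_left: "x \<in> carrier A ==> c \<odot>\<^bsub>A\<^esub> x = (c \<odot>\<^bsub>A\<^esub> \<one>) \<otimes> x"
    and scalar_right: "x \<in> carrier A ==> c \<odot>\<^bsub>A\<^esub> x = x \<otimes> (c \<odot>\<^bsub>A\<^esub> \<one>)"
begin

lemma tensor_algebra_product:
  "tensor_product (UNIV :: 'k set) (\<lambda>x c. c \<odot>\<^bsub>A\<^esub> x) A (smult A) A (tensor_algebra A)"
  by unfold_locales (auto simp: tensor_algebra_def Let_def scalar_closed)

sublocale TA: tensor_product "UNIV :: 'k set" "\<lambda>x c. c \<odot>\<^bsub>A\<^esub> x" A "smult A" A "tensor_algebra A"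
  by (rule tensor_algebra_product)

lemma pure_tensor: "pure_tensor A x y = TA.tens x y"
  by (simp add: pure_tensor_def TA.tens_def)

end

text \<open>\<open>am\<close> and \<open>an\<close> are biadditive and compatible with scalars;
  multiplicativity is not part of the setting, so the algebra acting on itself fits as well. The
  action of A \<otimes> A on M \<otimes> N arises from two uses of the universal property:
  \<open>tact\<close> for fixed h and h', then \<open>act\<close>, where the element of A \<otimes>
  A varies.\<close>

locale tensor_action_pair = k_algebra A +
  TM: tensor_product "UNIV :: 'k set" ra M la N T
  for A :: "('k::field, 'h, 'e) module_scheme" and ra and M :: "('m, 'f) ring_scheme" and la
    and N :: "('n, 'g) ring_scheme" and T :: "(('m \<times> 'n \<Rightarrow>\<^sub>0 int) set, 'i) ring_scheme" +
  fixes am :: "'h => 'm => 'm" and an :: "'h => 'n => 'n"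
  assumes am: "\<And>h. h \<in> carrier A ==> additive M M (am h)"
      "\<And>x. x \<in> carrier M ==> additive A M (\<lambda>h. am h x)"
      "\<And>h c x. h \<in> carrier A ==> x \<in> carrier M ==> am h (ra x c) = ra (am h x) c"
      "\<And>h c x. h \<in> carrier A ==> x \<in> carrier M ==> am (c \<odot>\<^bsub>A\<^esub> h) x = ra (am h x) c"
    and an: "\<And>h. h \<in> carrier A ==> additive N N (an h)"
      "\<And>y. y \<in> carrier N ==> additive A N (\<lambda>h. an h y)"
      "\<And>h c y. h \<in> carrier A ==> y \<in> carrier N ==> an h (la c y) = la c (an h y)"
      "\<And>h c y. h \<in> carrier A ==> y \<in> carrier N ==> an (c \<odot>\<^bsub>A\<^esub> h) y = la c (an h y)"
begin

lemmas am_simps = additiveD[OF am(1)] additiveD(2)[OF am(2)]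
lemmas an_simps = additiveD[OF an(1)] additiveD(2)[OF an(2)]

definition tact :: "'h => 'h => ('m \<times> 'n \<Rightarrow>\<^sub>0 int) set => ('m \<times> 'n \<Rightarrow>\<^sub>0 int) set" where
  "tact h h' = (SOME f. additive T T f \<and>
     (\<forall>x\<in>carrier M. \<forall>y\<in>carrier N. f (TM.tens x y) = TM.tens (am h x) (an h' y)))"

lemma tact:
  assumes h: "h \<in> carrier A" "h' \<in> carrier A"
  shows "additive T T (tact h h')"
    "x \<in> carrier M ==> y \<in> carrier N ==> tact h h' (TM.tens x y) = TM.tens (am h x) (an h' y)"
proof -
  have "balanced (UNIV :: 'k set) ra M la N T (\<lambda>x y. TM.tens (am h x) (an h' y))"
    by (rule balancedI) (simp_all add: h am_simps an_simps am(3) an(3) TM.tens_simps)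
  from TM.lift[OF TM.T_abelian this] have "\<exists>f. additive T T f \<and>
     (\<forall>x\<in>carrier M. \<forall>y\<in>carrier N. f (TM.tens x y) = TM.tens (am h x) (an h' y))" by metis
  from someI_ex[OF this] show "additive T T (tact h h')"
    "x \<in> carrier M ==> y \<in> carrier N ==> tact h h' (TM.tens x y) = TM.tens (am h x) (an h' y)"
    unfolding tact_def by simp_all
qed

lemma tact_balanced:
  assumes X: "X \<in> carrier T"
  shows "balanced (UNIV :: 'k set) (\<lambda>x c. c \<odot>\<^bsub>A\<^esub> x) A (smult A) A T (\<lambda>h h'. tact h h' X)"
proof (rule balancedI)
  show "tact h h' X \<in> carrier T" if "h \<in> carrier A" "h' \<in> carrier A" for h h'
    using additiveD(1)[OF tact(1)[OF that] X] .
  show "tact (h \<oplus>\<^bsub>A\<^esub> k) h' X = tact h h' X \<oplus>\<^bsub>T\<^esub> tact k h' X"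
    if hk: "h \<in> carrier A" "k \<in> carrier A" "h' \<in> carrier A" for h k h'
    using X
  proof (induction X rule: TM.tens_induct)
    case zero
    then show ?case using hk additive_0[OF tact(1) TM.T_abelian TM.T_abelian] by simp
  next
    case (tens x y)
    then show ?case using hk by (simp add: tact(2) am_simps an_simps TM.tens_simps)
  next
    case (add X Y)
    have "tact h h' X \<in> carrier T" "tact h h' Y \<in> carrier T" "tact k h' X \<in> carrier T" "tact k h' Y \<in> carrier T"
      using additiveD(1)[OF tact(1)] hk add by simp_all
    then show ?case using add hk by (simp add: additiveD(2)[OF tact(1)] TM.T.a_ac)
  qed
  show "tact h (h' \<oplus>\<^bsub>A\<^esub> k) X = tact h h' X \<oplus>\<^bsub>T\<^esub> tact h k X"
    if hk: "h \<in> carrier A" "h' \<in> carrier A" "k \<in> carrier A" for h h' k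
    using X
  proof (induction X rule: TM.tens_induct)
    case zero
    then show ?case using hk additive_0[OF tact(1) TM.T_abelian TM.T_abelian] by simp
  next
    case (tens x y)
    then show ?case using hk by (simp add: tact(2) am_simps an_simps TM.tens_simps)
  next
    case (add X Y)
    have "tact h h' X \<in> carrier T" "tact h h' Y \<in> carrier T" "tact h k X \<in> carrier T" "tact h k Y \<in> carrier T"
      using additiveD(1)[OF tact(1)] hk add by simp_all
    then show ?case using add hk by (simp add: additiveD(2)[OF tact(1)] TM.T.a_ac)
  qed
  show "tact (c \<odot>\<^bsub>A\<^esub> h) h' X = tact h (c \<odot>\<^bsub>A\<^esub> h') X" if hk: "h \<in> carrier A" "h' \<in> carrier A" for h c h'
  proof (rule TM.additive_eqI[OF TM.T_abelian tact(1) tact(1) _ X])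
    show "tact (c \<odot>\<^bsub>A\<^esub> h) h' (TM.tens x y) = tact h (c \<odot>\<^bsub>A\<^esub> h') (TM.tens x y)" if "x \<in> carrier M" "y \<in> carrier N" for x y
      using that hk by (simp add: tact(2) scalar_closed am(4) an(4) TM.tens_simps am_simps an_simps)
  qed (use hk scalar_closed in auto)
qed

text \<open>For fixed X the universal property of A \<otimes> A gives an additive map in C;
  additivity in X is recovered afterwards in \<open>act_additive\<close>.\<close>

definition act :: "('h \<times> 'h \<Rightarrow>\<^sub>0 int) set => ('m \<times> 'n \<Rightarrow>\<^sub>0 int) set => ('m \<times> 'n \<Rightarrow>\<^sub>0 int) set" where
  "act C X = (SOME f. additive (tensor_algebra A) T f \<and>
     (\<forall>h\<in>carrier A. \<forall>h'\<in>carrier A. f (TA.tens h h') = tact h h' X)) C"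

lemma act:
  assumes X: "X \<in> carrier T"
  shows "additive (tensor_algebra A) T (\<lambda>C. act C X)"
    "h \<in> carrier A ==> h' \<in> carrier A ==> act (TA.tens h h') X = tact h h' X"
proof -
  from TA.lift[OF TM.T_abelian tact_balanced[OF X]]
  have ex: "\<exists>f. additive (tensor_algebra A) T f \<and>
     (\<forall>h\<in>carrier A. \<forall>h'\<in>carrier A. f (TA.tens h h') = tact h h' X)" by metis
  show "additive (tensor_algebra A) T (\<lambda>C. act C X)"
    "h \<in> carrier A ==> h' \<in> carrier A ==> act (TA.tens h h') X = tact h h' X"
    unfolding act_def using someI_ex[OF ex] by simp_all
qed

lemma act_closed: "C \<in> carrier (tensor_algebra A) ==> X \<in> carrier T ==> act C X \<in> carrier T"
  using additiveD(1)[OF act(1)] .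

lemma act_additive: "C \<in> carrier (tensor_algebra A) ==> additive T T (act C)"
proof (rule additiveI)
  assume C: "C \<in> carrier (tensor_algebra A)"
  show "act C (X \<oplus>\<^bsub>T\<^esub> Y) = act C X \<oplus>\<^bsub>T\<^esub> act C Y" if XY: "X \<in> carrier T" "Y \<in> carrier T" for X Y
    using C
  proof (induction C rule: TA.tens_induct)
    case zero
    then show ?case using XY additive_0[OF act(1) TA.T_abelian TM.T_abelian] by simp
  next
    case (tens h h')
    then show ?case using XY by (simp add: act(2) additiveD(2)[OF tact(1)])
  next
    case (add C D)
    have "act C X \<in> carrier T" "act C Y \<in> carrier T" "act D X \<in> carrier T" "act D Y \<in> carrier T"
      using act_closed add XY by simp_all
    then show ?case using add XY by (simp add: additiveD(2)[OF act(1)] TM.T.a_ac)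
  qed
qed (rule act_closed)

lemma keys_tensor_action:
  assumes "keys c \<subseteq> carrier A \<times> carrier A" "keys w \<subseteq> carrier M \<times> carrier N"
  shows "keys (tensor_action am an c w) \<subseteq> carrier M \<times> carrier N"
  using assms(1)
proof (induction c rule: frag_set_induct)
  case zero
  then show ?case by (simp add: tensor_action_def)
next
  case (diff c d)
  then show ?case by (simp add: tensor_action_diff_left keys_diff_subset)
next
  case (frag hh)
  show ?case using assms(2)
  proof (induction w rule: frag_set_induct)
    case zero
    then show ?case by (simp add: tensor_action_def split_beta)
  next
    case (diff v w)
    then show ?case by (simp add: tensor_action_diff_right keys_diff_subset)
  next
    case (frag xy)
    then show ?case using \<open>hh \<in> carrier A \<times> carrier A\<close>
      by (cases hh, cases xy) (simp add: tensor_action_of keys_frag_of am_simps an_simps)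
  qed
qed

lemma cl_tensor_action:
  assumes "keys c \<subseteq> carrier A \<times> carrier A" "keys w \<subseteq> carrier M \<times> carrier N"
  shows "TM.cl (tensor_action am an c w) = act (TA.cl c) (TM.cl w)"
  using assms(1)
proof (induction c rule: frag_set_induct)
  case zero
  then show ?case using additive_0[OF act(1)[OF TM.cl_closed[OF assms(2)]] TA.T_abelian TM.T_abelian]
    by (simp add: tensor_action_def TA.cl_0 TM.cl_0)
next
  case (diff c d)
  note X = TM.cl_closed[OF assms(2)]
  have "act (TA.cl (c - d)) (TM.cl w) = act (TA.cl c) (TM.cl w) \<ominus>\<^bsub>T\<^esub> act (TA.cl d) (TM.cl w)"
    using diff additiveD(2)[OF act(1)[OF X], of "TA.cl c" "\<ominus>\<^bsub>tensor_algebra A\<^esub> TA.cl d"]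
      additive_minus[OF act(1)[OF X] TA.T_abelian TM.T_abelian, of "TA.cl d"] TA.cl_closed
    by (simp add: TA.cl_diff TA.T.minus_eq TM.T.minus_eq)
  then show ?case using diff keys_tensor_action[OF _ assms(2)]
    by (simp add: tensor_action_diff_left TM.cl_diff)
next
  case (frag hh)
  then obtain h h' where h: "hh = (h, h')" "h \<in> carrier A" "h' \<in> carrier A" by auto
  have *: "TA.cl (frag_of hh) = TA.tens h h'" by (simp add: h TA.tens_def)
  show ?case unfolding * using assms(2)
  proof (induction w rule: frag_set_induct)
    case zero
    then show ?case using h additive_0[OF act_additive[OF TA.tens_closed] TM.T_abelian TM.T_abelian]
      by (simp add: tensor_action_def TM.cl_0 split_beta)
  next
    case (diff v w)
    note t = act_additive[OF TA.tens_closed[OF h(2,3)]]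
    have "act (TA.tens h h') (TM.cl (v - w)) = act (TA.tens h h') (TM.cl v) \<ominus>\<^bsub>T\<^esub> act (TA.tens h h') (TM.cl w)"
      using diff additiveD(2)[OF t, of "TM.cl v" "\<ominus>\<^bsub>T\<^esub> TM.cl w"]
        additive_minus[OF t TM.T_abelian TM.T_abelian, of "TM.cl w"] TM.cl_closed
      by (simp add: TM.cl_diff TM.T.minus_eq)
    then show ?case using diff keys_tensor_action[of "frag_of hh"] h
      by (simp add: tensor_action_diff_right TM.cl_diff keys_frag_of)
  next
    case (frag xy)
    then obtain x y where xy: "xy = (x, y)" "x \<in> carrier M" "y \<in> carrier N" by auto
    show ?case using h xy tact(2)[OF h(2,3) xy(2,3)] act(2)[OF TM.tens_closed[OF xy(2,3)] h(2,3)]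
      by (simp add: tensor_action_of TM.tens_def[symmetric])
  qed
qed

text \<open>Identifies the double union over representatives, as used for
  \<open>tensor_algebra\<close> and \<open>tensor_module\<close>, with \<open>act\<close>: the union
  is constant and its index classes are nonempty.\<close>

lemma union_tensor_action:
  assumes C: "C \<in> carrier (tensor_algebra A)" and X: "X \<in> carrier T"
  shows "(\<Union>c\<in>C. \<Union>w\<in>X. TM.cl (tensor_action am an c w)) = act C X"
proof -
  obtain c0 where c0: "C = TA.cl c0" "keys c0 \<subseteq> carrier A \<times> carrier A" using C TA.carrier_T by auto
  obtain w0 where w0: "X = TM.cl w0" "keys w0 \<subseteq> carrier M \<times> carrier N" using X TM.carrier_T by auto
  have "TM.cl (tensor_action am an c w) = act C X" if "c \<in> C" "w \<in> X" for c w
    using TA.in_cl[OF c0(2), of c] TM.in_cl[OF w0(2), of w] that cl_tensor_action[of c w] c0(1) w0(1) by simp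
  moreover have "c0 \<in> C" "w0 \<in> X" using TA.self_in_cl[OF c0(2)] TM.self_in_cl[OF w0(2)] c0(1) w0(1) by auto
  ultimately show ?thesis by auto
qed

lemma act_tens:
  "h \<in> carrier A ==> h' \<in> carrier A ==> x \<in> carrier M ==> y \<in> carrier N ==>
    act (TA.tens h h') (TM.tens x y) = TM.tens (am h x) (an h' y)"
  by (simp add: act(2) tact(2) TM.tens_closed)

end

context k_algebra
begin

lemma mult_scalar_right: "h \<in> carrier A ==> x \<in> carrier A ==> h \<otimes> (c \<odot>\<^bsub>A\<^esub> x) = c \<odot>\<^bsub>A\<^esub> (h \<otimes> x)"
proof -
  assume hx: "h \<in> carrier A" "x \<in> carrier A"
  have c1: "c \<odot>\<^bsub>A\<^esub> \<one> \<in> carrier A" by (simp add: scalar_closed)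
  have "h \<otimes> (c \<odot>\<^bsub>A\<^esub> x) = h \<otimes> (x \<otimes> (c \<odot>\<^bsub>A\<^esub> \<one>))" using scalar_right[OF hx(2)] by simp
  also have "\<dots> = (h \<otimes> x) \<otimes> (c \<odot>\<^bsub>A\<^esub> \<one>)" using hx c1 by (simp add: m_assoc)
  also have "\<dots> = c \<odot>\<^bsub>A\<^esub> (h \<otimes> x)" using hx by (simp add: scalar_right[symmetric])
  finally show ?thesis .
qed

lemma mult_scalar_left: "h \<in> carrier A ==> x \<in> carrier A ==> (c \<odot>\<^bsub>A\<^esub> h) \<otimes> x = c \<odot>\<^bsub>A\<^esub> (h \<otimes> x)"
proof -
  assume hx: "h \<in> carrier A" "x \<in> carrier A"
  have c1: "c \<odot>\<^bsub>A\<^esub> \<one> \<in> carrier A" by (simp add: scalar_closed)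
  have "(c \<odot>\<^bsub>A\<^esub> h) \<otimes> x = ((c \<odot>\<^bsub>A\<^esub> \<one>) \<otimes> h) \<otimes> x" using scalar_left[OF hx(1)] by simp
  also have "\<dots> = (c \<odot>\<^bsub>A\<^esub> \<one>) \<otimes> (h \<otimes> x)" using hx c1 by (simp add: m_assoc)
  also have "\<dots> = c \<odot>\<^bsub>A\<^esub> (h \<otimes> x)" using hx by (simp add: scalar_left[symmetric])
  finally show ?thesis .
qed

text \<open>With A acting on itself by left multiplication, the product of A \<otimes> A becomes an
  instance of the same action.\<close>

sublocale reg: tensor_action_pair A "\<lambda>x c. c \<odot>\<^bsub>A\<^esub> x" A "smult A" A "tensor_algebra A" "(\<otimes>)" "(\<otimes>)"
proof unfold_locales
  show "additive A A ((\<otimes>) h)" if "h \<in> carrier A" for h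
    using that by (intro additiveI) (simp_all add: r_distr)
  show "additive A A (\<lambda>h. h \<otimes> x)" if "x \<in> carrier A" for x
    using that by (intro additiveI) (simp_all add: l_distr)
qed (simp_all add: mult_scalar_left mult_scalar_right)

lemma tensor_algebra_mult:
  "C \<in> carrier (tensor_algebra A) ==> D \<in> carrier (tensor_algebra A) ==>
    C \<otimes>\<^bsub>tensor_algebra A\<^esub> D = reg.act C D"
  using reg.union_tensor_action[of C D] by (simp add: tensor_algebra_def Let_def)

lemma tensor_algebra_mult_closed:
  "C \<in> carrier (tensor_algebra A) ==> D \<in> carrier (tensor_algebra A) ==>
    C \<otimes>\<^bsub>tensor_algebra A\<^esub> D \<in> carrier (tensor_algebra A)"
  by (simp add: tensor_algebra_mult reg.act_closed)

lemma tensor_algebra_one: "\<one>\<^bsub>tensor_algebra A\<^esub> = TA.tens \<one> \<one>"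
  by (simp add: tensor_algebra_def Let_def TA.tens_def)

lemma tensor_algebra_pow_closed:
  "C \<in> carrier (tensor_algebra A) ==> C [^]\<^bsub>tensor_algebra A\<^esub> (i::nat) \<in> carrier (tensor_algebra A)"
  by (induction i) (simp_all add: nat_pow_def tensor_algebra_one TA.tens_closed tensor_algebra_mult_closed)

end

locale tensor_modules = k_algebra A + M: left_module A M + N: left_module A N
  for A :: "('k::field, 'h, 'e) module_scheme" and M :: "('h, 'm, 'f) module_scheme"
    and N :: "('h, 'n, 'g) module_scheme" +
  fixes T :: "(('m \<times> 'n \<Rightarrow>\<^sub>0 int) set, 'i) ring_scheme"
  assumes T: "carrier T = carrier (tensor_group (UNIV :: 'k set) (\<lambda>x c. scalar_mult A M c x) M (scalar_mult A N) N)"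
    "add T = mult (tensor_group (UNIV :: 'k set) (\<lambda>x c. scalar_mult A M c x) M (scalar_mult A N) N)"
    "\<zero>\<^bsub>T\<^esub> = \<one>\<^bsub>tensor_group (UNIV :: 'k set) (\<lambda>x c. scalar_mult A M c x) M (scalar_mult A N) N\<^esub>"
begin

lemma scalar_mult_facts:
  assumes "left_module A L" "h \<in> carrier A" "x \<in> carrier L"
  shows "scalar_mult A L c x \<in> carrier L"
    "h \<odot>\<^bsub>L\<^esub> scalar_mult A L c x = scalar_mult A L c (h \<odot>\<^bsub>L\<^esub> x)"
    "(c \<odot>\<^bsub>A\<^esub> h) \<odot>\<^bsub>L\<^esub> x = scalar_mult A L c (h \<odot>\<^bsub>L\<^esub> x)"
proof -
  interpret L: left_module A L by fact
  have c1: "c \<odot>\<^bsub>A\<^esub> \<one>\<^bsub>A\<^esub> \<in> carrier A" by (simp add: scalar_closed)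
  show "scalar_mult A L c x \<in> carrier L" using assms c1 by (simp add: scalar_mult_def L.smult_closed)
  have "h \<otimes>\<^bsub>A\<^esub> (c \<odot>\<^bsub>A\<^esub> \<one>\<^bsub>A\<^esub>) = (c \<odot>\<^bsub>A\<^esub> \<one>\<^bsub>A\<^esub>) \<otimes>\<^bsub>A\<^esub> h"
    using scalar_left[OF assms(2)] scalar_right[OF assms(2)] by simp
  then show "h \<odot>\<^bsub>L\<^esub> scalar_mult A L c x = scalar_mult A L c (h \<odot>\<^bsub>L\<^esub> x)"
    using assms c1 by (simp add: scalar_mult_def L.smult_assoc[symmetric])
  show "(c \<odot>\<^bsub>A\<^esub> h) \<odot>\<^bsub>L\<^esub> x = scalar_mult A L c (h \<odot>\<^bsub>L\<^esub> x)"
    using assms c1 scalar_left[OF assms(2)] by (simp add: scalar_mult_def L.smult_assoc[symmetric])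
qed

sublocale tensor_action_pair A "\<lambda>x c. scalar_mult A M c x" M "scalar_mult A N" N T "smult M" "smult N"
proof unfold_locales
  note f = scalar_mult_facts[OF M.left_module_axioms] scalar_mult_facts[OF N.left_module_axioms]
  show "additive M M (smult M h)" if "h \<in> carrier A" for h
    using that by (intro additiveI) (simp_all add: M.smult_closed M.smult_r_distr)
  show "additive A M (\<lambda>h. h \<odot>\<^bsub>M\<^esub> x)" if "x \<in> carrier M" for x
    using that by (intro additiveI) (simp_all add: M.smult_closed M.smult_l_distr)
  show "additive N N (smult N h)" if "h \<in> carrier A" for h
    using that by (intro additiveI) (simp_all add: N.smult_closed N.smult_r_distr)
  show "additive A N (\<lambda>h. h \<odot>\<^bsub>N\<^esub> x)" if "x \<in> carrier N" for x
    using that by (intro additiveI) (simp_all add: N.smult_closed N.smult_l_distr)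
qed (use T scalar_mult_facts[OF M.left_module_axioms] scalar_mult_facts[OF N.left_module_axioms]
    scalar_mult_facts(1)[OF M.left_module_axioms one_closed] scalar_mult_facts(1)[OF N.left_module_axioms one_closed] in simp_all)

text \<open>Both sides are additive in C and in D, so pure tensors decide; there the claim is
  associativity of the actions on M and N.\<close>

lemma act_mult:
  assumes "C \<in> carrier (tensor_algebra A)" "D \<in> carrier (tensor_algebra A)" "X \<in> carrier T"
  shows "act (C \<otimes>\<^bsub>tensor_algebra A\<^esub> D) X = act C (act D X)"
  using assms(1)
proof (induction C rule: TA.tens_induct)
  case zero
  have "reg.act \<zero>\<^bsub>tensor_algebra A\<^esub> D = \<zero>\<^bsub>tensor_algebra A\<^esub>"
    using additive_0[OF reg.act(1)[OF assms(2)] TA.T_abelian TA.T_abelian] .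
  then show ?case using assms additive_0[OF act(1) TA.T_abelian TM.T_abelian] act_closed
    by (simp add: tensor_algebra_mult)
next
  case (add C C')
  then show ?case using assms
    by (simp add: tensor_algebra_mult additiveD(2)[OF reg.act(1)] additiveD(2)[OF act(1)] reg.act_closed act_closed)
next
  case (tens a b)
  note ab = tens
  show ?case using assms(2)
  proof (induction D rule: TA.tens_induct)
    case zero
    have "reg.act (TA.tens a b) \<zero>\<^bsub>tensor_algebra A\<^esub> = \<zero>\<^bsub>tensor_algebra A\<^esub>"
      using additive_0[OF reg.act_additive[OF TA.tens_closed[OF ab]] TA.T_abelian TA.T_abelian] .
    then show ?case using ab assms(3) additive_0[OF act(1)[OF assms(3)] TA.T_abelian TM.T_abelian]
        additive_0[OF act_additive[OF TA.tens_closed[OF ab]] TM.T_abelian TM.T_abelian]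
      by (simp add: tensor_algebra_mult TA.tens_closed)
  next
    case (add D D')
    then show ?case using assms(3) ab TA.tens_closed[OF ab]
      by (simp add: tensor_algebra_mult additiveD(2)[OF reg.act_additive] additiveD(2)[OF act_additive]
          additiveD(2)[OF act(1)] reg.act_closed act_closed)
  next
    case (tens c d)
    have 1: "TA.tens a b \<otimes>\<^bsub>tensor_algebra A\<^esub> TA.tens c d = TA.tens (a \<otimes>\<^bsub>A\<^esub> c) (b \<otimes>\<^bsub>A\<^esub> d)"
      using ab tens by (simp add: tensor_algebra_mult TA.tens_closed reg.act_tens)
    note t = act_additive[OF TA.tens_closed]
    show ?case unfolding 1
    proof (rule TM.additive_eqI[OF TM.T_abelian _ _ _ assms(3)])
      show "additive T T (act (TA.tens (a \<otimes>\<^bsub>A\<^esub> c) (b \<otimes>\<^bsub>A\<^esub> d)))" using ab tens by (intro t) auto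
      show "additive T T (\<lambda>X. act (TA.tens a b) (act (TA.tens c d) X))"
        using additiveD[OF t[OF ab]] additiveD[OF t[OF tens]] by (intro additiveI) simp_all
      show "act (TA.tens (a \<otimes>\<^bsub>A\<^esub> c) (b \<otimes>\<^bsub>A\<^esub> d)) (TM.tens x y) = act (TA.tens a b) (act (TA.tens c d) (TM.tens x y))"
        if "x \<in> carrier M" "y \<in> carrier N" for x y
        using that ab tens by (simp add: act_tens M.smult_closed N.smult_closed M.smult_assoc N.smult_assoc)
    qed
  qed
qed

lemma act_one: "X \<in> carrier T ==> act \<one>\<^bsub>tensor_algebra A\<^esub> X = X"
  unfolding tensor_algebra_one
  by (rule TM.additive_eqI[OF TM.T_abelian act_additive])
    (simp_all add: TA.tens_closed additive_def act_tens M.smult_one N.smult_one)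

lemma act_pow:
  assumes "C \<in> carrier (tensor_algebra A)" "X \<in> carrier T"
  shows "act (C [^]\<^bsub>tensor_algebra A\<^esub> (i::nat)) X = (act C ^^ i) X"
proof -
  have cl: "(act C ^^ i) Y \<in> carrier T" if "Y \<in> carrier T" for Y i
    using that by (induction i) (simp_all add: act_closed assms)
  show ?thesis using assms(2)
  proof (induction i arbitrary: X)
    case 0
    then show ?case by (simp add: nat_pow_def act_one)
  next
    case (Suc i)
    have "C [^]\<^bsub>tensor_algebra A\<^esub> Suc i = (C [^]\<^bsub>tensor_algebra A\<^esub> i) \<otimes>\<^bsub>tensor_algebra A\<^esub> C"
      by (simp add: nat_pow_def)
    then show ?case using Suc assms(1) tensor_algebra_pow_closed
      by (simp add: act_mult act_closed funpow_swap1)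
  qed
qed

end

section \<open>The Hopf algebras $kG$ and $kG(\chi^{-1},a,0)$\<close>

lemma (in twisted_monoid_algebra) k_algebra: "k_algebra R"
  by (intro k_algebra.intro k_algebra_axioms.intro ring smult_closed smult_left smult_right)

locale hopf_ore_data = group G for G :: "('g, 'e) monoid_scheme" (structure) +
  fixes \<chi> :: "'g => 'k::field" and a :: 'g
  assumes a: "a \<in> carrier G" "\<And>g. g \<in> carrier G ==> a \<otimes> g = g \<otimes> a"
    and chi_mult: "\<And>g h. g \<in> carrier G ==> h \<in> carrier G ==> \<chi> (g \<otimes> h) = \<chi> g * \<chi> h"
    and chi_nz: "\<And>g. g \<in> carrier G ==> \<chi> g \<noteq> 0"
begin

lemma chi_one: "\<chi> \<one> = 1"
  using chi_mult[of \<one> \<one>] chi_nz[of \<one>] by simp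

definition H where "H = hopf_ore G \<chi> a"
definition KG :: "('k, 'g \<Rightarrow>\<^sub>0 'k) hopf_algebra" where "KG = group_hopf_algebra G"

definition omult where "omult = (\<lambda>(g, i) (h, j). (g \<otimes> h, i + j :: nat))"
definition ococ where "ococ = (\<lambda>(g :: 'g, i :: nat) (h, j :: nat). inverse (\<chi> h) ^ i)"

lemma H_simps:
  "carrier H = carrier (ore_algebra G \<chi>)" "mult H = mult (ore_algebra G \<chi>)" "\<one>\<^bsub>H\<^esub> = \<one>\<^bsub>ore_algebra G \<chi>\<^esub>"
  "\<zero>\<^bsub>H\<^esub> = \<zero>\<^bsub>ore_algebra G \<chi>\<^esub>" "add H = add (ore_algebra G \<chi>)" "smult H = smult (ore_algebra G \<chi>)"
  by (simp_all add: H_def hopf_ore_def Let_def module.defs)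

lemma KG_simps:
  "carrier KG = {f. keys f \<subseteq> carrier G}" "mult KG = mult (group_algebra G)" "\<one>\<^bsub>KG\<^esub> = single \<one> 1"
  "\<zero>\<^bsub>KG\<^esub> = 0" "add KG = (+)" "smult KG = smult (group_algebra G)"
  by (simp_all add: KG_def group_hopf_algebra_def module.defs group_algebra_def)

lemma ore_twisted: "twisted_monoid_algebra (ore_algebra G \<chi>) (carrier G \<times> UNIV) omult (\<one>, 0) ococ"
  by unfold_locales
    (auto simp: ore_algebra_def omult_def ococ_def case_prod_unfold m_assoc chi_mult chi_one power_add power_mult_distrib)

lemma H_twisted: "twisted_monoid_algebra H (carrier G \<times> UNIV) omult (\<one>, 0) ococ"
  using ore_twisted unfolding twisted_monoid_algebra_def H_simps by simp

lemma KG_twisted: "twisted_monoid_algebra KG (carrier G) (\<otimes>) \<one> (\<lambda>_ _. 1)"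
  by unfold_locales (auto simp: KG_simps group_algebra_def m_assoc)

sublocale H: twisted_monoid_algebra H "carrier G \<times> UNIV" omult "(\<one>, 0)" ococ
  by (rule H_twisted)
sublocale KG: twisted_monoid_algebra KG "carrier G" "(\<otimes>)" \<one> "\<lambda>_ _. 1"
  by (rule KG_twisted)
sublocale HA: k_algebra H by (rule H.k_algebra)
sublocale KGA: k_algebra KG by (rule KG.k_algebra)

definition hs :: "'k => 'g \<times> nat \<Rightarrow>\<^sub>0 'k" where "hs c = single (\<one>, 0) c"
definition hg :: "'g => 'g \<times> nat \<Rightarrow>\<^sub>0 'k" where "hg g = single (g, 0) 1"
definition hx :: "'g \<times> nat \<Rightarrow>\<^sub>0 'k" where "hx = single (\<one>, 1) 1"

lemma h_closed [simp]: "hs c \<in> carrier H" "g \<in> carrier G ==> hg g \<in> carrier H" "hx \<in> carrier H"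
  by (simp_all add: hs_def hg_def hx_def H.single_closed)

lemma keys_H: "f \<in> carrier H ==> b \<in> keys f ==> fst b \<in> carrier G"
  unfolding H.car by auto

lemma hs_1: "hs 1 = \<one>\<^bsub>H\<^esub>" "hg \<one> = \<one>\<^bsub>H\<^esub>"
  by (simp_all add: hs_def hg_def H.one)

lemma scalar_mult_H: "scalar_mult H M c x = hs c \<odot>\<^bsub>M\<^esub> x"
  by (simp add: scalar_mult_def H.smult_one hs_def)

lemma hx_pow: "hx [^]\<^bsub>H\<^esub> (i::nat) = single (\<one>, i) 1"
proof (induction i)
  case (Suc i)
  have "hx [^]\<^bsub>H\<^esub> Suc i = (hx [^]\<^bsub>H\<^esub> i) \<otimes>\<^bsub>H\<^esub> hx" by (simp add: nat_pow_def)
  then show ?case unfolding Suc by (simp add: hx_def H.mult_single omult_def ococ_def chi_one)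
qed (simp add: nat_pow_def H.one)

subsection \<open>Modules determined by the generators\<close>

text \<open>A weakening of \<open>left_module\<close>: the action is closed and that of c g x^i is
  composed of the actions of x, g and c. An additive map between such structures is H-linear once it
  commutes with scalars, group elements and x, and for a tensor product the property can be read off
  from the formula for \<Delta> on the basis.\<close>

definition expands :: "('g \<times> nat \<Rightarrow>\<^sub>0 'k, 'm, 'f) module_scheme => bool" where
  "expands M \<longleftrightarrow> abelian_group M \<and> (\<forall>f\<in>carrier H. \<forall>x\<in>carrier M. f \<odot>\<^bsub>M\<^esub> x \<in> carrier M) \<and>
     (\<forall>f\<in>carrier H. \<forall>x\<in>carrier M. f \<odot>\<^bsub>M\<^esub> x =
        finsum M (\<lambda>b. hs (lookup f b) \<odot>\<^bsub>M\<^esub> (hg (fst b) \<odot>\<^bsub>M\<^esub> (((\<lambda>y. hx \<odot>\<^bsub>M\<^esub> y) ^^ snd b) x))) (keys f))"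

lemma left_module_expands:
  assumes "left_module H M"
  shows "expands M"
proof -
  interpret M: left_module H M by fact
  have px: "((\<lambda>y. hx \<odot>\<^bsub>M\<^esub> y) ^^ i) x = (hx [^]\<^bsub>H\<^esub> i) \<odot>\<^bsub>M\<^esub> x \<and> ((\<lambda>y. hx \<odot>\<^bsub>M\<^esub> y) ^^ i) x \<in> carrier M"
    if "x \<in> carrier M" for x and i :: nat
    using that
  proof (induction i arbitrary: x)
    case 0
    then show ?case by (simp add: nat_pow_def M.smult_one)
  next
    case (Suc i)
    have "hx [^]\<^bsub>H\<^esub> Suc i = (hx [^]\<^bsub>H\<^esub> i) \<otimes>\<^bsub>H\<^esub> hx" by (simp add: nat_pow_def)
    then show ?case using Suc.IH[of "hx \<odot>\<^bsub>M\<^esub> x"] Suc.prems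
      by (simp add: funpow_swap1 M.smult_closed M.smult_assoc hx_pow H.single_closed)
  qed
  have "f \<odot>\<^bsub>M\<^esub> x = finsum M (\<lambda>b. hs (lookup f b) \<odot>\<^bsub>M\<^esub> (hg (fst b) \<odot>\<^bsub>M\<^esub> (((\<lambda>y. hx \<odot>\<^bsub>M\<^esub> y) ^^ snd b) x))) (keys f)"
    if f: "f \<in> carrier H" and x: "x \<in> carrier M" for f x
    unfolding H.module_expand[OF assms f x]
  proof (intro M.M.finsum_cong' refl)
    fix b assume "b \<in> keys f"
    then obtain g i where b: "b = (g, i)" "g \<in> carrier G" using f H.car by (cases b) auto
    have "single b 1 = hg g \<otimes>\<^bsub>H\<^esub> (hx [^]\<^bsub>H\<^esub> i)"
      using b by (simp add: hx_pow hg_def H.mult_single omult_def ococ_def)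
    then have "single b 1 \<odot>\<^bsub>M\<^esub> x = hg g \<odot>\<^bsub>M\<^esub> (((\<lambda>y. hx \<odot>\<^bsub>M\<^esub> y) ^^ i) x)"
      using px[OF x, of i] x b by (simp add: M.smult_assoc hx_pow H.single_closed)
    then show "single (\<one>, 0) (lookup f b) \<odot>\<^bsub>M\<^esub> (single b 1 \<odot>\<^bsub>M\<^esub> x) =
      hs (lookup f b) \<odot>\<^bsub>M\<^esub> (hg (fst b) \<odot>\<^bsub>M\<^esub> (((\<lambda>y. hx \<odot>\<^bsub>M\<^esub> y) ^^ snd b) x))"
      by (simp add: hs_def b)
  next
    have "hs (lookup f b) \<odot>\<^bsub>M\<^esub> (hg (fst b) \<odot>\<^bsub>M\<^esub> (((\<lambda>y. hx \<odot>\<^bsub>M\<^esub> y) ^^ snd b) x)) \<in> carrier M" if "b \<in> keys f" for b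
      using keys_H[OF f that] by (intro M.smult_closed conjunct2[OF px[OF x]]) auto
    then show "(\<lambda>b. hs (lookup f b) \<odot>\<^bsub>M\<^esub> (hg (fst b) \<odot>\<^bsub>M\<^esub> (((\<lambda>y. hx \<odot>\<^bsub>M\<^esub> y) ^^ snd b) x))) \<in> keys f \<rightarrow> carrier M"
      by blast
  qed
  then show ?thesis unfolding expands_def using M.M.abelian_group_axioms M.smult_closed by blast
qed

lemma expandsD:
  assumes "expands M"
  shows "abelian_group M" "\<And>f x. f \<in> carrier H ==> x \<in> carrier M ==> f \<odot>\<^bsub>M\<^esub> x \<in> carrier M"
    "\<And>f x. f \<in> carrier H ==> x \<in> carrier M ==> f \<odot>\<^bsub>M\<^esub> x =
        finsum M (\<lambda>b. hs (lookup f b) \<odot>\<^bsub>M\<^esub> (hg (fst b) \<odot>\<^bsub>M\<^esub> (((\<lambda>y. hx \<odot>\<^bsub>M\<^esub> y) ^^ snd b) x))) (keys f)"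
  using assms unfolding expands_def by auto

lemma expands_hom:
  assumes M: "expands M" and N: "expands N" and \<phi>: "additive M N \<phi>"
    and s: "\<And>c x. x \<in> carrier M ==> \<phi> (hs c \<odot>\<^bsub>M\<^esub> x) = hs c \<odot>\<^bsub>N\<^esub> \<phi> x"
    and g: "\<And>g x. g \<in> carrier G ==> x \<in> carrier M ==> \<phi> (hg g \<odot>\<^bsub>M\<^esub> x) = hg g \<odot>\<^bsub>N\<^esub> \<phi> x"
    and x: "\<And>x. x \<in> carrier M ==> \<phi> (hx \<odot>\<^bsub>M\<^esub> x) = hx \<odot>\<^bsub>N\<^esub> \<phi> x"
    and fz: "f \<in> carrier H" "z \<in> carrier M"
  shows "\<phi> (f \<odot>\<^bsub>M\<^esub> z) = f \<odot>\<^bsub>N\<^esub> \<phi> z"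
proof -
  note Md = expandsD[OF M] and Nd = expandsD[OF N] and pd = additiveD[OF \<phi>]
  interpret N: abelian_group N by (rule Nd)
  have pw: "((\<lambda>y. hx \<odot>\<^bsub>M\<^esub> y) ^^ i) z \<in> carrier M \<and>
    \<phi> (((\<lambda>y. hx \<odot>\<^bsub>M\<^esub> y) ^^ i) z) = ((\<lambda>y. hx \<odot>\<^bsub>N\<^esub> y) ^^ i) (\<phi> z)" for i
    by (induction i) (use fz x Md(2) in auto)
  note kf = keys_H[OF fz(1)]
  have "\<phi> (f \<odot>\<^bsub>M\<^esub> z) = finsum N (\<lambda>b. \<phi> (hs (lookup f b) \<odot>\<^bsub>M\<^esub> (hg (fst b) \<odot>\<^bsub>M\<^esub> (((\<lambda>y. hx \<odot>\<^bsub>M\<^esub> y) ^^ snd b) z)))) (keys f)"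
    unfolding Md(3)[OF fz] using pw kf
    by (intro additive_finsum[OF Md(1) Nd(1) pd]) (auto intro!: Md(2))
  also have "\<dots> = f \<odot>\<^bsub>N\<^esub> \<phi> z"
    unfolding Nd(3)[OF fz(1) pd(1)[OF fz(2)]] using pw kf pd(1)[OF fz(2)]
  proof (intro N.finsum_cong' refl)
    fix b assume b: "b \<in> keys f"
    show "\<phi> (hs (lookup f b) \<odot>\<^bsub>M\<^esub> (hg (fst b) \<odot>\<^bsub>M\<^esub> (((\<lambda>y. hx \<odot>\<^bsub>M\<^esub> y) ^^ snd b) z))) =
       hs (lookup f b) \<odot>\<^bsub>N\<^esub> (hg (fst b) \<odot>\<^bsub>N\<^esub> (((\<lambda>y. hx \<odot>\<^bsub>N\<^esub> y) ^^ snd b) (\<phi> z)))"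
      using pw[of "snd b"] kf[OF b] by (simp add: s g Md(2))
  next
    show "(\<lambda>b. hs (lookup f b) \<odot>\<^bsub>N\<^esub> (hg (fst b) \<odot>\<^bsub>N\<^esub> (((\<lambda>y. hx \<odot>\<^bsub>N\<^esub> y) ^^ snd b) (\<phi> z)))) \<in> keys f \<rightarrow> carrier N"
      using pw kf pd(1) by (auto intro!: Nd(2)) (metis pd(1))
  qed
  finally show ?thesis .
qed

subsection \<open>The tensor product of two modules\<close>

text \<open>\<open>tensor_algebra\<close> reads only the algebra part of the record, which H shares
  with \<open>ore_algebra\<close>; the comultiplication of H is defined through the latter.\<close>

lemma tensor_algebra_H: "tensor_algebra H = tensor_algebra (ore_algebra G \<chi>)"
  "pure_tensor H = pure_tensor (ore_algebra G \<chi>)"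
  by (simp_all add: tensor_algebra_def Let_def tensor_group_def tensor_class_def tensor_kernel_def
      tensor_relators_def H_simps pure_tensor_def fun_eq_iff)

definition \<Delta>x where
  "\<Delta>x = HA.TA.tens hx (hg a) \<oplus>\<^bsub>tensor_algebra H\<^esub> HA.TA.tens \<one>\<^bsub>H\<^esub> hx"

lemma \<Delta>x_closed: "\<Delta>x \<in> carrier (tensor_algebra H)"
  unfolding \<Delta>x_def using a by (intro HA.TA.T.a_closed HA.TA.tens_closed) auto

lemma comult_H:
  "comult H f = finsum (tensor_algebra H) (\<lambda>b. HA.TA.tens (lookup f b \<odot>\<^bsub>H\<^esub> hg (fst b)) (hg (fst b))
     \<otimes>\<^bsub>tensor_algebra H\<^esub> (\<Delta>x [^]\<^bsub>tensor_algebra H\<^esub> snd b)) (keys f)"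
proof -
  have "comult H = (\<lambda>f. finsum (tensor_algebra (ore_algebra G \<chi>)) (\<lambda>b. pure_tensor (ore_algebra G \<chi>)
      (lookup f b \<odot>\<^bsub>ore_algebra G \<chi>\<^esub> single (fst b, 0) 1) (single (fst b, 0) 1)
     \<otimes>\<^bsub>tensor_algebra (ore_algebra G \<chi>)\<^esub> ((pure_tensor (ore_algebra G \<chi>) (single (\<one>, 1) 1) (single (a, 0) 1)
       \<oplus>\<^bsub>tensor_algebra (ore_algebra G \<chi>)\<^esub> pure_tensor (ore_algebra G \<chi>) \<one>\<^bsub>ore_algebra G \<chi>\<^esub> (single (\<one>, 1) 1))
          [^]\<^bsub>tensor_algebra (ore_algebra G \<chi>)\<^esub> snd b)) (keys f))"
    by (simp add: H_def hopf_ore_def Let_def module.defs hopf_algebra.defs)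
  then show ?thesis
    unfolding \<Delta>x_def HA.pure_tensor[symmetric] unfolding tensor_algebra_H unfolding H_simps hg_def hx_def
    by simp
qed

lemma comult_H_term:
  assumes "f \<in> carrier H" "b \<in> keys f"
  shows "HA.TA.tens (lookup f b \<odot>\<^bsub>H\<^esub> hg (fst b)) (hg (fst b)) \<in> carrier (tensor_algebra H)"
    "\<Delta>x [^]\<^bsub>tensor_algebra H\<^esub> snd b \<in> carrier (tensor_algebra H)"
  using keys_H[OF assms]
  by (auto intro!: HA.tensor_algebra_pow_closed \<Delta>x_closed HA.TA.tens_closed H.smult_closed)

lemma comult_H_closed: "f \<in> carrier H ==> comult H f \<in> carrier (tensor_algebra H)"
  unfolding comult_H using comult_H_term
  by (intro HA.TA.T.finsum_closed) (auto intro!: HA.tensor_algebra_mult_closed)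

lemma comult_KG:
  "comult KG f = finsum (tensor_algebra KG) (\<lambda>g. KGA.TA.tens (single g (lookup f g)) (single g 1)) (keys f)"
proof -
  have t: "tensor_algebra KG = tensor_algebra (group_algebra G)" "pure_tensor KG = pure_tensor (group_algebra G)"
    by (simp_all add: tensor_algebra_def Let_def tensor_group_def tensor_class_def tensor_kernel_def
      tensor_relators_def KG_simps pure_tensor_def fun_eq_iff group_algebra_def)
  have "comult KG = (\<lambda>f. finsum (tensor_algebra (group_algebra G))
    (\<lambda>g. pure_tensor (group_algebra G) (single g (lookup f g)) (single g 1)) (keys f))"
    by (simp add: KG_def group_hopf_algebra_def module.defs hopf_algebra.defs)
  then show ?thesis unfolding KGA.pure_tensor[symmetric] t by simp
qed

lemma comult_KG_closed: "f \<in> carrier KG ==> comult KG f \<in> carrier (tensor_algebra KG)"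
  unfolding comult_KG using KG.car
  by (intro KGA.TA.T.finsum_closed) (auto intro!: KGA.TA.tens_closed KG.single_closed)

end

locale ore_tensor = hopf_ore_data G \<chi> a + M: left_module H M + N: left_module H N
  for G :: "('g, 'e) monoid_scheme" (structure) and \<chi> :: "'g => 'k::field" and a
    and M :: "('g \<times> nat \<Rightarrow>\<^sub>0 'k, 'm, 'f) module_scheme" and N :: "('g \<times> nat \<Rightarrow>\<^sub>0 'k, 'n, 'h) module_scheme"
begin

definition T where "T = tensor_module H M N"

sublocale TP: tensor_modules H M N T
  by unfold_locales (simp_all add: T_def tensor_module_def Let_def)

abbreviation tens where "tens \<equiv> TP.TM.tens"

lemma smult_T: "f \<in> carrier H ==> X \<in> carrier T ==> f \<odot>\<^bsub>T\<^esub> X = TP.act (comult H f) X"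
  using TP.union_tensor_action[OF comult_H_closed, of f X]
  by (simp add: T_def tensor_module_def Let_def)

lemma smult_T_expand:
  assumes f: "f \<in> carrier H" and X: "X \<in> carrier T"
  shows "f \<odot>\<^bsub>T\<^esub> X = finsum T (\<lambda>b. TP.act (HA.TA.tens (lookup f b \<odot>\<^bsub>H\<^esub> hg (fst b)) (hg (fst b)))
    ((TP.act \<Delta>x ^^ snd b) X)) (keys f)"
proof -
  have "f \<odot>\<^bsub>T\<^esub> X = finsum T (\<lambda>b. TP.act (HA.TA.tens (lookup f b \<odot>\<^bsub>H\<^esub> hg (fst b)) (hg (fst b))
     \<otimes>\<^bsub>tensor_algebra H\<^esub> (\<Delta>x [^]\<^bsub>tensor_algebra H\<^esub> snd b)) X) (keys f)"
    unfolding smult_T[OF f X] comult_H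
    using comult_H_term[OF f] HA.tensor_algebra_mult_closed additiveD[OF TP.act(1)[OF X]]
    by (intro additive_finsum[OF HA.TA.T_abelian TP.TM.T_abelian]) auto
  also have "\<dots> = finsum T (\<lambda>b. TP.act (HA.TA.tens (lookup f b \<odot>\<^bsub>H\<^esub> hg (fst b)) (hg (fst b)))
    ((TP.act \<Delta>x ^^ snd b) X)) (keys f)"
  proof (intro TP.TM.T.finsum_cong' refl)
    fix b assume b: "b \<in> keys f"
    show "TP.act (HA.TA.tens (lookup f b \<odot>\<^bsub>H\<^esub> hg (fst b)) (hg (fst b))
      \<otimes>\<^bsub>tensor_algebra H\<^esub> (\<Delta>x [^]\<^bsub>tensor_algebra H\<^esub> snd b)) X =
      TP.act (HA.TA.tens (lookup f b \<odot>\<^bsub>H\<^esub> hg (fst b)) (hg (fst b))) ((TP.act \<Delta>x ^^ snd b) X)"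
      using comult_H_term[OF f b] X \<Delta>x_closed by (simp add: TP.act_mult TP.act_pow)
  next
    show "(\<lambda>b. TP.act (HA.TA.tens (lookup f b \<odot>\<^bsub>H\<^esub> hg (fst b)) (hg (fst b))) ((TP.act \<Delta>x ^^ snd b) X))
      \<in> keys f \<rightarrow> carrier T"
      using comult_H_term[OF f] X \<Delta>x_closed TP.act_closed by (auto simp: TP.act_pow[symmetric])
  qed
  finally show ?thesis .
qed

lemma smult_T_closed: "f \<in> carrier H ==> X \<in> carrier T ==> f \<odot>\<^bsub>T\<^esub> X \<in> carrier T"
  by (simp add: smult_T TP.act_closed comult_H_closed)

lemma smult_T_single:
  assumes "g \<in> carrier G" "X \<in> carrier T"
  shows "single (g, i) c \<odot>\<^bsub>T\<^esub> X = TP.act (HA.TA.tens (c \<odot>\<^bsub>H\<^esub> hg g) (hg g)) ((TP.act \<Delta>x ^^ i) X)"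
proof (cases "c = 0")
  \<comment> \<open>\<open>single (g, i) 0\<close> has no keys, so the defining sum is empty and the
    right-hand side has to be shown to vanish separately.\<close>
  case True
  have "0 \<odot>\<^bsub>H\<^esub> hg g = \<zero>\<^bsub>H\<^esub>" by (simp add: hg_def H.smult_single H.zero)
  moreover have "HA.TA.tens \<zero>\<^bsub>H\<^esub> (hg g) = \<zero>\<^bsub>tensor_algebra H\<^esub>"
    using additive_0[OF HA.TA.tens_additive(2) HA.abelian_group_axioms HA.TA.T_abelian] assms by simp
  moreover have "(TP.act \<Delta>x ^^ i) X \<in> carrier T"
    using assms \<Delta>x_closed by (simp add: TP.act_pow[symmetric] TP.act_closed HA.tensor_algebra_pow_closed)
  ultimately have "TP.act (HA.TA.tens (c \<odot>\<^bsub>H\<^esub> hg g) (hg g)) ((TP.act \<Delta>x ^^ i) X) = \<zero>\<^bsub>T\<^esub>"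
    using True additive_0[OF TP.act(1) HA.TA.T_abelian TP.TM.T_abelian] by simp
  moreover have "single (g, i) c \<odot>\<^bsub>T\<^esub> X = \<zero>\<^bsub>T\<^esub>"
    using True smult_T_expand[of "single (g, i) c" X] assms by (simp add: H.car)
  ultimately show ?thesis by simp
next
  case False
  have "TP.act (HA.TA.tens (c \<odot>\<^bsub>H\<^esub> hg g) (hg g)) ((TP.act \<Delta>x ^^ i) X) \<in> carrier T"
    using assms \<Delta>x_closed by (auto simp: TP.act_pow[symmetric]
      intro!: TP.act_closed HA.tensor_algebra_pow_closed HA.TA.tens_closed H.smult_closed)
  then show ?thesis
    using False smult_T_expand[of "single (g, i) c" X] assms by (simp add: H.single_closed Pi_def)
qed

lemma smult_T_hs: "X \<in> carrier T ==> hs c \<odot>\<^bsub>T\<^esub> X = TP.act (HA.TA.tens (hs c) \<one>\<^bsub>H\<^esub>) X"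
  using smult_T_single[of \<one> X 0 c] by (simp add: hs_def[symmetric] hs_1 H.smult_one)

lemma smult_T_hg: "g \<in> carrier G ==> X \<in> carrier T ==> hg g \<odot>\<^bsub>T\<^esub> X = TP.act (HA.TA.tens (hg g) (hg g)) X"
  using smult_T_single[of g X 0 1] by (simp add: hg_def[symmetric]) (simp add: hg_def H.smult_single)

lemma smult_T_hx: "X \<in> carrier T ==> hx \<odot>\<^bsub>T\<^esub> X = TP.act \<Delta>x X"
  using smult_T_single[of \<one> X "Suc 0" 1] HA.tensor_algebra_one TP.act_one TP.act_closed \<Delta>x_closed
  by (simp add: hx_def hs_1 H.smult_one H.one[symmetric])

lemma smult_tens:
  assumes "x \<in> carrier M" "y \<in> carrier N"
  shows "hs c \<odot>\<^bsub>T\<^esub> tens x y = tens (hs c \<odot>\<^bsub>M\<^esub> x) y"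
    "g \<in> carrier G ==> hg g \<odot>\<^bsub>T\<^esub> tens x y = tens (hg g \<odot>\<^bsub>M\<^esub> x) (hg g \<odot>\<^bsub>N\<^esub> y)"
    "hx \<odot>\<^bsub>T\<^esub> tens x y = tens (hx \<odot>\<^bsub>M\<^esub> x) (hg a \<odot>\<^bsub>N\<^esub> y) \<oplus>\<^bsub>T\<^esub> tens x (hx \<odot>\<^bsub>N\<^esub> y)"
  using assms a(1)
  by (simp_all add: smult_T_hs smult_T_hg smult_T_hx TP.TM.tens_closed TP.act_tens M.smult_one N.smult_one
      \<Delta>x_def additiveD(2)[OF TP.act(1)] HA.TA.tens_closed)

text \<open>Read off from \<Delta>(g x^i) = (g \<otimes> g) \<Delta>(x)^i, together with cg
  \<otimes> g = (c \<otimes> 1)(g \<otimes> g).\<close>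

lemma expands_T: "expands T"
  unfolding expands_def
proof (intro conjI ballI)
  show "abelian_group T" by (rule TP.TM.T_abelian)
  fix f X assume f: "f \<in> carrier H" and X: "X \<in> carrier T"
  show "f \<odot>\<^bsub>T\<^esub> X \<in> carrier T" using f X by (rule smult_T_closed)
  have pw: "((\<lambda>y. hx \<odot>\<^bsub>T\<^esub> y) ^^ i) X = (TP.act \<Delta>x ^^ i) X \<and> (TP.act \<Delta>x ^^ i) X \<in> carrier T" for i
    by (induction i) (use X in \<open>auto simp: smult_T_hx TP.act_closed \<Delta>x_closed\<close>)
  show "f \<odot>\<^bsub>T\<^esub> X = finsum T (\<lambda>b. hs (lookup f b) \<odot>\<^bsub>T\<^esub> (hg (fst b) \<odot>\<^bsub>T\<^esub> (((\<lambda>y. hx \<odot>\<^bsub>T\<^esub> y) ^^ snd b) X))) (keys f)"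
    unfolding smult_T_expand[OF f X]
  proof (intro TP.TM.T.finsum_cong' refl)
    fix b assume b: "b \<in> keys f"
    have g: "fst b \<in> carrier G" using keys_H[OF f b] .
    have m: "HA.TA.tens (lookup f b \<odot>\<^bsub>H\<^esub> hg (fst b)) (hg (fst b)) =
      HA.TA.tens (hs (lookup f b)) \<one>\<^bsub>H\<^esub> \<otimes>\<^bsub>tensor_algebra H\<^esub> HA.TA.tens (hg (fst b)) (hg (fst b))"
      using g H.smult_left[of "hg (fst b)" "lookup f b"]
      by (simp add: HA.tensor_algebra_mult HA.TA.tens_closed HA.reg.act_tens H.smult_one hs_def[symmetric])
    show "TP.act (HA.TA.tens (lookup f b \<odot>\<^bsub>H\<^esub> hg (fst b)) (hg (fst b))) ((TP.act \<Delta>x ^^ snd b) X) =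
      hs (lookup f b) \<odot>\<^bsub>T\<^esub> (hg (fst b) \<odot>\<^bsub>T\<^esub> (((\<lambda>y. hx \<odot>\<^bsub>T\<^esub> y) ^^ snd b) X))"
      using pw[of "snd b"] g
      by (simp add: m TP.act_mult HA.TA.tens_closed smult_T_hs smult_T_hg TP.act_closed)
  next
    show "(\<lambda>b. hs (lookup f b) \<odot>\<^bsub>T\<^esub> (hg (fst b) \<odot>\<^bsub>T\<^esub> (((\<lambda>y. hx \<odot>\<^bsub>T\<^esub> y) ^^ snd b) X))) \<in> keys f \<rightarrow> carrier T"
      using pw keys_H[OF f] by (auto intro!: smult_T_closed)
  qed
qed

end

section \<open>Tensor products over the group algebra\<close>

locale group_tensor = hopf_ore_data G \<chi> a + M: left_module KG M + N: left_module KG N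
  for G :: "('g, 'e) monoid_scheme" (structure) and \<chi> :: "'g => 'k::field" and a
    and M :: "('g \<Rightarrow>\<^sub>0 'k, 'm, 'f) module_scheme" and N :: "('g \<Rightarrow>\<^sub>0 'k, 'n, 'h) module_scheme"
begin

definition T where "T = tensor_module KG M N"

sublocale TP: tensor_modules KG M N T
  by unfold_locales (simp_all add: T_def tensor_module_def Let_def)

abbreviation tens where "tens \<equiv> TP.TM.tens"

lemma smult_T: "f \<in> carrier KG ==> X \<in> carrier T ==> f \<odot>\<^bsub>T\<^esub> X = TP.act (comult KG f) X"
  using TP.union_tensor_action[OF comult_KG_closed, of f X]
  by (simp add: T_def tensor_module_def Let_def)

lemma smult_T_closed: "f \<in> carrier KG ==> X \<in> carrier T ==> f \<odot>\<^bsub>T\<^esub> X \<in> carrier T"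
  by (simp add: smult_T TP.act_closed comult_KG_closed)

lemma smult_tens:
  assumes "g \<in> carrier G" "x \<in> carrier M" "y \<in> carrier N"
  shows "single g c \<odot>\<^bsub>T\<^esub> tens x y = tens (single g c \<odot>\<^bsub>M\<^esub> x) (single g 1 \<odot>\<^bsub>N\<^esub> y)"
proof (cases "c = 0")
  case True
  have "0 \<odot>\<^bsub>M\<^esub> x = \<zero>\<^bsub>M\<^esub>" using M.smult_zero_left[OF assms(2)] by (simp add: KG.zero)
  moreover have "single g 1 \<odot>\<^bsub>N\<^esub> y \<in> carrier N" using assms by (simp add: N.smult_closed KG.single_closed)
  moreover have "comult KG 0 = \<zero>\<^bsub>tensor_algebra KG\<^esub>" by (simp add: comult_KG)
  ultimately show ?thesis
    using True assms additive_0[OF TP.TM.tens_additive(2) M.M.abelian_group_axioms TP.TM.T_abelian]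
      additive_0[OF TP.act(1) KGA.TA.T_abelian TP.TM.T_abelian] KG.zero
    by (simp add: smult_T KG.car TP.TM.tens_closed)
next
  case False
  have "comult KG (single g c) = KGA.TA.tens (single g c) (single g 1)"
    using False assms by (simp add: comult_KG Pi_def KGA.TA.tens_closed KG.single_closed)
  then show ?thesis using assms by (simp add: smult_T TP.TM.tens_closed TP.act_tens KG.single_closed)
qed

end

section \<open>Isomorphisms and direct sums\<close>

lemma module_isoI:
  assumes "\<And>x. x \<in> carrier M ==> \<phi> x \<in> carrier N" "\<And>y. y \<in> carrier N ==> \<psi> y \<in> carrier M"
    "\<And>x. x \<in> carrier M ==> \<psi> (\<phi> x) = x" "\<And>y. y \<in> carrier N ==> \<phi> (\<psi> y) = y"
    "\<And>x y. x \<in> carrier M ==> y \<in> carrier M ==> \<phi> (x \<oplus>\<^bsub>M\<^esub> y) = \<phi> x \<oplus>\<^bsub>N\<^esub> \<phi> y"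
    "\<And>r x. r \<in> carrier R ==> x \<in> carrier M ==> \<phi> (r \<odot>\<^bsub>M\<^esub> x) = r \<odot>\<^bsub>N\<^esub> \<phi> x"
  shows "module_iso R M N"
  unfolding module_iso_def
proof (intro exI[of _ \<phi>] conjI ballI)
  show "bij_betw \<phi> (carrier M) (carrier N)"
    by (rule bij_betw_byWitness[of _ \<psi>]) (use assms(1-4) in auto)
qed (use assms(5,6) in auto)

definition inverse_isos where
  "inverse_isos R M N \<phi> \<psi> \<longleftrightarrow> (\<forall>x\<in>carrier M. \<phi> x \<in> carrier N) \<and> (\<forall>y\<in>carrier N. \<psi> y \<in> carrier M) \<and>
     (\<forall>x\<in>carrier M. \<psi> (\<phi> x) = x) \<and> (\<forall>y\<in>carrier N. \<phi> (\<psi> y) = y) \<and>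
     (\<forall>x\<in>carrier M. \<forall>y\<in>carrier M. \<phi> (x \<oplus>\<^bsub>M\<^esub> y) = \<phi> x \<oplus>\<^bsub>N\<^esub> \<phi> y) \<and>
     (\<forall>r\<in>carrier R. \<forall>x\<in>carrier M. \<phi> (r \<odot>\<^bsub>M\<^esub> x) = r \<odot>\<^bsub>N\<^esub> \<phi> x)"

lemma inverse_isosD:
  assumes "inverse_isos R M N \<phi> \<psi>"
  shows "\<And>x. x \<in> carrier M ==> \<phi> x \<in> carrier N" "\<And>y. y \<in> carrier N ==> \<psi> y \<in> carrier M"
    "\<And>x. x \<in> carrier M ==> \<psi> (\<phi> x) = x" "\<And>y. y \<in> carrier N ==> \<phi> (\<psi> y) = y"
    "\<And>x y. x \<in> carrier M ==> y \<in> carrier M ==> \<phi> (x \<oplus>\<^bsub>M\<^esub> y) = \<phi> x \<oplus>\<^bsub>N\<^esub> \<phi> y"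
    "\<And>r x. r \<in> carrier R ==> x \<in> carrier M ==> \<phi> (r \<odot>\<^bsub>M\<^esub> x) = r \<odot>\<^bsub>N\<^esub> \<phi> x"
  using assms unfolding inverse_isos_def by simp_all

lemma module_isoE:
  assumes "module_iso R M N"
  obtains \<phi> \<psi> where "inverse_isos R M N \<phi> \<psi>"
proof -
  obtain \<phi> where \<phi>: "bij_betw \<phi> (carrier M) (carrier N)"
    "\<forall>x\<in>carrier M. \<forall>y\<in>carrier M. \<phi> (x \<oplus>\<^bsub>M\<^esub> y) = \<phi> x \<oplus>\<^bsub>N\<^esub> \<phi> y"
    "\<forall>r\<in>carrier R. \<forall>x\<in>carrier M. \<phi> (r \<odot>\<^bsub>M\<^esub> x) = r \<odot>\<^bsub>N\<^esub> \<phi> x"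
    using assms unfolding module_iso_def by blast
  have "inverse_isos R M N \<phi> (inv_into (carrier M) \<phi>)"
    unfolding inverse_isos_def
    using \<phi>(2,3) bij_betw_apply[OF \<phi>(1)] bij_betw_apply[OF bij_betw_inv_into[OF \<phi>(1)]]
        bij_betw_inv_into_left[OF \<phi>(1)] bij_betw_inv_into_right[OF \<phi>(1)] by simp
  then show thesis by (rule that)
qed

lemma module_iso_trans [trans]:
  assumes "module_iso R M N" "module_iso R N L"
  shows "module_iso R M L"
proof -
  obtain \<phi> where \<phi>: "bij_betw \<phi> (carrier M) (carrier N)"
    "\<forall>x\<in>carrier M. \<forall>y\<in>carrier M. \<phi> (x \<oplus>\<^bsub>M\<^esub> y) = \<phi> x \<oplus>\<^bsub>N\<^esub> \<phi> y"
    "\<forall>r\<in>carrier R. \<forall>x\<in>carrier M. \<phi> (r \<odot>\<^bsub>M\<^esub> x) = r \<odot>\<^bsub>N\<^esub> \<phi> x"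
    using assms(1) unfolding module_iso_def by blast
  obtain \<psi> where \<psi>: "bij_betw \<psi> (carrier N) (carrier L)"
    "\<forall>x\<in>carrier N. \<forall>y\<in>carrier N. \<psi> (x \<oplus>\<^bsub>N\<^esub> y) = \<psi> x \<oplus>\<^bsub>L\<^esub> \<psi> y"
    "\<forall>r\<in>carrier R. \<forall>x\<in>carrier N. \<psi> (r \<odot>\<^bsub>N\<^esub> x) = r \<odot>\<^bsub>L\<^esub> \<psi> x"
    using assms(2) unfolding module_iso_def by blast
  show ?thesis unfolding module_iso_def
    by (intro exI[of _ "\<psi> \<circ> \<phi>"] conjI bij_betw_trans[OF \<phi>(1) \<psi>(1)])
      (use \<phi> \<psi> bij_betw_apply[OF \<phi>(1)] in auto)
qed

lemma module_iso_refl: "module_iso R M M"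
  unfolding module_iso_def by (intro exI[of _ "\<lambda>x. x"]) (auto simp: bij_betw_def)

text \<open>Only closure of M under its operations is assumed, which is what is at hand for a tensor
  product of H-modules.\<close>

lemma module_iso_sym:
  assumes "module_iso R M N"
    and "\<And>x y. x \<in> carrier M ==> y \<in> carrier M ==> x \<oplus>\<^bsub>M\<^esub> y \<in> carrier M"
    and "\<And>r x. r \<in> carrier R ==> x \<in> carrier M ==> r \<odot>\<^bsub>M\<^esub> x \<in> carrier M"
  shows "module_iso R N M"
proof -
  obtain \<phi> \<psi> where "inverse_isos R M N \<phi> \<psi>" using module_isoE[OF assms(1)] .
  note * = inverse_isosD[OF this]
  show ?thesis
  proof (rule module_isoI[of N \<psi> M \<phi>])
    show "\<psi> (x \<oplus>\<^bsub>N\<^esub> y) = \<psi> x \<oplus>\<^bsub>M\<^esub> \<psi> y" if "x \<in> carrier N" "y \<in> carrier N" for x y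
      using *(3)[OF assms(2)[OF *(2)[OF that(1)] *(2)[OF that(2)]]] that by (simp add: *)
    show "\<psi> (r \<odot>\<^bsub>N\<^esub> x) = r \<odot>\<^bsub>M\<^esub> \<psi> x" if "r \<in> carrier R" "x \<in> carrier N" for r x
      using *(3)[OF assms(3)[OF that(1) *(2)[OF that(2)]]] that by (simp add: *)
  qed (use * in auto)
qed

lemma left_module_iso_sym: "module_iso R M N ==> left_module R M ==> module_iso R N M"
  by (rule module_iso_sym)
    (auto simp: left_module_def left_module_axioms_def abelian_group_def abelian_monoid.a_closed)

text \<open>The map is injective and respects the operations, so each module axiom may be checked in
  N.\<close>

lemma left_module_transfer:
  assumes iso: "module_iso R M N" and N: "left_module R N" and M: "abelian_group M"
    and closed: "\<And>r x. r \<in> carrier R ==> x \<in> carrier M ==> r \<odot>\<^bsub>M\<^esub> x \<in> carrier M"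
  shows "left_module R M"
proof -
  interpret N: left_module R N by fact
  interpret M: abelian_group M by fact
  obtain \<phi> \<psi> where "inverse_isos R M N \<phi> \<psi>" using module_isoE[OF iso] .
  note ** = inverse_isosD[OF this]
  note * = **(1,3,5,6)
  have inj: "x = y" if "x \<in> carrier M" "y \<in> carrier M" "\<phi> x = \<phi> y" for x y
    using arg_cong[OF that(3), of \<psi>] unfolding *(2)[OF that(1)] *(2)[OF that(2)] .
  show ?thesis
  proof (rule left_moduleI[OF N.R.ring_axioms M closed])
    show "(r \<oplus>\<^bsub>R\<^esub> s) \<odot>\<^bsub>M\<^esub> x = (r \<odot>\<^bsub>M\<^esub> x) \<oplus>\<^bsub>M\<^esub> (s \<odot>\<^bsub>M\<^esub> x)"
      if "r \<in> carrier R" "s \<in> carrier R" "x \<in> carrier M" for r s x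
      by (rule inj) (simp_all add: that closed *(1,3,4) N.smult_l_distr)
    show "(r \<otimes>\<^bsub>R\<^esub> s) \<odot>\<^bsub>M\<^esub> x = r \<odot>\<^bsub>M\<^esub> (s \<odot>\<^bsub>M\<^esub> x)"
      if "r \<in> carrier R" "s \<in> carrier R" "x \<in> carrier M" for r s x
      by (rule inj) (simp_all add: that closed *(1,3,4) N.smult_assoc)
    show "r \<odot>\<^bsub>M\<^esub> (x \<oplus>\<^bsub>M\<^esub> y) = (r \<odot>\<^bsub>M\<^esub> x) \<oplus>\<^bsub>M\<^esub> (r \<odot>\<^bsub>M\<^esub> y)"
      if "r \<in> carrier R" "x \<in> carrier M" "y \<in> carrier M" for r x y
      by (rule inj) (simp_all add: that closed *(1,3,4) N.smult_r_distr)
    show "\<one>\<^bsub>R\<^esub> \<odot>\<^bsub>M\<^esub> x = x" if "x \<in> carrier M" for x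
      by (rule inj) (simp_all add: that closed *(1,3,4) N.smult_one)
  qed
qed

lemma direct_sum_simps:
  "carrier (direct_sum I M) = {f \<in> \<Pi>\<^sub>E i\<in>I. carrier (M i). finite {i \<in> I. f i \<noteq> \<zero>\<^bsub>M i\<^esub>}}"
  "\<zero>\<^bsub>direct_sum I M\<^esub> = (\<lambda>i\<in>I. \<zero>\<^bsub>M i\<^esub>)"
  "f \<oplus>\<^bsub>direct_sum I M\<^esub> g = (\<lambda>i\<in>I. f i \<oplus>\<^bsub>M i\<^esub> g i)"
  "r \<odot>\<^bsub>direct_sum I M\<^esub> f = (\<lambda>i\<in>I. r \<odot>\<^bsub>M i\<^esub> f i)"
  by (simp_all add: direct_sum_def)

lemma PiE_eqI: "f \<in> PiE I A ==> g \<in> PiE I B ==> (\<And>i. i \<in> I ==> f i = g i) ==> f = g"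
  by (rule extensionalityI[of _ I]) (auto simp: PiE_def)

lemma direct_sum_abelian:
  assumes "\<And>i. i \<in> I ==> abelian_group (M i)"
  shows "abelian_group (direct_sum I M)"
proof -
  have M: "abelian_monoid (M i)" if "i \<in> I" for i using assms[OF that] by (simp add: abelian_group_def)
  note zc = abelian_monoid.zero_closed[OF M] and ac = abelian_monoid.a_closed[OF M] and lz = abelian_monoid.l_zero[OF M]
  show ?thesis
  proof (rule abelian_groupI)
    fix f g assume fg: "f \<in> carrier (direct_sum I M)" "g \<in> carrier (direct_sum I M)"
    have "{i \<in> I. f i \<oplus>\<^bsub>M i\<^esub> g i \<noteq> \<zero>\<^bsub>M i\<^esub>} \<subseteq> {i \<in> I. f i \<noteq> \<zero>\<^bsub>M i\<^esub>} \<union> {i \<in> I. g i \<noteq> \<zero>\<^bsub>M i\<^esub>}"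
    proof
      fix i assume i: "i \<in> {i \<in> I. f i \<oplus>\<^bsub>M i\<^esub> g i \<noteq> \<zero>\<^bsub>M i\<^esub>}"
      then have "\<not> (f i = \<zero>\<^bsub>M i\<^esub> \<and> g i = \<zero>\<^bsub>M i\<^esub>)" using lz[of i "\<zero>\<^bsub>M i\<^esub>"] zc[of i] by auto
      then show "i \<in> {i \<in> I. f i \<noteq> \<zero>\<^bsub>M i\<^esub>} \<union> {i \<in> I. g i \<noteq> \<zero>\<^bsub>M i\<^esub>}" using i by auto
    qed
    moreover have "finite \<dots>" using fg by (simp add: direct_sum_simps)
    ultimately have "finite {i \<in> I. f i \<oplus>\<^bsub>M i\<^esub> g i \<noteq> \<zero>\<^bsub>M i\<^esub>}" by (rule finite_subset)
    then show "f \<oplus>\<^bsub>direct_sum I M\<^esub> g \<in> carrier (direct_sum I M)"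
      using fg ac by (auto simp: direct_sum_simps PiE_iff cong: conj_cong)
    show "f \<oplus>\<^bsub>direct_sum I M\<^esub> g = g \<oplus>\<^bsub>direct_sum I M\<^esub> f"
      using fg M by (auto simp: direct_sum_simps PiE_iff fun_eq_iff abelian_monoid.a_comm)
  next
    fix f g h assume "f \<in> carrier (direct_sum I M)" "g \<in> carrier (direct_sum I M)" "h \<in> carrier (direct_sum I M)"
    then show "f \<oplus>\<^bsub>direct_sum I M\<^esub> g \<oplus>\<^bsub>direct_sum I M\<^esub> h = f \<oplus>\<^bsub>direct_sum I M\<^esub> (g \<oplus>\<^bsub>direct_sum I M\<^esub> h)"
      using M by (auto simp: direct_sum_simps PiE_iff fun_eq_iff abelian_monoid.a_assoc)
  next
    show "\<zero>\<^bsub>direct_sum I M\<^esub> \<in> carrier (direct_sum I M)" using zc by (auto simp: direct_sum_simps cong: conj_cong)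
  next
    fix f assume f: "f \<in> carrier (direct_sum I M)"
    show "\<zero>\<^bsub>direct_sum I M\<^esub> \<oplus>\<^bsub>direct_sum I M\<^esub> f = f"
      using f lz by (intro ext) (auto simp: direct_sum_simps PiE_iff extensional_def)
    define n where "n i = \<ominus>\<^bsub>M i\<^esub> f i" for i
    have fi: "f i \<in> carrier (M i)" if "i \<in> I" for i using f that by (auto simp: direct_sum_simps)
    have n: "n i \<in> carrier (M i) \<and> n i \<oplus>\<^bsub>M i\<^esub> f i = \<zero>\<^bsub>M i\<^esub>" if "i \<in> I" for i
      using assms[OF that] fi[OF that] by (simp add: n_def abelian_group.l_neg abelian_group.a_inv_closed)
    have "n i = \<zero>\<^bsub>M i\<^esub>" if "i \<in> I" "f i = \<zero>\<^bsub>M i\<^esub>" for i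
      using n[OF that(1)] that abelian_monoid.r_zero[OF M[OF that(1)]] by metis
    then have "{i \<in> I. n i \<noteq> \<zero>\<^bsub>M i\<^esub>} \<subseteq> {i \<in> I. f i \<noteq> \<zero>\<^bsub>M i\<^esub>}" by auto
    then have "finite {i \<in> I. n i \<noteq> \<zero>\<^bsub>M i\<^esub>}" using f by (auto simp: direct_sum_simps intro: finite_subset)
    then show "\<exists>y\<in>carrier (direct_sum I M). y \<oplus>\<^bsub>direct_sum I M\<^esub> f = \<zero>\<^bsub>direct_sum I M\<^esub>"
      using n by (intro bexI[of _ "\<lambda>i\<in>I. n i"]) (auto simp: direct_sum_simps cong: conj_cong)
  qed
qed

lemma direct_sum_left_module:
  assumes R: "ring R" and M: "\<And>i. i \<in> I ==> left_module R (M i)"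
  shows "left_module R (direct_sum I M)"
proof (rule left_moduleI[OF R direct_sum_abelian])
  show "abelian_group (M i)" if "i \<in> I" for i using M[OF that] by (simp add: left_module_def)
  fix r f assume r: "r \<in> carrier R" and f: "f \<in> carrier (direct_sum I M)"
  have "{i \<in> I. r \<odot>\<^bsub>M i\<^esub> f i \<noteq> \<zero>\<^bsub>M i\<^esub>} \<subseteq> {i \<in> I. f i \<noteq> \<zero>\<^bsub>M i\<^esub>}"
    using left_module.smult_zero_right[OF M r] by auto
  then have "finite {i \<in> I. r \<odot>\<^bsub>M i\<^esub> f i \<noteq> \<zero>\<^bsub>M i\<^esub>}"
    using f by (auto simp: direct_sum_simps intro: finite_subset)
  then show "r \<odot>\<^bsub>direct_sum I M\<^esub> f \<in> carrier (direct_sum I M)"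
    using f left_module.smult_closed[OF M r] by (auto simp: direct_sum_simps PiE_iff cong: conj_cong)
next
  fix r s f assume "r \<in> carrier R" "s \<in> carrier R" "f \<in> carrier (direct_sum I M)"
  then show "(r \<oplus>\<^bsub>R\<^esub> s) \<odot>\<^bsub>direct_sum I M\<^esub> f = (r \<odot>\<^bsub>direct_sum I M\<^esub> f) \<oplus>\<^bsub>direct_sum I M\<^esub> (s \<odot>\<^bsub>direct_sum I M\<^esub> f)"
    "(r \<otimes>\<^bsub>R\<^esub> s) \<odot>\<^bsub>direct_sum I M\<^esub> f = r \<odot>\<^bsub>direct_sum I M\<^esub> (s \<odot>\<^bsub>direct_sum I M\<^esub> f)"
    using M by (auto simp: direct_sum_simps PiE_iff fun_eq_iff left_module.smult_l_distr left_module.smult_assoc)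
next
  fix r f g assume "r \<in> carrier R" "f \<in> carrier (direct_sum I M)" "g \<in> carrier (direct_sum I M)"
  then show "r \<odot>\<^bsub>direct_sum I M\<^esub> (f \<oplus>\<^bsub>direct_sum I M\<^esub> g) = (r \<odot>\<^bsub>direct_sum I M\<^esub> f) \<oplus>\<^bsub>direct_sum I M\<^esub> (r \<odot>\<^bsub>direct_sum I M\<^esub> g)"
    using left_module.smult_r_distr[OF M] by (auto simp: direct_sum_simps PiE_iff fun_eq_iff)
next
  fix f assume "f \<in> carrier (direct_sum I M)"
  then show "\<one>\<^bsub>R\<^esub> \<odot>\<^bsub>direct_sum I M\<^esub> f = f"
    using M by (intro ext) (auto simp: direct_sum_simps PiE_iff extensional_def left_module.smult_one)
qed

lemma copies_left_module: "ring R ==> left_module R M ==> left_module R (copies n M)"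
  unfolding copies_def by (rule direct_sum_left_module)

lemma direct_sum_cong:
  assumes iso: "\<And>i. i \<in> I ==> module_iso R (M i) (N i)"
    and ab: "\<And>i. i \<in> I ==> abelian_group (M i)" "\<And>i. i \<in> I ==> abelian_group (N i)"
  shows "module_iso R (direct_sum I M) (direct_sum I N)"
proof -
  have "\<forall>i. \<exists>\<phi> \<psi>. i \<in> I \<longrightarrow> inverse_isos R (M i) (N i) \<phi> \<psi>"
    using iso module_isoE by metis
  then obtain \<phi> \<psi> where P: "\<And>i. i \<in> I ==> inverse_isos R (M i) (N i) (\<phi> i) (\<psi> i)" by metis
  note P = inverse_isosD[OF P]
  have z: "\<phi> i \<zero>\<^bsub>M i\<^esub> = \<zero>\<^bsub>N i\<^esub>" if "i \<in> I" for i
    using P(1,5)[OF that] by (intro additive_zero[OF ab(1)[OF that] ab(2)[OF that]])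
  have z': "\<psi> i \<zero>\<^bsub>N i\<^esub> = \<zero>\<^bsub>M i\<^esub>" if "i \<in> I" for i
    using P(3)[OF that, of "\<zero>\<^bsub>M i\<^esub>"] z[OF that] ab(1)[OF that]
    by (simp add: abelian_group_def abelian_monoid.zero_closed)
  show ?thesis
  proof (rule module_isoI[of _ "\<lambda>f. \<lambda>i\<in>I. \<phi> i (f i)" _ "\<lambda>f. \<lambda>i\<in>I. \<psi> i (f i)"])
    fix f assume f: "f \<in> carrier (direct_sum I M)"
    have "{i \<in> I. \<phi> i (f i) \<noteq> \<zero>\<^bsub>N i\<^esub>} \<subseteq> {i \<in> I. f i \<noteq> \<zero>\<^bsub>M i\<^esub>}" using z by auto
    then have "finite {i \<in> I. \<phi> i (f i) \<noteq> \<zero>\<^bsub>N i\<^esub>}" using f by (auto simp: direct_sum_simps intro: finite_subset)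
    then show "(\<lambda>i\<in>I. \<phi> i (f i)) \<in> carrier (direct_sum I N)"
      using f P by (auto simp: direct_sum_simps PiE_iff cong: conj_cong)
    show "(\<lambda>i\<in>I. \<psi> i ((\<lambda>i\<in>I. \<phi> i (f i)) i)) = f"
      using f P by (intro ext) (auto simp: direct_sum_simps PiE_iff extensional_def)
  next
    fix f assume f: "f \<in> carrier (direct_sum I N)"
    have "{i \<in> I. \<psi> i (f i) \<noteq> \<zero>\<^bsub>M i\<^esub>} \<subseteq> {i \<in> I. f i \<noteq> \<zero>\<^bsub>N i\<^esub>}" using z' by auto
    then have "finite {i \<in> I. \<psi> i (f i) \<noteq> \<zero>\<^bsub>M i\<^esub>}" using f by (auto simp: direct_sum_simps intro: finite_subset)
    then show "(\<lambda>i\<in>I. \<psi> i (f i)) \<in> carrier (direct_sum I M)"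
      using f P by (auto simp: direct_sum_simps PiE_iff cong: conj_cong)
    show "(\<lambda>i\<in>I. \<phi> i ((\<lambda>i\<in>I. \<psi> i (f i)) i)) = f"
      using f P by (intro ext) (auto simp: direct_sum_simps PiE_iff extensional_def)
  qed (use P in \<open>auto simp: direct_sum_simps PiE_iff fun_eq_iff\<close>)
qed

lemma direct_sum_reindex:
  assumes "bij_betw \<pi> J I"
  shows "module_iso R (direct_sum I M) (direct_sum J (\<lambda>j. M (\<pi> j)))"
proof -
  let ?inv = "inv_into J \<pi>"
  note \<pi> = bij_betw_apply[OF assms] and i = bij_betw_apply[OF bij_betw_inv_into[OF assms]]
    and l = bij_betw_inv_into_left[OF assms] and r = bij_betw_inv_into_right[OF assms]
  have inj: "inj_on \<pi> J" and im: "\<pi> ` J = I" using assms by (auto simp: bij_betw_def)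
  show ?thesis
  proof (rule module_isoI[of _ "\<lambda>f. \<lambda>j\<in>J. f (\<pi> j)" _ "\<lambda>h. \<lambda>i\<in>I. h (?inv i)"])
    fix f assume f: "f \<in> carrier (direct_sum I M)"
    have "finite {j \<in> J. f (\<pi> j) \<noteq> \<zero>\<^bsub>M (\<pi> j)\<^esub>}"
    proof (rule inj_on_finite[of \<pi>])
      show "inj_on \<pi> {j \<in> J. f (\<pi> j) \<noteq> \<zero>\<^bsub>M (\<pi> j)\<^esub>}" using inj by (rule inj_on_subset) auto
      show "finite {i \<in> I. f i \<noteq> \<zero>\<^bsub>M i\<^esub>}" using f by (simp add: direct_sum_simps)
    qed (use \<pi> in auto)
    then show "(\<lambda>j\<in>J. f (\<pi> j)) \<in> carrier (direct_sum J (\<lambda>j. M (\<pi> j)))"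
      using f \<pi> by (auto simp: direct_sum_simps PiE_iff cong: conj_cong)
    show "(\<lambda>i\<in>I. (\<lambda>j\<in>J. f (\<pi> j)) (?inv i)) = f"
      using f i r by (intro ext) (auto simp: direct_sum_simps PiE_iff extensional_def)
  next
    fix h assume h: "h \<in> carrier (direct_sum J (\<lambda>j. M (\<pi> j)))"
    have "{i \<in> I. h (?inv i) \<noteq> \<zero>\<^bsub>M i\<^esub>} \<subseteq> \<pi> ` {j \<in> J. h j \<noteq> \<zero>\<^bsub>M (\<pi> j)\<^esub>}"
    proof
      fix x assume "x \<in> {i \<in> I. h (?inv i) \<noteq> \<zero>\<^bsub>M i\<^esub>}"
      then show "x \<in> \<pi> ` {j \<in> J. h j \<noteq> \<zero>\<^bsub>M (\<pi> j)\<^esub>}"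
        using i r by (intro image_eqI[of _ _ "?inv x"]) auto
    qed
    then have "finite {i \<in> I. h (?inv i) \<noteq> \<zero>\<^bsub>M i\<^esub>}" using h by (auto simp: direct_sum_simps intro: finite_subset)
    moreover have "h (?inv x) \<in> carrier (M x)" if "x \<in> I" for x
      using h i[OF that] r[OF that] unfolding direct_sum_simps PiE_iff mem_Collect_eq by metis
    ultimately show "(\<lambda>i\<in>I. h (?inv i)) \<in> carrier (direct_sum I M)"
      by (auto simp: direct_sum_simps PiE_iff cong: conj_cong)
    show "(\<lambda>j\<in>J. (\<lambda>i\<in>I. h (?inv i)) (\<pi> j)) = h"
      using h \<pi> l by (intro ext) (auto simp: direct_sum_simps PiE_iff extensional_def)
  qed (use \<pi> in \<open>auto simp: direct_sum_simps fun_eq_iff\<close>)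
qed

lemma direct_sum_Sigma:
  "module_iso R (direct_sum I (\<lambda>i. direct_sum (J i) (M i))) (direct_sum (Sigma I J) (\<lambda>p. M (fst p) (snd p)))"
proof (rule module_isoI[of _ "\<lambda>f. \<lambda>p\<in>Sigma I J. f (fst p) (snd p)" _ "\<lambda>h. \<lambda>i\<in>I. \<lambda>j\<in>J i. h (i, j)"])
  fix f assume f: "f \<in> carrier (direct_sum I (\<lambda>i. direct_sum (J i) (M i)))"
  have fi: "f i \<in> carrier (direct_sum (J i) (M i))" if "i \<in> I" for i
    using f that unfolding direct_sum_simps(1)[of I] PiE_iff by blast
  have "{p \<in> Sigma I J. f (fst p) (snd p) \<noteq> \<zero>\<^bsub>M (fst p) (snd p)\<^esub>} \<subseteq>
    Sigma {i \<in> I. f i \<noteq> \<zero>\<^bsub>direct_sum (J i) (M i)\<^esub>} (\<lambda>i. {j \<in> J i. f i j \<noteq> \<zero>\<^bsub>M i j\<^esub>})"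
    by (auto simp: direct_sum_simps)
  moreover have "finite \<dots>"
    using f fi by (intro finite_SigmaI) (auto simp: direct_sum_simps)
  ultimately have "finite {p \<in> Sigma I J. f (fst p) (snd p) \<noteq> \<zero>\<^bsub>M (fst p) (snd p)\<^esub>}" by (rule finite_subset)
  then show "(\<lambda>p\<in>Sigma I J. f (fst p) (snd p)) \<in> carrier (direct_sum (Sigma I J) (\<lambda>p. M (fst p) (snd p)))"
    using fi by (auto simp: direct_sum_simps PiE_iff cong: conj_cong)
  show "(\<lambda>i\<in>I. \<lambda>j\<in>J i. (\<lambda>p\<in>Sigma I J. f (fst p) (snd p)) (i, j)) = f"
  proof (rule PiE_eqI)
    show "f \<in> (\<Pi>\<^sub>E i\<in>I. carrier (direct_sum (J i) (M i)))" using f by (simp add: direct_sum_simps(1)[of I])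
    show "(\<lambda>i\<in>I. \<lambda>j\<in>J i. (\<lambda>p\<in>Sigma I J. f (fst p) (snd p)) (i, j)) \<in> (\<Pi>\<^sub>E i\<in>I. UNIV)" by auto
    show "(\<lambda>i\<in>I. \<lambda>j\<in>J i. (\<lambda>p\<in>Sigma I J. f (fst p) (snd p)) (i, j)) i = f i" if "i \<in> I" for i
      using fi[OF that] that by (intro ext) (auto simp: direct_sum_simps PiE_iff extensional_def)
  qed
next
  fix h assume h: "h \<in> carrier (direct_sum (Sigma I J) (\<lambda>p. M (fst p) (snd p)))"
  let ?S = "{p \<in> Sigma I J. h p \<noteq> \<zero>\<^bsub>M (fst p) (snd p)\<^esub>}"
  have S: "finite ?S" using h by (simp add: direct_sum_simps)
  have hi: "(\<lambda>j\<in>J i. h (i, j)) \<in> carrier (direct_sum (J i) (M i))" if "i \<in> I" for i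
  proof -
    have "{j \<in> J i. h (i, j) \<noteq> \<zero>\<^bsub>M i j\<^esub>} \<subseteq> snd ` ?S"
    proof
      fix j assume "j \<in> {j \<in> J i. h (i, j) \<noteq> \<zero>\<^bsub>M i j\<^esub>}"
      then show "j \<in> snd ` ?S" using that by (intro image_eqI[of _ _ "(i, j)"]) auto
    qed
    then have "finite {j \<in> J i. h (i, j) \<noteq> \<zero>\<^bsub>M i j\<^esub>}" using S by (auto intro: finite_subset)
    then show ?thesis using h that by (auto simp: direct_sum_simps PiE_iff cong: conj_cong)
  qed
  have "{i \<in> I. (\<lambda>j\<in>J i. h (i, j)) \<noteq> \<zero>\<^bsub>direct_sum (J i) (M i)\<^esub>} \<subseteq> fst ` ?S"
  proof
    fix i assume i: "i \<in> {i \<in> I. (\<lambda>j\<in>J i. h (i, j)) \<noteq> \<zero>\<^bsub>direct_sum (J i) (M i)\<^esub>}"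
    then obtain j where "j \<in> J i" "h (i, j) \<noteq> \<zero>\<^bsub>M i j\<^esub>"
      by (auto simp: direct_sum_simps fun_eq_iff restrict_def split: if_splits)
    then show "i \<in> fst ` ?S" using i by (intro image_eqI[of _ _ "(i, j)"]) auto
  qed
  then have "finite {i \<in> I. (\<lambda>j\<in>J i. h (i, j)) \<noteq> \<zero>\<^bsub>direct_sum (J i) (M i)\<^esub>}" using S by (auto intro: finite_subset)
  then show "(\<lambda>i\<in>I. \<lambda>j\<in>J i. h (i, j)) \<in> carrier (direct_sum I (\<lambda>i. direct_sum (J i) (M i)))"
    using hi unfolding direct_sum_simps(1)[of I] by (auto cong: conj_cong)
  show "(\<lambda>p\<in>Sigma I J. (\<lambda>i\<in>I. \<lambda>j\<in>J i. h (i, j)) (fst p) (snd p)) = h"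
    using h by (intro ext) (auto simp: direct_sum_simps PiE_iff extensional_def)
qed (auto simp: direct_sum_simps fun_eq_iff)

lemma direct_sum2_simps:
  "carrier (M \<oplus>\<^sub>M N) = carrier M \<times> carrier N" "\<zero>\<^bsub>M \<oplus>\<^sub>M N\<^esub> = (\<zero>\<^bsub>M\<^esub>, \<zero>\<^bsub>N\<^esub>)"
  "(x, y) \<oplus>\<^bsub>M \<oplus>\<^sub>M N\<^esub> (x', y') = (x \<oplus>\<^bsub>M\<^esub> x', y \<oplus>\<^bsub>N\<^esub> y')" "r \<odot>\<^bsub>M \<oplus>\<^sub>M N\<^esub> (x, y) = (r \<odot>\<^bsub>M\<^esub> x, r \<odot>\<^bsub>N\<^esub> y)"
  by (simp_all add: direct_sum2_def)

lemma direct_sum2_cong: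
  assumes "module_iso R M M'" "module_iso R N N'"
  shows "module_iso R (M \<oplus>\<^sub>M N) (M' \<oplus>\<^sub>M N')"
proof -
  obtain \<phi> \<psi> where "inverse_isos R M M' \<phi> \<psi>" using module_isoE[OF assms(1)] .
  note 1 = inverse_isosD[OF this]
  obtain \<phi>' \<psi>' where "inverse_isos R N N' \<phi>' \<psi>'" using module_isoE[OF assms(2)] .
  note 2 = inverse_isosD[OF this]
  show ?thesis
    by (rule module_isoI[of _ "map_prod \<phi> \<phi>'" _ "map_prod \<psi> \<psi>'"]) (use 1 2 in \<open>auto simp: direct_sum2_simps\<close>)
qed

lemma direct_sum2_union:
  assumes "A \<inter> B = {}"
  shows "module_iso R (direct_sum A M \<oplus>\<^sub>M direct_sum B M) (direct_sum (A \<union> B) M)"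
proof (rule module_isoI[of _ "\<lambda>(f, g). \<lambda>i\<in>A \<union> B. if i \<in> A then f i else g i" _ "\<lambda>h. (restrict h A, restrict h B)"])
  fix x assume x: "x \<in> carrier (direct_sum A M \<oplus>\<^sub>M direct_sum B M)"
  then obtain f g where fg: "x = (f, g)" "f \<in> carrier (direct_sum A M)" "g \<in> carrier (direct_sum B M)"
    by (auto simp: direct_sum2_simps)
  have "{i \<in> A \<union> B. (if i \<in> A then f i else g i) \<noteq> \<zero>\<^bsub>M i\<^esub>} \<subseteq>
    {i \<in> A. f i \<noteq> \<zero>\<^bsub>M i\<^esub>} \<union> {i \<in> B. g i \<noteq> \<zero>\<^bsub>M i\<^esub>}" by (auto split: if_splits)
  moreover have "finite \<dots>" using fg by (simp add: direct_sum_simps)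
  ultimately have "finite {i \<in> A \<union> B. (if i \<in> A then f i else g i) \<noteq> \<zero>\<^bsub>M i\<^esub>}" by (rule finite_subset)
  then show "(case x of (f, g) => \<lambda>i\<in>A \<union> B. if i \<in> A then f i else g i) \<in> carrier (direct_sum (A \<union> B) M)"
    using fg by (auto simp: direct_sum_simps PiE_iff cong: conj_cong)
  show "(\<lambda>h. (restrict h A, restrict h B)) (case x of (f, g) => \<lambda>i\<in>A \<union> B. if i \<in> A then f i else g i) = x"
    using fg assms by (auto simp: direct_sum_simps PiE_iff extensional_def fun_eq_iff)
next
  fix h assume h: "h \<in> carrier (direct_sum (A \<union> B) M)"
  have "finite {i \<in> A. h i \<noteq> \<zero>\<^bsub>M i\<^esub>}" "finite {i \<in> B. h i \<noteq> \<zero>\<^bsub>M i\<^esub>}"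
    using h by (auto simp: direct_sum_simps elim!: finite_subset[rotated])
  then show "(restrict h A, restrict h B) \<in> carrier (direct_sum A M \<oplus>\<^sub>M direct_sum B M)"
    using h by (auto simp: direct_sum_simps direct_sum2_simps PiE_iff cong: conj_cong)
  show "(case (restrict h A, restrict h B) of (f, g) => \<lambda>i\<in>A \<union> B. if i \<in> A then f i else g i) = h"
    using h by (intro ext) (auto simp: direct_sum_simps PiE_iff extensional_def)
qed (auto simp: direct_sum_simps direct_sum2_simps fun_eq_iff)

section \<open>Graded modules over a $kG$-module\<close>

text \<open>
  \<open>gmod P B dg X\<close> is the space of functions \<open>B \<rightarrow> P\<close>, that is \<open>k\<^sup>B \<otimes> P\<close>, where \<open>x\<close> acts by the matrix
  \<open>X\<close> and \<open>g\<close> acts on the component \<open>b\<close> by \<open>\<chi>(g)\<close> to the power \<open>dg b\<close> times its action on \<open>P\<close>.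
\<close>

context hopf_ore_data
begin

definition ks :: "'k => 'g \<Rightarrow>\<^sub>0 'k" where "ks c = single \<one> c"
definition kg :: "'g => 'g \<Rightarrow>\<^sub>0 'k" where "kg g = single g 1"

lemma k_closed [simp]: "ks c \<in> carrier KG" "g \<in> carrier G ==> kg g \<in> carrier KG"
  by (simp_all add: ks_def kg_def KG.single_closed)

lemma scalar_mult_KG: "scalar_mult KG M c x = ks c \<odot>\<^bsub>M\<^esub> x"
  by (simp add: scalar_mult_def KG.smult_one ks_def)

lemma ks_kg: "g \<in> carrier G ==> ks c \<otimes>\<^bsub>KG\<^esub> kg g = single g c" "g \<in> carrier G ==> kg g \<otimes>\<^bsub>KG\<^esub> ks c = single g c"
  by (simp_all add: ks_def kg_def KG.mult_single)

definition mact :: "('g \<Rightarrow>\<^sub>0 'k, 'p, 'f) module_scheme => 'b set => 'j set => ('b => 'j => 'k) => ('j => 'p) => 'b => 'p" where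
  "mact P B J S h = (\<lambda>b\<in>B. finsum P (\<lambda>j. ks (S b j) \<odot>\<^bsub>P\<^esub> h j) J)"

definition gsc :: "('g \<Rightarrow>\<^sub>0 'k, 'p, 'f) module_scheme => 'b set => 'k => ('b => 'p) => 'b => 'p" where
  "gsc P B c h = (\<lambda>b\<in>B. ks c \<odot>\<^bsub>P\<^esub> h b)"

definition grho :: "('g \<Rightarrow>\<^sub>0 'k, 'p, 'f) module_scheme => 'b set => ('b => nat) => 'g => ('b => 'p) => 'b => 'p" where
  "grho P B dg g h = (\<lambda>b\<in>B. ks (\<chi> g ^ dg b) \<odot>\<^bsub>P\<^esub> (kg g \<odot>\<^bsub>P\<^esub> h b))"

text \<open>The scalar action of \<open>gmod\<close> is a \<open>finsum\<close> in the additive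
  group of the very record being defined, so this group has to be available first, with its
  \<open>smult\<close> left open.\<close>

definition gmod0 :: "('g \<Rightarrow>\<^sub>0 'k, 'p, 'f) module_scheme => 'b set => ('g \<times> nat \<Rightarrow>\<^sub>0 'k, 'b => 'p) module" where
  "gmod0 P B = \<lparr>carrier = (\<Pi>\<^sub>E b\<in>B. carrier P), mult = undefined, one = undefined,
     ring.zero = (\<lambda>b\<in>B. \<zero>\<^bsub>P\<^esub>), add = (\<lambda>f h. \<lambda>b\<in>B. f b \<oplus>\<^bsub>P\<^esub> h b), smult = undefined\<rparr>"

definition gmod :: "('g \<Rightarrow>\<^sub>0 'k, 'p, 'f) module_scheme => 'b set => ('b => nat) => ('b => 'b => 'k) =>
    ('g \<times> nat \<Rightarrow>\<^sub>0 'k, 'b => 'p) module" where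
  "gmod P B dg X = (gmod0 P B)\<lparr>smult := \<lambda>f h. finsum (gmod0 P B)
     (\<lambda>(g, i). gsc P B (lookup f (g, i)) (grho P B dg g ((mact P B B X ^^ i) h))) (keys f)\<rparr>"

text \<open>On the module this is the relation x g = \<chi>^-1(g) g x, since g acts in degree d with
  the extra factor \<chi>(g)^d.\<close>

definition degree_one :: "'b set => ('b => nat) => ('b => 'b => 'k) => bool" where
  "degree_one B dg X \<longleftrightarrow> finite B \<and> (\<forall>b\<in>B. \<forall>b'\<in>B. X b b' \<noteq> 0 \<longrightarrow> dg b = dg b' + 1)"

lemma gmod_simps:
  "carrier (gmod P B dg X) = (\<Pi>\<^sub>E b\<in>B. carrier P)" "\<zero>\<^bsub>gmod P B dg X\<^esub> = (\<lambda>b\<in>B. \<zero>\<^bsub>P\<^esub>)"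
  "f \<oplus>\<^bsub>gmod P B dg X\<^esub> h = (\<lambda>b\<in>B. f b \<oplus>\<^bsub>P\<^esub> h b)"
  by (simp_all add: gmod_def gmod0_def)

lemma finsum_gmod: "finsum (gmod0 P B) = finsum (gmod P B dg X)"
  by (intro ext) (simp add: finsum_def gmod_def gmod0_def)

end

locale group_module = hopf_ore_data G \<chi> a + P: left_module KG P
  for G :: "('g, 'e) monoid_scheme" (structure) and \<chi> :: "'g => 'k::field" and a
    and P :: "('g \<Rightarrow>\<^sub>0 'k, 'p, 'f) module_scheme"
begin

lemma ks_simps:
  assumes "v \<in> carrier P"
  shows "ks c \<odot>\<^bsub>P\<^esub> v \<in> carrier P" "g \<in> carrier G ==> kg g \<odot>\<^bsub>P\<^esub> v \<in> carrier P"
    "ks c \<odot>\<^bsub>P\<^esub> (ks d \<odot>\<^bsub>P\<^esub> v) = ks (c * d) \<odot>\<^bsub>P\<^esub> v" "ks 1 \<odot>\<^bsub>P\<^esub> v = v" "ks 0 \<odot>\<^bsub>P\<^esub> v = \<zero>\<^bsub>P\<^esub>"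
    "ks (c + d) \<odot>\<^bsub>P\<^esub> v = ks c \<odot>\<^bsub>P\<^esub> v \<oplus>\<^bsub>P\<^esub> ks d \<odot>\<^bsub>P\<^esub> v"
    "g \<in> carrier G ==> kg g \<odot>\<^bsub>P\<^esub> (ks c \<odot>\<^bsub>P\<^esub> v) = ks c \<odot>\<^bsub>P\<^esub> (kg g \<odot>\<^bsub>P\<^esub> v)"
    "g \<in> carrier G ==> h \<in> carrier G ==> kg g \<odot>\<^bsub>P\<^esub> (kg h \<odot>\<^bsub>P\<^esub> v) = kg (g \<otimes> h) \<odot>\<^bsub>P\<^esub> v"
    "kg \<one> \<odot>\<^bsub>P\<^esub> v = v"
    "g \<in> carrier G ==> single g c \<odot>\<^bsub>P\<^esub> v = ks c \<odot>\<^bsub>P\<^esub> (kg g \<odot>\<^bsub>P\<^esub> v)"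
proof -
  show "ks c \<odot>\<^bsub>P\<^esub> v \<in> carrier P" "g \<in> carrier G ==> kg g \<odot>\<^bsub>P\<^esub> v \<in> carrier P"
    using assms by (simp_all add: P.smult_closed)
  show "ks c \<odot>\<^bsub>P\<^esub> (ks d \<odot>\<^bsub>P\<^esub> v) = ks (c * d) \<odot>\<^bsub>P\<^esub> v"
    using assms by (simp add: P.smult_assoc[symmetric]) (simp add: ks_def KG.mult_single)
  show "ks 1 \<odot>\<^bsub>P\<^esub> v = v" "kg \<one> \<odot>\<^bsub>P\<^esub> v = v"
    using assms P.smult_one[of v] by (simp_all add: ks_def kg_def KG.one)
  show "ks 0 \<odot>\<^bsub>P\<^esub> v = \<zero>\<^bsub>P\<^esub>" using assms P.smult_zero_left[of v] by (simp add: ks_def KG.zero)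
  have "ks (c + d) = ks c \<oplus>\<^bsub>KG\<^esub> ks d" by (simp add: ks_def KG.add single_add)
  then show "ks (c + d) \<odot>\<^bsub>P\<^esub> v = ks c \<odot>\<^bsub>P\<^esub> v \<oplus>\<^bsub>P\<^esub> ks d \<odot>\<^bsub>P\<^esub> v"
    using assms by (simp add: P.smult_l_distr)
  show "g \<in> carrier G ==> kg g \<odot>\<^bsub>P\<^esub> (ks c \<odot>\<^bsub>P\<^esub> v) = ks c \<odot>\<^bsub>P\<^esub> (kg g \<odot>\<^bsub>P\<^esub> v)"
    "g \<in> carrier G ==> single g c \<odot>\<^bsub>P\<^esub> v = ks c \<odot>\<^bsub>P\<^esub> (kg g \<odot>\<^bsub>P\<^esub> v)"
    using assms by (simp_all add: P.smult_assoc[symmetric] ks_kg)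
  show "g \<in> carrier G ==> h \<in> carrier G ==> kg g \<odot>\<^bsub>P\<^esub> (kg h \<odot>\<^bsub>P\<^esub> v) = kg (g \<otimes> h) \<odot>\<^bsub>P\<^esub> v"
    using assms by (simp add: P.smult_assoc[symmetric]) (simp add: kg_def KG.mult_single)
qed

lemma ks_additive: "additive P P (\<lambda>v. ks c \<odot>\<^bsub>P\<^esub> v)"
  by (rule additiveI) (simp_all add: P.smult_closed P.smult_r_distr)
lemma kg_additive: "g \<in> carrier G ==> additive P P (\<lambda>v. kg g \<odot>\<^bsub>P\<^esub> v)"
  by (rule additiveI) (simp_all add: P.smult_closed P.smult_r_distr)

lemma ks_sum: "v \<in> carrier P ==> ks (\<Sum>i\<in>A. c i) \<odot>\<^bsub>P\<^esub> v = finsum P (\<lambda>i. ks (c i) \<odot>\<^bsub>P\<^esub> v) A"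
  by (induction A rule: infinite_finite_induct) (simp_all add: ks_simps Pi_def)

lemma ks_finsum: "(\<And>j. j \<in> J ==> h j \<in> carrier P) ==> ks c \<odot>\<^bsub>P\<^esub> finsum P h J = finsum P (\<lambda>j. ks c \<odot>\<^bsub>P\<^esub> h j) J"
  by (rule P.smult_finsum) simp_all
lemma kg_finsum: "g \<in> carrier G ==> (\<And>j. j \<in> J ==> h j \<in> carrier P) ==>
  kg g \<odot>\<^bsub>P\<^esub> finsum P h J = finsum P (\<lambda>j. kg g \<odot>\<^bsub>P\<^esub> h j) J"
  by (rule P.smult_finsum) simp_all

lemma PiE_val: "h \<in> (\<Pi>\<^sub>E j\<in>J. carrier P) ==> j \<in> J ==> h j \<in> carrier P"
  by auto

lemma fcong: "(\<And>j. j \<in> J ==> f j = h j) ==> (\<And>j. j \<in> J ==> h j \<in> carrier P) ==> finsum P f J = finsum P h J"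
  by (rule P.M.finsum_cong') auto

lemma mact_closed: "h \<in> (\<Pi>\<^sub>E j\<in>J. carrier P) ==> mact P B J S h \<in> (\<Pi>\<^sub>E b\<in>B. carrier P)"
  unfolding mact_def by (auto intro!: P.M.finsum_closed ks_simps)

lemma mact_apply: "b \<in> B ==> mact P B J S h b = finsum P (\<lambda>j. ks (S b j) \<odot>\<^bsub>P\<^esub> h j) J"
  by (simp add: mact_def)

lemma mact_cong: "(\<And>b j. b \<in> B ==> j \<in> J ==> S b j = S' b j) ==> h \<in> (\<Pi>\<^sub>E j\<in>J. carrier P) ==>
  mact P B J S h = mact P B J S' h"
  unfolding mact_def by (intro restrict_ext fcong) (auto intro!: ks_simps)

lemma mact_add:
  assumes "f \<in> (\<Pi>\<^sub>E j\<in>J. carrier P)" "h \<in> (\<Pi>\<^sub>E j\<in>J. carrier P)"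
  shows "mact P B J S (\<lambda>j\<in>J. f j \<oplus>\<^bsub>P\<^esub> h j) = (\<lambda>b\<in>B. mact P B J S f b \<oplus>\<^bsub>P\<^esub> mact P B J S h b)"
  unfolding mact_def
proof (intro restrict_ext)
  fix b assume b: "b \<in> B"
  have "finsum P (\<lambda>j. ks (S b j) \<odot>\<^bsub>P\<^esub> (\<lambda>j\<in>J. f j \<oplus>\<^bsub>P\<^esub> h j) j) J =
    finsum P (\<lambda>j. ks (S b j) \<odot>\<^bsub>P\<^esub> f j \<oplus>\<^bsub>P\<^esub> ks (S b j) \<odot>\<^bsub>P\<^esub> h j) J"
    by (intro fcong) (simp_all add: ks_simps PiE_val[OF assms(1)] PiE_val[OF assms(2)] P.smult_r_distr)
  also have "\<dots> = finsum P (\<lambda>j. ks (S b j) \<odot>\<^bsub>P\<^esub> f j) J \<oplus>\<^bsub>P\<^esub> finsum P (\<lambda>j. ks (S b j) \<odot>\<^bsub>P\<^esub> h j) J"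
    using assms by (intro P.M.finsum_addf) (auto intro!: ks_simps)
  finally show "finsum P (\<lambda>j. ks (S b j) \<odot>\<^bsub>P\<^esub> (\<lambda>j\<in>J. f j \<oplus>\<^bsub>P\<^esub> h j) j) J =
    (\<lambda>b\<in>B. finsum P (\<lambda>j. ks (S b j) \<odot>\<^bsub>P\<^esub> f j) J) b \<oplus>\<^bsub>P\<^esub> (\<lambda>b\<in>B. finsum P (\<lambda>j. ks (S b j) \<odot>\<^bsub>P\<^esub> h j) J) b"
    using b by simp
qed

lemma mact_gsc:
  assumes "h \<in> (\<Pi>\<^sub>E j\<in>J. carrier P)"
  shows "mact P B J S (gsc P J c h) = gsc P B c (mact P B J S h)"
  unfolding mact_def gsc_def
proof (intro restrict_ext)
  fix b assume b: "b \<in> B"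
  have "finsum P (\<lambda>j. ks (S b j) \<odot>\<^bsub>P\<^esub> (\<lambda>j\<in>J. ks c \<odot>\<^bsub>P\<^esub> h j) j) J = finsum P (\<lambda>j. ks c \<odot>\<^bsub>P\<^esub> (ks (S b j) \<odot>\<^bsub>P\<^esub> h j)) J"
    using assms by (intro fcong) (auto intro!: ks_simps simp: ks_simps PiE_val[OF assms] mult.commute)
  also have "\<dots> = ks c \<odot>\<^bsub>P\<^esub> finsum P (\<lambda>j. ks (S b j) \<odot>\<^bsub>P\<^esub> h j) J"
    using assms by (intro ks_finsum[symmetric]) (auto intro!: ks_simps)
  finally show "finsum P (\<lambda>j. ks (S b j) \<odot>\<^bsub>P\<^esub> (\<lambda>j\<in>J. ks c \<odot>\<^bsub>P\<^esub> h j) j) J =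
    ks c \<odot>\<^bsub>P\<^esub> (\<lambda>b\<in>B. finsum P (\<lambda>j. ks (S b j) \<odot>\<^bsub>P\<^esub> h j) J) b"
    using b by simp
qed

lemma mact_mact:
  assumes h: "h \<in> (\<Pi>\<^sub>E i\<in>I. carrier P)" and fin: "finite J" "finite I"
  shows "mact P B J S (mact P J I R h) = mact P B I (\<lambda>b i. \<Sum>j\<in>J. S b j * R j i) h"
  unfolding mact_def
proof (intro restrict_ext)
  fix b assume b: "b \<in> B"
  note c = PiE_val[OF h]
  have "finsum P (\<lambda>j. ks (S b j) \<odot>\<^bsub>P\<^esub> (\<lambda>b\<in>J. finsum P (\<lambda>j. ks (R b j) \<odot>\<^bsub>P\<^esub> h j) I) j) J =
    finsum P (\<lambda>j. finsum P (\<lambda>i. ks (S b j * R j i) \<odot>\<^bsub>P\<^esub> h i) I) J"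
  proof (rule fcong)
    fix j assume j: "j \<in> J"
    have "ks (S b j) \<odot>\<^bsub>P\<^esub> finsum P (\<lambda>i. ks (R j i) \<odot>\<^bsub>P\<^esub> h i) I = finsum P (\<lambda>i. ks (S b j) \<odot>\<^bsub>P\<^esub> (ks (R j i) \<odot>\<^bsub>P\<^esub> h i)) I"
      by (rule ks_finsum) (simp add: ks_simps c)
    also have "\<dots> = finsum P (\<lambda>i. ks (S b j * R j i) \<odot>\<^bsub>P\<^esub> h i) I"
      by (rule fcong) (simp_all add: ks_simps c)
    finally show "ks (S b j) \<odot>\<^bsub>P\<^esub> (\<lambda>b\<in>J. finsum P (\<lambda>j. ks (R b j) \<odot>\<^bsub>P\<^esub> h j) I) j =
      finsum P (\<lambda>i. ks (S b j * R j i) \<odot>\<^bsub>P\<^esub> h i) I" using j by simp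
  qed (auto intro!: P.M.finsum_closed ks_simps c)
  also have "\<dots> = finsum P (\<lambda>i. finsum P (\<lambda>j. ks (S b j * R j i) \<odot>\<^bsub>P\<^esub> h i) J) I"
    by (rule finsum_swap[OF P.M.abelian_group_axioms fin]) (simp add: ks_simps c)
  also have "\<dots> = finsum P (\<lambda>i. ks (\<Sum>j\<in>J. S b j * R j i) \<odot>\<^bsub>P\<^esub> h i) I"
    by (rule fcong) (simp_all add: ks_sum c ks_simps)
  finally show "finsum P (\<lambda>j. ks (S b j) \<odot>\<^bsub>P\<^esub> (\<lambda>b\<in>J. finsum P (\<lambda>j. ks (R b j) \<odot>\<^bsub>P\<^esub> h j) I) j) J =
    finsum P (\<lambda>i. ks (\<Sum>j\<in>J. S b j * R j i) \<odot>\<^bsub>P\<^esub> h i) I" .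
qed

lemma mact_row:
  assumes "h \<in> (\<Pi>\<^sub>E j\<in>J. carrier P)" "finite J" "b \<in> B" "j0 \<in> J" "\<And>j. j \<in> J ==> j \<noteq> j0 ==> S b j = 0"
  shows "mact P B J S h b = ks (S b j0) \<odot>\<^bsub>P\<^esub> h j0"
  unfolding mact_apply[OF assms(3)]
  by (rule finsum_single[OF P.M.abelian_group_axioms]) (use assms in \<open>auto intro!: ks_simps simp: ks_simps PiE_val\<close>)

lemma mact_row_zero:
  assumes "h \<in> (\<Pi>\<^sub>E j\<in>J. carrier P)" "b \<in> B" "\<And>j. j \<in> J ==> S b j = 0"
  shows "mact P B J S h b = \<zero>\<^bsub>P\<^esub>"
proof -
  have "mact P B J S h b = finsum P (\<lambda>j. \<zero>\<^bsub>P\<^esub>) J"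
    unfolding mact_apply[OF assms(2)] using assms by (intro fcong) (auto simp: ks_simps PiE_val)
  then show ?thesis by simp
qed

lemma mact_id:
  assumes "h \<in> (\<Pi>\<^sub>E b\<in>B. carrier P)" "finite B" "\<And>b b'. b \<in> B ==> b' \<in> B ==> S b b' = (if b = b' then 1 else 0)"
  shows "mact P B B S h = h"
proof (rule PiE_eqI[OF mact_closed[OF assms(1)] assms(1)])
  fix b assume b: "b \<in> B"
  have "mact P B B S h b = ks (S b b) \<odot>\<^bsub>P\<^esub> h b"
    using assms b by (intro mact_row) auto
  then show "mact P B B S h b = h b" using assms b by (simp add: ks_simps PiE_val)
qed

text \<open>A matrix of degree \<delta> commutes with g up to \<chi>(g)^\<delta>. The case \<delta>
  = 1 is the relation between x and g, the case \<delta> = 0 makes homogeneous base changes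
  equivariant.\<close>

lemma grho_mact:
  assumes h: "h \<in> (\<Pi>\<^sub>E j\<in>J. carrier P)" and g: "g \<in> carrier G"
    and S: "\<And>b j. b \<in> B ==> j \<in> J ==> S b j \<noteq> 0 ==> dg b = dg' j + \<delta>"
  shows "grho P B dg g (mact P B J S h) = gsc P B (\<chi> g ^ \<delta>) (mact P B J S (grho P J dg' g h))"
  unfolding grho_def gsc_def mact_def
proof (intro restrict_ext)
  fix b assume b: "b \<in> B"
  note c = PiE_val[OF h]
  have "ks (\<chi> g ^ dg b) \<odot>\<^bsub>P\<^esub> (kg g \<odot>\<^bsub>P\<^esub> finsum P (\<lambda>j. ks (S b j) \<odot>\<^bsub>P\<^esub> h j) J) =
    ks (\<chi> g ^ dg b) \<odot>\<^bsub>P\<^esub> finsum P (\<lambda>j. kg g \<odot>\<^bsub>P\<^esub> (ks (S b j) \<odot>\<^bsub>P\<^esub> h j)) J"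
    using g by (subst kg_finsum) (simp_all add: ks_simps c)
  also have "\<dots> = finsum P (\<lambda>j. ks (\<chi> g ^ dg b) \<odot>\<^bsub>P\<^esub> (kg g \<odot>\<^bsub>P\<^esub> (ks (S b j) \<odot>\<^bsub>P\<^esub> h j))) J"
    using g by (intro ks_finsum) (simp_all add: ks_simps c)
  also have "\<dots> = finsum P (\<lambda>j. ks (\<chi> g ^ \<delta>) \<odot>\<^bsub>P\<^esub> (ks (S b j) \<odot>\<^bsub>P\<^esub> (ks (\<chi> g ^ dg' j) \<odot>\<^bsub>P\<^esub> (kg g \<odot>\<^bsub>P\<^esub> h j)))) J"
  proof (rule fcong)
    fix j assume j: "j \<in> J"
    have "\<chi> g ^ dg b * S b j = \<chi> g ^ \<delta> * (S b j * \<chi> g ^ dg' j)"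
      using S[OF b j] by (cases "S b j = 0") (auto simp: power_add)
    then show "ks (\<chi> g ^ dg b) \<odot>\<^bsub>P\<^esub> (kg g \<odot>\<^bsub>P\<^esub> (ks (S b j) \<odot>\<^bsub>P\<^esub> h j)) =
      ks (\<chi> g ^ \<delta>) \<odot>\<^bsub>P\<^esub> (ks (S b j) \<odot>\<^bsub>P\<^esub> (ks (\<chi> g ^ dg' j) \<odot>\<^bsub>P\<^esub> (kg g \<odot>\<^bsub>P\<^esub> h j)))"
      using g c[OF j] by (simp only: ks_simps)
  qed (use g in \<open>simp add: ks_simps c\<close>)
  also have "\<dots> = ks (\<chi> g ^ \<delta>) \<odot>\<^bsub>P\<^esub> finsum P (\<lambda>j. ks (S b j) \<odot>\<^bsub>P\<^esub> (ks (\<chi> g ^ dg' j) \<odot>\<^bsub>P\<^esub> (kg g \<odot>\<^bsub>P\<^esub> h j))) J"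
    using g by (intro ks_finsum[symmetric]) (simp_all add: ks_simps c)
  also have "finsum P (\<lambda>j. ks (S b j) \<odot>\<^bsub>P\<^esub> (ks (\<chi> g ^ dg' j) \<odot>\<^bsub>P\<^esub> (kg g \<odot>\<^bsub>P\<^esub> h j))) J =
    finsum P (\<lambda>j. ks (S b j) \<odot>\<^bsub>P\<^esub> (\<lambda>j\<in>J. ks (\<chi> g ^ dg' j) \<odot>\<^bsub>P\<^esub> (kg g \<odot>\<^bsub>P\<^esub> h j)) j) J"
    using g by (intro fcong) (simp_all add: ks_simps c)
  finally show "ks (\<chi> g ^ dg b) \<odot>\<^bsub>P\<^esub> (kg g \<odot>\<^bsub>P\<^esub> (\<lambda>b\<in>B. finsum P (\<lambda>j. ks (S b j) \<odot>\<^bsub>P\<^esub> h j) J) b) =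
    ks (\<chi> g ^ \<delta>) \<odot>\<^bsub>P\<^esub> (\<lambda>b\<in>B. finsum P (\<lambda>j. ks (S b j) \<odot>\<^bsub>P\<^esub> (\<lambda>j\<in>J. ks (\<chi> g ^ dg' j) \<odot>\<^bsub>P\<^esub> (kg g \<odot>\<^bsub>P\<^esub> h j)) j) J) b"
    using b by simp
qed

lemma gsc_closed: "h \<in> (\<Pi>\<^sub>E b\<in>B. carrier P) ==> gsc P B c h \<in> (\<Pi>\<^sub>E b\<in>B. carrier P)"
  unfolding gsc_def by (auto intro!: ks_simps)
lemma grho_closed: "h \<in> (\<Pi>\<^sub>E b\<in>B. carrier P) ==> g \<in> carrier G ==> grho P B dg g h \<in> (\<Pi>\<^sub>E b\<in>B. carrier P)"
  unfolding grho_def by (auto intro!: ks_simps)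

lemma gmod_abelian: "abelian_group (gmod P B dg X)"
proof (rule abelian_groupI)
  fix f assume f: "f \<in> carrier (gmod P B dg X)"
  then show "\<exists>y\<in>carrier (gmod P B dg X). y \<oplus>\<^bsub>gmod P B dg X\<^esub> f = \<zero>\<^bsub>gmod P B dg X\<^esub>"
    by (intro bexI[of _ "\<lambda>b\<in>B. \<ominus>\<^bsub>P\<^esub> f b"])
      (auto simp: gmod_simps P.M.l_neg PiE_val intro!: restrict_ext)
  show "\<zero>\<^bsub>gmod P B dg X\<^esub> \<oplus>\<^bsub>gmod P B dg X\<^esub> f = f"
    using f by (intro ext) (auto simp: gmod_simps PiE_iff extensional_def)
qed (auto simp: gmod_simps P.M.a_assoc PiE_val intro!: restrict_ext P.M.a_comm)

text \<open>Since X has degree one, x and g satisfy the defining relation of H; iterating it shows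
  that (g, i) acting as g after X^i is a representation with cocycle \<open>ococ\<close>, as
  \<open>left_module_from_basis\<close> requires.\<close>

lemma gmod_left_module:
  assumes X: "degree_one B dg X"
  shows "left_module H (gmod P B dg X)"
proof -
  let ?M = "gmod P B dg X" and ?\<xi> = "mact P B B X"
  let ?\<rho> = "\<lambda>(g, i) h. grho P B dg g ((?\<xi> ^^ i) h)"
  let ?C = "\<Pi>\<^sub>E b\<in>B. carrier P"
  have pw: "(?\<xi> ^^ i) h \<in> ?C" if "h \<in> ?C" for h i
    using that by (induction i) (simp_all add: mact_closed)
  have comm: "?\<xi> (grho P B dg g h) = gsc P B (inverse (\<chi> g)) (grho P B dg g (?\<xi> h))" if "h \<in> ?C" "g \<in> carrier G" for g h
  proof -
    have "grho P B dg g (?\<xi> h) = gsc P B (\<chi> g ^ 1) (?\<xi> (grho P B dg g h))"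
      using X that by (intro grho_mact) (auto simp: degree_one_def)
    then have "gsc P B (inverse (\<chi> g)) (grho P B dg g (?\<xi> h)) =
      gsc P B (inverse (\<chi> g)) (gsc P B (\<chi> g) (?\<xi> (grho P B dg g h)))" by simp
    also have "\<dots> = ?\<xi> (grho P B dg g h)"
    proof (rule PiE_eqI)
      show "?\<xi> (grho P B dg g h) \<in> ?C" using that by (intro mact_closed grho_closed)
      then show "gsc P B (inverse (\<chi> g)) (gsc P B (\<chi> g) (?\<xi> (grho P B dg g h))) \<in> ?C" by (intro gsc_closed)
      show "gsc P B (inverse (\<chi> g)) (gsc P B (\<chi> g) (?\<xi> (grho P B dg g h))) b = ?\<xi> (grho P B dg g h) b" if "b \<in> B" for b
        using that PiE_val[OF \<open>?\<xi> (grho P B dg g h) \<in> ?C\<close> that] chi_nz[OF \<open>g \<in> carrier G\<close>]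
        by (simp add: gsc_def ks_simps)
    qed
    finally show ?thesis ..
  qed
  have gsc2: "gsc P B c (gsc P B d h) = gsc P B (c * d) h" if "h \<in> ?C" for c d h
    unfolding gsc_def using that by (intro restrict_ext) (simp add: ks_simps PiE_val)
  have rsc: "grho P B dg g (gsc P B c h) = gsc P B c (grho P B dg g h)" if "h \<in> ?C" "g \<in> carrier G" for c g h
    unfolding gsc_def grho_def using that by (intro restrict_ext) (simp add: ks_simps PiE_val mult.commute)
  have xsc: "(?\<xi> ^^ i) (gsc P B c h) = gsc P B c ((?\<xi> ^^ i) h)" if "h \<in> ?C" for i c h
    by (induction i) (simp_all add: mact_gsc pw[OF that])
  have rr: "grho P B dg g (grho P B dg g' h) = grho P B dg (g \<otimes> g') h" if "h \<in> ?C" "g \<in> carrier G" "g' \<in> carrier G" for g g' h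
    unfolding grho_def using that
    by (intro restrict_ext) (simp add: ks_simps PiE_val chi_mult power_mult_distrib)
  have commi: "(?\<xi> ^^ i) (grho P B dg g h) = gsc P B (inverse (\<chi> g) ^ i) (grho P B dg g ((?\<xi> ^^ i) h))"
    if "h \<in> ?C" "g \<in> carrier G" for g h i
  proof (induction i)
    case 0
    have "grho P B dg g h \<in> ?C" using that by (rule grho_closed)
    then show ?case
      by (intro PiE_eqI[OF _ gsc_closed]) (auto simp: gsc_def ks_simps PiE_val)
  next
    case (Suc i)
    have 1: "grho P B dg g ((?\<xi> ^^ i) h) \<in> ?C" using that by (intro grho_closed pw)
    have 2: "?\<xi> ((?\<xi> ^^ i) h) \<in> ?C" by (intro mact_closed pw that)
    have "(?\<xi> ^^ Suc i) (grho P B dg g h) = gsc P B (inverse (\<chi> g) ^ i) (?\<xi> (grho P B dg g ((?\<xi> ^^ i) h)))"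
      by (simp add: Suc mact_gsc[OF 1])
    also have "\<dots> = gsc P B (inverse (\<chi> g) ^ i) (gsc P B (inverse (\<chi> g)) (grho P B dg g ((?\<xi> ^^ Suc i) h)))"
      using that by (simp add: comm pw)
    also have "\<dots> = gsc P B (inverse (\<chi> g) ^ Suc i) (grho P B dg g ((?\<xi> ^^ Suc i) h))"
      using grho_closed[OF 2 that(2)] by (subst gsc2) (simp_all add: mult.commute)
    finally show ?case .
  qed
  have padd: "(?\<xi> ^^ i) (\<lambda>b\<in>B. f b \<oplus>\<^bsub>P\<^esub> h b) = (\<lambda>b\<in>B. (?\<xi> ^^ i) f b \<oplus>\<^bsub>P\<^esub> (?\<xi> ^^ i) h b)" if "f \<in> ?C" "h \<in> ?C" for f h i
  proof (induction i)
    case 0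
    show ?case by simp
  next
    case (Suc i)
    show ?case using mact_add[OF pw[OF that(1), of i] pw[OF that(2), of i]] by (simp only: funpow.simps comp_apply Suc)
  qed
  show ?thesis
  proof (rule H.left_module_from_basis[OF gmod_abelian, of B dg X "gsc P B" ?\<rho>])
    fix d d' x y assume x: "x \<in> carrier ?M"
    then have x': "x \<in> ?C" by (simp add: gmod_simps)
    show "gsc P B d x \<in> carrier ?M" using x by (simp add: gmod_simps gsc_closed)
    show "gsc P B (d + d') x = gsc P B d x \<oplus>\<^bsub>?M\<^esub> gsc P B d' x"
      unfolding gmod_simps gsc_def by (intro restrict_ext) (simp add: ks_simps PiE_val[OF x'])
    show "gsc P B (d * d') x = gsc P B d (gsc P B d' x)" using gsc2[OF x'] by simp
    show "gsc P B 1 x = x"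
      by (rule PiE_eqI[OF gsc_closed[OF x'] x']) (simp add: gsc_def ks_simps PiE_val[OF x'])
    show "?\<rho> (\<one>, 0) x = x"
      using grho_closed[OF x', of \<one>]
      by (simp, intro PiE_eqI[OF _ x']) (auto simp: grho_def chi_one ks_simps PiE_val[OF x'])
    show "gsc P B d (x \<oplus>\<^bsub>?M\<^esub> y) = gsc P B d x \<oplus>\<^bsub>?M\<^esub> gsc P B d y" if "y \<in> carrier ?M"
      using that unfolding gmod_simps gsc_def
      by (intro restrict_ext) (simp add: additiveD(2)[OF ks_additive] PiE_val[OF x'] PiE_val)
  next
    fix p :: "'g \<times> nat" and h assume p: "p \<in> carrier G \<times> UNIV" and h: "h \<in> carrier ?M"
    obtain g i where gi: "p = (g, i)" "g \<in> carrier G" using p by auto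
    have h': "h \<in> ?C" using h by (simp add: gmod_simps)
    show "?\<rho> p h \<in> carrier ?M"
      using gi h' by (simp add: gmod_simps grho_closed pw)
    show "?\<rho> p (gsc P B d h) =
      gsc P B d (?\<rho> p h)" for d
      using gi h' by (simp add: xsc rsc pw)
    show "?\<rho> p (h \<oplus>\<^bsub>?M\<^esub> k) =
      ?\<rho> p h \<oplus>\<^bsub>?M\<^esub> ?\<rho> p k"
      if k: "k \<in> carrier ?M" for k
    proof -
      have k': "k \<in> ?C" using k by (simp add: gmod_simps)
      show ?thesis unfolding gi(1) prod.case gmod_simps padd[OF h' k'] unfolding grho_def
        using PiE_val[OF pw[OF h']] PiE_val[OF pw[OF k']] gi(2)
        by (intro restrict_ext) (simp add: additiveD(2)[OF ks_additive] additiveD(2)[OF kg_additive] ks_simps)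
    qed
    show "?\<rho> p (?\<rho> p' h) =
      gsc P B (ococ p p') (?\<rho> (omult p p') h)"
      if p': "p' \<in> carrier G \<times> UNIV" for p'
    proof -
      obtain g' j where gj: "p' = (g', j)" "g' \<in> carrier G" using p' by auto
      have "grho P B dg g ((?\<xi> ^^ i) (grho P B dg g' ((?\<xi> ^^ j) h))) =
        gsc P B (inverse (\<chi> g') ^ i) (grho P B dg g (grho P B dg g' ((?\<xi> ^^ i) ((?\<xi> ^^ j) h))))"
        using gi gj pw[OF h'] pw[OF pw[OF h']] by (simp add: commi rsc grho_closed)
      also have "\<dots> = gsc P B (inverse (\<chi> g') ^ i) (grho P B dg (g \<otimes> g') ((?\<xi> ^^ (i + j)) h))"
        using gi gj pw[OF pw[OF h']] by (simp add: rr funpow_add)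
      finally show ?thesis using gi gj by (simp add: ococ_def omult_def)
    qed
  next
    fix f h
    show "f \<odot>\<^bsub>?M\<^esub> h = finsum ?M (\<lambda>p. gsc P B (lookup f p) (?\<rho> p h)) (keys f)"
      unfolding finsum_gmod[of P B dg X, symmetric] by (simp add: gmod_def case_prod_unfold)
  qed
qed

lemma gmod_generators:
  assumes X: "degree_one B dg X" and h: "h \<in> carrier (gmod P B dg X)"
  shows "hs c \<odot>\<^bsub>gmod P B dg X\<^esub> h = gsc P B c h"
    "g \<in> carrier G ==> hg g \<odot>\<^bsub>gmod P B dg X\<^esub> h = grho P B dg g h"
    "hx \<odot>\<^bsub>gmod P B dg X\<^esub> h = mact P B B X h"
proof -
  let ?M = "gmod P B dg X" and ?\<xi> = "mact P B B X"
  let ?C = "\<Pi>\<^sub>E b\<in>B. carrier P"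
  interpret M: abelian_group ?M by (rule gmod_abelian)
  have h': "h \<in> ?C" using h by (simp add: gmod_simps)
  have pw: "(?\<xi> ^^ i) h \<in> ?C" for i
    by (induction i) (simp_all add: mact_closed h')
  have g1: "gsc P B 1 k = k" if "k \<in> ?C" for k
    using that by (intro PiE_eqI[OF gsc_closed]) (auto simp: gsc_def ks_simps PiE_val)
  have r1: "grho P B dg \<one> k = k" if "k \<in> ?C" for k
    using that by (intro PiE_eqI[OF grho_closed]) (auto simp: grho_def chi_one ks_simps PiE_val)
  have s: "single (g, i) c \<odot>\<^bsub>?M\<^esub> h = gsc P B c (grho P B dg g ((?\<xi> ^^ i) h))" if g: "g \<in> carrier G" for g i c
  proof (cases "c = 0")
    case True
    have 1: "grho P B dg g ((?\<xi> ^^ i) h) \<in> ?C" by (intro grho_closed pw g)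
    have "gsc P B 0 (grho P B dg g ((?\<xi> ^^ i) h)) = \<zero>\<^bsub>?M\<^esub>"
      unfolding gsc_def gmod_simps by (intro restrict_ext) (simp add: ks_simps PiE_val[OF 1])
    moreover have "single (g, i) c \<odot>\<^bsub>?M\<^esub> h = finsum (gmod0 P B) (\<lambda>(g, i). gsc P B (lookup 0 (g, i)) (grho P B dg g ((?\<xi> ^^ i) h))) {}"
      using True by (simp add: gmod_def)
    ultimately show ?thesis using True by (simp add: finsum_gmod[of P B dg X])
  next
    case False
    have "gsc P B c (grho P B dg g ((?\<xi> ^^ i) h)) \<in> carrier ?M"
      unfolding gmod_simps by (intro gsc_closed grho_closed pw g)
    moreover have "single (g, i) c \<odot>\<^bsub>?M\<^esub> h =
      finsum (gmod0 P B) (\<lambda>(g', i'). gsc P B (lookup (single (g, i) c) (g', i')) (grho P B dg g' ((?\<xi> ^^ i') h))) {(g, i)}"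
      using False by (simp add: gmod_def)
    ultimately show ?thesis by (simp add: finsum_gmod[of P B dg X] Pi_def)
  qed
  show "hs c \<odot>\<^bsub>?M\<^esub> h = gsc P B c h" using s[of \<one> 0 c] r1[OF h'] by (simp add: hs_def)
  show "hg g \<odot>\<^bsub>?M\<^esub> h = grho P B dg g h" if "g \<in> carrier G"
    using s[OF that, of 0 1] g1 grho_closed[OF h' that] by (simp add: hg_def)
  show "hx \<odot>\<^bsub>?M\<^esub> h = ?\<xi> h" using s[of \<one> 1 1] r1[OF mact_closed[OF h']] g1[OF mact_closed[OF h']] by (simp add: hx_def)
qed

end

section \<open>Isomorphisms of graded modules, and strings\<close>

context hopf_ore_data
begin

lemma group_moduleI: "left_module KG P ==> group_module G \<chi> a P"
  by (intro group_module.intro hopf_ore_data_axioms)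

lemma expands_isoI:
  assumes M: "expands M" and N: "expands N"
    and \<phi>: "\<And>x. x \<in> carrier M ==> \<phi> x \<in> carrier N" "\<And>y. y \<in> carrier N ==> \<psi> y \<in> carrier M"
    "\<And>x. x \<in> carrier M ==> \<psi> (\<phi> x) = x" "\<And>y. y \<in> carrier N ==> \<phi> (\<psi> y) = y"
    "\<And>x y. x \<in> carrier M ==> y \<in> carrier M ==> \<phi> (x \<oplus>\<^bsub>M\<^esub> y) = \<phi> x \<oplus>\<^bsub>N\<^esub> \<phi> y"
    and s: "\<And>c x. x \<in> carrier M ==> \<phi> (hs c \<odot>\<^bsub>M\<^esub> x) = hs c \<odot>\<^bsub>N\<^esub> \<phi> x"
    and g: "\<And>g x. g \<in> carrier G ==> x \<in> carrier M ==> \<phi> (hg g \<odot>\<^bsub>M\<^esub> x) = hg g \<odot>\<^bsub>N\<^esub> \<phi> x"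
    and x: "\<And>x. x \<in> carrier M ==> \<phi> (hx \<odot>\<^bsub>M\<^esub> x) = hx \<odot>\<^bsub>N\<^esub> \<phi> x"
  shows "module_iso H M N"
proof (rule module_isoI[of _ \<phi> _ \<psi>])
  have "additive M N \<phi>" using \<phi> by (auto intro: additiveI)
  then show "\<phi> (r \<odot>\<^bsub>M\<^esub> x) = r \<odot>\<^bsub>N\<^esub> \<phi> x" if "r \<in> carrier H" "x \<in> carrier M" for r x
    using expands_hom[OF M N _ s g x that] by blast
qed (fact \<phi>)+

lemma gmod_expands: "left_module KG P ==> degree_one B dg X ==> expands (gmod P B dg X)"
  by (rule left_module_expands)
    (auto intro!: group_module.gmod_left_module group_moduleI)

lemma gmod_isoI:
  assumes P: "left_module KG P" "left_module KG P'" and X: "degree_one B dg X" "degree_one B' dg' X'"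
    and \<phi>: "\<And>h. h \<in> (\<Pi>\<^sub>E b\<in>B. carrier P) ==> \<phi> h \<in> (\<Pi>\<^sub>E b\<in>B'. carrier P')"
      "\<And>h. h \<in> (\<Pi>\<^sub>E b\<in>B'. carrier P') ==> \<psi> h \<in> (\<Pi>\<^sub>E b\<in>B. carrier P)"
      "\<And>h. h \<in> (\<Pi>\<^sub>E b\<in>B. carrier P) ==> \<psi> (\<phi> h) = h"
      "\<And>h. h \<in> (\<Pi>\<^sub>E b\<in>B'. carrier P') ==> \<phi> (\<psi> h) = h"
      "\<And>f h. f \<in> (\<Pi>\<^sub>E b\<in>B. carrier P) ==> h \<in> (\<Pi>\<^sub>E b\<in>B. carrier P) ==>
        \<phi> (\<lambda>b\<in>B. f b \<oplus>\<^bsub>P\<^esub> h b) = (\<lambda>b\<in>B'. \<phi> f b \<oplus>\<^bsub>P'\<^esub> \<phi> h b)"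
    and s: "\<And>c h. h \<in> (\<Pi>\<^sub>E b\<in>B. carrier P) ==> \<phi> (gsc P B c h) = gsc P' B' c (\<phi> h)"
    and g: "\<And>g h. g \<in> carrier G ==> h \<in> (\<Pi>\<^sub>E b\<in>B. carrier P) ==> \<phi> (grho P B dg g h) = grho P' B' dg' g (\<phi> h)"
    and x: "\<And>h. h \<in> (\<Pi>\<^sub>E b\<in>B. carrier P) ==> \<phi> (mact P B B X h) = mact P' B' B' X' (\<phi> h)"
  shows "module_iso H (gmod P B dg X) (gmod P' B' dg' X')"
proof -
  interpret P: group_module G \<chi> a P by (intro group_moduleI P)
  interpret P': group_module G \<chi> a P' by (intro group_moduleI P)
  show ?thesis
  proof (rule expands_isoI[of _ _ \<phi> \<psi>])
    fix h assume h: "h \<in> carrier (gmod P B dg X)"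
    then have h': "h \<in> (\<Pi>\<^sub>E b\<in>B. carrier P)" by (simp add: gmod_simps)
    have c: "\<phi> h \<in> carrier (gmod P' B' dg' X')" using \<phi>(1)[OF h'] by (simp add: gmod_simps)
    show "\<phi> (hs c \<odot>\<^bsub>gmod P B dg X\<^esub> h) = hs c \<odot>\<^bsub>gmod P' B' dg' X'\<^esub> \<phi> h" for c
      unfolding P.gmod_generators[OF X(1) h] P'.gmod_generators[OF X(2) c] by (rule s[OF h'])
    show "\<phi> (hg g \<odot>\<^bsub>gmod P B dg X\<^esub> h) = hg g \<odot>\<^bsub>gmod P' B' dg' X'\<^esub> \<phi> h" if "g \<in> carrier G" for g
      unfolding P.gmod_generators(2)[OF X(1) h that] P'.gmod_generators(2)[OF X(2) c that] by (rule g[OF that h'])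
    show "\<phi> (hx \<odot>\<^bsub>gmod P B dg X\<^esub> h) = hx \<odot>\<^bsub>gmod P' B' dg' X'\<^esub> \<phi> h"
      unfolding P.gmod_generators[OF X(1) h] P'.gmod_generators[OF X(2) c] by (rule x[OF h'])
  qed (simp_all only: gmod_simps gmod_expands P X \<phi>)
qed

text \<open>The matrix stays while coefficients and grading change together: \<tau> respects g only
  with the powers of \<chi> attached, which is how a shift of degree becomes a twist of the
  coefficients.\<close>

lemma gmod_map:
  assumes P: "left_module KG P" "left_module KG P'" and X: "degree_one B dg X" "degree_one B dg' X"
    and \<tau>: "\<And>v. v \<in> carrier P ==> \<tau> v \<in> carrier P'" "\<And>v. v \<in> carrier P' ==> \<tau>' v \<in> carrier P"
      "\<And>v. v \<in> carrier P ==> \<tau>' (\<tau> v) = v" "\<And>v. v \<in> carrier P' ==> \<tau> (\<tau>' v) = v"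
      "\<And>v w. v \<in> carrier P ==> w \<in> carrier P ==> \<tau> (v \<oplus>\<^bsub>P\<^esub> w) = \<tau> v \<oplus>\<^bsub>P'\<^esub> \<tau> w"
    and s: "\<And>c v. v \<in> carrier P ==> \<tau> (ks c \<odot>\<^bsub>P\<^esub> v) = ks c \<odot>\<^bsub>P'\<^esub> \<tau> v"
    and g: "\<And>b g v. b \<in> B ==> g \<in> carrier G ==> v \<in> carrier P ==>
      \<tau> (ks (\<chi> g ^ dg b) \<odot>\<^bsub>P\<^esub> (kg g \<odot>\<^bsub>P\<^esub> v)) = ks (\<chi> g ^ dg' b) \<odot>\<^bsub>P'\<^esub> (kg g \<odot>\<^bsub>P'\<^esub> \<tau> v)"
  shows "module_iso H (gmod P B dg X) (gmod P' B dg' X)"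
proof -
  interpret P: group_module G \<chi> a P by (intro group_moduleI P)
  interpret P': group_module G \<chi> a P' by (intro group_moduleI P)
  show ?thesis
  proof (rule gmod_isoI[OF P X, of "\<lambda>h. \<lambda>b\<in>B. \<tau> (h b)" "\<lambda>h. \<lambda>b\<in>B. \<tau>' (h b)"])
    fix h assume h: "h \<in> (\<Pi>\<^sub>E b\<in>B. carrier P)"
    note c = P.PiE_val[OF h]
    show "(\<lambda>b\<in>B. \<tau> (h b)) \<in> (\<Pi>\<^sub>E b\<in>B. carrier P')" using c \<tau>(1) by simp
    show "(\<lambda>b\<in>B. \<tau>' ((\<lambda>b\<in>B. \<tau> (h b)) b)) = h"
      by (rule PiE_eqI[OF _ h, where A = "\<lambda>_. carrier P"]) (use c \<tau> in simp_all)
    show "(\<lambda>b\<in>B. \<tau> (gsc P B c h b)) = gsc P' B c (\<lambda>b\<in>B. \<tau> (h b))" for c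
      unfolding gsc_def by (intro restrict_ext) (simp add: s c)
    show "(\<lambda>b\<in>B. \<tau> (grho P B dg g h b)) = grho P' B dg' g (\<lambda>b\<in>B. \<tau> (h b))" if "g \<in> carrier G" for g
      unfolding grho_def by (intro restrict_ext) (simp add: g c that)
    show "(\<lambda>b\<in>B. \<tau> (mact P B B X h b)) = mact P' B B X (\<lambda>b\<in>B. \<tau> (h b))"
      unfolding mact_def
    proof (intro restrict_ext)
      fix b assume b: "b \<in> B"
      have "\<tau> (finsum P (\<lambda>j. ks (X b j) \<odot>\<^bsub>P\<^esub> h j) B) = finsum P' (\<lambda>j. \<tau> (ks (X b j) \<odot>\<^bsub>P\<^esub> h j)) B"
        by (rule additive_finsum[OF P.P.M.abelian_group_axioms P'.P.M.abelian_group_axioms \<tau>(1) \<tau>(5)])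
          (simp_all add: P.ks_simps c)
      also have "\<dots> = finsum P' (\<lambda>j. ks (X b j) \<odot>\<^bsub>P'\<^esub> (\<lambda>b\<in>B. \<tau> (h b)) j) B"
        by (rule P'.fcong) (simp_all add: s c P'.ks_simps \<tau>(1))
      finally show "\<tau> ((\<lambda>b\<in>B. finsum P (\<lambda>j. ks (X b j) \<odot>\<^bsub>P\<^esub> h j) B) b) =
        finsum P' (\<lambda>j. ks (X b j) \<odot>\<^bsub>P'\<^esub> (\<lambda>b\<in>B. \<tau> (h b)) j) B" using b by simp
    qed
    show "(\<lambda>b\<in>B. \<tau> ((\<lambda>b\<in>B. h b \<oplus>\<^bsub>P\<^esub> k b) b)) = (\<lambda>b\<in>B. (\<lambda>b\<in>B. \<tau> (h b)) b \<oplus>\<^bsub>P'\<^esub> (\<lambda>b\<in>B. \<tau> (k b)) b)"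
      if "k \<in> (\<Pi>\<^sub>E b\<in>B. carrier P)" for k
      using P.PiE_val[OF that] c by (intro restrict_ext) (simp add: \<tau>)
  next
    fix h assume h: "h \<in> (\<Pi>\<^sub>E b\<in>B. carrier P')"
    note c = P'.PiE_val[OF h]
    show "(\<lambda>b\<in>B. \<tau>' (h b)) \<in> (\<Pi>\<^sub>E b\<in>B. carrier P)" using c \<tau>(2) by simp
    show "(\<lambda>b\<in>B. \<tau> ((\<lambda>b\<in>B. \<tau>' (h b)) b)) = h"
      by (rule PiE_eqI[OF _ h, where A = "\<lambda>_. carrier P'"]) (use c \<tau> in simp_all)
  qed
qed

text \<open>Scalar matrices commute with the action of kG on P up to the degree, so a homogeneous
  invertible S that carries Y to X is H-linear.\<close>

lemma gmod_basis_change: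
  assumes P: "left_module KG P" and X: "degree_one B dg X" and Y: "degree_one J dg' Y"
    and S: "\<And>b j. b \<in> B ==> j \<in> J ==> S b j \<noteq> 0 ==> dg b = dg' j"
    and inv: "\<And>b b'. b \<in> B ==> b' \<in> B ==> (\<Sum>j\<in>J. S b j * S' j b') = (if b = b' then 1 else 0)"
      "\<And>j j'. j \<in> J ==> j' \<in> J ==> (\<Sum>b\<in>B. S' j b * S b j') = (if j = j' then 1 else 0)"
    and comm: "\<And>b j. b \<in> B ==> j \<in> J ==> (\<Sum>b'\<in>B. X b b' * S b' j) = (\<Sum>j'\<in>J. S b j' * Y j' j)"
  shows "module_iso H (gmod P J dg' Y) (gmod P B dg X)"
proof -
  interpret P: group_module G \<chi> a P by (intro group_moduleI P)
  have fin: "finite B" "finite J" using X Y by (simp_all add: degree_one_def)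
  show ?thesis
  proof (rule gmod_isoI[OF P P Y X, of "mact P B J S" "mact P J B S'"])
    fix h assume h: "h \<in> (\<Pi>\<^sub>E b\<in>J. carrier P)"
    show "mact P B J S h \<in> (\<Pi>\<^sub>E b\<in>B. carrier P)" by (rule P.mact_closed[OF h])
    show "mact P J B S' (mact P B J S h) = h"
      unfolding P.mact_mact[OF h fin] by (rule P.mact_id[OF h fin(2)]) (rule inv)
    show "mact P B J S (\<lambda>b\<in>J. h b \<oplus>\<^bsub>P\<^esub> k b) = (\<lambda>b\<in>B. mact P B J S h b \<oplus>\<^bsub>P\<^esub> mact P B J S k b)"
      if "k \<in> (\<Pi>\<^sub>E b\<in>J. carrier P)" for k using P.mact_add[OF h that] .
    show "mact P B J S (gsc P J c h) = gsc P B c (mact P B J S h)" for c by (rule P.mact_gsc[OF h])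
    show "mact P B J S (grho P J dg' g h) = grho P B dg g (mact P B J S h)" if g: "g \<in> carrier G" for g
    proof -
      have c: "mact P B J S (grho P J dg' g h) \<in> (\<Pi>\<^sub>E b\<in>B. carrier P)" by (intro P.mact_closed P.grho_closed h g)
      have "grho P B dg g (mact P B J S h) = gsc P B (\<chi> g ^ 0) (mact P B J S (grho P J dg' g h))"
        by (rule P.grho_mact[OF h g]) (simp add: S)
      also have "\<dots> = mact P B J S (grho P J dg' g h)"
        by (rule PiE_eqI[OF P.gsc_closed[OF c] c]) (simp add: gsc_def P.ks_simps P.PiE_val[OF c])
      finally show ?thesis ..
    qed
    show "mact P B J S (mact P J J Y h) = mact P B B X (mact P B J S h)"
      unfolding P.mact_mact[OF h fin(2) fin(2)] P.mact_mact[OF h fin(1) fin(2)]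
      by (rule P.mact_cong[OF _ h]) (simp add: comm)
  next
    fix h assume h: "h \<in> (\<Pi>\<^sub>E b\<in>B. carrier P)"
    show "mact P J B S' h \<in> (\<Pi>\<^sub>E b\<in>J. carrier P)" by (rule P.mact_closed[OF h])
    show "mact P B J S (mact P J B S' h) = h"
      unfolding P.mact_mact[OF h fin(2) fin(1)] by (rule P.mact_id[OF h fin(1)]) (rule inv)
  qed
qed

text \<open>A Jordan string of length n with P in each place; its first place carries P twisted by
  \<chi>^d. For d = 0 it is a concrete model of the truncated induced module, see
  \<open>truncated_verma_string\<close>.\<close>

definition string_module :: "('g \<Rightarrow>\<^sub>0 'k, 'p, 'f) module_scheme => nat => nat => ('g \<times> nat \<Rightarrow>\<^sub>0 'k, nat => 'p) module" where
  "string_module P d n = gmod P {..<n} (\<lambda>e. d + e) (\<lambda>e e'. if e = Suc e' then 1 else 0)"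

lemma shift_degree_one: "degree_one {..<n} (\<lambda>e. d + e) (\<lambda>e e'. if e = Suc e' then 1 else 0)"
  by (simp add: degree_one_def)

lemma string_left_module: "left_module KG P ==> left_module H (string_module P d n)"
  unfolding string_module_def
  by (rule group_module.gmod_left_module[OF group_moduleI shift_degree_one])

end

context group_module
begin

lemma mact_shift:
  assumes "h \<in> (\<Pi>\<^sub>E e\<in>{..<n}. carrier P)" "e < n"
  shows "mact P {..<n} {..<n} (\<lambda>e e'. if e = Suc e' then 1 else 0) h e = (case e of 0 => \<zero>\<^bsub>P\<^esub> | Suc e' => h e')"
proof (cases e)
  case 0
  then show ?thesis using mact_row_zero[OF assms(1), of e "{..<n}"] assms(2) by simp
next
  case (Suc e')
  then show ?thesis using mact_row[OF assms(1), of e "{..<n}" e'] assms by (simp add: ks_simps PiE_val)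
qed

lemma string_generators:
  assumes h: "h \<in> (\<Pi>\<^sub>E e\<in>{..<n}. carrier P)"
  shows "hs c \<odot>\<^bsub>string_module P d n\<^esub> h = (\<lambda>e\<in>{..<n}. ks c \<odot>\<^bsub>P\<^esub> h e)"
    "g \<in> carrier G ==> hg g \<odot>\<^bsub>string_module P d n\<^esub> h = (\<lambda>e\<in>{..<n}. ks (\<chi> g ^ (d + e)) \<odot>\<^bsub>P\<^esub> (kg g \<odot>\<^bsub>P\<^esub> h e))"
    "hx \<odot>\<^bsub>string_module P d n\<^esub> h = (\<lambda>e\<in>{..<n}. case e of 0 => \<zero>\<^bsub>P\<^esub> | Suc e' => h e')"
proof -
  let ?M = "string_module P d n"
  have h': "h \<in> carrier (gmod P {..<n} (\<lambda>e. d + e) (\<lambda>e e'. if e = Suc e' then 1 else 0))" using h by (simp add: gmod_simps)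
  note gen = gmod_generators[OF shift_degree_one h', folded string_module_def]
  show "hs c \<odot>\<^bsub>?M\<^esub> h = (\<lambda>e\<in>{..<n}. ks c \<odot>\<^bsub>P\<^esub> h e)"
    "g \<in> carrier G ==> hg g \<odot>\<^bsub>?M\<^esub> h = (\<lambda>e\<in>{..<n}. ks (\<chi> g ^ (d + e)) \<odot>\<^bsub>P\<^esub> (kg g \<odot>\<^bsub>P\<^esub> h e))"
    using gen by (simp_all add: gsc_def grho_def)
  show "hx \<odot>\<^bsub>?M\<^esub> h = (\<lambda>e\<in>{..<n}. case e of 0 => \<zero>\<^bsub>P\<^esub> | Suc e' => h e')"
    unfolding gen using mact_closed[OF h]
    by (intro extensionalityI[of _ "{..<n}"]) (auto simp: mact_shift[OF h] PiE_def)
qed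

lemma string_simps: "carrier (string_module P d n) = (\<Pi>\<^sub>E e\<in>{..<n}. carrier P)"
  "f \<oplus>\<^bsub>string_module P d n\<^esub> h = (\<lambda>e\<in>{..<n}. f e \<oplus>\<^bsub>P\<^esub> h e)" "\<zero>\<^bsub>string_module P d n\<^esub> = (\<lambda>e\<in>{..<n}. \<zero>\<^bsub>P\<^esub>)"
  by (simp_all add: string_module_def gmod_simps)

lemma gmod_strings:
  assumes "finite D"
  shows "module_iso H
    (gmod P (Sigma D (\<lambda>d. {..<L d})) (\<lambda>j. fst j + snd j) (\<lambda>j j'. if fst j = fst j' \<and> snd j = Suc (snd j') then 1 else 0))
    (direct_sum D (\<lambda>d. string_module P d (L d)))"
proof -
  let ?S = "Sigma D (\<lambda>d. {..<L d})" and ?dg = "\<lambda>j. fst j + snd j"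
  let ?Y = "\<lambda>j j'. if fst j = fst j' \<and> snd j = Suc (snd j') then 1 else 0"
  let ?N = "direct_sum D (\<lambda>d. string_module P d (L d))"
  have Y: "degree_one ?S ?dg ?Y" using assms by (auto simp: degree_one_def)
  have sm: "left_module H (string_module P d (L d))" for d by (rule string_left_module[OF P.left_module_axioms])
  have N: "left_module H ?N" by (rule direct_sum_left_module[OF H.ring sm])
  have carN: "carrier ?N = (\<Pi>\<^sub>E d\<in>D. \<Pi>\<^sub>E e\<in>{..<L d}. carrier P)"
    using assms by (simp add: direct_sum_simps string_simps)
  show ?thesis
  proof (rule expands_isoI[of _ _ "\<lambda>h. \<lambda>d\<in>D. \<lambda>e\<in>{..<L d}. h (d, e)" "\<lambda>f. \<lambda>j\<in>?S. f (fst j) (snd j)"])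
    show "expands (gmod P ?S ?dg ?Y)" by (rule gmod_expands[OF P.left_module_axioms Y])
    show "expands ?N" by (rule left_module_expands[OF N])
    fix h assume h0: "h \<in> carrier (gmod P ?S ?dg ?Y)"
    then have h: "h \<in> (\<Pi>\<^sub>E j\<in>?S. carrier P)" by (simp add: gmod_simps)
    have c: "h (d, e) \<in> carrier P" if "d \<in> D" "e < L d" for d e using PiE_val[OF h, of "(d, e)"] that by simp
    have hd: "(\<lambda>e\<in>{..<L d}. h (d, e)) \<in> (\<Pi>\<^sub>E e\<in>{..<L d}. carrier P)" if "d \<in> D" for d using c that by simp
    note gen = gmod_generators[OF Y h0]
    show "(\<lambda>d\<in>D. \<lambda>e\<in>{..<L d}. h (d, e)) \<in> carrier ?N" unfolding carN using c by simp
    show "(\<lambda>j\<in>?S. (\<lambda>d\<in>D. \<lambda>e\<in>{..<L d}. h (d, e)) (fst j) (snd j)) = h"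
      by (rule PiE_eqI[OF _ h, where A = "\<lambda>_. carrier P"]) (use c in auto)
    show "(\<lambda>d\<in>D. \<lambda>e\<in>{..<L d}. (h \<oplus>\<^bsub>gmod P ?S ?dg ?Y\<^esub> k) (d, e)) =
      (\<lambda>d\<in>D. \<lambda>e\<in>{..<L d}. h (d, e)) \<oplus>\<^bsub>?N\<^esub> (\<lambda>d\<in>D. \<lambda>e\<in>{..<L d}. k (d, e))" for k
      unfolding direct_sum_simps string_simps gmod_simps by (intro restrict_ext) (auto intro!: restrict_ext)
    show "(\<lambda>d\<in>D. \<lambda>e\<in>{..<L d}. (hs c \<odot>\<^bsub>gmod P ?S ?dg ?Y\<^esub> h) (d, e)) = hs c \<odot>\<^bsub>?N\<^esub> (\<lambda>d\<in>D. \<lambda>e\<in>{..<L d}. h (d, e))" for c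
      unfolding gen direct_sum_simps gsc_def
      by (intro restrict_ext) (auto simp: string_generators[OF hd] intro!: restrict_ext)
    show "(\<lambda>d\<in>D. \<lambda>e\<in>{..<L d}. (hg g \<odot>\<^bsub>gmod P ?S ?dg ?Y\<^esub> h) (d, e)) = hg g \<odot>\<^bsub>?N\<^esub> (\<lambda>d\<in>D. \<lambda>e\<in>{..<L d}. h (d, e))"
      if "g \<in> carrier G" for g
      unfolding gen(2)[OF that] direct_sum_simps grho_def using that
      by (intro restrict_ext) (auto simp: string_generators(2)[OF hd] intro!: restrict_ext)
    show "(\<lambda>d\<in>D. \<lambda>e\<in>{..<L d}. (hx \<odot>\<^bsub>gmod P ?S ?dg ?Y\<^esub> h) (d, e)) = hx \<odot>\<^bsub>?N\<^esub> (\<lambda>d\<in>D. \<lambda>e\<in>{..<L d}. h (d, e))"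
      unfolding gen direct_sum_simps
    proof (intro restrict_ext)
      fix d assume d: "d \<in> D"
      have "mact P ?S ?S ?Y h (d, e) = (case e of 0 => \<zero>\<^bsub>P\<^esub> | Suc e' => (\<lambda>e\<in>{..<L d}. h (d, e)) e')" if e: "e < L d" for e
      proof (cases e)
        case 0
        then show ?thesis using mact_row_zero[OF h, of "(d, e)" ?S ?Y] d e by simp
      next
        case (Suc e')
        have "mact P ?S ?S ?Y h (d, e) = ks (?Y (d, e) (d, e')) \<odot>\<^bsub>P\<^esub> h (d, e')"
          by (rule mact_row[OF h]) (use d e Suc assms in auto)
        then show ?thesis using Suc d e c by (simp add: ks_simps)
      qed
      then show "(\<lambda>e\<in>{..<L d}. mact P ?S ?S ?Y h (d, e)) =
        hx \<odot>\<^bsub>string_module P d (L d)\<^esub> (\<lambda>d\<in>D. \<lambda>e\<in>{..<L d}. h (d, e)) d"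
        using d by (simp add: string_generators(3)[OF hd] cong: restrict_cong)
    qed
  next
    fix f assume "f \<in> carrier ?N"
    then have f: "f \<in> (\<Pi>\<^sub>E d\<in>D. \<Pi>\<^sub>E e\<in>{..<L d}. carrier P)" by (simp add: carN)
    then have fd: "f d \<in> (\<Pi>\<^sub>E e\<in>{..<L d}. carrier P)" if "d \<in> D" for d using that by (rule PiE_mem)
    show "(\<lambda>j\<in>?S. f (fst j) (snd j)) \<in> carrier (gmod P ?S ?dg ?Y)"
      unfolding gmod_simps using PiE_mem[OF fd] by auto
    show "(\<lambda>d\<in>D. \<lambda>e\<in>{..<L d}. (\<lambda>j\<in>?S. f (fst j) (snd j)) (d, e)) = f"
    proof (rule PiE_eqI[OF _ f])
      show "(\<lambda>d\<in>D. \<lambda>e\<in>{..<L d}. (\<lambda>j\<in>?S. f (fst j) (snd j)) (d, e)) \<in> (\<Pi>\<^sub>E d\<in>D. \<Pi>\<^sub>E e\<in>{..<L d}. carrier P)"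
        using PiE_mem[OF fd] by auto
      fix d assume d: "d \<in> D"
      show "(\<lambda>d\<in>D. \<lambda>e\<in>{..<L d}. (\<lambda>j\<in>?S. f (fst j) (snd j)) (d, e)) d = f d"
        by (rule PiE_eqI[OF _ fd[OF d], where A = "\<lambda>_. carrier P"]) (use d PiE_mem[OF fd[OF d]] in simp_all)
    qed
  qed
qed

end

text \<open>The cosets of the kernel are the fibres of \<theta>, so each operation on cosets becomes
  an operation on their labels in N.\<close>

lemma fibre_quotient_iso:
  assumes M: "left_module R M" and N: "left_module R N" and \<theta>: "additive M N \<theta>"
    and lin: "\<And>r x. r \<in> carrier R ==> x \<in> carrier M ==> \<theta> (r \<odot>\<^bsub>M\<^esub> x) = r \<odot>\<^bsub>N\<^esub> \<theta> x"
    and surj: "\<And>y. y \<in> carrier N ==> \<exists>x\<in>carrier M. \<theta> x = y"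
    and U: "U = {x \<in> carrier M. \<theta> x = \<zero>\<^bsub>N\<^esub>}"
  shows "module_iso R (quotient_module M U) N" "left_module R (quotient_module M U)"
proof -
  interpret M: left_module R M by fact
  interpret N: left_module R N by fact
  note ad = additiveD[OF \<theta>] and am = additive_minus[OF \<theta> M.M.abelian_group_axioms N.M.abelian_group_axioms]
  define fib where "fib y = {x \<in> carrier M. \<theta> x = y}" for y
  have Ux: "U +>\<^bsub>M\<^esub> x = fib (\<theta> x)" if x: "x \<in> carrier M" for x
  proof -
    have "y \<in> (\<Union>h\<in>U. {h \<oplus>\<^bsub>M\<^esub> x})" if "y \<in> carrier M" "\<theta> y = \<theta> x" for y
    proof
      show "y \<ominus>\<^bsub>M\<^esub> x \<in> U" using that x by (simp add: U M.M.minus_eq ad am N.M.r_neg)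
      show "y \<in> {(y \<ominus>\<^bsub>M\<^esub> x) \<oplus>\<^bsub>M\<^esub> x}" using that x by (simp add: M.M.minus_eq M.M.a_assoc M.M.l_neg)
    qed
    then show ?thesis unfolding a_r_coset_def' fib_def U using x ad by auto
  qed
  have ne: "\<exists>x. x \<in> fib y" if "y \<in> carrier N" for y using surj[OF that] by (auto simp: fib_def)
  have the: "\<theta> (SOME x. x \<in> fib y) = y" if "y \<in> carrier N" for y
    using someI_ex[OF ne[OF that]] by (simp add: fib_def)
  let ?Q = "quotient_module M U"
  have car: "carrier ?Q = fib ` carrier N"
    unfolding quotient_module_def using surj ad(1) by (auto simp: A_RCOSETS_def' Ux image_iff)
  have zero: "\<zero>\<^bsub>?Q\<^esub> = fib \<zero>\<^bsub>N\<^esub>" by (simp add: quotient_module_def U fib_def)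
  have add: "fib y \<oplus>\<^bsub>?Q\<^esub> fib z = fib (y \<oplus>\<^bsub>N\<^esub> z)" if yz: "y \<in> carrier N" "z \<in> carrier N" for y z
  proof -
    have "x \<in> (\<Union>h\<in>fib y. \<Union>k\<in>fib z. {h \<oplus>\<^bsub>M\<^esub> k})" if x: "x \<in> fib (y \<oplus>\<^bsub>N\<^esub> z)" for x
    proof -
      obtain h where h: "h \<in> fib y" using ne yz by blast
      have "\<theta> x = y \<oplus>\<^bsub>N\<^esub> z" "x \<in> carrier M" "h \<in> carrier M" "\<theta> h = y" using x h by (auto simp: fib_def)
      then have "\<ominus>\<^bsub>M\<^esub> h \<oplus>\<^bsub>M\<^esub> x \<in> fib z" "x = h \<oplus>\<^bsub>M\<^esub> (\<ominus>\<^bsub>M\<^esub> h \<oplus>\<^bsub>M\<^esub> x)"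
        using yz by (simp_all add: fib_def ad am N.M.a_assoc[symmetric] N.M.l_neg M.M.a_assoc[symmetric] M.M.r_neg)
      then show ?thesis using h by blast
    qed
    then show ?thesis unfolding quotient_module_def using ad
      by (auto simp: set_add_def' fib_def)
  qed
  have smult: "r \<odot>\<^bsub>?Q\<^esub> fib y = fib (r \<odot>\<^bsub>N\<^esub> y)" if r: "r \<in> carrier R" and y: "y \<in> carrier N" for r y
  proof -
    have "U +>\<^bsub>M\<^esub> (r \<odot>\<^bsub>M\<^esub> x) = fib (r \<odot>\<^bsub>N\<^esub> y)" if "x \<in> fib y" for x
      using that r by (simp add: fib_def Ux M.smult_closed lin)
    then show ?thesis unfolding quotient_module_def using ne[OF y] by auto
  qed
  show iso: "module_iso R ?Q N"
    by (rule module_isoI[of _ "\<lambda>X. \<theta> (SOME x. x \<in> X)" _ fib])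
      (auto simp: car the add smult N.smult_closed)
  have ab: "abelian_group ?Q"
  proof (rule abelian_groupI)
    show "\<exists>y\<in>carrier ?Q. y \<oplus>\<^bsub>?Q\<^esub> x = \<zero>\<^bsub>?Q\<^esub>" if x: "x \<in> carrier ?Q" for x
    proof -
      obtain z where z: "z \<in> carrier N" "x = fib z" using x car by auto
      then show ?thesis by (intro bexI[of _ "fib (\<ominus>\<^bsub>N\<^esub> z)"]) (auto simp: car add zero N.M.l_neg)
    qed
    show "x \<oplus>\<^bsub>?Q\<^esub> y = y \<oplus>\<^bsub>?Q\<^esub> x" if "x \<in> carrier ?Q" "y \<in> carrier ?Q" for x y
      using that by (auto simp only: car add N.M.a_comm image_iff)
  qed (auto simp: car add zero N.M.a_assoc)
  show "left_module R ?Q"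
    by (rule left_module_transfer[OF iso N ab]) (auto simp: car smult N.smult_closed)
qed

lemma submodule_generated_submodule:
  assumes M: "left_module R M" and S: "S \<subseteq> carrier M"
  shows "submodule (submodule_generated R M S) R M" "S \<subseteq> submodule_generated R M S"
    "submodule U R M ==> S \<subseteq> U ==> submodule_generated R M S \<subseteq> U"
proof -
  interpret M: left_module R M by fact
  have top: "submodule (carrier M) R M"
    by (intro submodule.intro submodule_axioms.intro)
      (use group.subgroup_self[OF M.M.a_group] M.smult_closed in auto)
  show "submodule (submodule_generated R M S) R M"
  proof (intro submodule.intro submodule_axioms.intro)
    show "subgroup (submodule_generated R M S) (add_monoid M)"
      unfolding submodule_generated_def
      by (rule group.subgroups_Inter[OF M.M.a_group]) (use top S in \<open>auto simp: submodule_def\<close>)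
    show "r \<odot>\<^bsub>M\<^esub> x \<in> submodule_generated R M S" if "r \<in> carrier R" "x \<in> submodule_generated R M S" for r x
      using that by (auto simp: submodule_generated_def submodule_def submodule_axioms_def)
  qed
  show "S \<subseteq> submodule_generated R M S" "submodule U R M ==> S \<subseteq> U ==> submodule_generated R M S \<subseteq> U"
    by (auto simp: submodule_generated_def)
qed

lemma kernel_submodule:
  assumes M: "left_module R M" and N: "left_module R N" and \<theta>: "additive M N \<theta>"
    and lin: "\<And>r x. r \<in> carrier R ==> x \<in> carrier M ==> \<theta> (r \<odot>\<^bsub>M\<^esub> x) = r \<odot>\<^bsub>N\<^esub> \<theta> x"
  shows "submodule {x \<in> carrier M. \<theta> x = \<zero>\<^bsub>N\<^esub>} R M"
proof -
  interpret M: left_module R M by fact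
  interpret N: left_module R N by fact
  note ab = M.M.abelian_group_axioms N.M.abelian_group_axioms
  show ?thesis
    by (intro submodule.intro submodule_axioms.intro subgroup.intro)
      (auto simp: a_inv_def[symmetric] additive_minus[OF \<theta> ab] additive_0[OF \<theta> ab] additiveD[OF \<theta>] lin M.smult_closed N.smult_zero_right)
qed

section \<open>Induced modules and their truncations\<close>

context group_module
begin

lemma incl_single: "group_algebra_incl (single g c) = single (g, 0) c"
  by (simp add: group_algebra_incl_def)

lemma incl_add: "group_algebra_incl (f + f') = group_algebra_incl f + group_algebra_incl (f' :: 'g \<Rightarrow>\<^sub>0 'k)"
proof -
  have *: "group_algebra_incl h = (\<Sum>g\<in>keys f \<union> keys f'. single (g, 0) (lookup h g))" if "keys h \<subseteq> keys f \<union> keys f'" for h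
    unfolding group_algebra_incl_def using that by (intro sum.mono_neutral_left) (auto simp: in_keys_iff)
  show ?thesis
    unfolding *[OF keys_add] *[OF Un_upper1] *[OF Un_upper2] by (simp only: lookup_add single_add sum.distrib)
qed

lemma group_algebra_carrier: "carrier (group_algebra G :: ('k, 'g \<Rightarrow>\<^sub>0 'k) module) = carrier KG"
  by (simp add: KG_simps group_algebra_def)

lemma incl_closed: "f \<in> carrier KG ==> group_algebra_incl f \<in> carrier H"
  unfolding KG.car mem_Collect_eq
  by (induction f rule: poly_mapping_set_induct)
    (simp_all add: incl_single incl_add H.single_closed KG.S_ne HA.a_closed[unfolded H.add])

definition VM where "VM = verma_module G \<chi> a P"

sublocale VT: tensor_product "carrier (group_algebra G :: ('k, 'g \<Rightarrow>\<^sub>0 'k) module)"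
  "\<lambda>h b. h \<otimes>\<^bsub>H\<^esub> group_algebra_incl b" H "smult P" P VM
  by unfold_locales
    (simp_all add: VM_def verma_module_def induced_module_def Let_def H_def[symmetric] group_algebra_carrier
      incl_closed P.smult_closed H.mult_closed)

lemma VM_smult:
  assumes h: "h \<in> carrier H"
  shows "additive VM VM (\<lambda>X. h \<odot>\<^bsub>VM\<^esub> X)"
    "x \<in> carrier H ==> v \<in> carrier P ==> h \<odot>\<^bsub>VM\<^esub> VT.tens x v = VT.tens (h \<otimes>\<^bsub>H\<^esub> x) v"
proof -
  let ?e = "frag_extend (\<lambda>(h', v). frag_of (h \<otimes>\<^bsub>H\<^esub> h', v))"
  have s: "h \<odot>\<^bsub>VM\<^esub> X = (\<Union>w\<in>X. VT.cl (?e w))" for X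
    by (simp add: VM_def verma_module_def induced_module_def Let_def H_def[symmetric])
  have ke: "keys (?e w) \<subseteq> carrier H \<times> carrier P" if "keys w \<subseteq> carrier H \<times> carrier P" for w
    using that
  proof (induction w rule: frag_set_induct)
    case (diff x y)
    then show ?case by (simp add: frag_extend_diff keys_diff_subset)
  qed (use h in \<open>auto simp: keys_frag_of H.mult_closed\<close>)
  have d: "VT.cl (?e (v - w)) = VT.cl (?e v) \<ominus>\<^bsub>VM\<^esub> VT.cl (?e w)"
      if "keys v \<subseteq> carrier H \<times> carrier P" "keys w \<subseteq> carrier H \<times> carrier P" for v w
      using VT.cl_diff[OF ke[OF that(1)] ke[OF that(2)]] by (simp add: frag_extend_diff)
  have b: "balanced (carrier (group_algebra G :: ('k, 'g \<Rightarrow>\<^sub>0 'k) module)) (\<lambda>h b. h \<otimes>\<^bsub>H\<^esub> group_algebra_incl b) H (smult P) P VM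
      (\<lambda>x y. VT.cl (?e (frag_of (x, y))))"
    proof (rule balancedI)
      fix x y b assume xyb: "x \<in> carrier H" "b \<in> carrier (group_algebra G :: ('k, 'g \<Rightarrow>\<^sub>0 'k) module)" "y \<in> carrier P"
      have b: "group_algebra_incl b \<in> carrier H" using xyb(2) by (simp add: group_algebra_carrier incl_closed)
      have "VT.tens (h \<otimes>\<^bsub>H\<^esub> (x \<otimes>\<^bsub>H\<^esub> group_algebra_incl b)) y = VT.tens (h \<otimes>\<^bsub>H\<^esub> x \<otimes>\<^bsub>H\<^esub> group_algebra_incl b) y"
        using HA.m_assoc[OF h xyb(1) b] by simp
      also have "\<dots> = VT.tens (h \<otimes>\<^bsub>H\<^esub> x) (b \<odot>\<^bsub>P\<^esub> y)"
        using xyb h by (intro VT.tens_simps H.mult_closed)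
      finally show "VT.cl (?e (frag_of (x \<otimes>\<^bsub>H\<^esub> group_algebra_incl b, y))) = VT.cl (?e (frag_of (x, b \<odot>\<^bsub>P\<^esub> y)))"
        by (simp add: VT.tens_def)
    qed (use h in \<open>simp_all add: VT.tens_def[symmetric] VT.tens_closed H.mult_closed HA.r_distr VT.tens_simps\<close>)
  obtain A where A: "additive VM VM A"
    "\<And>x v. x \<in> carrier H ==> v \<in> carrier P ==> A (VT.tens x v) = VT.cl (?e (frag_of (x, v)))"
    "\<And>w. keys w \<subseteq> carrier H \<times> carrier P ==> A (VT.cl w) = VT.cl (?e w)"
    "\<And>X w. X \<in> carrier VM ==> w \<in> X ==> VT.cl (?e w) = A X"
  proof (rule VT.union_over_representatives[OF VT.T_abelian d b])
    fix A assume "additive VM VM A"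
      "\<And>x v. x \<in> carrier H ==> v \<in> carrier P ==> A (VT.tens x v) = VT.cl (?e (frag_of (x, v)))"
      "\<And>w. keys w \<subseteq> carrier H \<times> carrier P ==> A (VT.cl w) = VT.cl (?e w)"
      "\<And>X w. X \<in> carrier VM ==> w \<in> X ==> VT.cl (?e w) = A X"
    then show thesis by (rule that)
  qed
  have sA: "h \<odot>\<^bsub>VM\<^esub> X = A X" if "X \<in> carrier VM" for X
  proof -
    have "h \<odot>\<^bsub>VM\<^esub> X = (\<Union>w\<in>X. A X)" unfolding s by (rule SUP_cong[OF refl A(4)[OF that]])
    moreover have "X \<noteq> {}" using VT.class_nonempty[OF that] by blast
    ultimately show ?thesis by (simp only: UN_constant if_False)
  qed
  show "additive VM VM (\<lambda>X. h \<odot>\<^bsub>VM\<^esub> X)"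
    using A(1) unfolding additive_def by (simp only: sA VT.T.a_closed simp_thms ball_triv cong: ball_cong)
  show "h \<odot>\<^bsub>VM\<^esub> VT.tens x v = VT.tens (h \<otimes>\<^bsub>H\<^esub> x) v" if "x \<in> carrier H" "v \<in> carrier P"
    unfolding sA[OF VT.tens_closed[OF that]] A(2)[OF that] by (simp add: VT.tens_def)
qed

lemma VM_left_module: "left_module H VM"
proof (rule left_moduleI[OF H.ring VT.T_abelian])
  fix r assume r: "r \<in> carrier H"
  note ad = VM_smult(1)[OF r]
  show "r \<odot>\<^bsub>VM\<^esub> X \<in> carrier VM" if "X \<in> carrier VM" for X by (rule additiveD(1)[OF ad that])
  show "r \<odot>\<^bsub>VM\<^esub> (X \<oplus>\<^bsub>VM\<^esub> Y) = r \<odot>\<^bsub>VM\<^esub> X \<oplus>\<^bsub>VM\<^esub> r \<odot>\<^bsub>VM\<^esub> Y" if "X \<in> carrier VM" "Y \<in> carrier VM" for X Y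
    by (rule additiveD(2)[OF ad that])
  fix s assume s: "s \<in> carrier H"
  note ad' = VM_smult(1)[OF s]
  fix X assume X: "X \<in> carrier VM"
  show "(r \<oplus>\<^bsub>H\<^esub> s) \<odot>\<^bsub>VM\<^esub> X = r \<odot>\<^bsub>VM\<^esub> X \<oplus>\<^bsub>VM\<^esub> s \<odot>\<^bsub>VM\<^esub> X"
  proof (rule VT.additive_eqI[OF VT.T_abelian VM_smult(1) _ _ X])
    show "additive VM VM (\<lambda>X. r \<odot>\<^bsub>VM\<^esub> X \<oplus>\<^bsub>VM\<^esub> s \<odot>\<^bsub>VM\<^esub> X)"
      by (rule additiveI) (simp_all add: additiveD[OF ad] additiveD[OF ad'] VT.T.a_ac)
  qed (simp_all add: r s VM_smult VT.tens_simps HA.l_distr H.mult_closed)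
  show "(r \<otimes>\<^bsub>H\<^esub> s) \<odot>\<^bsub>VM\<^esub> X = r \<odot>\<^bsub>VM\<^esub> (s \<odot>\<^bsub>VM\<^esub> X)"
  proof (rule VT.additive_eqI[OF VT.T_abelian VM_smult(1) _ _ X])
    show "additive VM VM (\<lambda>X. r \<odot>\<^bsub>VM\<^esub> (s \<odot>\<^bsub>VM\<^esub> X))"
      by (rule additiveI) (simp_all add: additiveD[OF ad] additiveD[OF ad'])
  qed (simp_all add: r s VM_smult HA.m_assoc H.mult_closed)
next
  fix X assume X: "X \<in> carrier VM"
  show "\<one>\<^bsub>H\<^esub> \<odot>\<^bsub>VM\<^esub> X = X"
    by (rule VT.additive_eqI[OF VT.T_abelian VM_smult(1) _ _ X])
      (simp_all add: VM_smult additiveI)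
qed

end

context group_module
begin

text \<open>For i >= n the value is the zero function, in accordance with x^n = 0 on a string of
  length n.\<close>

definition delta :: "nat => nat => 'p => nat => 'p" where
  "delta n i v = (\<lambda>e\<in>{..<n}. if e = i then v else \<zero>\<^bsub>P\<^esub>)"

lemma delta_closed: "v \<in> carrier P ==> delta n i v \<in> (\<Pi>\<^sub>E e\<in>{..<n}. carrier P)"
  by (simp add: delta_def)

lemma delta_additive: "additive P (string_module P d n) (delta n i)"
  by (rule additiveI) (auto simp: string_simps delta_def intro!: restrict_ext)

lemma string_single_delta:
  assumes g: "g \<in> carrier G" and v: "v \<in> carrier P"
  shows "single (g, 0) c \<odot>\<^bsub>string_module P 0 n\<^esub> delta n 0 v = delta n 0 (single g c \<odot>\<^bsub>P\<^esub> v)"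
proof -
  interpret S: left_module H "string_module P 0 n" by (rule string_left_module[OF P.left_module_axioms])
  have gv: "kg g \<odot>\<^bsub>P\<^esub> v \<in> carrier P" using g v by (simp add: ks_simps)
  have z: "kg g \<odot>\<^bsub>P\<^esub> \<zero>\<^bsub>P\<^esub> = \<zero>\<^bsub>P\<^esub>" "ks c \<odot>\<^bsub>P\<^esub> \<zero>\<^bsub>P\<^esub> = \<zero>\<^bsub>P\<^esub>" for c using g by (simp_all add: P.smult_zero_right)
  have "hg g \<odot>\<^bsub>string_module P 0 n\<^esub> delta n 0 v = delta n 0 (kg g \<odot>\<^bsub>P\<^esub> v)"
    unfolding string_generators(2)[OF delta_closed[OF v] g] unfolding delta_def
    by (intro restrict_ext) (simp add: z ks_simps gv)
  then have "hs c \<odot>\<^bsub>string_module P 0 n\<^esub> (hg g \<odot>\<^bsub>string_module P 0 n\<^esub> delta n 0 v) = delta n 0 (ks c \<odot>\<^bsub>P\<^esub> (kg g \<odot>\<^bsub>P\<^esub> v))"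
    unfolding \<open>hg g \<odot>\<^bsub>string_module P 0 n\<^esub> delta n 0 v = delta n 0 (kg g \<odot>\<^bsub>P\<^esub> v)\<close> string_generators(1)[OF delta_closed[OF gv]]
    unfolding delta_def by (intro restrict_ext) (simp add: z)
  moreover have "single (g, 0) c = hs c \<otimes>\<^bsub>H\<^esub> hg g"
    using g by (simp add: hs_def hg_def H.mult_single omult_def ococ_def chi_one)
  ultimately show ?thesis
    using g v by (simp add: S.smult_assoc string_simps delta_closed ks_simps)
qed

lemma hx_pow_delta:
  assumes v: "v \<in> carrier P"
  shows "single (\<one>, i) 1 \<odot>\<^bsub>string_module P 0 n\<^esub> delta n 0 v = delta n i v"
proof -
  interpret S: left_module H "string_module P 0 n" by (rule string_left_module[OF P.left_module_axioms])
  show ?thesis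
  proof (induction i)
    case 0
    then show ?case using string_single_delta[OF one_closed v, where c = 1 and n = n] ks_simps(9)[OF v] by (simp add: kg_def)
  next
    case (Suc i)
    have "single (\<one>, Suc i) 1 = hx \<otimes>\<^bsub>H\<^esub> single (\<one>, i) 1"
      by (simp add: hx_def H.mult_single omult_def ococ_def chi_one)
    then have "single (\<one>, Suc i) 1 \<odot>\<^bsub>string_module P 0 n\<^esub> delta n 0 v = hx \<odot>\<^bsub>string_module P 0 n\<^esub> delta n i v"
      using v by (simp add: S.smult_assoc string_simps delta_closed H.single_closed Suc)
    also have "\<dots> = delta n (Suc i) v"
      unfolding string_generators(3)[OF delta_closed[OF v]] unfolding delta_def
      by (intro restrict_ext) (auto split: nat.split)
    finally show ?case .
  qed
qed

lemma string_decompose: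
  assumes f: "f \<in> carrier (string_module P d n)"
  shows "f = finsum (string_module P d n) (\<lambda>e. delta n e (f e)) {..<n}"
proof -
  let ?S = "string_module P d n"
  interpret S: left_module H ?S by (rule string_left_module[OF P.left_module_axioms])
  have f': "f \<in> (\<Pi>\<^sub>E e\<in>{..<n}. carrier P)" using f by (simp add: string_simps)
  note c = PiE_val[OF f']
  have dc: "delta n e (f e) \<in> carrier ?S" if "e \<in> {..<n}" for e using delta_closed[OF c[OF that]] by (simp add: string_simps)
  have sc: "finsum ?S (\<lambda>e. delta n e (f e)) {..<n} \<in> carrier ?S" using dc by (intro S.M.finsum_closed) auto
  show ?thesis
  proof (rule PiE_eqI[OF f' sc[unfolded string_simps]])
    fix e assume e: "e \<in> {..<n}"
    have ev: "additive ?S P (\<lambda>f. f e)" using e by (auto simp: additive_def string_simps)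
    have "finsum ?S (\<lambda>e. delta n e (f e)) {..<n} e = finsum P (\<lambda>i. delta n i (f i) e) {..<n}"
      using additive_finsum[OF S.M.abelian_group_axioms P.M.abelian_group_axioms, of "\<lambda>f. f e" "{..<n}" "\<lambda>e. delta n e (f e)"] additiveD[OF ev] dc by simp
    also have "\<dots> = delta n e (f e) e"
      by (rule finsum_single[OF P.M.abelian_group_axioms]) (use e c in \<open>auto simp: delta_def\<close>)
    finally show "f e = finsum ?S (\<lambda>e. delta n e (f e)) {..<n} e" using e by (simp add: delta_def)
  qed
qed

text \<open>\<theta> sends h \<otimes> v to h acting on v in place 0, and \<xi> is an additive
  section of it. The kernel of \<theta> is the submodule U generated by the tensors x^n \<otimes> v,
  because X - \<xi>(\<theta> X) always lies in U. By additivity this concerns only x^i \<otimes> v',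
  which \<xi> \<theta> fixes if i < n and which lies in U otherwise.\<close>

lemma truncated_verma_string:
  "module_iso H (truncated_verma G \<chi> a n P) (string_module P 0 n)" "left_module H (truncated_verma G \<chi> a n P)"
proof -
  let ?S = "string_module P 0 n" and ?K = "carrier (group_algebra G :: ('k, 'g \<Rightarrow>\<^sub>0 'k) module)"
  let ?x = "\<lambda>i. single (\<one>, i) 1 :: 'g \<times> nat \<Rightarrow>\<^sub>0 'k"
  interpret S: left_module H ?S by (rule string_left_module[OF P.left_module_axioms])
  interpret VM: left_module H VM by (rule VM_left_module)
  have dS: "delta n i v \<in> carrier ?S" if "v \<in> carrier P" for i v using delta_closed[OF that] by (simp add: string_simps)
  have xH: "?x i \<in> carrier H" for i by (simp add: H.single_closed)
  have bal: "balanced ?K (\<lambda>h b. h \<otimes>\<^bsub>H\<^esub> group_algebra_incl b) H (smult P) P ?S (\<lambda>h v. h \<odot>\<^bsub>?S\<^esub> delta n 0 v)"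
  proof (rule balancedI)
    fix h b v assume h: "h \<in> carrier H" and b: "b \<in> ?K" and v: "v \<in> carrier P"
    have "group_algebra_incl b \<odot>\<^bsub>?S\<^esub> delta n 0 v = delta n 0 (b \<odot>\<^bsub>P\<^esub> v)"
      using b unfolding group_algebra_carrier KG.car mem_Collect_eq
    proof (induction b rule: poly_mapping_set_induct)
      case (single g c)
      then show ?case by (simp add: incl_single string_single_delta v)
    next
      case (add f f')
      have cl: "f \<in> carrier KG" "f' \<in> carrier KG" using add by (simp_all add: KG.car)
      have "group_algebra_incl (f + f') \<odot>\<^bsub>?S\<^esub> delta n 0 v =
        (group_algebra_incl f \<odot>\<^bsub>?S\<^esub> delta n 0 v) \<oplus>\<^bsub>?S\<^esub> (group_algebra_incl f' \<odot>\<^bsub>?S\<^esub> delta n 0 v)"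
        using S.smult_l_distr[OF incl_closed[OF cl(1)] incl_closed[OF cl(2)] dS[OF v]] by (simp add: incl_add H.add)
      also have "\<dots> = delta n 0 ((f \<odot>\<^bsub>P\<^esub> v) \<oplus>\<^bsub>P\<^esub> (f' \<odot>\<^bsub>P\<^esub> v))"
        unfolding add.IH using cl v by (simp add: additiveD(2)[OF delta_additive[where d = 0]] P.smult_closed)
      also have "(f \<odot>\<^bsub>P\<^esub> v) \<oplus>\<^bsub>P\<^esub> (f' \<odot>\<^bsub>P\<^esub> v) = (f + f') \<odot>\<^bsub>P\<^esub> v"
        using P.smult_l_distr[OF cl v] by (simp add: KG.add)
      finally show ?case .
    qed (rule KG.S_ne)
    then show "(h \<otimes>\<^bsub>H\<^esub> group_algebra_incl b) \<odot>\<^bsub>?S\<^esub> delta n 0 v = h \<odot>\<^bsub>?S\<^esub> delta n 0 (b \<odot>\<^bsub>P\<^esub> v)"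
      using h b v dS by (simp add: S.smult_assoc group_algebra_carrier incl_closed)
  qed (simp_all add: dS S.smult_closed S.smult_l_distr S.smult_r_distr additiveD(2)[OF delta_additive[where d = 0]])
  obtain \<theta> where \<theta>: "additive VM ?S \<theta>"
    "\<And>h v. h \<in> carrier H ==> v \<in> carrier P ==> \<theta> (VT.tens h v) = h \<odot>\<^bsub>?S\<^esub> delta n 0 v"
    using VT.lift[OF S.M.abelian_group_axioms bal] by blast
  have lin: "\<theta> (h \<odot>\<^bsub>VM\<^esub> X) = h \<odot>\<^bsub>?S\<^esub> \<theta> X" if h: "h \<in> carrier H" and X: "X \<in> carrier VM" for h X
  proof (rule VT.additive_eqI[OF S.M.abelian_group_axioms _ _ _ X])
    show "additive VM ?S (\<lambda>X. \<theta> (h \<odot>\<^bsub>VM\<^esub> X))"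
      by (rule additiveI) (simp_all add: h additiveD[OF \<theta>(1)] additiveD[OF VM_smult(1)[OF h]])
    show "additive VM ?S (\<lambda>X. h \<odot>\<^bsub>?S\<^esub> \<theta> X)"
      by (rule additiveI) (simp_all add: h additiveD[OF \<theta>(1)] S.smult_closed S.smult_r_distr)
  qed (simp_all add: h VM_smult \<theta>(2) H.mult_closed S.smult_assoc dS)
  define \<xi> where "\<xi> f = finsum VM (\<lambda>e. VT.tens (?x e) (f e)) {..<n}" for f
  have fc: "f e \<in> carrier P" if "f \<in> carrier ?S" "e \<in> {..<n}" for f e
    using that by (auto simp: string_simps)
  have tc: "VT.tens (?x e) (f e) \<in> carrier VM" if "f \<in> carrier ?S" "e \<in> {..<n}" for f e
    by (rule VT.tens_closed[OF xH fc[OF that]])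
  have \<xi>_closed: "\<xi> f \<in> carrier VM" if "f \<in> carrier ?S" for f
    unfolding \<xi>_def using tc[OF that] by (intro VT.T.finsum_closed) auto
  have \<xi>_additive: "additive ?S VM \<xi>"
  proof (rule additiveI[OF \<xi>_closed])
    fix f h assume f: "f \<in> carrier ?S" and h: "h \<in> carrier ?S"
    have "\<xi> (f \<oplus>\<^bsub>?S\<^esub> h) = finsum VM (\<lambda>e. VT.tens (?x e) (f e) \<oplus>\<^bsub>VM\<^esub> VT.tens (?x e) (h e)) {..<n}"
      unfolding \<xi>_def
      by (intro VT.T.finsum_cong' refl)
        (simp_all add: string_simps VT.tens_simps(3)[OF xH] fc[OF f] fc[OF h] tc[OF f] tc[OF h])
    also have "\<dots> = \<xi> f \<oplus>\<^bsub>VM\<^esub> \<xi> h"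
      unfolding \<xi>_def by (rule VT.T.finsum_addf) (simp_all add: tc[OF f] tc[OF h])
    finally show "\<xi> (f \<oplus>\<^bsub>?S\<^esub> h) = \<xi> f \<oplus>\<^bsub>VM\<^esub> \<xi> h" .
  qed
  have \<theta>\<xi>: "\<theta> (\<xi> f) = f" if f: "f \<in> carrier ?S" for f
  proof -
    have "\<theta> (\<xi> f) = finsum ?S (\<lambda>e. \<theta> (VT.tens (?x e) (f e))) {..<n}"
      unfolding \<xi>_def
      by (rule additive_finsum[OF VT.T_abelian S.M.abelian_group_axioms additiveD[OF \<theta>(1)] tc[OF f]])
    also have "\<dots> = finsum ?S (\<lambda>e. delta n e (f e)) {..<n}"
      by (rule S.M.finsum_cong') (simp_all add: \<theta>(2)[OF xH] fc[OF f] hx_pow_delta dS)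
    finally show ?thesis using string_decompose[OF f] by simp
  qed
  let ?xt = "x_power_tensors G \<chi> a P n"
  have xt: "?xt = (\<lambda>v. VT.tens (?x n) v) ` carrier P"
    unfolding x_power_tensors_def H_def[symmetric] hx_pow[unfolded hx_def] VT.tens_def by blast
  have xtc: "?xt \<subseteq> carrier VM" unfolding xt using VT.tens_closed[OF xH] by auto
  define U where "U = submodule_generated H VM ?xt"
  note Us = submodule_generated_submodule[OF VM_left_module xtc, folded U_def]
  let ?ker = "{X \<in> carrier VM. \<theta> X = \<zero>\<^bsub>?S\<^esub>}"
  have ker: "submodule ?ker H VM" by (rule kernel_submodule[OF VM_left_module S.left_module_axioms \<theta>(1) lin])
  have delta0: "delta n i v = \<zero>\<^bsub>?S\<^esub>" if "i \<ge> n" for i v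
    unfolding delta_def string_simps using that by (intro restrict_ext) auto
  have "?xt \<subseteq> ?ker"
    unfolding xt using VT.tens_closed[OF xH] by (auto simp: \<theta>(2)[OF xH] hx_pow_delta delta0)
  then have sub: "U \<subseteq> ?ker" by (rule Us(3)[OF ker])
  interpret U: submodule U H VM by (rule Us(1))
  have Uz: "\<zero>\<^bsub>VM\<^esub> \<in> U" using U.one_closed by simp
  have Ua: "X \<oplus>\<^bsub>VM\<^esub> Y \<in> U" if "X \<in> U" "Y \<in> U" for X Y using U.m_closed[OF that] by simp
  \<comment> \<open>Since \<theta> \<xi> is the identity, this map projects onto the kernel of
    \<theta>; once its values are known to lie in U, the kernel is contained in U.\<close>
  let ?\<rho> = "\<lambda>X. X \<ominus>\<^bsub>VM\<^esub> \<xi> (\<theta> X)"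
  have \<rho>: "additive VM VM ?\<rho>"
    by (rule additiveI)
      (simp_all add: additiveD[OF \<theta>(1)] additiveD[OF \<xi>_additive] VT.T.minus_eq VT.T.minus_add VT.T.a_ac)
  have \<rho>U: "?\<rho> X \<in> U" if "X \<in> carrier VM" for X
    using that
  proof (induction X rule: VT.tens_induct)
    case zero
    show ?case using additive_0[OF \<rho> VT.T_abelian VT.T_abelian] Uz by simp
  next
    case (add X Y)
    then show ?case using additiveD(2)[OF \<rho>] Ua by simp
  next
    case (tens h v)
    have "keys h \<subseteq> carrier G \<times> UNIV" using tens(1) by (simp add: H.car)
    then show ?case
    proof (induction h rule: poly_mapping_set_induct)
      case (single b c)
      obtain g i where b: "b = (g, i)" "g \<in> carrier G" using single by auto
      \<comment> \<open>g x^i = \<chi>(g)^i x^i g moves the group element to the right, where it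
        passes through the tensor sign to v.\<close>
      let ?b = "single g (c * \<chi> g ^ i)"
      define v' where "v' = ?b \<odot>\<^bsub>P\<^esub> v"
      have bK: "?b \<in> carrier KG" using b by (simp add: KG.single_closed)
      have v': "v' \<in> carrier P" unfolding v'_def by (rule P.smult_closed[OF bK tens(2)])
      have "single b c = ?x i \<otimes>\<^bsub>H\<^esub> group_algebra_incl ?b"
        using b chi_nz[OF b(2)] by (simp add: incl_single H.mult_single omult_def ococ_def power_inverse mult.assoc)
      then have e: "VT.tens (single b c) v = VT.tens (?x i) v'"
        using VT.tens_simps(4)[OF xH _ tens(2), of ?b i] bK by (simp add: group_algebra_carrier v'_def)
      have \<theta>e: "\<theta> (VT.tens (?x i) v') = delta n i v'" by (simp add: \<theta>(2)[OF xH v'] hx_pow_delta[OF v'])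
      have tx: "VT.tens (?x i) v' \<in> carrier VM" by (rule VT.tens_closed[OF xH v'])
      show ?case
      proof (cases "i < n")
        case True
        have "\<xi> (delta n i v') = VT.tens (?x i) (delta n i v' i)"
          unfolding \<xi>_def
          by (rule finsum_single[OF VT.T_abelian])
            (use True tx in \<open>auto simp: delta_def additive_0[OF VT.tens_additive(1)[OF xH] P.M.abelian_group_axioms VT.T_abelian]\<close>)
        also have "\<dots> = VT.tens (?x i) v'" using True by (simp add: delta_def)
        finally have "?\<rho> (VT.tens (single b c) v) = \<zero>\<^bsub>VM\<^esub>"
          unfolding e \<theta>e using VT.T.minus_eq_zero_iff[OF tx tx] by simp
        then show ?thesis using Uz by simp
      next
        case False
        have "\<xi> \<zero>\<^bsub>?S\<^esub> = \<zero>\<^bsub>VM\<^esub>" by (rule additive_0[OF \<xi>_additive S.M.abelian_group_axioms VT.T_abelian])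
        then have "?\<rho> (VT.tens (single b c) v) = VT.tens (?x i) v'"
          unfolding e \<theta>e using False delta0[of i v'] tx by (simp add: VT.T.minus_eq)
        also have "?x i = ?x (i - n) \<otimes>\<^bsub>H\<^esub> ?x n"
          using False by (simp add: H.mult_single omult_def ococ_def chi_one)
        also have "VT.tens (?x (i - n) \<otimes>\<^bsub>H\<^esub> ?x n) v' = ?x (i - n) \<odot>\<^bsub>VM\<^esub> VT.tens (?x n) v'"
          by (rule VM_smult(2)[OF xH xH v', symmetric])
        also have "\<dots> \<in> U" by (rule U.smult_closed[OF xH]) (use Us(2) v' in \<open>auto simp: xt\<close>)
        finally show ?thesis .
      qed
    next
      case (add f f')
      have cl: "f \<in> carrier H" "f' \<in> carrier H" using add by (simp_all add: H.car)
      have "VT.tens (f + f') v = VT.tens f v \<oplus>\<^bsub>VM\<^esub> VT.tens f' v"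
        using VT.tens_simps(2)[OF cl tens(2)] by (simp add: H.add)
      then have "?\<rho> (VT.tens (f + f') v) = ?\<rho> (VT.tens f v) \<oplus>\<^bsub>VM\<^esub> ?\<rho> (VT.tens f' v)"
        using additiveD(2)[OF \<rho> VT.tens_closed[OF cl(1) tens(2)] VT.tens_closed[OF cl(2) tens(2)]] by simp
      then show ?case using Ua[OF add.IH] by simp
    qed (rule H.S_ne)
  qed
  have U: "U = ?ker"
  proof (rule subset_antisym[OF sub], rule subsetI)
    fix X assume X: "X \<in> ?ker"
    have "\<xi> \<zero>\<^bsub>?S\<^esub> = \<zero>\<^bsub>VM\<^esub>" by (rule additive_0[OF \<xi>_additive S.M.abelian_group_axioms VT.T_abelian])
    then have "?\<rho> X = X" using X by (simp add: VT.T.minus_eq)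
    then show "X \<in> U" using \<rho>U[of X] X by simp
  qed
  have W: "truncated_verma G \<chi> a n P = quotient_module VM U"
    by (simp add: truncated_verma_def VM_def U_def H_def)
  show "module_iso H (truncated_verma G \<chi> a n P) ?S" "left_module H (truncated_verma G \<chi> a n P)"
    unfolding W using \<xi>_closed \<theta>\<xi>
    by (intro fibre_quotient_iso[OF VM_left_module S.left_module_axioms \<theta>(1) lin _ U]; blast)+
qed

end

text \<open>Place and summand are interchanged. Finite support carries over because a string has
  finitely many places.\<close>

lemma (in hopf_ore_data) string_module_direct_sum:
  assumes M: "\<And>i. i \<in> I ==> left_module KG (M i)"
  shows "module_iso H (string_module (direct_sum I M) d n) (direct_sum I (\<lambda>i. string_module (M i) d n))"
proof -
  let ?D = "direct_sum I M" and ?N = "direct_sum I (\<lambda>i. string_module (M i) d n)"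
  have D: "left_module KG ?D" by (rule direct_sum_left_module[OF KG.ring M])
  interpret D: group_module G \<chi> a ?D by (intro group_moduleI D)
  have M': "group_module G \<chi> a (M i)" if "i \<in> I" for i by (intro group_moduleI M that)
  have N: "left_module H ?N" by (rule direct_sum_left_module[OF H.ring string_left_module[OF M]])
  have carN: "f \<in> carrier ?N \<longleftrightarrow> f \<in> (\<Pi>\<^sub>E i\<in>I. \<Pi>\<^sub>E e\<in>{..<n}. carrier (M i)) \<and> finite {i \<in> I. f i \<noteq> (\<lambda>e\<in>{..<n}. \<zero>\<^bsub>M i\<^esub>)}" for f
    using group_module.string_simps[OF M'] by (simp add: direct_sum_simps cong: PiE_cong conj_cong)
  show ?thesis
  proof (rule expands_isoI[of _ _ "\<lambda>h. \<lambda>i\<in>I. \<lambda>e\<in>{..<n}. h e i" "\<lambda>f. \<lambda>e\<in>{..<n}. \<lambda>i\<in>I. f i e"])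
    show "expands (string_module ?D d n)" by (rule left_module_expands[OF string_left_module[OF D]])
    show "expands ?N" by (rule left_module_expands[OF N])
    fix h assume "h \<in> carrier (string_module ?D d n)"
    then have h: "h \<in> (\<Pi>\<^sub>E e\<in>{..<n}. carrier ?D)" by (simp add: D.string_simps)
    then have he: "h e \<in> (\<Pi>\<^sub>E i\<in>I. carrier (M i))" "finite {i \<in> I. h e i \<noteq> \<zero>\<^bsub>M i\<^esub>}" if "e < n" for e
      using PiE_mem[OF h, of e] that by (simp_all add: direct_sum_simps)
    have hi: "(\<lambda>e\<in>{..<n}. h e i) \<in> (\<Pi>\<^sub>E e\<in>{..<n}. carrier (M i))" if "i \<in> I" for i
      using PiE_mem[OF he(1) that] by simp
    have "{i \<in> I. (\<lambda>e\<in>{..<n}. h e i) \<noteq> (\<lambda>e\<in>{..<n}. \<zero>\<^bsub>M i\<^esub>)} \<subseteq> (\<Union>e\<in>{..<n}. {i \<in> I. h e i \<noteq> \<zero>\<^bsub>M i\<^esub>})"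
      by (auto intro!: restrict_ext)
    moreover have "finite (\<Union>e\<in>{..<n}. {i \<in> I. h e i \<noteq> \<zero>\<^bsub>M i\<^esub>})" using he(2) by simp
    ultimately have "finite {i \<in> I. (\<lambda>e\<in>{..<n}. h e i) \<noteq> (\<lambda>e\<in>{..<n}. \<zero>\<^bsub>M i\<^esub>)}" by (rule finite_subset)
    moreover have "{i \<in> I. (\<lambda>i\<in>I. \<lambda>e\<in>{..<n}. h e i) i \<noteq> (\<lambda>e\<in>{..<n}. \<zero>\<^bsub>M i\<^esub>)} = {i \<in> I. (\<lambda>e\<in>{..<n}. h e i) \<noteq> (\<lambda>e\<in>{..<n}. \<zero>\<^bsub>M i\<^esub>)}"
      by auto
    moreover have "(\<lambda>i\<in>I. \<lambda>e\<in>{..<n}. h e i) \<in> (\<Pi>\<^sub>E i\<in>I. \<Pi>\<^sub>E e\<in>{..<n}. carrier (M i))"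
      using hi by (simp only: restrict_PiE_iff) blast
    ultimately show "(\<lambda>i\<in>I. \<lambda>e\<in>{..<n}. h e i) \<in> carrier ?N"
      unfolding carN by (intro conjI) simp_all
    show "(\<lambda>e\<in>{..<n}. \<lambda>i\<in>I. (\<lambda>i\<in>I. \<lambda>e\<in>{..<n}. h e i) i e) = h"
    proof (rule PiE_eqI[OF _ h])
      show "(\<lambda>e\<in>{..<n}. \<lambda>i\<in>I. (\<lambda>i\<in>I. \<lambda>e\<in>{..<n}. h e i) i e) \<in> (\<Pi>\<^sub>E e\<in>{..<n}. UNIV)" by simp
      fix e assume e: "e \<in> {..<n}"
      then show "(\<lambda>e\<in>{..<n}. \<lambda>i\<in>I. (\<lambda>i\<in>I. \<lambda>e\<in>{..<n}. h e i) i e) e = h e"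
        by (intro PiE_eqI[OF _ he(1), where A = "\<lambda>_. UNIV"]) auto
    qed
    show "(\<lambda>i\<in>I. \<lambda>e\<in>{..<n}. (h \<oplus>\<^bsub>string_module ?D d n\<^esub> k) e i) =
      (\<lambda>i\<in>I. \<lambda>e\<in>{..<n}. h e i) \<oplus>\<^bsub>?N\<^esub> (\<lambda>i\<in>I. \<lambda>e\<in>{..<n}. k e i)" for k
      unfolding D.string_simps direct_sum_simps
      by (intro restrict_ext) (simp add: group_module.string_simps[OF M'] direct_sum_simps cong: restrict_cong)
    show "(\<lambda>i\<in>I. \<lambda>e\<in>{..<n}. (hs c \<odot>\<^bsub>string_module ?D d n\<^esub> h) e i) = hs c \<odot>\<^bsub>?N\<^esub> (\<lambda>i\<in>I. \<lambda>e\<in>{..<n}. h e i)" for c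
      unfolding D.string_generators[OF h] direct_sum_simps
      by (intro restrict_ext) (simp add: group_module.string_generators[OF M' hi] cong: restrict_cong)
    show "(\<lambda>i\<in>I. \<lambda>e\<in>{..<n}. (hg g \<odot>\<^bsub>string_module ?D d n\<^esub> h) e i) = hg g \<odot>\<^bsub>?N\<^esub> (\<lambda>i\<in>I. \<lambda>e\<in>{..<n}. h e i)" if "g \<in> carrier G" for g
      unfolding D.string_generators(2)[OF h that] direct_sum_simps
      by (intro restrict_ext) (simp add: group_module.string_generators(2)[OF M' hi that] cong: restrict_cong)
    show "(\<lambda>i\<in>I. \<lambda>e\<in>{..<n}. (hx \<odot>\<^bsub>string_module ?D d n\<^esub> h) e i) = hx \<odot>\<^bsub>?N\<^esub> (\<lambda>i\<in>I. \<lambda>e\<in>{..<n}. h e i)"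
      unfolding D.string_generators[OF h] direct_sum_simps
      by (intro restrict_ext)
        (auto simp: group_module.string_generators(3)[OF M' hi] split: nat.split intro!: restrict_ext)
  next
    fix f assume "f \<in> carrier ?N"
    then have f: "f \<in> (\<Pi>\<^sub>E i\<in>I. \<Pi>\<^sub>E e\<in>{..<n}. carrier (M i))" "finite {i \<in> I. f i \<noteq> (\<lambda>e\<in>{..<n}. \<zero>\<^bsub>M i\<^esub>)}"
      by (simp_all add: carN)
    have fi: "f i \<in> (\<Pi>\<^sub>E e\<in>{..<n}. carrier (M i))" if "i \<in> I" for i using f(1) that by (rule PiE_mem)
    have "(\<lambda>i\<in>I. f i e) \<in> carrier ?D" if e: "e < n" for e
    proof -
      have "{i \<in> I. (\<lambda>i\<in>I. f i e) i \<noteq> \<zero>\<^bsub>M i\<^esub>} \<subseteq> {i \<in> I. f i \<noteq> (\<lambda>e\<in>{..<n}. \<zero>\<^bsub>M i\<^esub>)}" using e by auto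
      then have "finite {i \<in> I. (\<lambda>i\<in>I. f i e) i \<noteq> \<zero>\<^bsub>M i\<^esub>}" using f(2) by (rule finite_subset)
      then show ?thesis unfolding direct_sum_simps using PiE_mem[OF fi] e by simp
    qed
    then show "(\<lambda>e\<in>{..<n}. \<lambda>i\<in>I. f i e) \<in> carrier (string_module ?D d n)"
      by (simp add: D.string_simps)
    show "(\<lambda>i\<in>I. \<lambda>e\<in>{..<n}. (\<lambda>e\<in>{..<n}. \<lambda>i\<in>I. f i e) e i) = f"
    proof (rule PiE_eqI[OF _ f(1)])
      show "(\<lambda>i\<in>I. \<lambda>e\<in>{..<n}. (\<lambda>e\<in>{..<n}. \<lambda>i\<in>I. f i e) e i) \<in> (\<Pi>\<^sub>E i\<in>I. UNIV)" by simp
      fix i assume i: "i \<in> I"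
      then show "(\<lambda>i\<in>I. \<lambda>e\<in>{..<n}. (\<lambda>e\<in>{..<n}. \<lambda>i\<in>I. f i e) e i) i = f i"
        by (intro PiE_eqI[OF _ fi[OF i], where A = "\<lambda>_. UNIV"]) auto
    qed
  qed
qed

section \<open>Tensor products of strings\<close>

text \<open>A weighted version of y + z: X1 weights the step in the first coordinate, X2 the step in
  the second, both evaluated at the starting point of the step.\<close>

definition box_matrix :: "(nat => nat => 'k) => (nat => nat => 'k) => nat \<times> nat => nat \<times> nat => 'k::field" where
  "box_matrix X1 X2 b b' = (if fst b = Suc (fst b') \<and> snd b = snd b' then X1 (fst b') (snd b') else 0) +
     (if fst b = fst b' \<and> snd b = Suc (snd b') then X2 (fst b') (snd b') else 0)"

lemma (in hopf_ore_data) box_degree_one: "degree_one ({..<n} \<times> {..<m}) (\<lambda>b. fst b + snd b) (box_matrix X1 X2)"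
  by (auto simp: degree_one_def box_matrix_def split: if_splits)

lemma (in group_module) mact_box:
  assumes h: "h \<in> (\<Pi>\<^sub>E b\<in>{..<n} \<times> {..<m}. carrier P)" and kl: "k < n" "l < m"
  shows "mact P ({..<n} \<times> {..<m}) ({..<n} \<times> {..<m}) (box_matrix X1 X2) h (k, l) =
    (case k of 0 => \<zero>\<^bsub>P\<^esub> | Suc k' => ks (X1 k' l) \<odot>\<^bsub>P\<^esub> h (k', l)) \<oplus>\<^bsub>P\<^esub>
    (case l of 0 => \<zero>\<^bsub>P\<^esub> | Suc l' => ks (X2 k l') \<odot>\<^bsub>P\<^esub> h (k, l'))"
proof -
  let ?B = "{..<n} \<times> {..<m}"
  let ?Y1 = "\<lambda>b b'. if fst b = Suc (fst b') \<and> snd b = snd b' then X1 (fst b') (snd b') else 0"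
  let ?Y2 = "\<lambda>b b'. if fst b = fst b' \<and> snd b = Suc (snd b') then X2 (fst b') (snd b') else 0"
  note c = PiE_val[OF h]
  have "mact P ?B ?B (box_matrix X1 X2) h (k, l) = finsum P (\<lambda>j. ks (?Y1 (k, l) j) \<odot>\<^bsub>P\<^esub> h j \<oplus>\<^bsub>P\<^esub> ks (?Y2 (k, l) j) \<odot>\<^bsub>P\<^esub> h j) ?B"
    unfolding mact_def box_matrix_def using kl by (simp, intro fcong) (simp_all add: ks_simps c)
  also have "\<dots> = mact P ?B ?B ?Y1 h (k, l) \<oplus>\<^bsub>P\<^esub> mact P ?B ?B ?Y2 h (k, l)"
    using kl by (simp add: mact_apply) (intro P.M.finsum_addf, auto intro!: ks_simps c)
  also have "mact P ?B ?B ?Y1 h (k, l) = (case k of 0 => \<zero>\<^bsub>P\<^esub> | Suc k' => ks (X1 k' l) \<odot>\<^bsub>P\<^esub> h (k', l))"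
  proof (cases k)
    case 0
    then show ?thesis using mact_row_zero[OF h, of "(k, l)" ?B ?Y1] kl by simp
  next
    case (Suc k')
    have "mact P ?B ?B ?Y1 h (k, l) = ks (?Y1 (k, l) (k', l)) \<odot>\<^bsub>P\<^esub> h (k', l)"
      by (rule mact_row[OF h]) (use Suc kl in auto)
    then show ?thesis using Suc by simp
  qed
  also have "mact P ?B ?B ?Y2 h (k, l) = (case l of 0 => \<zero>\<^bsub>P\<^esub> | Suc l' => ks (X2 k l') \<odot>\<^bsub>P\<^esub> h (k, l'))"
  proof (cases l)
    case 0
    then show ?thesis using mact_row_zero[OF h, of "(k, l)" ?B ?Y2] kl by simp
  next
    case (Suc l')
    have "mact P ?B ?B ?Y2 h (k, l) = ks (?Y2 (k, l) (k, l')) \<odot>\<^bsub>P\<^esub> h (k, l')"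
      by (rule mact_row[OF h]) (use Suc kl in auto)
    then show ?thesis using Suc by simp
  qed
  finally show ?thesis .
qed

text \<open>
  The assumptions on the maps \<open>\<kappa> k l\<close> say that they identify each \<open>x\<^sup>k V1 \<otimes> x\<^sup>l V2\<close> with \<open>P\<close> in such a way
  that \<open>x\<close> acts through scalars only.
\<close>

lemma (in hopf_ore_data) string_tensor_box:
  assumes V: "left_module KG V1" "left_module KG V2" "left_module KG P"
    and \<kappa>: "\<And>k l v w. v \<in> carrier V1 ==> w \<in> carrier V2 ==> \<kappa> k l v w \<in> carrier P"
      "\<And>k l v v' w. v \<in> carrier V1 ==> v' \<in> carrier V1 ==> w \<in> carrier V2 ==>
        \<kappa> k l (v \<oplus>\<^bsub>V1\<^esub> v') w = \<kappa> k l v w \<oplus>\<^bsub>P\<^esub> \<kappa> k l v' w"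
      "\<And>k l v w w'. v \<in> carrier V1 ==> w \<in> carrier V2 ==> w' \<in> carrier V2 ==>
        \<kappa> k l v (w \<oplus>\<^bsub>V2\<^esub> w') = \<kappa> k l v w \<oplus>\<^bsub>P\<^esub> \<kappa> k l v w'"
      "\<And>k l c v w. v \<in> carrier V1 ==> w \<in> carrier V2 ==> \<kappa> k l (ks c \<odot>\<^bsub>V1\<^esub> v) w = ks c \<odot>\<^bsub>P\<^esub> \<kappa> k l v w"
      "\<And>k l c v w. v \<in> carrier V1 ==> w \<in> carrier V2 ==> \<kappa> k l v (ks c \<odot>\<^bsub>V2\<^esub> w) = ks c \<odot>\<^bsub>P\<^esub> \<kappa> k l v w"
      "\<And>k l g v w. g \<in> carrier G ==> v \<in> carrier V1 ==> w \<in> carrier V2 ==>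
        \<kappa> k l (kg g \<odot>\<^bsub>V1\<^esub> v) (kg g \<odot>\<^bsub>V2\<^esub> w) = kg g \<odot>\<^bsub>P\<^esub> \<kappa> k l v w"
    and x: "\<And>k l v w. v \<in> carrier V1 ==> w \<in> carrier V2 ==>
        \<kappa> (Suc k) l v (ks (\<chi> a ^ l) \<odot>\<^bsub>V2\<^esub> (kg a \<odot>\<^bsub>V2\<^esub> w)) = ks (X1 k l) \<odot>\<^bsub>P\<^esub> \<kappa> k l v w"
      "\<And>k l v w. v \<in> carrier V1 ==> w \<in> carrier V2 ==> \<kappa> k (Suc l) v w = ks (X2 k l) \<odot>\<^bsub>P\<^esub> \<kappa> k l v w"
    and span: "\<And>k l h h' p. additive P P h ==> additive P P h' ==>
        (\<And>v w. v \<in> carrier V1 ==> w \<in> carrier V2 ==> h (\<kappa> k l v w) = h' (\<kappa> k l v w)) ==> p \<in> carrier P ==> h p = h' p"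
    and univ: "\<And>k l \<gamma>. balanced (UNIV :: 'k set) (\<lambda>v c. ks c \<odot>\<^bsub>V1\<^esub> v) V1 (\<lambda>c w. ks c \<odot>\<^bsub>V2\<^esub> w) V2
          (tensor_module H (string_module V1 0 n1) (string_module V2 0 n2)) \<gamma> ==>
        \<exists>\<theta>. additive P (tensor_module H (string_module V1 0 n1) (string_module V2 0 n2)) \<theta> \<and>
          (\<forall>v\<in>carrier V1. \<forall>w\<in>carrier V2. \<theta> (\<kappa> k l v w) = \<gamma> v w)"
  shows "module_iso H (tensor_module H (string_module V1 0 n1) (string_module V2 0 n2))
    (gmod P ({..<n1} \<times> {..<n2}) (\<lambda>b. fst b + snd b) (box_matrix X1 X2))"
proof -
  interpret V1: group_module G \<chi> a V1 by (intro group_moduleI V)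
  interpret V2: group_module G \<chi> a V2 by (intro group_moduleI V)
  interpret P: group_module G \<chi> a P by (intro group_moduleI V)
  let ?M = "string_module V1 0 n1" and ?N = "string_module V2 0 n2"
  interpret M: left_module H ?M by (rule string_left_module[OF V(1)])
  interpret N: left_module H ?N by (rule string_left_module[OF V(2)])
  interpret T: ore_tensor G \<chi> a ?M ?N
    by (intro ore_tensor.intro hopf_ore_data_axioms M.left_module_axioms N.left_module_axioms)
  let ?T = "tensor_module H ?M ?N" and ?B = "{..<n1} \<times> {..<n2}"
  note Tdef = T.T_def[symmetric]
  let ?G = "gmod P ?B (\<lambda>b. fst b + snd b) (box_matrix X1 X2)"
  note X = box_degree_one[of n1 n2 X1 X2]
  have Gab: "abelian_group ?G" by (rule P.gmod_abelian)
  interpret Gab: abelian_group ?G by (rule Gab)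
  \<comment> \<open>Coordinates of f \<otimes> g: the place (k, l) of the box receives the image of
    the components f k and g l under \<kappa> k l.\<close>
  define \<beta> where "\<beta> f g = (\<lambda>b\<in>?B. \<kappa> (fst b) (snd b) (f (fst b)) (g (snd b)))" for f g
  have fM: "f k \<in> carrier V1" if "f \<in> carrier ?M" "k < n1" for f k using that by (auto simp: V1.string_simps)
  have fN: "g l \<in> carrier V2" if "g \<in> carrier ?N" "l < n2" for g l using that by (auto simp: V2.string_simps)
  have cM: "f \<in> (\<Pi>\<^sub>E e\<in>{..<n1}. carrier V1)" if "f \<in> carrier ?M" for f using that by (simp add: V1.string_simps)
  have cN: "g \<in> (\<Pi>\<^sub>E e\<in>{..<n2}. carrier V2)" if "g \<in> carrier ?N" for g using that by (simp add: V2.string_simps)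
  have \<beta>B: "\<beta> f g \<in> (\<Pi>\<^sub>E b\<in>?B. carrier P)" if "f \<in> carrier ?M" "g \<in> carrier ?N" for f g
    unfolding \<beta>_def using fM[OF that(1)] fN[OF that(2)] \<kappa>(1) by auto
  have \<beta>G: "\<beta> f g \<in> carrier ?G" if "f \<in> carrier ?M" "g \<in> carrier ?N" for f g
    using \<beta>B[OF that] by (simp add: gmod_simps)
  have \<beta>s: "\<beta> (hs c \<odot>\<^bsub>?M\<^esub> f) g = gsc P ?B c (\<beta> f g)" "\<beta> f (hs c \<odot>\<^bsub>?N\<^esub> g) = gsc P ?B c (\<beta> f g)"
    if "f \<in> carrier ?M" "g \<in> carrier ?N" for c f g
    unfolding V1.string_generators[OF cM[OF that(1)]] V2.string_generators[OF cN[OF that(2)]] \<beta>_def gsc_def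
    by (intro restrict_ext; use fM[OF that(1)] fN[OF that(2)] \<kappa>(4,5) in auto)+
  have bal: "balanced (UNIV :: 'k set) (\<lambda>x c. scalar_mult H ?M c x) ?M (scalar_mult H ?N) ?N ?G \<beta>"
  proof (rule balancedI)
    fix f f' g assume f: "f \<in> carrier ?M" "f' \<in> carrier ?M" and g: "g \<in> carrier ?N"
    show "\<beta> (f \<oplus>\<^bsub>?M\<^esub> f') g = \<beta> f g \<oplus>\<^bsub>?G\<^esub> \<beta> f' g"
      unfolding gmod_simps V1.string_simps \<beta>_def
      by (intro restrict_ext) (use fM[OF f(1)] fM[OF f(2)] fN[OF g] \<kappa>(2) in auto)
  next
    fix f g g' assume f: "f \<in> carrier ?M" and g: "g \<in> carrier ?N" "g' \<in> carrier ?N"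
    show "\<beta> f (g \<oplus>\<^bsub>?N\<^esub> g') = \<beta> f g \<oplus>\<^bsub>?G\<^esub> \<beta> f g'"
      unfolding gmod_simps V2.string_simps \<beta>_def
      by (intro restrict_ext) (use fN[OF g(1)] fN[OF g(2)] fM[OF f] \<kappa>(3) in auto)
  next
    fix f g c assume "f \<in> carrier ?M" "g \<in> carrier ?N"
    then show "\<beta> (scalar_mult H ?M c f) g = \<beta> f (scalar_mult H ?N c g)"
      by (simp add: scalar_mult_H \<beta>s)
  qed (rule \<beta>G)
  obtain \<Phi> where \<Phi>: "additive ?T ?G \<Phi>" "\<And>f g. f \<in> carrier ?M ==> g \<in> carrier ?N ==> \<Phi> (T.tens f g) = \<beta> f g"
    using T.TP.TM.lift[OF Gab bal] unfolding T.T_def by blast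
  note TT = T.TP.TM.T_abelian[unfolded T.T_def]
  interpret TA: abelian_group ?T by (rule TT)
  note tens_closed = T.TP.TM.tens_closed[unfolded T.T_def] and tens_simps = T.TP.TM.tens_simps[unfolded T.T_def]
    and smult_tens = T.smult_tens[unfolded T.T_def] and eqI = T.TP.TM.additive_eqI[unfolded T.T_def]
    and Tcl = T.smult_T_closed[unfolded T.T_def] and expT = T.expands_T[unfolded T.T_def]
    and tens_additive = T.TP.TM.tens_additive[unfolded T.T_def]
  have Tad: "additive ?T ?T (\<lambda>X. r \<odot>\<^bsub>?T\<^esub> X)" if r: "r \<in> carrier H" for r
    using T.TP.act_additive[OF comult_H_closed[OF r]] T.smult_T[OF r] unfolding T.T_def additive_def by simp
  have Gl: "left_module H ?G" by (rule P.gmod_left_module[OF X])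
  have Gad: "additive ?G ?G (\<lambda>h. r \<odot>\<^bsub>?G\<^esub> h)" if "r \<in> carrier H" for r
    using left_module.smult_closed[OF Gl that] left_module.smult_r_distr[OF Gl that] by (intro additiveI)
  have lin: "\<Phi> (r \<odot>\<^bsub>?T\<^esub> Y) = r \<odot>\<^bsub>?G\<^esub> \<Phi> Y"
    if r: "r \<in> carrier H" and Y: "Y \<in> carrier ?T"
      and t: "\<And>f g. f \<in> carrier ?M ==> g \<in> carrier ?N ==> \<Phi> (r \<odot>\<^bsub>?T\<^esub> T.tens f g) = r \<odot>\<^bsub>?G\<^esub> \<beta> f g" for r Y
  proof (rule eqI[OF Gab _ _ _ Y])
    show "additive ?T ?G (\<lambda>X. \<Phi> (r \<odot>\<^bsub>?T\<^esub> X))"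
      using additiveD[OF Tad[OF r]] additiveD[OF \<Phi>(1)] by (intro additiveI) simp_all
    show "additive ?T ?G (\<lambda>X. r \<odot>\<^bsub>?G\<^esub> \<Phi> X)"
      using additiveD[OF Gad[OF r]] additiveD[OF \<Phi>(1)] by (intro additiveI) simp_all
  qed (simp add: t \<Phi>(2))
  let ?d1 = "\<lambda>k v. V1.delta n1 k v" and ?d2 = "\<lambda>l w. V2.delta n2 l w"
  have d1: "?d1 k v \<in> carrier ?M" if "v \<in> carrier V1" for k v using V1.delta_closed[OF that] by (simp add: V1.string_simps)
  have d2: "?d2 l w \<in> carrier ?N" if "w \<in> carrier V2" for l w using V2.delta_closed[OF that] by (simp add: V2.string_simps)
  have z1: "ks c \<odot>\<^bsub>V1\<^esub> \<zero>\<^bsub>V1\<^esub> = \<zero>\<^bsub>V1\<^esub>" and z2: "ks c \<odot>\<^bsub>V2\<^esub> \<zero>\<^bsub>V2\<^esub> = \<zero>\<^bsub>V2\<^esub>" for c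
    by (simp_all add: V1.P.smult_zero_right V2.P.smult_zero_right)
  have d1s: "?d1 k (ks c \<odot>\<^bsub>V1\<^esub> v) = scalar_mult H ?M c (?d1 k v)" if "v \<in> carrier V1" for k c v
    unfolding scalar_mult_H V1.string_generators(1)[OF V1.delta_closed[OF that]]
    unfolding V1.delta_def by (intro restrict_ext) (simp add: z1)
  have d2s: "?d2 l (ks c \<odot>\<^bsub>V2\<^esub> w) = scalar_mult H ?N c (?d2 l w)" if "w \<in> carrier V2" for l c w
    unfolding scalar_mult_H V2.string_generators(1)[OF V2.delta_closed[OF that]]
    unfolding V2.delta_def by (intro restrict_ext) (simp add: z2)
  have bd: "balanced (UNIV :: 'k set) (\<lambda>v c. ks c \<odot>\<^bsub>V1\<^esub> v) V1 (\<lambda>c w. ks c \<odot>\<^bsub>V2\<^esub> w) V2 ?T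
    (\<lambda>v w. T.tens (?d1 k v) (?d2 l w))" for k l
  proof (rule balancedI)
    fix v v' w assume v: "v \<in> carrier V1" "v' \<in> carrier V1" and w: "w \<in> carrier V2"
    show "T.tens (?d1 k (v \<oplus>\<^bsub>V1\<^esub> v')) (?d2 l w) = T.tens (?d1 k v) (?d2 l w) \<oplus>\<^bsub>?T\<^esub> T.tens (?d1 k v') (?d2 l w)"
      using tens_simps(2)[OF d1[OF v(1)] d1[OF v(2)] d2[OF w]] additiveD(2)[OF V1.delta_additive[where d = 0] v] by simp
  next
    fix v w w' assume v: "v \<in> carrier V1" and w: "w \<in> carrier V2" "w' \<in> carrier V2"
    show "T.tens (?d1 k v) (?d2 l (w \<oplus>\<^bsub>V2\<^esub> w')) = T.tens (?d1 k v) (?d2 l w) \<oplus>\<^bsub>?T\<^esub> T.tens (?d1 k v) (?d2 l w')"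
      using tens_simps(3)[OF d1[OF v] d2[OF w(1)] d2[OF w(2)]] additiveD(2)[OF V2.delta_additive[where d = 0] w] by simp
  next
    fix v c w assume v: "v \<in> carrier V1" and w: "w \<in> carrier V2"
    show "T.tens (?d1 k (ks c \<odot>\<^bsub>V1\<^esub> v)) (?d2 l w) = T.tens (?d1 k v) (?d2 l (ks c \<odot>\<^bsub>V2\<^esub> w))"
      unfolding d1s[OF v] d2s[OF w] by (rule tens_simps(4)[OF d1[OF v] UNIV_I d2[OF w]])
  qed (intro tens_closed d1 d2)
  have "\<forall>k l. \<exists>\<theta>. additive P ?T \<theta> \<and> (\<forall>v\<in>carrier V1. \<forall>w\<in>carrier V2. \<theta> (\<kappa> k l v w) = T.tens (?d1 k v) (?d2 l w))"
    using univ[OF bd] by blast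
  then obtain \<theta> where \<theta>: "\<And>k l. additive P ?T (\<theta> k l)"
    "\<And>k l v w. v \<in> carrier V1 ==> w \<in> carrier V2 ==> \<theta> k l (\<kappa> k l v w) = T.tens (?d1 k v) (?d2 l w)" by metis
  let ?r = "\<lambda>h k. finsum ?T (\<lambda>l. \<theta> k l (h (k, l))) {..<n2}"
  \<comment> \<open>The inverse map: the component at (k, l) is sent back by \<theta> k l to the
    tensors of vectors concentrated in places k and l.\<close>
  define \<Psi> where "\<Psi> h = finsum ?T (\<lambda>k. ?r h k) {..<n1}" for h
  have \<theta>c: "\<theta> k l (h (k, l)) \<in> carrier ?T" if "h \<in> carrier ?G" "k \<in> {..<n1}" "l \<in> {..<n2}" for h k l
    using that additiveD(1)[OF \<theta>(1)] by (auto simp: gmod_simps)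
  have \<theta>c2: "?r h k \<in> carrier ?T" if "h \<in> carrier ?G" "k \<in> {..<n1}" for h k
    using \<theta>c[OF that] by (intro TA.finsum_closed) auto
  have \<Psi>c: "\<Psi> h \<in> carrier ?T" if "h \<in> carrier ?G" for h
    unfolding \<Psi>_def using \<theta>c2[OF that] by (intro TA.finsum_closed) auto
  have \<Psi>a: "additive ?G ?T \<Psi>"
  proof (rule additiveI[OF \<Psi>c])
    fix h h' assume h: "h \<in> carrier ?G" "h' \<in> carrier ?G"
    have "\<Psi> (h \<oplus>\<^bsub>?G\<^esub> h') = finsum ?T (\<lambda>k. ?r h k \<oplus>\<^bsub>?T\<^esub> ?r h' k) {..<n1}"
      unfolding \<Psi>_def
    proof (intro TA.finsum_cong' refl)
      fix k assume k: "k \<in> {..<n1}"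
      have "finsum ?T (\<lambda>l. \<theta> k l ((h \<oplus>\<^bsub>?G\<^esub> h') (k, l))) {..<n2} =
        finsum ?T (\<lambda>l. \<theta> k l (h (k, l)) \<oplus>\<^bsub>?T\<^esub> \<theta> k l (h' (k, l))) {..<n2}"
      proof (intro TA.finsum_cong' refl)
        fix l assume l: "l \<in> {..<n2}"
        have "h (k, l) \<in> carrier P" "h' (k, l) \<in> carrier P" using h k l by (auto simp: gmod_simps)
        then show "\<theta> k l ((h \<oplus>\<^bsub>?G\<^esub> h') (k, l)) = \<theta> k l (h (k, l)) \<oplus>\<^bsub>?T\<^esub> \<theta> k l (h' (k, l))"
          using k l additiveD(2)[OF \<theta>(1)] by (simp add: gmod_simps)
      qed (use \<theta>c[OF h(1) k] \<theta>c[OF h(2) k] in auto)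
      also have "\<dots> = ?r h k \<oplus>\<^bsub>?T\<^esub> ?r h' k"
        using \<theta>c[OF h(1) k] \<theta>c[OF h(2) k] by (intro TA.finsum_addf) auto
      finally show "finsum ?T (\<lambda>l. \<theta> k l ((h \<oplus>\<^bsub>?G\<^esub> h') (k, l))) {..<n2} =
        ?r h k \<oplus>\<^bsub>?T\<^esub> ?r h' k" .
    qed (use \<theta>c2[OF h(1)] \<theta>c2[OF h(2)] in auto)
    also have "\<dots> = \<Psi> h \<oplus>\<^bsub>?T\<^esub> \<Psi> h'"
      unfolding \<Psi>_def using \<theta>c2[OF h(1)] \<theta>c2[OF h(2)] by (intro TA.finsum_addf) auto
    finally show "\<Psi> (h \<oplus>\<^bsub>?G\<^esub> h') = \<Psi> h \<oplus>\<^bsub>?T\<^esub> \<Psi> h'" .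
  qed
  have \<Psi>\<Phi>: "\<Psi> (\<Phi> Y) = Y" if Y: "Y \<in> carrier ?T" for Y
  proof (rule eqI[OF TT _ _ _ Y])
    show "additive ?T ?T (\<lambda>Y. \<Psi> (\<Phi> Y))"
      using additiveD[OF \<Psi>a] additiveD[OF \<Phi>(1)] by (intro additiveI) simp_all
    show "additive ?T ?T (\<lambda>Y. Y)" by (rule additiveI) simp_all
    fix f g assume f: "f \<in> carrier ?M" and g: "g \<in> carrier ?N"
    have fk: "?d1 k (f k) \<in> carrier ?M" if "k \<in> {..<n1}" for k using d1[OF fM[OF f]] that by simp
    have gl: "?d2 l (g l) \<in> carrier ?N" if "l \<in> {..<n2}" for l using d2[OF fN[OF g]] that by simp
    have "T.tens f g = T.tens (finsum ?M (\<lambda>k. ?d1 k (f k)) {..<n1}) g" using V1.string_decompose[OF f] by simp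
    also have "\<dots> = finsum ?T (\<lambda>k. T.tens (?d1 k (f k)) g) {..<n1}"
      by (rule additive_finsum[OF M.M.abelian_group_axioms TT additiveD[OF tens_additive(2)[OF g]] fk])
    also have "\<dots> = finsum ?T (\<lambda>k. finsum ?T (\<lambda>l. T.tens (?d1 k (f k)) (?d2 l (g l))) {..<n2}) {..<n1}"
    proof (intro TA.finsum_cong' refl)
      fix k assume k: "k \<in> {..<n1}"
      have "T.tens (?d1 k (f k)) g = T.tens (?d1 k (f k)) (finsum ?N (\<lambda>l. ?d2 l (g l)) {..<n2})"
        using V2.string_decompose[OF g] by simp
      also have "\<dots> = finsum ?T (\<lambda>l. T.tens (?d1 k (f k)) (?d2 l (g l))) {..<n2}"
        by (rule additive_finsum[OF N.M.abelian_group_axioms TT additiveD[OF tens_additive(1)[OF fk[OF k]]] gl])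
      finally show "T.tens (?d1 k (f k)) g = finsum ?T (\<lambda>l. T.tens (?d1 k (f k)) (?d2 l (g l))) {..<n2}" .
    qed (use tens_closed fk gl in \<open>auto intro!: TA.finsum_closed\<close>)
    also have "\<dots> = \<Psi> (\<beta> f g)"
      unfolding \<Psi>_def
    proof (intro TA.finsum_cong' refl)
      fix k l assume "k \<in> {..<n1}" "l \<in> {..<n2}"
      then show "T.tens (?d1 k (f k)) (?d2 l (g l)) = \<theta> k l (\<beta> f g (k, l))"
        using \<theta>(2)[OF fM[OF f] fN[OF g]] by (simp add: \<beta>_def)
    qed (use \<theta>c[OF \<beta>G[OF f g]] \<theta>c2[OF \<beta>G[OF f g]] in auto)
    finally show "\<Psi> (\<Phi> (T.tens f g)) = T.tens f g" using \<Phi>(2)[OF f g] by simp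
  qed
  have \<kappa>0: "\<kappa> k l \<zero>\<^bsub>V1\<^esub> w = \<zero>\<^bsub>P\<^esub>" if "w \<in> carrier V2" for k l w
    by (rule additive_0[of V1 P "\<lambda>v. \<kappa> k l v w"])
      (use \<kappa>(1,2) that V1.P.M.abelian_group_axioms P.P.M.abelian_group_axioms in \<open>simp_all add: additive_def\<close>)
  have \<kappa>0': "\<kappa> k l v \<zero>\<^bsub>V2\<^esub> = \<zero>\<^bsub>P\<^esub>" if "v \<in> carrier V1" for k l v
    by (rule additive_0[of V2 P "\<lambda>w. \<kappa> k l v w"])
      (use \<kappa>(1,3) that V2.P.M.abelian_group_axioms P.P.M.abelian_group_axioms in \<open>simp_all add: additive_def\<close>)
  \<comment> \<open>Both sides are additive in p, so \<open>span\<close> reduces the claim to p =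
    \<kappa> k l v w. There \<theta> k l p is a pure tensor of vectors concentrated in one place
    each, whose coordinates are known.\<close>
  have \<Phi>\<theta>: "\<Phi> (\<theta> k l p) b = (if b = (k, l) then p else \<zero>\<^bsub>P\<^esub>)" if b: "b \<in> ?B" and p: "p \<in> carrier P" for k l p b
  proof (rule span[of "\<lambda>p. \<Phi> (\<theta> k l p) b" "\<lambda>p. if b = (k, l) then p else \<zero>\<^bsub>P\<^esub>", OF _ _ _ p])
    have ev: "additive ?G P (\<lambda>h. h b)" using b by (auto simp: additive_def gmod_simps)
    show "additive P P (\<lambda>p. \<Phi> (\<theta> k l p) b)"
      using additiveD[OF ev] additiveD[OF \<Phi>(1)] additiveD[OF \<theta>(1)] by (intro additiveI) simp_all
    show "additive P P (\<lambda>p. if b = (k, l) then p else \<zero>\<^bsub>P\<^esub>)" by (rule additiveI) simp_all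
    fix v w assume v: "v \<in> carrier V1" and w: "w \<in> carrier V2"
    show "\<Phi> (\<theta> k l (\<kappa> k l v w)) b = (if b = (k, l) then \<kappa> k l v w else \<zero>\<^bsub>P\<^esub>)"
      unfolding \<theta>(2)[OF v w] \<Phi>(2)[OF d1[OF v] d2[OF w]] \<beta>_def
      using b v w by (cases b) (auto simp: V1.delta_def V2.delta_def \<kappa>0 \<kappa>0')
  qed
  have \<Phi>\<Psi>: "\<Phi> (\<Psi> h) = h" if h: "h \<in> carrier ?G" for h
  proof (rule PiE_eqI)
    show "\<Phi> (\<Psi> h) \<in> (\<Pi>\<^sub>E b\<in>?B. carrier P)" "h \<in> (\<Pi>\<^sub>E b\<in>?B. carrier P)"
      using additiveD(1)[OF \<Phi>(1) \<Psi>c[OF h]] h by (simp_all add: gmod_simps)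
    fix b assume b: "b \<in> ?B"
    obtain k0 l0 where kl: "b = (k0, l0)" "k0 \<in> {..<n1}" "l0 \<in> {..<n2}" using b by auto
    have ev: "additive ?T P (\<lambda>Y. \<Phi> Y b)"
      using b additiveD[OF \<Phi>(1)] by (auto simp: additive_def gmod_simps)
    have hc: "h (k, l) \<in> carrier P" if "k \<in> {..<n1}" "l \<in> {..<n2}" for k l using h that by (auto simp: gmod_simps)
    have "\<Phi> (\<Psi> h) b = finsum P (\<lambda>k. \<Phi> (?r h k) b) {..<n1}"
      unfolding \<Psi>_def
      by (rule additive_finsum[OF TT P.P.M.abelian_group_axioms, of "\<lambda>Y. \<Phi> Y b"]) (use additiveD[OF ev] \<theta>c2[OF h] in simp_all)
    also have "\<dots> = \<Phi> (?r h k0) b"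
    proof (rule finsum_single[OF P.P.M.abelian_group_axioms _ kl(2)])
      show "\<Phi> (?r h k) b = \<zero>\<^bsub>P\<^esub>" if k: "k \<in> {..<n1}" "k \<noteq> k0" for k
      proof -
        have "\<Phi> (?r h k) b = finsum P (\<lambda>l. \<Phi> (\<theta> k l (h (k, l))) b) {..<n2}"
          by (rule additive_finsum[OF TT P.P.M.abelian_group_axioms, of "\<lambda>Y. \<Phi> Y b"]) (use additiveD[OF ev] \<theta>c[OF h k(1)] in simp_all)
        also have "\<dots> = finsum P (\<lambda>l. \<zero>\<^bsub>P\<^esub>) {..<n2}"
          by (rule P.fcong) (use k kl(1) \<Phi>\<theta>[OF b hc] in auto)
        finally show ?thesis by simp
      qed
    qed (use additiveD(1)[OF ev] \<theta>c2[OF h kl(2)] in simp_all)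
    also have "\<dots> = finsum P (\<lambda>l. \<Phi> (\<theta> k0 l (h (k0, l))) b) {..<n2}"
      by (rule additive_finsum[OF TT P.P.M.abelian_group_axioms, of "\<lambda>Y. \<Phi> Y b"]) (use additiveD[OF ev] \<theta>c[OF h kl(2)] in simp_all)
    also have "\<dots> = \<Phi> (\<theta> k0 l0 (h (k0, l0))) b"
      by (rule finsum_single[OF P.P.M.abelian_group_axioms _ kl(3)])
        (use \<Phi>\<theta>[OF b hc[OF kl(2)]] kl hc in auto)
    also have "\<dots> = h b" using \<Phi>\<theta>[OF b hc[OF kl(2,3)]] kl by simp
    finally show "\<Phi> (\<Psi> h) b = h b" .
  qed
  show ?thesis
  proof (rule expands_isoI[of _ _ \<Phi> \<Psi>])
    show "expands ?T" by (rule expT)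
    show "expands ?G" by (rule gmod_expands[OF V(3) X])
    fix Y assume Y: "Y \<in> carrier ?T"
    show "\<Phi> (hs c \<odot>\<^bsub>?T\<^esub> Y) = hs c \<odot>\<^bsub>?G\<^esub> \<Phi> Y" for c
    proof (rule lin[OF _ Y])
      fix f g assume f: "f \<in> carrier ?M" and g: "g \<in> carrier ?N"
      show "\<Phi> (hs c \<odot>\<^bsub>?T\<^esub> T.tens f g) = hs c \<odot>\<^bsub>?G\<^esub> \<beta> f g"
        unfolding smult_tens(1)[OF f g] P.gmod_generators(1)[OF X \<beta>G[OF f g]] \<beta>s(1)[OF f g, symmetric]
        by (rule \<Phi>(2)[OF M.smult_closed[OF h_closed(1) f] g])
    qed simp
    show "\<Phi> (hg b \<odot>\<^bsub>?T\<^esub> Y) = hg b \<odot>\<^bsub>?G\<^esub> \<Phi> Y" if b: "b \<in> carrier G" for b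
    proof (rule lin[OF _ Y])
      fix f g assume f: "f \<in> carrier ?M" and g: "g \<in> carrier ?N"
      have "\<Phi> (hg b \<odot>\<^bsub>?T\<^esub> T.tens f g) = \<beta> (hg b \<odot>\<^bsub>?M\<^esub> f) (hg b \<odot>\<^bsub>?N\<^esub> g)"
        unfolding smult_tens(2)[OF f g b] by (rule \<Phi>(2)) (simp_all add: M.smult_closed N.smult_closed f g b)
      also have "\<dots> = grho P ?B (\<lambda>b. fst b + snd b) b (\<beta> f g)"
        unfolding V1.string_generators(2)[OF cM[OF f] b] V2.string_generators(2)[OF cN[OF g] b] \<beta>_def grho_def
      proof (intro restrict_ext)
        fix z assume "z \<in> ?B"
        then obtain k l where z: "z = (k, l)" "k < n1" "l < n2" by auto
        note v = fM[OF f z(2)] and w = fN[OF g z(3)]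
        have bv: "kg b \<odot>\<^bsub>V1\<^esub> f k \<in> carrier V1" and bw: "kg b \<odot>\<^bsub>V2\<^esub> g l \<in> carrier V2"
          using V1.ks_simps(2)[OF v b] V2.ks_simps(2)[OF w b] .
        have "\<kappa> k l (ks (\<chi> b ^ (0 + k)) \<odot>\<^bsub>V1\<^esub> (kg b \<odot>\<^bsub>V1\<^esub> f k)) (ks (\<chi> b ^ (0 + l)) \<odot>\<^bsub>V2\<^esub> (kg b \<odot>\<^bsub>V2\<^esub> g l)) =
          ks (\<chi> b ^ k) \<odot>\<^bsub>P\<^esub> (ks (\<chi> b ^ l) \<odot>\<^bsub>P\<^esub> (kg b \<odot>\<^bsub>P\<^esub> \<kappa> k l (f k) (g l)))"
          using \<kappa>(4)[OF bv V2.ks_simps(1)[OF bw]] \<kappa>(5)[OF bv bw] \<kappa>(6)[OF b v w] by simp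
        also have "\<dots> = ks (\<chi> b ^ (k + l)) \<odot>\<^bsub>P\<^esub> (kg b \<odot>\<^bsub>P\<^esub> \<kappa> k l (f k) (g l))"
          using P.ks_simps(3)[OF P.ks_simps(2)[OF \<kappa>(1)[OF v w] b]] by (simp add: power_add)
        finally show "\<kappa> (fst z) (snd z) ((\<lambda>e\<in>{..<n1}. ks (\<chi> b ^ (0 + e)) \<odot>\<^bsub>V1\<^esub> (kg b \<odot>\<^bsub>V1\<^esub> f e)) (fst z))
            ((\<lambda>e\<in>{..<n2}. ks (\<chi> b ^ (0 + e)) \<odot>\<^bsub>V2\<^esub> (kg b \<odot>\<^bsub>V2\<^esub> g e)) (snd z)) =
          ks (\<chi> b ^ (fst z + snd z)) \<odot>\<^bsub>P\<^esub> (kg b \<odot>\<^bsub>P\<^esub> (\<lambda>b\<in>?B. \<kappa> (fst b) (snd b) (f (fst b)) (g (snd b))) z)"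
          using z by simp
      qed
      finally show "\<Phi> (hg b \<odot>\<^bsub>?T\<^esub> T.tens f g) = hg b \<odot>\<^bsub>?G\<^esub> \<beta> f g"
        using P.gmod_generators(2)[OF X \<beta>G[OF f g] b] by simp
    qed (simp add: b)
    show "\<Phi> (hx \<odot>\<^bsub>?T\<^esub> Y) = hx \<odot>\<^bsub>?G\<^esub> \<Phi> Y"
    proof (rule lin[OF _ Y])
      fix f g assume f: "f \<in> carrier ?M" and g: "g \<in> carrier ?N"
      let ?f = "hx \<odot>\<^bsub>?M\<^esub> f" and ?g = "hx \<odot>\<^bsub>?N\<^esub> g" and ?ag = "hg a \<odot>\<^bsub>?N\<^esub> g"
      have cl: "?f \<in> carrier ?M" "?g \<in> carrier ?N" "?ag \<in> carrier ?N"
        using f g a(1) by (simp_all add: M.smult_closed N.smult_closed)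
      have "\<Phi> (hx \<odot>\<^bsub>?T\<^esub> T.tens f g) = \<beta> ?f ?ag \<oplus>\<^bsub>?G\<^esub> \<beta> f ?g"
        unfolding smult_tens(3)[OF f g] using f g cl
        by (simp add: additiveD(2)[OF \<Phi>(1)] tens_closed \<Phi>(2))
      also have "\<dots> = mact P ?B ?B (box_matrix X1 X2) (\<beta> f g)"
      proof (rule PiE_eqI)
        show "\<beta> ?f ?ag \<oplus>\<^bsub>?G\<^esub> \<beta> f ?g \<in> (\<Pi>\<^sub>E b\<in>?B. carrier P)"
          using Gab.a_closed[OF \<beta>G[OF cl(1,3)] \<beta>G[OF f cl(2)]] by (simp add: gmod_simps)
        show "mact P ?B ?B (box_matrix X1 X2) (\<beta> f g) \<in> (\<Pi>\<^sub>E b\<in>?B. carrier P)" by (rule P.mact_closed[OF \<beta>B[OF f g]])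
        fix z assume zB: "z \<in> ?B"
        then obtain k l where z: "z = (k, l)" "k < n1" "l < n2" by auto
        note v = fM[OF f z(2)] and w = fN[OF g z(3)]
        have aw: "kg a \<odot>\<^bsub>V2\<^esub> g l \<in> carrier V2" by (rule V2.ks_simps(2)[OF w a(1)])
        have "\<kappa> k l (?f k) (?ag l) = (case k of 0 => \<zero>\<^bsub>P\<^esub> | Suc k' => ks (X1 k' l) \<odot>\<^bsub>P\<^esub> \<beta> f g (k', l))"
        proof (cases k)
          case 0
          then show ?thesis unfolding V1.string_generators(3)[OF cM[OF f]] V2.string_generators(2)[OF cN[OF g] a(1)]
            using z V2.ks_simps(1)[OF aw] by (simp add: \<kappa>0)
        next
          case (Suc k')
          have k': "k' < n1" using Suc z by simp
          show ?thesis unfolding V1.string_generators(3)[OF cM[OF f]] V2.string_generators(2)[OF cN[OF g] a(1)]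
            using z Suc k' x(1)[OF fM[OF f k'] w] by (simp add: \<beta>_def)
        qed
        moreover have "\<kappa> k l (f k) (?g l) = (case l of 0 => \<zero>\<^bsub>P\<^esub> | Suc l' => ks (X2 k l') \<odot>\<^bsub>P\<^esub> \<beta> f g (k, l'))"
        proof (cases l)
          case 0
          then show ?thesis unfolding V2.string_generators(3)[OF cN[OF g]]
            using z v by (simp add: \<kappa>0')
        next
          case (Suc l')
          have l': "l' < n2" using Suc z by simp
          show ?thesis unfolding V2.string_generators(3)[OF cN[OF g]]
            using z Suc l' x(2)[OF v fN[OF g l']] by (simp add: \<beta>_def)
        qed
        ultimately show "(\<beta> ?f ?ag \<oplus>\<^bsub>?G\<^esub> \<beta> f ?g) z = mact P ?B ?B (box_matrix X1 X2) (\<beta> f g) z"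
          unfolding z(1) P.mact_box[OF \<beta>B[OF f g] z(2,3)] gmod_simps using z by (simp add: \<beta>_def)
      qed
      finally show "\<Phi> (hx \<odot>\<^bsub>?T\<^esub> T.tens f g) = hx \<odot>\<^bsub>?G\<^esub> \<beta> f g"
        using P.gmod_generators(3)[OF X \<beta>G[OF f g]] by simp
    qed simp
  qed (use additiveD[OF \<Phi>(1)] \<Psi>c \<Psi>\<Phi> \<Phi>\<Psi> in simp_all)
qed

section \<open>Tensor products of isomorphic modules\<close>

lemma inverse_isos_sym:
  assumes i: "inverse_isos R M N \<phi> \<psi>" and M: "left_module R M"
  shows "inverse_isos R N M \<psi> \<phi>"
proof -
  interpret M: left_module R M by fact
  note * = inverse_isosD[OF i]
  have "\<psi> (x \<oplus>\<^bsub>N\<^esub> y) = \<psi> x \<oplus>\<^bsub>M\<^esub> \<psi> y" if "x \<in> carrier N" "y \<in> carrier N" for x y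
    using *(3)[OF M.M.a_closed[OF *(2)[OF that(1)] *(2)[OF that(2)]]] that by (simp add: *)
  moreover have "\<psi> (r \<odot>\<^bsub>N\<^esub> x) = r \<odot>\<^bsub>M\<^esub> \<psi> x" if "r \<in> carrier R" "x \<in> carrier N" for r x
    using *(3)[OF M.smult_closed[OF that(1) *(2)[OF that(2)]]] that by (simp add: *)
  ultimately show ?thesis using * by (simp add: inverse_isos_def)
qed

lemma (in hopf_ore_data) tensor_module_cong:
  assumes mods: "left_module H M" "left_module H N" "left_module H M'" "left_module H N'"
    and iso: "module_iso H M M'" "module_iso H N N'"
  shows "module_iso H (tensor_module H M N) (tensor_module H M' N')"
proof -
  interpret T: ore_tensor G \<chi> a M N by (intro ore_tensor.intro hopf_ore_data_axioms mods)
  interpret T': ore_tensor G \<chi> a M' N' by (intro ore_tensor.intro hopf_ore_data_axioms mods)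
  obtain \<phi> \<psi> where i: "inverse_isos H M M' \<phi> \<psi>" using module_isoE[OF iso(1)] .
  obtain \<phi>' \<psi>' where i': "inverse_isos H N N' \<phi>' \<psi>'" using module_isoE[OF iso(2)] .
  note j = inverse_isos_sym[OF i mods(1)] and j' = inverse_isos_sym[OF i' mods(2)]
  note D = inverse_isosD[OF i] and D' = inverse_isosD[OF i'] and E = inverse_isosD[OF j] and E' = inverse_isosD[OF j']
  have "balanced (UNIV :: 'k set) (\<lambda>x c. scalar_mult H M c x) M (scalar_mult H N) N T'.T (\<lambda>x y. T'.tens (\<phi> x) (\<phi>' y))"
  proof (rule balancedI)
    fix x c y assume "x \<in> carrier M" "y \<in> carrier N"
    then show "T'.tens (\<phi> (scalar_mult H M c x)) (\<phi>' y) = T'.tens (\<phi> x) (\<phi>' (scalar_mult H N c y))"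
      using T'.TP.TM.tens_simps(4)[OF D(1) UNIV_I D'(1)] by (simp add: scalar_mult_H D(6) D'(6))
  qed (simp_all add: D(1,5) D'(1,5) T'.TP.TM.tens_closed T'.TP.TM.tens_simps)
  then obtain \<Phi> where \<Phi>: "additive T.T T'.T \<Phi>"
    "\<And>x y. x \<in> carrier M ==> y \<in> carrier N ==> \<Phi> (T.tens x y) = T'.tens (\<phi> x) (\<phi>' y)"
    using T.TP.TM.lift[OF T'.TP.TM.T_abelian] by blast
  have "balanced (UNIV :: 'k set) (\<lambda>x c. scalar_mult H M' c x) M' (scalar_mult H N') N' T.T (\<lambda>x y. T.tens (\<psi> x) (\<psi>' y))"
  proof (rule balancedI)
    fix x c y assume "x \<in> carrier M'" "y \<in> carrier N'"
    then show "T.tens (\<psi> (scalar_mult H M' c x)) (\<psi>' y) = T.tens (\<psi> x) (\<psi>' (scalar_mult H N' c y))"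
      using T.TP.TM.tens_simps(4)[OF E(1) UNIV_I E'(1)] by (simp add: scalar_mult_H E(6) E'(6))
  qed (simp_all add: E(1,5) E'(1,5) T.TP.TM.tens_closed T.TP.TM.tens_simps)
  then obtain \<Psi> where \<Psi>: "additive T'.T T.T \<Psi>"
    "\<And>x y. x \<in> carrier M' ==> y \<in> carrier N' ==> \<Psi> (T'.tens x y) = T.tens (\<psi> x) (\<psi>' y)"
    using T'.TP.TM.lift[OF T.TP.TM.T_abelian] by blast
  have Tad: "additive T.T T.T (\<lambda>X. r \<odot>\<^bsub>T.T\<^esub> X)" if r: "r \<in> carrier H" for r
    using T.TP.act_additive[OF comult_H_closed[OF r]] T.smult_T[OF r] unfolding additive_def by simp
  have Tad': "additive T'.T T'.T (\<lambda>X. r \<odot>\<^bsub>T'.T\<^esub> X)" if r: "r \<in> carrier H" for r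
    using T'.TP.act_additive[OF comult_H_closed[OF r]] T'.smult_T[OF r] unfolding additive_def by simp
  have lin: "\<Phi> (r \<odot>\<^bsub>T.T\<^esub> Y) = r \<odot>\<^bsub>T'.T\<^esub> \<Phi> Y"
    if r: "r \<in> carrier H" and Y: "Y \<in> carrier T.T"
      and t: "\<And>x y. x \<in> carrier M ==> y \<in> carrier N ==> \<Phi> (r \<odot>\<^bsub>T.T\<^esub> T.tens x y) = r \<odot>\<^bsub>T'.T\<^esub> T'.tens (\<phi> x) (\<phi>' y)" for r Y
  proof (rule T.TP.TM.additive_eqI[OF T'.TP.TM.T_abelian _ _ _ Y])
    show "additive T.T T'.T (\<lambda>X. \<Phi> (r \<odot>\<^bsub>T.T\<^esub> X))"
      using additiveD[OF Tad[OF r]] additiveD[OF \<Phi>(1)] by (intro additiveI) simp_all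
    show "additive T.T T'.T (\<lambda>X. r \<odot>\<^bsub>T'.T\<^esub> \<Phi> X)"
      using additiveD[OF Tad'[OF r]] additiveD[OF \<Phi>(1)] by (intro additiveI) simp_all
  qed (simp add: t \<Phi>(2))
  have "module_iso H T.T T'.T"
  proof (rule expands_isoI[OF T.expands_T T'.expands_T, of \<Phi> \<Psi>])
    fix Y assume Y: "Y \<in> carrier T.T"
    show "\<Psi> (\<Phi> Y) = Y"
      by (rule T.TP.TM.additive_eqI[OF T.TP.TM.T_abelian _ _ _ Y])
        (simp_all add: additive_def additiveD[OF \<Phi>(1)] additiveD[OF \<Psi>(1)] \<Phi>(2) \<Psi>(2) D D')
    show "\<Phi> (hs c \<odot>\<^bsub>T.T\<^esub> Y) = hs c \<odot>\<^bsub>T'.T\<^esub> \<Phi> Y" for c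
      by (rule lin[OF _ Y])
        (simp_all add: T.smult_tens(1) T'.smult_tens(1) \<Phi>(2) D(1,6) D'(1,6) T.M.smult_closed)
    show "\<Phi> (hg g \<odot>\<^bsub>T.T\<^esub> Y) = hg g \<odot>\<^bsub>T'.T\<^esub> \<Phi> Y" if "g \<in> carrier G" for g
      using that by (intro lin[OF _ Y])
        (simp_all add: T.smult_tens(2) T'.smult_tens(2) \<Phi>(2) D(1,6) D'(1,6) T.M.smult_closed T.N.smult_closed)
    show "\<Phi> (hx \<odot>\<^bsub>T.T\<^esub> Y) = hx \<odot>\<^bsub>T'.T\<^esub> \<Phi> Y"
      by (rule lin[OF _ Y])
        (simp_all add: T.smult_tens(3) T'.smult_tens(3) \<Phi>(2) D(1,6) D'(1,6) T.M.smult_closed T.N.smult_closed a(1)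
          T.TP.TM.tens_closed additiveD(2)[OF \<Phi>(1)])
  next
    fix Y assume Y: "Y \<in> carrier T'.T"
    show "\<Phi> (\<Psi> Y) = Y"
      by (rule T'.TP.TM.additive_eqI[OF T'.TP.TM.T_abelian _ _ _ Y])
        (simp_all add: additive_def additiveD[OF \<Phi>(1)] additiveD[OF \<Psi>(1)] \<Phi>(2) \<Psi>(2) E E')
  qed (simp_all add: additiveD[OF \<Phi>(1)] additiveD[OF \<Psi>(1)])
  then show ?thesis by (simp add: T.T_def T'.T_def)
qed

text \<open>
  The universal balanced map \<open>\<tau>\<close> is rescaled by \<open>a\<close> and by the scalars \<open>c\<close>: since \<open>\<Delta>(x) = x \<otimes> a + 1 \<otimes> x\<close>,
  replacing \<open>x\<^sup>k v \<otimes> x\<^sup>l w\<close> by \<open>x\<^sup>k v \<otimes> x\<^sup>l a\<^sup>-\<^sup>k w\<close> makes both terms act through scalars.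
\<close>

lemma (in hopf_ore_data) string_tensor_box_twisted:
  assumes V: "left_module KG V1" "left_module KG V2" "left_module KG P"
    and \<tau>: "\<And>v w. v \<in> carrier V1 ==> w \<in> carrier V2 ==> \<tau> v w \<in> carrier P"
      "\<And>v v' w. v \<in> carrier V1 ==> v' \<in> carrier V1 ==> w \<in> carrier V2 ==> \<tau> (v \<oplus>\<^bsub>V1\<^esub> v') w = \<tau> v w \<oplus>\<^bsub>P\<^esub> \<tau> v' w"
      "\<And>v w w'. v \<in> carrier V1 ==> w \<in> carrier V2 ==> w' \<in> carrier V2 ==> \<tau> v (w \<oplus>\<^bsub>V2\<^esub> w') = \<tau> v w \<oplus>\<^bsub>P\<^esub> \<tau> v w'"
      "\<And>c v w. v \<in> carrier V1 ==> w \<in> carrier V2 ==> \<tau> (ks c \<odot>\<^bsub>V1\<^esub> v) w = ks c \<odot>\<^bsub>P\<^esub> \<tau> v w"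
      "\<And>c v w. v \<in> carrier V1 ==> w \<in> carrier V2 ==> \<tau> v (ks c \<odot>\<^bsub>V2\<^esub> w) = ks c \<odot>\<^bsub>P\<^esub> \<tau> v w"
      "\<And>g v w. g \<in> carrier G ==> v \<in> carrier V1 ==> w \<in> carrier V2 ==>
        \<tau> (kg g \<odot>\<^bsub>V1\<^esub> v) (kg g \<odot>\<^bsub>V2\<^esub> w) = kg g \<odot>\<^bsub>P\<^esub> \<tau> v w"
    and c: "\<And>k l. c k l \<noteq> 0" "\<And>k l. X1 k l * c k l = c (Suc k) l * \<chi> a ^ l" "\<And>k l. X2 k l * c k l = c k (Suc l)"
    and span: "\<And>h h' p. additive P P h ==> additive P P h' ==>
        (\<And>v w. v \<in> carrier V1 ==> w \<in> carrier V2 ==> h (\<tau> v w) = h' (\<tau> v w)) ==> p \<in> carrier P ==> h p = h' p"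
    and univ: "\<And>\<gamma>. balanced (UNIV :: 'k set) (\<lambda>v c. ks c \<odot>\<^bsub>V1\<^esub> v) V1 (\<lambda>c w. ks c \<odot>\<^bsub>V2\<^esub> w) V2
          (tensor_module H (string_module V1 0 n1) (string_module V2 0 n2)) \<gamma> ==>
        \<exists>\<theta>. additive P (tensor_module H (string_module V1 0 n1) (string_module V2 0 n2)) \<theta> \<and>
          (\<forall>v\<in>carrier V1. \<forall>w\<in>carrier V2. \<theta> (\<tau> v w) = \<gamma> v w)"
  shows "module_iso H (tensor_module H (string_module V1 0 n1) (string_module V2 0 n2))
    (gmod P ({..<n1} \<times> {..<n2}) (\<lambda>b. fst b + snd b) (box_matrix X1 X2))"
proof -
  interpret V1: group_module G \<chi> a V1 by (intro group_moduleI V)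
  interpret V2: group_module G \<chi> a V2 by (intro group_moduleI V)
  interpret P: group_module G \<chi> a P by (intro group_moduleI V)
  define b where "b k = inv a [^] (k :: nat)" for k
  define b' where "b' k = a [^] (k :: nat)" for k
  have bc: "b k \<in> carrier G" "b' k \<in> carrier G" for k using a(1) by (simp_all add: b_def b'_def)
  have acomm: "inv a \<otimes> g = g \<otimes> inv a" if "g \<in> carrier G" for g
    using that a(1) a(2)[OF that] inv_equality by (metis inv_closed inv_mult_group inv_inv a(2))
  have bcomm: "b k \<otimes> g = g \<otimes> b k" if g: "g \<in> carrier G" for k g
  proof (induction k)
    case (Suc k)
    have "b (Suc k) \<otimes> g = b k \<otimes> (inv a \<otimes> g)" using g a(1) bc(1)[of k] by (simp add: b_def m_assoc)
    also have "\<dots> = b k \<otimes> g \<otimes> inv a" using g a(1) bc(1)[of k] by (simp add: acomm m_assoc)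
    also have "\<dots> = g \<otimes> b (Suc k)" using g a(1) bc(1)[of k] unfolding Suc by (simp add: b_def m_assoc)
    finally show ?case .
  qed (use g in \<open>simp add: b_def\<close>)
  have bSa: "b (Suc k) \<otimes> a = b k" for k using a(1) bc(1)[of k] by (simp add: b_def m_assoc)
  have bb: "b k \<otimes> b' k = \<one>" "b' k \<otimes> b k = \<one>" for k
    using a(1) bcomm[of "b' k" k] bc by (simp_all add: b_def b'_def nat_pow_inv)
  have kb: "kg (b k) \<odot>\<^bsub>V2\<^esub> w \<in> carrier V2" "kg (b' k) \<odot>\<^bsub>V2\<^esub> w \<in> carrier V2"
    "kg (b k) \<odot>\<^bsub>V2\<^esub> (kg (b' k) \<odot>\<^bsub>V2\<^esub> w) = w" "kg (b' k) \<odot>\<^bsub>V2\<^esub> (kg (b k) \<odot>\<^bsub>V2\<^esub> w) = w" if "w \<in> carrier V2" for k w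
    using that bc by (simp_all add: V2.ks_simps bb)
  define \<kappa> where "\<kappa> k l v w = ks (c k l) \<odot>\<^bsub>P\<^esub> \<tau> v (kg (b k) \<odot>\<^bsub>V2\<^esub> w)" for k l v w
  have cc: "ks (inverse (c k l)) \<odot>\<^bsub>P\<^esub> (ks (c k l) \<odot>\<^bsub>P\<^esub> p) = p" "ks (c k l) \<odot>\<^bsub>P\<^esub> (ks (inverse (c k l)) \<odot>\<^bsub>P\<^esub> p) = p"
    if "p \<in> carrier P" for k l p using that c(1)[of k l] by (simp_all add: P.ks_simps)
  have \<tau>b: "\<tau> v (kg (b k) \<odot>\<^bsub>V2\<^esub> w) \<in> carrier P" if "v \<in> carrier V1" "w \<in> carrier V2" for v k w
    by (rule \<tau>(1)[OF that(1) kb(1)[OF that(2)]])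
  show ?thesis
  proof (rule string_tensor_box[OF V, of \<kappa>])
    fix k l v w assume v: "v \<in> carrier V1" and w: "w \<in> carrier V2"
    show "\<kappa> k l v w \<in> carrier P" unfolding \<kappa>_def by (intro P.ks_simps(1) \<tau>b v w)
    show "\<kappa> k l (v \<oplus>\<^bsub>V1\<^esub> v') w = \<kappa> k l v w \<oplus>\<^bsub>P\<^esub> \<kappa> k l v' w" if "v' \<in> carrier V1" for v'
      unfolding \<kappa>_def \<tau>(2)[OF v that kb(1)[OF w]]
      by (rule additiveD(2)[OF P.ks_additive \<tau>b[OF v w] \<tau>b[OF that w]])
    show "\<kappa> k l v (w \<oplus>\<^bsub>V2\<^esub> w') = \<kappa> k l v w \<oplus>\<^bsub>P\<^esub> \<kappa> k l v w'" if "w' \<in> carrier V2" for w'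
      unfolding \<kappa>_def additiveD(2)[OF V2.kg_additive[OF bc(1)] w that] \<tau>(3)[OF v kb(1)[OF w] kb(1)[OF that]]
      by (rule additiveD(2)[OF P.ks_additive \<tau>b[OF v w] \<tau>b[OF v that]])
    show "\<kappa> k l (ks d \<odot>\<^bsub>V1\<^esub> v) w = ks d \<odot>\<^bsub>P\<^esub> \<kappa> k l v w" for d
      unfolding \<kappa>_def \<tau>(4)[OF v kb(1)[OF w]] using P.ks_simps(3)[OF \<tau>b[OF v w]] by (simp add: mult.commute)
    show "\<kappa> k l v (ks d \<odot>\<^bsub>V2\<^esub> w) = ks d \<odot>\<^bsub>P\<^esub> \<kappa> k l v w" for d
      unfolding \<kappa>_def V2.ks_simps(7)[OF w bc(1)] \<tau>(5)[OF v kb(1)[OF w]]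
      using P.ks_simps(3)[OF \<tau>b[OF v w]] by (simp add: mult.commute)
    show "\<kappa> k l (kg g \<odot>\<^bsub>V1\<^esub> v) (kg g \<odot>\<^bsub>V2\<^esub> w) = kg g \<odot>\<^bsub>P\<^esub> \<kappa> k l v w" if g: "g \<in> carrier G" for g
    proof -
      have "kg (b k) \<odot>\<^bsub>V2\<^esub> (kg g \<odot>\<^bsub>V2\<^esub> w) = kg g \<odot>\<^bsub>V2\<^esub> (kg (b k) \<odot>\<^bsub>V2\<^esub> w)"
        using g w bc by (simp add: V2.ks_simps bcomm)
      then show ?thesis unfolding \<kappa>_def using \<tau>(6)[OF g v kb(1)[OF w]] P.ks_simps(7)[OF \<tau>b[OF v w] g] by simp
    qed
    show "\<kappa> (Suc k) l v (ks (\<chi> a ^ l) \<odot>\<^bsub>V2\<^esub> (kg a \<odot>\<^bsub>V2\<^esub> w)) = ks (X1 k l) \<odot>\<^bsub>P\<^esub> \<kappa> k l v w"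
    proof -
      have aw: "kg a \<odot>\<^bsub>V2\<^esub> w \<in> carrier V2" by (rule V2.ks_simps(2)[OF w a(1)])
      have "kg (b (Suc k)) \<odot>\<^bsub>V2\<^esub> (ks (\<chi> a ^ l) \<odot>\<^bsub>V2\<^esub> (kg a \<odot>\<^bsub>V2\<^esub> w)) = ks (\<chi> a ^ l) \<odot>\<^bsub>V2\<^esub> (kg (b k) \<odot>\<^bsub>V2\<^esub> w)"
        unfolding V2.ks_simps(7)[OF aw bc(1)] V2.ks_simps(8)[OF w bc(1) a(1)] bSa ..
      then show ?thesis
        unfolding \<kappa>_def using \<tau>(5)[OF v kb(1)[OF w]] P.ks_simps(3)[OF \<tau>b[OF v w]] c(2)[of k l] by simp
    qed
    show "\<kappa> k (Suc l) v w = ks (X2 k l) \<odot>\<^bsub>P\<^esub> \<kappa> k l v w"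
      unfolding \<kappa>_def using P.ks_simps(3)[OF \<tau>b[OF v w]] c(3)[of k l] by simp
  next
    fix k l h h' p assume h: "additive P P h" "additive P P h'"
      and e: "\<And>v w. v \<in> carrier V1 ==> w \<in> carrier V2 ==> h (\<kappa> k l v w) = h' (\<kappa> k l v w)" and p: "p \<in> carrier P"
    show "h p = h' p"
    proof (rule span[OF h _ p])
      fix v w assume v: "v \<in> carrier V1" and w: "w \<in> carrier V2"
      have "\<kappa> k l (ks (inverse (c k l)) \<odot>\<^bsub>V1\<^esub> v) (kg (b' k) \<odot>\<^bsub>V2\<^esub> w) = \<tau> v w"
        unfolding \<kappa>_def kb(3)[OF w] \<tau>(4)[OF v w] cc(2)[OF \<tau>(1)[OF v w]] ..
      then show "h (\<tau> v w) = h' (\<tau> v w)"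
        using e[OF V1.ks_simps(1)[OF v] kb(2)[OF w]] by metis
    qed
  next
    fix k l \<gamma>
    let ?T = "tensor_module H (string_module V1 0 n1) (string_module V2 0 n2)"
    assume \<gamma>: "balanced (UNIV :: 'k set) (\<lambda>v c. ks c \<odot>\<^bsub>V1\<^esub> v) V1 (\<lambda>c w. ks c \<odot>\<^bsub>V2\<^esub> w) V2 ?T \<gamma>"
    note bal = balancedD[OF \<gamma>]
    \<comment> \<open>The rescaling in \<kappa> is undone first, so that the universal property of
      \<tau>, applied to \<gamma>', yields the one of \<kappa> for \<gamma>.\<close>
    define \<gamma>' where "\<gamma>' v w = \<gamma> (ks (inverse (c k l)) \<odot>\<^bsub>V1\<^esub> v) (kg (b' k) \<odot>\<^bsub>V2\<^esub> w)" for v w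
    have "balanced (UNIV :: 'k set) (\<lambda>v c. ks c \<odot>\<^bsub>V1\<^esub> v) V1 (\<lambda>c w. ks c \<odot>\<^bsub>V2\<^esub> w) V2 ?T \<gamma>'"
    proof (rule balancedI)
      fix v d w assume v: "v \<in> carrier V1" and w: "w \<in> carrier V2"
      have "ks (inverse (c k l)) \<odot>\<^bsub>V1\<^esub> (ks d \<odot>\<^bsub>V1\<^esub> v) = ks d \<odot>\<^bsub>V1\<^esub> (ks (inverse (c k l)) \<odot>\<^bsub>V1\<^esub> v)"
        using v by (simp add: V1.ks_simps mult.commute)
      then show "\<gamma>' (ks d \<odot>\<^bsub>V1\<^esub> v) w = \<gamma>' v (ks d \<odot>\<^bsub>V2\<^esub> w)"
        unfolding \<gamma>'_def V2.ks_simps(7)[OF w bc(2)] using bal(4)[OF V1.ks_simps(1)[OF v] UNIV_I kb(2)[OF w]] by simp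
    qed (simp_all add: \<gamma>'_def bal V1.ks_simps(1) V2.ks_simps(1) kb additiveD(2)[OF V1.ks_additive] additiveD(2)[OF V2.kg_additive[OF bc(2)]])
    then obtain \<theta> where \<theta>: "additive P ?T \<theta>" "\<forall>v\<in>carrier V1. \<forall>w\<in>carrier V2. \<theta> (\<tau> v w) = \<gamma>' v w" using univ by blast
    have "\<theta> (\<kappa> k l v w) = \<gamma> v w" if v: "v \<in> carrier V1" and w: "w \<in> carrier V2" for v w
    proof -
      have "\<kappa> k l v w = \<tau> (ks (c k l) \<odot>\<^bsub>V1\<^esub> v) (kg (b k) \<odot>\<^bsub>V2\<^esub> w)"
        unfolding \<kappa>_def \<tau>(4)[OF v kb(1)[OF w]] ..
      also have "\<theta> \<dots> = \<gamma>' (ks (c k l) \<odot>\<^bsub>V1\<^esub> v) (kg (b k) \<odot>\<^bsub>V2\<^esub> w)"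
        using \<theta>(2) V1.ks_simps(1)[OF v] kb(1)[OF w] by blast
      also have "\<dots> = \<gamma> v w"
        unfolding \<gamma>'_def kb(4)[OF w] using v c(1)[of k l] by (simp add: V1.ks_simps)
      finally show ?thesis .
    qed
    then show "\<exists>\<theta>. additive P ?T \<theta> \<and> (\<forall>v\<in>carrier V1. \<forall>w\<in>carrier V2. \<theta> (\<kappa> k l v w) = \<gamma> v w)" using \<theta>(1) by blast
  qed
qed

text \<open>The rescaling is chosen so that the weights become those of a quantum plane. In the
  first order c = \<chi>(a)^(-kl) gives the parameter \<chi>(a)^-1. In the second order c = 1 gives
  \<chi>(a) with the two coordinates exchanged, so that the side n1 can play the part of the
  y-direction again. Both orders use the same kG-module M \<otimes> N, in the second one through the
  balanced map taking (w, v) to v \<otimes> w.\<close>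

lemma (in group_tensor) tensor_strings_box:
  assumes P: "left_module KG T"
  shows "module_iso H (tensor_module H (string_module M 0 n1) (string_module N 0 n2))
      (gmod T ({..<n1} \<times> {..<n2}) (\<lambda>b. fst b + snd b) (box_matrix (\<lambda>_ _. 1) (\<lambda>k l. inverse (\<chi> a) ^ k)))"
    "module_iso H (tensor_module H (string_module N 0 n2) (string_module M 0 n1))
      (gmod T ({..<n2} \<times> {..<n1}) (\<lambda>b. fst b + snd b) (box_matrix (\<lambda>k l. \<chi> a ^ l) (\<lambda>_ _. 1)))"
proof -
  note V1 = M.left_module_axioms and V2 = N.left_module_axioms
  interpret V1: group_module G \<chi> a M by (intro group_moduleI V1)
  interpret V2: group_module G \<chi> a N by (intro group_moduleI V2)
  interpret P: group_module G \<chi> a T by (intro group_moduleI P)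
  have sm: "(\<lambda>x c. scalar_mult KG M c x) = (\<lambda>v c. ks c \<odot>\<^bsub>M\<^esub> v)" "scalar_mult KG N = (\<lambda>c w. ks c \<odot>\<^bsub>N\<^esub> w)"
    by (simp_all add: fun_eq_iff scalar_mult_KG)
  note ts = TP.TM.tens_simps
  have t4: "tens (ks c \<odot>\<^bsub>M\<^esub> v) w = ks c \<odot>\<^bsub>T\<^esub> tens v w" "tens v (ks c \<odot>\<^bsub>N\<^esub> w) = ks c \<odot>\<^bsub>T\<^esub> tens v w"
    if v: "v \<in> carrier M" and w: "w \<in> carrier N" for c v w
  proof -
    show "tens (ks c \<odot>\<^bsub>M\<^esub> v) w = ks c \<odot>\<^bsub>T\<^esub> tens v w"
      using smult_tens[OF one_closed v w, of c] V2.ks_simps(4)[OF w] by (simp add: ks_def)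
    then show "tens v (ks c \<odot>\<^bsub>N\<^esub> w) = ks c \<odot>\<^bsub>T\<^esub> tens v w" using ts(4)[OF v UNIV_I w, of c] by (simp add: scalar_mult_KG)
  qed
  have t6: "tens (kg g \<odot>\<^bsub>M\<^esub> v) (kg g \<odot>\<^bsub>N\<^esub> w) = kg g \<odot>\<^bsub>T\<^esub> tens v w"
    if "g \<in> carrier G" "v \<in> carrier M" "w \<in> carrier N" for g v w
    using smult_tens[OF that, of 1] by (simp add: kg_def)
  have q: "\<chi> a \<noteq> 0" by (rule chi_nz[OF a(1)])
  have ab: "abelian_group (tensor_module H (string_module M 0 n1) (string_module N 0 n2))"
    "abelian_group (tensor_module H (string_module N 0 n2) (string_module M 0 n1))"
  proof -
    interpret T1: ore_tensor G \<chi> a "string_module M 0 n1" "string_module N 0 n2"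
      by (intro ore_tensor.intro hopf_ore_data_axioms string_left_module V1 V2)
    interpret T2: ore_tensor G \<chi> a "string_module N 0 n2" "string_module M 0 n1"
      by (intro ore_tensor.intro hopf_ore_data_axioms string_left_module V1 V2)
    show "abelian_group (tensor_module H (string_module M 0 n1) (string_module N 0 n2))"
      "abelian_group (tensor_module H (string_module N 0 n2) (string_module M 0 n1))"
      using T1.TP.TM.T_abelian T2.TP.TM.T_abelian by (simp_all add: T1.T_def T2.T_def)
  qed
  show "module_iso H (tensor_module H (string_module M 0 n1) (string_module N 0 n2))
      (gmod T ({..<n1} \<times> {..<n2}) (\<lambda>b. fst b + snd b) (box_matrix (\<lambda>_ _. 1) (\<lambda>k l. inverse (\<chi> a) ^ k)))"
  proof (rule string_tensor_box_twisted[OF V1 V2 P, of tens "\<lambda>k l. inverse (\<chi> a) ^ (k * l)"])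
    show "1 * inverse (\<chi> a) ^ (k * l) = inverse (\<chi> a) ^ (Suc k * l) * \<chi> a ^ l" for k l
      using q by (simp add: power_add power_inverse)
    show "\<exists>\<theta>. additive T (tensor_module H (string_module M 0 n1) (string_module N 0 n2)) \<theta> \<and>
        (\<forall>v\<in>carrier M. \<forall>w\<in>carrier N. \<theta> (tens v w) = \<gamma> v w)"
      if \<gamma>: "balanced (UNIV :: 'k set) (\<lambda>v c. ks c \<odot>\<^bsub>M\<^esub> v) M (\<lambda>c w. ks c \<odot>\<^bsub>N\<^esub> w) N
        (tensor_module H (string_module M 0 n1) (string_module N 0 n2)) \<gamma>" for \<gamma>
      using TP.TM.lift[OF ab(1) \<gamma>[folded sm]] by metis
    show "h p = h' p" if "additive T T h" "additive T T h'"
      "\<And>v w. v \<in> carrier M ==> w \<in> carrier N ==> h (tens v w) = h' (tens v w)" "p \<in> carrier T" for h h' p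
      by (rule TP.TM.additive_eqI[OF TP.TM.T_abelian that])
  qed (simp_all add: q ts t4 t6 TP.TM.tens_closed power_add)
  show "module_iso H (tensor_module H (string_module N 0 n2) (string_module M 0 n1))
      (gmod T ({..<n2} \<times> {..<n1}) (\<lambda>b. fst b + snd b) (box_matrix (\<lambda>k l. \<chi> a ^ l) (\<lambda>_ _. 1)))"
  proof (rule string_tensor_box_twisted[OF V2 V1 P, of "\<lambda>w v. tens v w" "\<lambda>k l. 1"])
    show "\<exists>\<theta>. additive T (tensor_module H (string_module N 0 n2) (string_module M 0 n1)) \<theta> \<and>
        (\<forall>v\<in>carrier N. \<forall>w\<in>carrier M. \<theta> (tens w v) = \<gamma> v w)"
      if \<gamma>: "balanced (UNIV :: 'k set) (\<lambda>v c. ks c \<odot>\<^bsub>N\<^esub> v) N (\<lambda>c w. ks c \<odot>\<^bsub>M\<^esub> w) M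
        (tensor_module H (string_module N 0 n2) (string_module M 0 n1)) \<gamma>" for \<gamma>
    proof -
      have "balanced (UNIV :: 'k set) (\<lambda>v c. ks c \<odot>\<^bsub>M\<^esub> v) M (\<lambda>c w. ks c \<odot>\<^bsub>N\<^esub> w) N
        (tensor_module H (string_module N 0 n2) (string_module M 0 n1)) (\<lambda>v w. \<gamma> w v)"
        by (rule balancedI) (simp_all add: balancedD[OF \<gamma>])
      then show ?thesis using TP.TM.lift[OF ab(2)] unfolding sm[symmetric] by metis
    qed
    show "h p = h' p" if "additive T T h" "additive T T h'"
      "\<And>v w. v \<in> carrier N ==> w \<in> carrier M ==> h (tens w v) = h' (tens w v)" "p \<in> carrier T" for h h' p
      by (rule TP.TM.additive_eqI[OF TP.TM.T_abelian that(1,2) that(3) that(4)])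
  qed (simp_all add: ts t4 t6 TP.TM.tens_closed)
qed

section \<open>The box as a direct sum of strings\<close>

locale ore_plane = hopf_ore_data G \<chi> a + truncated_plane q s r r' p p'
  for G :: "('g, 'e) monoid_scheme" (structure) and \<chi> :: "'g => 'k::field_char_0" and a
    and q :: 'k and s r r' p p'
begin

lemma sum_box_xop:
  assumes kl: "k < n" "l < t"
  shows "(\<Sum>b\<in>{..<n} \<times> {..<t}. box_matrix (\<lambda>_ _. 1) (\<lambda>k l. q ^ k) (k, l) b * coef f (fst b) (snd b)) = coef (xop q f) k l"
proof -
  let ?B = "{..<n} \<times> {..<t}"
  have 1: "(\<Sum>b\<in>?B. (if k = Suc (fst b) \<and> l = snd b then 1 else 0) * coef f (fst b) (snd b)) = coef (yop f) k l"
  proof (cases k)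
    case (Suc k')
    have "(\<Sum>b\<in>?B. (if k = Suc (fst b) \<and> l = snd b then 1 else 0) * coef f (fst b) (snd b)) =
      (\<Sum>b\<in>?B. if b = (k', l) then coef f k' l else 0)"
      by (rule sum.cong) (auto simp: Suc)
    then show ?thesis using Suc kl by (simp add: yop_def)
  qed (simp add: yop_def)
  have 2: "(\<Sum>b\<in>?B. (if k = fst b \<and> l = Suc (snd b) then q ^ fst b else 0) * coef f (fst b) (snd b)) = coef (zop q f) k l"
  proof (cases l)
    case (Suc l')
    have "(\<Sum>b\<in>?B. (if k = fst b \<and> l = Suc (snd b) then q ^ fst b else 0) * coef f (fst b) (snd b)) =
      (\<Sum>b\<in>?B. if b = (k, l') then q ^ k * coef f k l' else 0)"
      by (rule sum.cong) (auto simp: Suc)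
    then show ?thesis using Suc kl by (simp add: zop_def)
  qed (simp add: zop_def)
  show ?thesis
    unfolding box_matrix_def fst_conv snd_conv distrib_right sum.distrib 1 2 by (simp add: xop_def)
qed

abbreviation len where "len d \<equiv> strlen (d div s) (d mod s)"

text \<open>The bijection \<pi> onto the standard box lets one statement serve both orders of the
  factors, with the identity for one and the swap of coordinates for the other. The base change is
  the matrix of the powers (y + z)^e w d from \<open>string_basis\<close>.\<close>

lemma box_strings:
  assumes P: "left_module KG P" and \<pi>: "bij_betw \<pi> B ({..<n} \<times> {..<t})"
    and dg: "\<And>b. b \<in> B ==> dg b = fst (\<pi> b) + snd (\<pi> b)"
    and X: "degree_one B dg X" "\<And>b b'. b \<in> B ==> b' \<in> B ==> X b b' = box_matrix (\<lambda>_ _. 1) (\<lambda>k l. q ^ k) (\<pi> b) (\<pi> b')"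
  shows "module_iso H (gmod P B dg X) (direct_sum {..<t} (\<lambda>d. string_module P d (len d)))"
proof -
  interpret P: group_module G \<chi> a P by (intro group_moduleI P)
  let ?J = "Sigma {..<t} (\<lambda>d. {..<len d})" and ?C = "{..<n} \<times> {..<t}"
  let ?Y = "\<lambda>j j'. if fst j = fst j' \<and> snd j = Suc (snd j') then 1 else 0 :: 'k"
  obtain w N where w: "\<And>d. d < t ==> homog d (w d)"
      "\<And>d. d < t ==> vanishes n t ((xop q ^^ len d) (w d))"
    and N: "\<And>b b'. b \<in> ?C ==> b' \<in> ?C ==>
       (\<Sum>j\<in>?J. coef ((xop q ^^ snd j) (w (fst j))) (fst b) (snd b) * N b' j) = (if b = b' then 1 else 0)"
      "\<And>j j'. j \<in> ?J ==> j' \<in> ?J ==>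
       (\<Sum>b\<in>?C. N b j * coef ((xop q ^^ snd j') (w (fst j'))) (fst b) (snd b)) = (if j = j' then 1 else 0)"
  proof (rule string_basis, goal_cases)
    case (1 w N)
    from 1(2-5) show ?case by (rule 1(1))
  qed
  note \<pi>B = bij_betw_apply[OF \<pi>]
  have inj: "\<pi> b = \<pi> b' \<longleftrightarrow> b = b'" if "b \<in> B" "b' \<in> B" for b b'
    using that \<pi> by (auto simp: bij_betw_def inj_on_def)
  define S where "S b j = coef ((xop q ^^ snd j) (w (fst j))) (fst (\<pi> b)) (snd (\<pi> b))" for b j
  have Y: "degree_one ?J (\<lambda>j. fst j + snd j) ?Y" by (auto simp: degree_one_def)
  have "module_iso H (gmod P ?J (\<lambda>j. fst j + snd j) ?Y) (gmod P B dg X)"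
  proof (rule gmod_basis_change[OF P X(1) Y, of S "\<lambda>j b. N (\<pi> b) j"])
    fix b j assume b: "b \<in> B" and j: "j \<in> ?J"
    obtain d e where de: "j = (d, e)" "d < t" "e < len d" using j by auto
    show "dg b = fst j + snd j" if "S b j \<noteq> 0"
      using homog_xpow[OF w(1)[OF de(2)], of e q] that de dg[OF b] by (simp add: S_def homog_def)
    have "(\<Sum>b'\<in>B. X b b' * S b' j) = (\<Sum>b'\<in>B. box_matrix (\<lambda>_ _. 1) (\<lambda>k l. q ^ k) (\<pi> b) (\<pi> b') *
      coef ((xop q ^^ e) (w d)) (fst (\<pi> b')) (snd (\<pi> b')))"
      using b by (intro sum.cong) (simp_all add: X(2) S_def de)
    also have "\<dots> = (\<Sum>c\<in>?C. box_matrix (\<lambda>_ _. 1) (\<lambda>k l. q ^ k) (\<pi> b) c * coef ((xop q ^^ e) (w d)) (fst c) (snd c))"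
      by (rule sum.reindex_bij_betw[OF \<pi>])
    also have "\<dots> = coef ((xop q ^^ Suc e) (w d)) (fst (\<pi> b)) (snd (\<pi> b))"
      using sum_box_xop[of "fst (\<pi> b)" "snd (\<pi> b)"] \<pi>B[OF b] by auto
    also have "\<dots> = (\<Sum>j'\<in>?J. S b j' * ?Y j' j)"
    proof -
      have "(\<Sum>j'\<in>?J. S b j' * ?Y j' j) = (\<Sum>j'\<in>?J. if j' = (d, Suc e) then S b (d, Suc e) else 0)"
        by (rule sum.cong) (auto simp: de)
      also have "\<dots> = (if Suc e < len d then S b (d, Suc e) else 0)" using de(2) by simp
      also have "\<dots> = coef ((xop q ^^ Suc e) (w d)) (fst (\<pi> b)) (snd (\<pi> b))"
      proof (cases "Suc e < len d")
        \<comment> \<open>At the end of a string the next power of y + z vanishes in the box, in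
          agreement with the zero column of the Jordan matrix.\<close>
        case False
        then have "Suc e = len d" using de(3) by simp
        then show ?thesis using w(2)[OF de(2)] \<pi>B[OF b] unfolding vanishes_def by auto
      qed (simp add: S_def)
      finally show ?thesis ..
    qed
    finally show "(\<Sum>b'\<in>B. X b b' * S b' j) = (\<Sum>j'\<in>?J. S b j' * ?Y j' j)" .
  next
    fix b b' assume b: "b \<in> B" "b' \<in> B"
    show "(\<Sum>j\<in>?J. S b j * N (\<pi> b') j) = (if b = b' then 1 else 0)"
      unfolding S_def using N(1)[OF \<pi>B[OF b(1)] \<pi>B[OF b(2)]] inj[OF b] by simp
  next
    fix j j' assume j: "j \<in> ?J" "j' \<in> ?J"
    have "(\<Sum>b\<in>B. N (\<pi> b) j * S b j') = (\<Sum>c\<in>?C. N c j * coef ((xop q ^^ snd j') (w (fst j'))) (fst c) (snd c))"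
      unfolding S_def by (rule sum.reindex_bij_betw[OF \<pi>])
    then show "(\<Sum>b\<in>B. N (\<pi> b) j * S b j') = (if j = j' then 1 else 0)" using N(2)[OF j] by simp
  qed
  then have "module_iso H (gmod P B dg X) (gmod P ?J (\<lambda>j. fst j + snd j) ?Y)"
    by (rule left_module_iso_sym[OF _ P.gmod_left_module[OF Y]])
  moreover have "module_iso H (gmod P ?J (\<lambda>j. fst j + snd j) ?Y) (direct_sum {..<t} (\<lambda>d. string_module P d (len d)))"
    by (rule P.gmod_strings) simp
  ultimately show ?thesis by (rule module_iso_trans)
qed

lemma box_strings_transposed:
  assumes P: "left_module KG P"
  shows "module_iso H (gmod P ({..<t} \<times> {..<n}) (\<lambda>b. fst b + snd b) (box_matrix (\<lambda>k l. q ^ l) (\<lambda>_ _. 1)))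
    (direct_sum {..<t} (\<lambda>d. string_module P d (len d)))"
proof (rule box_strings[OF P _ _ box_degree_one, of prod.swap])
  show "bij_betw prod.swap ({..<t} \<times> {..<n}) ({..<n} \<times> {..<t})" by (auto simp: bij_betw_def)
qed (auto simp: box_matrix_def)

end

section \<open>Characters and twists\<close>

lemma group_field_units: "group (field_units :: 'k::field monoid)"
proof (rule groupI)
  show "\<exists>y\<in>carrier field_units. y \<otimes>\<^bsub>field_units\<^esub> x = \<one>\<^bsub>field_units\<^esub>" if "x \<in> carrier field_units" for x :: 'k
    using that by (intro bexI[of _ "inverse x"]) (auto simp: field_units_def)
qed (auto simp: field_units_def)

lemma field_units_pow: "x [^]\<^bsub>field_units\<^esub> (n :: nat) = x ^ n"
  by (induction n) (simp_all add: field_units_def nat_pow_def mult.commute)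

lemma group_character_group:
  assumes "group G"
  shows "group (character_group G :: ('g => 'k::field) monoid)"
proof -
  interpret group G by fact
  let ?C = "character_group G :: ('g => 'k) monoid"
  have car: "carrier ?C = {\<phi>. (\<forall>g\<in>carrier G. \<phi> g \<noteq> 0) \<and> (\<forall>g\<in>carrier G. \<forall>h\<in>carrier G. \<phi> (g \<otimes>\<^bsub>G\<^esub> h) = \<phi> g * \<phi> h)} \<inter> extensional (carrier G)"
    by (auto simp: character_group_def hom_def field_units_def)
  show ?thesis
  proof (rule groupI)
    fix \<phi> assume \<phi>: "\<phi> \<in> carrier ?C"
    show "\<one>\<^bsub>?C\<^esub> \<otimes>\<^bsub>?C\<^esub> \<phi> = \<phi>"
      using \<phi> by (intro extensionalityI[of _ "carrier G"]) (auto simp: car character_group_def)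
    have "(\<lambda>g\<in>carrier G. inverse (\<phi> g)) \<in> carrier ?C" using \<phi> by (auto simp: car)
    moreover have "(\<lambda>g\<in>carrier G. inverse (\<phi> g)) \<otimes>\<^bsub>?C\<^esub> \<phi> = \<one>\<^bsub>?C\<^esub>"
      using \<phi>[unfolded car] by (intro extensionalityI[of _ "carrier G"]) (auto simp: character_group_def)
    ultimately show "\<exists>\<psi>\<in>carrier ?C. \<psi> \<otimes>\<^bsub>?C\<^esub> \<phi> = \<one>\<^bsub>?C\<^esub>" by blast
  qed (auto simp: car, auto simp: character_group_def intro!: restrict_ext)
qed

lemma character_group_pow:
  assumes "g \<in> carrier G"
  shows "(\<phi> [^]\<^bsub>character_group G\<^esub> (n :: nat)) g = \<phi> g ^ n"
  using assms by (induction n) (simp_all add: character_group_def nat_pow_def mult.commute)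

text \<open>Order 0 stands for infinite order; it is excluded by x^m = 1 with m > 0, and order 1 is
  excluded by x \<noteq> 1.\<close>

lemma prim_root_ord:
  fixes x :: "'k::field"
  assumes "x \<noteq> 0" "x \<noteq> 1" "group.ord field_units x = s" "x ^ m = 1" "m > 0"
  shows "prim_root x s"
proof -
  interpret group "field_units :: 'k monoid" by (rule group_field_units)
  have x: "x \<in> carrier field_units" using assms by (simp add: field_units_def)
  have e: "x ^ k = 1 \<longleftrightarrow> s dvd k" for k
  proof -
    have "\<one>\<^bsub>field_units\<^esub> = (1 :: 'k)" by (simp add: field_units_def)
    then show ?thesis using pow_eq_id[OF x, of k] unfolding assms(3) field_units_pow by simp
  qed
  have "s \<noteq> 0" using e[of m] assms by auto
  moreover have "s \<noteq> 1" using e[of 1] assms by auto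
  ultimately show ?thesis unfolding prim_root_def e by (auto dest: dvd_imp_le)
qed

lemma prim_root_inverse: "prim_root x s ==> prim_root (inverse x) s"
  by (simp add: prim_root_def power_inverse)

context hopf_ore_data
begin

lemma character_left_module: "left_module KG (character_module \<chi>)"
proof -
  let ?C = "character_module \<chi>"
  have c: "carrier ?C = UNIV" "add ?C = (+)" "\<zero>\<^bsub>?C\<^esub> = 0" by (simp_all add: character_module_def)
  show ?thesis
    by (rule KG.left_module_from_basis[OF finsum_field(1)[OF c], of "(*)" "\<lambda>g x. \<chi> g * x"])
      (simp_all add: c finsum_field(2)[OF c] algebra_simps chi_mult chi_one,
       simp add: character_module_def sum_distrib_left mult_ac)
qed

lemma character_smult: "g \<in> carrier G ==> single g c \<odot>\<^bsub>character_module \<chi>\<^esub> x = c * \<chi> g * x"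
  by (simp add: character_module_def)

text \<open>An isomorphism from the tensor product of V with the one-dimensional module of \<chi>^u
  to V', written without that tensor product: \<tau> v is the image of 1 \<otimes> v.\<close>

definition twisted_iso :: "nat => ('g \<Rightarrow>\<^sub>0 'k, 'v, 'f) module_scheme => ('g \<Rightarrow>\<^sub>0 'k, 'w, 'h) module_scheme =>
    ('v => 'w) => ('w => 'v) => bool" where
  "twisted_iso u V V' \<tau> \<tau>' \<longleftrightarrow> additive V V' \<tau> \<and> (\<forall>w\<in>carrier V'. \<tau>' w \<in> carrier V) \<and>
     (\<forall>v\<in>carrier V. \<tau>' (\<tau> v) = v) \<and> (\<forall>w\<in>carrier V'. \<tau> (\<tau>' w) = w) \<and>
     (\<forall>c. \<forall>v\<in>carrier V. \<tau> (ks c \<odot>\<^bsub>V\<^esub> v) = ks c \<odot>\<^bsub>V'\<^esub> \<tau> v) \<and>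
     (\<forall>g\<in>carrier G. \<forall>v\<in>carrier V. kg g \<odot>\<^bsub>V'\<^esub> \<tau> v = ks (\<chi> g ^ u) \<odot>\<^bsub>V'\<^esub> \<tau> (kg g \<odot>\<^bsub>V\<^esub> v))"

lemma twisted_isoD:
  assumes "twisted_iso u V V' \<tau> \<tau>'"
  shows "additive V V' \<tau>" "w \<in> carrier V' ==> \<tau>' w \<in> carrier V" "v \<in> carrier V ==> \<tau>' (\<tau> v) = v"
    "w \<in> carrier V' ==> \<tau> (\<tau>' w) = w" "v \<in> carrier V ==> \<tau> (ks c \<odot>\<^bsub>V\<^esub> v) = ks c \<odot>\<^bsub>V'\<^esub> \<tau> v"
    "g \<in> carrier G ==> v \<in> carrier V ==> kg g \<odot>\<^bsub>V'\<^esub> \<tau> v = ks (\<chi> g ^ u) \<odot>\<^bsub>V'\<^esub> \<tau> (kg g \<odot>\<^bsub>V\<^esub> v)"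
  using assms unfolding twisted_iso_def by simp_all

lemma twisted_iso_of_iso:
  assumes V: "left_module KG V" and V': "left_module KG V'"
    and iso: "module_iso KG (tensor_module KG (character_module \<chi>) V) V'"
  obtains \<tau> \<tau>' where "twisted_iso 1 V V' \<tau> \<tau>'"
proof -
  interpret V: group_module G \<chi> a V by (intro group_moduleI V)
  interpret V': group_module G \<chi> a V' by (intro group_moduleI V')
  let ?C = "character_module \<chi>"
  interpret T: group_tensor G \<chi> a ?C V by (intro group_tensor.intro hopf_ore_data_axioms character_left_module V)
  have C: "x \<in> carrier ?C" "add ?C = (+)" for x by (simp_all add: character_module_def)
  have kC: "ks c \<odot>\<^bsub>?C\<^esub> x = c * x" "g \<in> carrier G ==> kg g \<odot>\<^bsub>?C\<^esub> x = \<chi> g * x" for c g x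
    by (simp_all add: ks_def kg_def character_smult chi_one)
  obtain \<phi> \<psi> where i: "inverse_isos KG T.T V' \<phi> \<psi>" using module_isoE[OF iso[folded T.T_def]] .
  note D = inverse_isosD[OF i]
  \<comment> \<open>The map h induced by scalar multiplication is the inverse of v to 1 \<otimes>
    v.\<close>
  have "balanced (UNIV :: 'k set) (\<lambda>x c. scalar_mult KG ?C c x) ?C (scalar_mult KG V) V V (\<lambda>c v. ks c \<odot>\<^bsub>V\<^esub> v)"
    by (rule balancedI) (simp_all add: V.ks_simps C(2) scalar_mult_KG kC mult.commute additiveD(2)[OF V.ks_additive])
  then obtain h where h: "additive T.T V h" "\<And>c v. c \<in> carrier ?C ==> v \<in> carrier V ==> h (T.tens c v) = ks c \<odot>\<^bsub>V\<^esub> v"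
    using T.TP.TM.lift[OF V.P.M.abelian_group_axioms] by metis
  note ts = T.TP.TM.tens_simps
  have tc: "T.tens c v \<in> carrier T.T" if "v \<in> carrier V" for c v by (rule T.TP.TM.tens_closed[OF C(1) that])
  have t1: "T.tens 1 (ks c \<odot>\<^bsub>V\<^esub> v) = T.tens c v" if "v \<in> carrier V" for c v
    using ts(4)[OF C(1) UNIV_I that, of c 1] by (simp add: scalar_mult_KG kC)
  have sm: "ks c \<odot>\<^bsub>T.T\<^esub> T.tens x v = T.tens (c * x) v" if "v \<in> carrier V" for c x v
    using T.smult_tens[OF one_closed C(1) that, of c x] V.ks_simps(4)[OF that] by (simp add: ks_def[symmetric] kC)
  have sg: "kg g \<odot>\<^bsub>T.T\<^esub> T.tens x v = T.tens (\<chi> g * x) (kg g \<odot>\<^bsub>V\<^esub> v)" if "g \<in> carrier G" "v \<in> carrier V" for g x v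
    using T.smult_tens[OF that(1) C(1) that(2), of 1 x] by (simp add: kg_def[symmetric] kC that)
  have th: "T.tens 1 (h X) = X" if X: "X \<in> carrier T.T" for X
  proof (rule T.TP.TM.additive_eqI[OF T.TP.TM.T_abelian _ _ _ X])
    show "additive T.T T.T (\<lambda>X. T.tens 1 (h X))"
      using additiveD[OF h(1)] tc ts(3)[OF C(1)] by (intro additiveI) simp_all
    show "additive T.T T.T (\<lambda>X. X)" by (rule additiveI) simp_all
  qed (simp add: h(2) C t1)
  have "twisted_iso 1 V V' (\<lambda>v. \<phi> (T.tens 1 v)) (\<lambda>w. h (\<psi> w))"
    unfolding twisted_iso_def
  proof (intro conjI ballI allI)
    show "additive V V' (\<lambda>v. \<phi> (T.tens 1 v))"
      using D(1,5) tc ts(3)[OF C(1)] by (intro additiveI) simp_all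
    fix v assume v: "v \<in> carrier V"
    show "h (\<psi> (\<phi> (T.tens 1 v))) = v" using D(3) tc v h(2) C V.ks_simps(4) by simp
    show "\<phi> (T.tens 1 (ks c \<odot>\<^bsub>V\<^esub> v)) = ks c \<odot>\<^bsub>V'\<^esub> \<phi> (T.tens 1 v)" for c
      using D(6)[OF k_closed(1)[of c] tc[OF v, of 1]] sm[OF v, of c 1] t1[OF v] by simp
    show "kg g \<odot>\<^bsub>V'\<^esub> \<phi> (T.tens 1 v) = ks (\<chi> g ^ 1) \<odot>\<^bsub>V'\<^esub> \<phi> (T.tens 1 (kg g \<odot>\<^bsub>V\<^esub> v))" if g: "g \<in> carrier G" for g
      using D(6)[OF k_closed(2)[OF g] tc[OF v]] D(6)[OF k_closed(1) tc[OF V.ks_simps(2)[OF v g]]]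
        sg[OF g v] sm[OF V.ks_simps(2)[OF v g]] by (metis mult.right_neutral power_one_right)
  next
    fix w assume w: "w \<in> carrier V'"
    show "h (\<psi> w) \<in> carrier V" by (rule additiveD(1)[OF h(1) D(2)[OF w]])
    show "\<phi> (T.tens 1 (h (\<psi> w))) = w" using th[OF D(2)[OF w]] D(4)[OF w] by simp
  qed
  then show thesis by (rule that)
qed

lemma twisted_iso_id: "left_module KG V ==> twisted_iso 0 V V (\<lambda>v. v) (\<lambda>v. v)"
proof -
  assume V: "left_module KG V"
  interpret V: group_module G \<chi> a V by (intro group_moduleI V)
  show ?thesis unfolding twisted_iso_def by (simp add: additive_def V.ks_simps)
qed

lemma twisted_iso_comp:
  assumes V: "left_module KG V" "left_module KG V'" "left_module KG V''"
    and t: "twisted_iso u V V' \<tau> \<tau>'" "twisted_iso u' V' V'' \<upsilon> \<upsilon>'"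
  shows "twisted_iso (u + u') V V'' (\<lambda>v. \<upsilon> (\<tau> v)) (\<lambda>w. \<tau>' (\<upsilon>' w))"
proof -
  interpret V: group_module G \<chi> a V by (intro group_moduleI V)
  interpret V': group_module G \<chi> a V' by (intro group_moduleI V)
  interpret V'': group_module G \<chi> a V'' by (intro group_moduleI V)
  note T = twisted_isoD[OF t(1)] and U = twisted_isoD[OF t(2)]
  note ad = additiveD[OF T(1)] additiveD[OF U(1)]
  show ?thesis
    unfolding twisted_iso_def
  proof (intro conjI ballI allI)
    show "additive V V'' (\<lambda>v. \<upsilon> (\<tau> v))" by (rule additiveI) (simp_all add: ad)
    fix g v assume g: "g \<in> carrier G" and v: "v \<in> carrier V"
    have gv: "kg g \<odot>\<^bsub>V\<^esub> v \<in> carrier V" using V.ks_simps(2)[OF v g] .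
    have "kg g \<odot>\<^bsub>V''\<^esub> \<upsilon> (\<tau> v) = ks (\<chi> g ^ u') \<odot>\<^bsub>V''\<^esub> \<upsilon> (ks (\<chi> g ^ u) \<odot>\<^bsub>V'\<^esub> \<tau> (kg g \<odot>\<^bsub>V\<^esub> v))"
      using U(6)[OF g ad(1)[OF v]] T(6)[OF g v] by simp
    also have "\<dots> = ks (\<chi> g ^ (u + u')) \<odot>\<^bsub>V''\<^esub> \<upsilon> (\<tau> (kg g \<odot>\<^bsub>V\<^esub> v))"
      unfolding U(5)[OF ad(1)[OF gv]] V''.ks_simps(3)[OF ad(3)[OF ad(1)[OF gv]]] by (simp add: power_add mult.commute)
    finally show "kg g \<odot>\<^bsub>V''\<^esub> \<upsilon> (\<tau> v) = ks (\<chi> g ^ (u + u')) \<odot>\<^bsub>V''\<^esub> \<upsilon> (\<tau> (kg g \<odot>\<^bsub>V\<^esub> v))" .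
  qed (simp_all add: T(2-5) U(2-5) ad)
qed

text \<open>Starting u degrees higher is the same as twisting by \<chi>^u, and \<tau> absorbs this
  twist into the coefficients. Only the values of \<chi>^d enter, so d may be changed by multiples
  of the order of \<chi>.\<close>

lemma twisted_iso_string:
  assumes V: "left_module KG V" "left_module KG V'" and t: "twisted_iso u V V' \<tau> \<tau>'"
    and d: "\<And>g. g \<in> carrier G ==> \<chi> g ^ d = \<chi> g ^ d' * \<chi> g ^ u"
  shows "module_iso H (string_module V d n) (string_module V' d' n)"
proof -
  interpret V: group_module G \<chi> a V by (intro group_moduleI V)
  interpret V': group_module G \<chi> a V' by (intro group_moduleI V)
  note T = twisted_isoD[OF t]
  note ad = additiveD[OF T(1)]
  show ?thesis
    unfolding string_module_def
  proof (rule gmod_map[OF V shift_degree_one shift_degree_one, of \<tau> \<tau>'])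
    fix b g v assume g: "g \<in> carrier G" and v: "v \<in> carrier V"
    have gv: "kg g \<odot>\<^bsub>V\<^esub> v \<in> carrier V" using V.ks_simps(2)[OF v g] .
    show "\<tau> (ks (\<chi> g ^ (d + b)) \<odot>\<^bsub>V\<^esub> (kg g \<odot>\<^bsub>V\<^esub> v)) = ks (\<chi> g ^ (d' + b)) \<odot>\<^bsub>V'\<^esub> (kg g \<odot>\<^bsub>V'\<^esub> \<tau> v)"
      unfolding T(5)[OF gv] T(6)[OF g v] V'.ks_simps(3)[OF ad(1)[OF gv]] using d[OF g]
      by (simp add: power_add mult_ac)
  qed (simp_all add: T ad)
qed

end

section \<open>Decomposition of the tensor products\<close>

lemma direct_sum_eqI:
  assumes "\<And>i. i \<in> J ==> M i = M' i"
  shows "direct_sum J M = direct_sum J M'"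
proof -
  have "{i \<in> J. f i \<noteq> \<zero>\<^bsub>M i\<^esub>} = {i \<in> J. f i \<noteq> \<zero>\<^bsub>M' i\<^esub>}" for f using assms by auto
  then show ?thesis unfolding direct_sum_def by (simp add: assms cong: PiE_cong restrict_cong)
qed

lemma direct_sum2_left_module:
  assumes M: "left_module R M" and N: "left_module R N"
  shows "left_module R (M \<oplus>\<^sub>M N)"
proof -
  interpret M: left_module R M by fact
  interpret N: left_module R N by fact
  have ab: "abelian_group (M \<oplus>\<^sub>M N)"
  proof (rule abelian_groupI)
    show "\<exists>y\<in>carrier (M \<oplus>\<^sub>M N). y \<oplus>\<^bsub>M \<oplus>\<^sub>M N\<^esub> x = \<zero>\<^bsub>M \<oplus>\<^sub>M N\<^esub>" if "x \<in> carrier (M \<oplus>\<^sub>M N)" for x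
      using that by (intro bexI[of _ "(\<ominus>\<^bsub>M\<^esub> fst x, \<ominus>\<^bsub>N\<^esub> snd x)"])
        (auto simp: direct_sum2_simps M.M.l_neg N.M.l_neg)
  qed (auto simp: direct_sum2_simps M.M.a_ac N.M.a_ac)
  show ?thesis
    by (rule left_moduleI[OF M.R.ring_axioms ab])
      (auto simp: direct_sum2_simps M.smult_closed N.smult_closed M.smult_l_distr N.smult_l_distr
        M.smult_r_distr N.smult_r_distr M.smult_assoc N.smult_assoc M.smult_one N.smult_one)
qed

lemma direct_sum_triple:
  assumes R: "ring R" and M: "\<And>l m u. l \<in> I ==> m \<in> A ==> u \<in> B ==> left_module R (M l m u)"
  shows "module_iso R (direct_sum I (\<lambda>l. direct_sum A (\<lambda>m. direct_sum B (M l m))))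
      (direct_sum (I \<times> A \<times> B) (\<lambda>j. M (fst j) (fst (snd j)) (snd (snd j))))"
    "left_module R (direct_sum I (\<lambda>l. direct_sum A (\<lambda>m. direct_sum B (M l m))))"
proof -
  have mA: "left_module R (direct_sum A (\<lambda>m. direct_sum B (M l m)))" if "l \<in> I" for l
    by (intro direct_sum_left_module R M that)
  then show "left_module R (direct_sum I (\<lambda>l. direct_sum A (\<lambda>m. direct_sum B (M l m))))"
    by (rule direct_sum_left_module[OF R])
  have mAB: "left_module R (direct_sum (A \<times> B) (\<lambda>p. M l (fst p) (snd p)))" if "l \<in> I" for l
    by (rule direct_sum_left_module[OF R]) (use M that in auto)
  have "module_iso R (direct_sum I (\<lambda>l. direct_sum A (\<lambda>m. direct_sum B (M l m))))
    (direct_sum I (\<lambda>l. direct_sum (A \<times> B) (\<lambda>p. M l (fst p) (snd p))))"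
    by (rule direct_sum_cong[OF direct_sum_Sigma])
      (use mA mAB in \<open>simp_all add: left_module_def\<close>)
  from module_iso_trans[OF this direct_sum_Sigma]
  show "module_iso R (direct_sum I (\<lambda>l. direct_sum A (\<lambda>m. direct_sum B (M l m))))
      (direct_sum (I \<times> A \<times> B) (\<lambda>j. M (fst j) (fst (snd j)) (snd (snd j))))" .
qed

text \<open>The blocks are rectangles of index pairs (m, u), disjoint because their ranges of u are.
  Each block may use its own formula for the summand, which has to agree with M on its own rectangle
  only.\<close>

lemma direct_sum_four_pieces:
  assumes R: "ring R" and M: "\<And>l m u. l \<in> I ==> left_module R (M l m u)"
    and eq: "\<And>l m u. m \<in> A1 ==> u \<in> B1 ==> L1 l m u = M l m u" "\<And>l m u. m \<in> A2 ==> u \<in> B2 ==> L2 l m u = M l m u"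
      "\<And>l m u. m \<in> A3 ==> u \<in> B3 ==> L3 l m u = M l m u" "\<And>l m u. m \<in> A4 ==> u \<in> B4 ==> L4 l m u = M l m u"
    and disj: "B1 \<inter> B2 = {}" "B1 \<inter> B3 = {}" "B1 \<inter> B4 = {}" "B2 \<inter> B3 = {}" "B2 \<inter> B4 = {}" "B3 \<inter> B4 = {}"
    and un: "S = A1 \<times> B1 \<union> A2 \<times> B2 \<union> A3 \<times> B3 \<union> A4 \<times> B4"
  shows "module_iso R (direct_sum (I \<times> S) (\<lambda>j. M (fst j) (fst (snd j)) (snd (snd j))))
    (direct_sum I (\<lambda>l. direct_sum A1 (\<lambda>m. direct_sum B1 (\<lambda>u. L1 l m u))) \<oplus>\<^sub>M
     direct_sum I (\<lambda>l. direct_sum A2 (\<lambda>m. direct_sum B2 (\<lambda>u. L2 l m u))) \<oplus>\<^sub>M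
     direct_sum I (\<lambda>l. direct_sum A3 (\<lambda>m. direct_sum B3 (\<lambda>u. L3 l m u))) \<oplus>\<^sub>M
     direct_sum I (\<lambda>l. direct_sum A4 (\<lambda>m. direct_sum B4 (\<lambda>u. L4 l m u))))"
proof -
  let ?M = "\<lambda>j. M (fst j) (fst (snd j)) (snd (snd j))"
  have cong: "direct_sum I (\<lambda>l. direct_sum A (\<lambda>m. direct_sum B (\<lambda>u. L l m u))) =
    direct_sum I (\<lambda>l. direct_sum A (\<lambda>m. direct_sum B (\<lambda>u. M l m u)))"
    if e: "\<And>l m u. m \<in> A ==> u \<in> B ==> L l m u = M l m u" for A B L
    by (intro direct_sum_eqI) (rule e)
  note t = direct_sum_triple[OF R M]
  let ?D = "\<lambda>A B. direct_sum I (\<lambda>l. direct_sum A (\<lambda>m. direct_sum B (\<lambda>u. M l m u)))"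
  let ?E = "\<lambda>A B. direct_sum (I \<times> A \<times> B) ?M"
  have "module_iso R (?D A1 B1 \<oplus>\<^sub>M ?D A2 B2 \<oplus>\<^sub>M ?D A3 B3 \<oplus>\<^sub>M ?D A4 B4) (?E A1 B1 \<oplus>\<^sub>M ?E A2 B2 \<oplus>\<^sub>M ?E A3 B3 \<oplus>\<^sub>M ?E A4 B4)"
    by (intro direct_sum2_cong t(1)) simp_all
  also have "module_iso R \<dots> (?E A1 B1 \<oplus>\<^sub>M ?E A2 B2 \<oplus>\<^sub>M direct_sum (I \<times> A3 \<times> B3 \<union> I \<times> A4 \<times> B4) ?M)"
    by (intro direct_sum2_cong module_iso_refl direct_sum2_union) (use disj in auto)
  also have "module_iso R \<dots> (?E A1 B1 \<oplus>\<^sub>M direct_sum (I \<times> A2 \<times> B2 \<union> (I \<times> A3 \<times> B3 \<union> I \<times> A4 \<times> B4)) ?M)"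
    by (intro direct_sum2_cong module_iso_refl direct_sum2_union) (use disj in auto)
  also have "module_iso R \<dots> (direct_sum (I \<times> A1 \<times> B1 \<union> (I \<times> A2 \<times> B2 \<union> (I \<times> A3 \<times> B3 \<union> I \<times> A4 \<times> B4))) ?M)"
    by (intro direct_sum2_union) (use disj in auto)
  also have "I \<times> A1 \<times> B1 \<union> (I \<times> A2 \<times> B2 \<union> (I \<times> A3 \<times> B3 \<union> I \<times> A4 \<times> B4)) = I \<times> S" unfolding un by auto
  finally have "module_iso R (?D A1 B1 \<oplus>\<^sub>M ?D A2 B2 \<oplus>\<^sub>M ?D A3 B3 \<oplus>\<^sub>M ?D A4 B4) (direct_sum (I \<times> S) ?M)" .
  then have "module_iso R (direct_sum (I \<times> S) ?M) (?D A1 B1 \<oplus>\<^sub>M ?D A2 B2 \<oplus>\<^sub>M ?D A3 B3 \<oplus>\<^sub>M ?D A4 B4)"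
    by (rule left_module_iso_sym) (intro direct_sum2_left_module t(2))
  then show ?thesis
    by (simp only: cong[of A1 B1 L1, OF eq(1)] cong[of A2 B2 L2, OF eq(2)] cong[of A3 B3 L3, OF eq(3)] cong[of A4 B4 L4, OF eq(4)])
qed

section \<open>Decomposing the coefficients of a string\<close>

context hopf_ore_data
begin

lemma twisted_iso_0: "left_module KG V ==> left_module KG V' ==> inverse_isos KG V V' \<phi> \<psi> ==> twisted_iso 0 V V' \<phi> \<psi>"
proof -
  assume V: "left_module KG V" "left_module KG V'" and i: "inverse_isos KG V V' \<phi> \<psi>"
  interpret V: group_module G \<chi> a V by (intro group_moduleI V)
  interpret V': group_module G \<chi> a V' by (intro group_moduleI V)
  note D = inverse_isosD[OF i]
  show ?thesis unfolding twisted_iso_def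
    by (simp add: additive_def D(1-5) D(6)[OF k_closed(1)] D(6)[OF k_closed(2)] V.ks_simps(2) V'.ks_simps(2) V'.ks_simps(4))
qed

lemma twisted_iso_funpow:
  assumes V: "\<And>l. l \<in> I ==> left_module KG (V l)" and \<sigma>: "\<And>l. l \<in> I ==> \<sigma> l \<in> I"
    and iso: "\<And>l. l \<in> I ==> module_iso KG (tensor_module KG (character_module \<chi>) (V l)) (V (\<sigma> l))" and l: "l \<in> I"
  shows "(\<sigma> ^^ u) l \<in> I" "\<exists>\<tau> \<tau>'. twisted_iso u (V l) (V ((\<sigma> ^^ u) l)) \<tau> \<tau>'"
proof -
  show i: "(\<sigma> ^^ u) l \<in> I" for u by (induction u) (simp_all add: l \<sigma>)
  show "\<exists>\<tau> \<tau>'. twisted_iso u (V l) (V ((\<sigma> ^^ u) l)) \<tau> \<tau>'"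
  proof (induction u)
    case 0
    show ?case using twisted_iso_id[OF V[OF l]] by auto
  next
    case (Suc u)
    then obtain \<tau> \<tau>' where 1: "twisted_iso u (V l) (V ((\<sigma> ^^ u) l)) \<tau> \<tau>'" by blast
    obtain \<upsilon> \<upsilon>' where 2: "twisted_iso 1 (V ((\<sigma> ^^ u) l)) (V (\<sigma> ((\<sigma> ^^ u) l))) \<upsilon> \<upsilon>'"
      using twisted_iso_of_iso[OF V[OF i] V[OF \<sigma>[OF i]] iso[OF i]] .
    show ?case using twisted_iso_comp[OF V[OF l] V[OF i] V[OF \<sigma>[OF i]] 1 2] by auto
  qed
qed

text \<open>A string over P splits as P does; on each summand V l the starting degree d then turns
  into a twist by \<chi>^u, which replaces V l by V' l in a string starting in degree 0.\<close>

lemma string_module_decomposition: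
  assumes P: "left_module KG P" and V: "\<And>l. l \<in> I ==> left_module KG (V l)"
    and iso: "module_iso KG P (direct_sum I (\<lambda>l. copies (c l) (V l)))"
    and V': "\<And>l. l \<in> I ==> left_module KG (V' l)" and tw: "\<And>l. l \<in> I ==> \<exists>\<tau> \<tau>'. twisted_iso u (V l) (V' l) \<tau> \<tau>'"
    and d: "\<And>g. g \<in> carrier G ==> \<chi> g ^ d = \<chi> g ^ u"
  shows "module_iso H (string_module P d n) (direct_sum I (\<lambda>l. copies (c l) (truncated_verma G \<chi> a n (V' l))))"
proof -
  have cV: "left_module KG (copies (c l) (V l))" if "l \<in> I" for l by (rule copies_left_module[OF KG.ring V[OF that]])
  let ?D = "direct_sum I (\<lambda>l. copies (c l) (V l))"
  have D: "left_module KG ?D" by (rule direct_sum_left_module[OF KG.ring cV])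
  obtain \<phi> \<psi> where "inverse_isos KG P ?D \<phi> \<psi>" using module_isoE[OF iso] .
  then have "module_iso H (string_module P d n) (string_module ?D d n)"
    using twisted_iso_string[OF P D twisted_iso_0[OF P D], of _ _ d d n] by simp
  also have "module_iso H \<dots> (direct_sum I (\<lambda>l. string_module (copies (c l) (V l)) d n))"
    by (rule string_module_direct_sum[OF cV])
  also have "module_iso H \<dots> (direct_sum I (\<lambda>l. copies (c l) (truncated_verma G \<chi> a n (V' l))))"
  proof (rule direct_sum_cong)
    fix l assume l: "l \<in> I"
    interpret V': group_module G \<chi> a "V' l" by (intro group_moduleI V' l)
    let ?W = "truncated_verma G \<chi> a n (V' l)"
    note sV = string_left_module[OF V[OF l], of d n] and sV' = string_left_module[OF V'[OF l], of 0 n]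
    obtain \<tau> \<tau>' where "twisted_iso u (V l) (V' l) \<tau> \<tau>'" using tw[OF l] by blast
    then have "module_iso H (string_module (V l) d n) (string_module (V' l) 0 n)"
      by (rule twisted_iso_string[OF V[OF l] V'[OF l]]) (simp add: d)
    also have "module_iso H \<dots> ?W"
      by (rule left_module_iso_sym[OF V'.truncated_verma_string])
    finally have "module_iso H (direct_sum {..<c l} (\<lambda>_. string_module (V l) d n)) (copies (c l) ?W)"
      unfolding copies_def using sV V'.truncated_verma_string(2)
      by (intro direct_sum_cong) (simp_all add: left_module_def)
    then show "module_iso H (string_module (copies (c l) (V l)) d n) (copies (c l) ?W)"
      using string_module_direct_sum[of "{..<c l}" "\<lambda>_. V l" d n] V[OF l] unfolding copies_def
      by (blast intro: module_iso_trans)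
    show "abelian_group (string_module (copies (c l) (V l)) d n)"
      using string_left_module[OF cV[OF l]] by (simp add: left_module_def)
    show "abelian_group (copies (c l) ?W)"
      using copies_left_module[OF H.ring V'.truncated_verma_string(2)] by (simp add: left_module_def)
  qed
  finally show ?thesis .
qed

end

section \<open>The tensor product of two truncated induced modules\<close>

locale tensor_plane = group_tensor G \<chi> a M N + ore_plane G \<chi> a "\<chi> a" s r r' p p'
  for G :: "('g, 'e) monoid_scheme" (structure) and \<chi> :: "'g => 'k::field_char_0" and a
    and M :: "('g \<Rightarrow>\<^sub>0 'k, 'm, 'f) module_scheme" and N :: "('g \<Rightarrow>\<^sub>0 'k, 'n, 'h) module_scheme" and s r r' p p'
begin

abbreviation W where "W \<equiv> truncated_verma G \<chi> a"

lemma tensor_strings: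
  assumes P: "left_module KG T"
  shows "module_iso H (tensor_module H (W n M) (W t N)) (direct_sum {..<t} (\<lambda>d. string_module T d (len d)))"
    "module_iso H (tensor_module H (W t N) (W n M)) (direct_sum {..<t} (\<lambda>d. string_module T d (len d)))"
proof -
  interpret V1: group_module G \<chi> a M by (intro group_moduleI M.left_module_axioms)
  interpret V2: group_module G \<chi> a N by (intro group_moduleI N.left_module_axioms)
  \<comment> \<open>The first order of the factors has parameter \<chi>(a)^-1. Since
    \<open>strlen\<close> does not mention q, the lengths of this second instance are the same
    function.\<close>
  interpret inv: ore_plane G \<chi> a "inverse (\<chi> a)" s r r' p p'
    by (intro ore_plane.intro hopf_ore_data_axioms truncated_plane.intro prim_root_inverse q p le)
  note sM = string_left_module[OF M.left_module_axioms, of 0 n] and sN = string_left_module[OF N.left_module_axioms, of 0 t]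
  have "module_iso H (tensor_module H (W n M) (W t N)) (tensor_module H (string_module M 0 n) (string_module N 0 t))"
    by (intro tensor_module_cong V1.truncated_verma_string V2.truncated_verma_string sM sN)
  also note tensor_strings_box(1)[OF P]
  also have "module_iso H (gmod T ({..<n} \<times> {..<t}) (\<lambda>b. fst b + snd b) (box_matrix (\<lambda>_ _. 1) (\<lambda>k l. inverse (\<chi> a) ^ k)))
    (direct_sum {..<t} (\<lambda>d. string_module T d (len d)))"
    by (rule inv.box_strings[OF P _ _ box_degree_one, of "\<lambda>b. b"]) (auto simp: bij_betw_def)
  finally show "module_iso H (tensor_module H (W n M) (W t N)) (direct_sum {..<t} (\<lambda>d. string_module T d (len d)))" .
  have "module_iso H (tensor_module H (W t N) (W n M)) (tensor_module H (string_module N 0 t) (string_module M 0 n))"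
    by (intro tensor_module_cong V1.truncated_verma_string V2.truncated_verma_string sM sN)
  also note tensor_strings_box(2)[OF P]
  also note box_strings_transposed[OF P]
  finally show "module_iso H (tensor_module H (W t N) (W n M)) (direct_sum {..<t} (\<lambda>d. string_module T d (len d)))" .
qed

lemma tensor_commutes:
  assumes P: "left_module KG T"
  shows "module_iso H (tensor_module H (W n M) (W t N)) (tensor_module H (W t N) (W n M))"
proof -
  interpret V1: group_module G \<chi> a M by (intro group_moduleI M.left_module_axioms)
  interpret V2: group_module G \<chi> a N by (intro group_moduleI N.left_module_axioms)
  interpret T2: ore_tensor G \<chi> a "W t N" "W n M"
    by (intro ore_tensor.intro hopf_ore_data_axioms V1.truncated_verma_string V2.truncated_verma_string)
  have "module_iso H (direct_sum {..<t} (\<lambda>d. string_module T d (len d))) (tensor_module H (W t N) (W n M))"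
    using module_iso_sym[OF tensor_strings(2)[OF P]] T2.TP.TM.T.a_closed T2.smult_T_closed unfolding T2.T_def by blast
  then show ?thesis using tensor_strings(1)[OF P] by (blast intro: module_iso_trans)
qed

text \<open>The starting degrees d < t of the strings, written as d = ms + u.\<close>

definition region where "region = {(m, u). u < s \<and> m * s + u < t}"

lemma region_eq: "region = {(m, u). u < p \<and> m \<le> r} \<union> {(m, u). p \<le> u \<and> u < s \<and> m < r}"
proof -
  have "m * s + u < r * s + p \<longleftrightarrow> (if u < p then m \<le> r else m < r)" if u: "u < s" for m u
  proof -
    consider "m < r" | "m = r" | "m > r" by linarith
    then show ?thesis
    proof cases
      case 1
      then have "Suc m * s \<le> r * s" by (intro mult_le_mono1) simp
      then show ?thesis using 1 u by simp
    next
      case 3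
      then have "Suc r * s \<le> m * s" by (intro mult_le_mono1) simp
      then show ?thesis using 3 p by simp
    qed simp
  qed
  then show ?thesis unfolding region_def t_def using p(1) by (auto split: if_splits)
qed

lemma tensor_region:
  assumes P: "left_module KG T" and V: "\<And>l. l \<in> I ==> left_module KG (V l)"
    and mult: "module_iso KG T (direct_sum I (\<lambda>l. copies (c l) (V l)))" and \<sigma>: "\<And>l. l \<in> I ==> \<sigma> l \<in> I"
    and tw: "\<And>l. l \<in> I ==> module_iso KG (tensor_module KG (character_module \<chi>) (V l)) (V (\<sigma> l))"
    and \<chi>s: "\<And>g. g \<in> carrier G ==> \<chi> g ^ s = 1"
  shows "module_iso H (tensor_module H (W t N) (W n M))
    (direct_sum (I \<times> region) (\<lambda>j. copies (c (fst j)) (W (strlen (fst (snd j)) (snd (snd j))) (V ((\<sigma> ^^ snd (snd j)) (fst j))))))"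
proof -
  have fp: "(\<sigma> ^^ u) l \<in> I" "\<exists>\<tau> \<tau>'. twisted_iso u (V l) (V ((\<sigma> ^^ u) l)) \<tau> \<tau>'" if "l \<in> I" for l u
    by (rule twisted_iso_funpow[of I V \<sigma>]; (assumption | rule V \<sigma> tw that)+)+
  let ?F = "\<lambda>l m u. copies (c l) (W (strlen m u) (V ((\<sigma> ^^ u) l)))"
  have F: "left_module H (?F l m u)" if "l \<in> I" for l m u
  proof -
    have "left_module KG (V ((\<sigma> ^^ u) l))" by (rule V[OF fp(1)[OF that]])
    then interpret V1: group_module G \<chi> a "V ((\<sigma> ^^ u) l)" by (rule group_moduleI)
    show ?thesis by (rule copies_left_module[OF H.ring V1.truncated_verma_string(2)])
  qed
  have s: "s > 0" using p by simp
  note tensor_strings(2)[OF P]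
  also have "module_iso H (direct_sum {..<t} (\<lambda>d. string_module T d (len d))) (direct_sum {..<t} (\<lambda>d. direct_sum I (\<lambda>l. ?F l (d div s) (d mod s))))"
  proof (rule direct_sum_cong)
    fix d
    show "module_iso H (string_module T d (len d)) (direct_sum I (\<lambda>l. ?F l (d div s) (d mod s)))"
    proof (rule string_module_decomposition[OF P V mult, where u = "d mod s"])
      fix l assume l: "l \<in> I"
      show "left_module KG (V ((\<sigma> ^^ (d mod s)) l))" by (rule V[OF fp(1)[OF l]])
      show "\<exists>\<tau> \<tau>'. twisted_iso (d mod s) (V l) (V ((\<sigma> ^^ (d mod s)) l)) \<tau> \<tau>'"
        by (rule fp(2)[OF l])
    next
      fix g assume g: "g \<in> carrier G"
      have "\<chi> g ^ d = \<chi> g ^ (s * (d div s) + d mod s)" by simp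
      also have "\<dots> = (\<chi> g ^ s) ^ (d div s) * \<chi> g ^ (d mod s)" by (simp only: power_add power_mult)
      also have "\<dots> = \<chi> g ^ (d mod s)" by (simp add: \<chi>s[OF g])
      finally show "\<chi> g ^ d = \<chi> g ^ (d mod s)" .
    qed
    show "abelian_group (string_module T d (len d))" using string_left_module[OF P] by (simp add: left_module_def)
    have "left_module H (direct_sum I (\<lambda>l. ?F l (d div s) (d mod s)))" by (rule direct_sum_left_module[OF H.ring F])
    then show "abelian_group (direct_sum I (\<lambda>l. ?F l (d div s) (d mod s)))" by (simp add: left_module_def)
  qed
  also note direct_sum_Sigma
  also have "module_iso H (direct_sum (Sigma {..<t} (\<lambda>_. I)) (\<lambda>j. ?F (snd j) (fst j div s) (fst j mod s)))
    (direct_sum (I \<times> region) (\<lambda>j. ?F (snd (fst (snd j) * s + snd (snd j), fst j))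
      (fst (fst (snd j) * s + snd (snd j), fst j) div s) (fst (fst (snd j) * s + snd (snd j), fst j) mod s)))"
  proof (rule direct_sum_reindex)
    show "bij_betw (\<lambda>j. (fst (snd j) * s + snd (snd j), fst j)) (I \<times> region) (Sigma {..<t} (\<lambda>_. I))"
      by (rule bij_betw_byWitness[where f' = "\<lambda>j. (snd j, fst j div s, fst j mod s)"])
        (use s in \<open>auto simp: region_def\<close>)
  qed
  also have "direct_sum (I \<times> region) (\<lambda>j. ?F (snd (fst (snd j) * s + snd (snd j), fst j))
      (fst (fst (snd j) * s + snd (snd j), fst j) div s) (fst (fst (snd j) * s + snd (snd j), fst j) mod s)) =
    direct_sum (I \<times> region) (\<lambda>j. ?F (fst j) (fst (snd j)) (snd (snd j)))"
    by (rule direct_sum_eqI) (auto simp: region_def)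
  finally show ?thesis .
qed

end

text \<open>In each case the four blocks are the rectangles into which the tests of
  \<open>strlen\<close> cut the index set \<open>region\<close>. The natural subtractions in the
  lengths are exact on the ranges given, since t <= n forces r <= r', and r < r' if p' < p.\<close>

theorem proposition5p5:
  fixes G :: "('g, 'e) monoid_scheme"
    and \<chi> :: "'g \<Rightarrow> 'k::{alg_closed_field, field_char_0}"
    and a :: 'g
    and I :: "'i set"
    and V :: "'i \<Rightarrow> ('g \<Rightarrow>\<^sub>0 'k, 'v) module"
    and \<sigma> :: "'i \<Rightarrow> 'i"
    and N :: "'i \<Rightarrow> 'i \<Rightarrow> 'i \<Rightarrow> nat"
    and i j :: 'i
    and s n t r r' p p' :: nat
  defines "KG \<equiv> (group_hopf_algebra G :: ('k, 'g \<Rightarrow>\<^sub>0 'k) hopf_algebra)"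
    and "H \<equiv> hopf_ore G \<chi> a"
    and "W \<equiv> (\<lambda>m l. truncated_verma G \<chi> a m (V l))"
  assumes "group G" and "finite (carrier G)"
    and "a \<in> carrier G" and "\<forall>g\<in>carrier G. a \<otimes>\<^bsub>G\<^esub> g = g \<otimes>\<^bsub>G\<^esub> a"
    and "\<chi> \<in> carrier (character_group G)"
    and "\<chi> a \<noteq> 1"
    and "group.ord field_units (\<chi> a) = s"
    and "group.ord (character_group G) \<chi> = s"
    and "simple_representatives KG I V"
    and "bij_betw \<sigma> I I"
    and "\<forall>l\<in>I. module_iso KG (tensor_module KG (character_module \<chi>) (V l)) (V (\<sigma> l))"
    and "\<forall>l\<in>I. \<forall>l'\<in>I. multiplicities KG I V (tensor_module KG (V l) (V l')) (N l l')"
    and "i \<in> I" and "j \<in> I"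
    and "n \<ge> t" and "t \<ge> 1"
    and "n = r' * s + p'" and "t = r * s + p" and "p' \<le> s - 1" and "p \<le> s - 1"
  shows
    "(p + p' \<le> s \<longrightarrow>
       (p \<le> p' \<longrightarrow>
          module_iso H (tensor_module H (W n i) (W t j)) (tensor_module H (W t j) (W n i)) \<and>
          module_iso H (tensor_module H (W t j) (W n i))
           (direct_sum I (\<lambda>l. direct_sum {0..r} (\<lambda>m. direct_sum {0..<p} (\<lambda>u.
              copies (N i j l) (W (n + t - 1 - 2 * m * s - 2 * u) ((\<sigma> ^^ u) l))))) \<oplus>\<^sub>M
            direct_sum I (\<lambda>l. direct_sum {0..<r} (\<lambda>m. direct_sum {p..<p'} (\<lambda>u.
              copies (N i j l) (W ((r + r' - 2 * m) * s) ((\<sigma> ^^ u) l))))) \<oplus>\<^sub>M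
            direct_sum I (\<lambda>l. direct_sum {0..<r} (\<lambda>m. direct_sum {p'..<p + p'} (\<lambda>u.
              copies (N i j l) (W (n + t - 1 - 2 * m * s - 2 * u) ((\<sigma> ^^ u) l))))) \<oplus>\<^sub>M
            direct_sum I (\<lambda>l. direct_sum {0..<r} (\<lambda>m. direct_sum {p + p'..<s} (\<lambda>u.
              copies (N i j l) (W ((r + r' - 1 - 2 * m) * s) ((\<sigma> ^^ u) l))))))) \<and>
       (p \<ge> p' \<longrightarrow>
          module_iso H (tensor_module H (W n i) (W t j)) (tensor_module H (W t j) (W n i)) \<and>
          module_iso H (tensor_module H (W t j) (W n i))
           (direct_sum I (\<lambda>l. direct_sum {0..r} (\<lambda>m. direct_sum {0..<p'} (\<lambda>u.
              copies (N i j l) (W (n + t - 1 - 2 * m * s - 2 * u) ((\<sigma> ^^ u) l))))) \<oplus>\<^sub>M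
            direct_sum I (\<lambda>l. direct_sum {0..r} (\<lambda>m. direct_sum {p'..<p} (\<lambda>u.
              copies (N i j l) (W ((r + r' - 2 * m) * s) ((\<sigma> ^^ u) l))))) \<oplus>\<^sub>M
            direct_sum I (\<lambda>l. direct_sum {0..<r} (\<lambda>m. direct_sum {p..<p + p'} (\<lambda>u.
              copies (N i j l) (W (n + t - 1 - 2 * m * s - 2 * u) ((\<sigma> ^^ u) l))))) \<oplus>\<^sub>M
            direct_sum I (\<lambda>l. direct_sum {0..<r} (\<lambda>m. direct_sum {p + p'..<s} (\<lambda>u.
              copies (N i j l) (W ((r + r' - 1 - 2 * m) * s) ((\<sigma> ^^ u) l)))))))) \<and>
     (p + p' \<ge> s + 1 \<longrightarrow> (let mb = p + p' - s - 1 in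
       (p \<le> p' \<longrightarrow>
          module_iso H (tensor_module H (W n i) (W t j)) (tensor_module H (W t j) (W n i)) \<and>
          module_iso H (tensor_module H (W t j) (W n i))
           (direct_sum I (\<lambda>l. direct_sum {0..r} (\<lambda>m. direct_sum {0..mb} (\<lambda>u.
              copies (N i j l) (W ((r + r' + 1 - 2 * m) * s) ((\<sigma> ^^ u) l))))) \<oplus>\<^sub>M
            direct_sum I (\<lambda>l. direct_sum {0..r} (\<lambda>m. direct_sum {mb + 1..<p} (\<lambda>u.
              copies (N i j l) (W (n + t - 1 - 2 * m * s - 2 * u) ((\<sigma> ^^ u) l))))) \<oplus>\<^sub>M
            direct_sum I (\<lambda>l. direct_sum {0..<r} (\<lambda>m. direct_sum {p..<p'} (\<lambda>u.
              copies (N i j l) (W ((r + r' - 2 * m) * s) ((\<sigma> ^^ u) l))))) \<oplus>\<^sub>M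
            direct_sum I (\<lambda>l. direct_sum {0..<r} (\<lambda>m. direct_sum {p'..<s} (\<lambda>u.
              copies (N i j l) (W (n + t - 1 - 2 * m * s - 2 * u) ((\<sigma> ^^ u) l))))))) \<and>
       (p \<ge> p' \<longrightarrow>
          module_iso H (tensor_module H (W n i) (W t j)) (tensor_module H (W t j) (W n i)) \<and>
          module_iso H (tensor_module H (W t j) (W n i))
           (direct_sum I (\<lambda>l. direct_sum {0..r} (\<lambda>m. direct_sum {0..mb} (\<lambda>u.
              copies (N i j l) (W ((r + r' + 1 - 2 * m) * s) ((\<sigma> ^^ u) l))))) \<oplus>\<^sub>M
            direct_sum I (\<lambda>l. direct_sum {0..r} (\<lambda>m. direct_sum {mb + 1..<p'} (\<lambda>u.
              copies (N i j l) (W (n + t - 1 - 2 * m * s - 2 * u) ((\<sigma> ^^ u) l))))) \<oplus>\<^sub>M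
            direct_sum I (\<lambda>l. direct_sum {0..r} (\<lambda>m. direct_sum {p'..<p} (\<lambda>u.
              copies (N i j l) (W ((r + r' - 2 * m) * s) ((\<sigma> ^^ u) l))))) \<oplus>\<^sub>M
            direct_sum I (\<lambda>l. direct_sum {0..<r} (\<lambda>m. direct_sum {p..<s} (\<lambda>u.
              copies (N i j l) (W (n + t - 1 - 2 * m * s - 2 * u) ((\<sigma> ^^ u) l)))))))))"
proof -
  note KG = KG_def and H = H_def and W = W_def and fin = \<open>finite (carrier G)\<close>
    and a = \<open>a \<in> carrier G\<close> and ij = \<open>i \<in> I\<close> \<open>j \<in> I\<close>
    and simple = \<open>simple_representatives KG I V\<close>
    and tw = \<open>\<forall>l\<in>I. module_iso KG (tensor_module KG (character_module \<chi>) (V l)) (V (\<sigma> l))\<close>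
  interpret group G by fact
  interpret C: group "character_group G :: ('g => 'k) monoid" by (rule group_character_group) fact
  have \<chi>hom: "\<chi> \<in> hom G field_units"
    using \<open>\<chi> \<in> carrier (character_group G)\<close> by (simp add: character_group_def)
  interpret O: hopf_ore_data G \<chi> a
    by unfold_locales
      (use \<chi>hom a \<open>\<forall>g\<in>carrier G. a \<otimes>\<^bsub>G\<^esub> g = g \<otimes>\<^bsub>G\<^esub> a\<close> in \<open>auto simp: hom_def field_units_def\<close>)
  have HK: "O.H = H" "O.KG = KG" by (simp_all add: O.H_def O.KG_def H KG)
  have \<chi>s: "\<chi> g ^ s = 1" if "g \<in> carrier G" for g
  proof -
    have "\<chi> [^]\<^bsub>character_group G\<^esub> s = \<one>\<^bsub>character_group G\<^esub>"
      using C.pow_ord_eq_1[OF \<open>\<chi> \<in> carrier (character_group G)\<close>] \<open>group.ord (character_group G) \<chi> = s\<close> by simp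
    then show ?thesis using character_group_pow[OF that, of \<chi> s] that by (simp add: character_group_def)
  qed
  have \<chi>pow: "\<chi> (a [^]\<^bsub>G\<^esub> k) = \<chi> a ^ k" for k :: nat
    by (induction k) (simp_all add: O.chi_one O.chi_mult a mult.commute)
  \<comment> \<open>The order of \<chi>(a) is finite because G is; this rules out the value s = 0,
    which would stand for infinite order.\<close>
  have "\<chi> a ^ card (carrier G) = 1"
    using pow_order_eq_1[OF a] \<chi>pow[of "card (carrier G)"] O.chi_one by (simp add: order_def)
  then have q: "prim_root (\<chi> a) s"
    using fin by (intro prim_root_ord[of _ _ "card (carrier G)"] O.chi_nz a \<open>\<chi> a \<noteq> 1\<close> \<open>group.ord field_units (\<chi> a) = s\<close>)
      (auto simp: card_gt_0_iff)
  then have s: "2 \<le> s" by (simp add: prim_root_def)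
  have ps: "p < s" "p' < s" using s \<open>p' \<le> s - 1\<close> \<open>p \<le> s - 1\<close> by auto
  have V: "left_module O.KG (V l)" if "l \<in> I" for l
    using simple that by (simp add: HK simple_representatives_def simple_module_def)
  interpret T: tensor_plane G \<chi> a "V i" "V j" s r r' p p'
    by (intro tensor_plane.intro group_tensor.intro ore_plane.intro truncated_plane.intro O.hopf_ore_data_axioms V ij q ps)
      (use \<open>n \<ge> t\<close> \<open>n = r' * s + p'\<close> \<open>t = r * s + p\<close> in simp)
  have nt: "T.n = n" "T.t = t" by (simp_all add: T.n_def T.t_def \<open>n = r' * s + p'\<close> \<open>t = r * s + p\<close>)
  have mult: "module_iso O.KG T.T (direct_sum I (\<lambda>l. copies (N i j l) (V l)))"
    using \<open>\<forall>l\<in>I. \<forall>l'\<in>I. multiplicities KG I V (tensor_module KG (V l) (V l')) (N l l')\<close> ij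
    by (simp add: multiplicities_def T.T_def HK)
  \<comment> \<open>The kG-module axioms for the tensor product of V i and V j are pulled back from
    the direct sum of simple modules to which it is isomorphic.\<close>
  have P: "left_module O.KG T.T"
    by (rule left_module_transfer[OF mult _ T.TP.TM.T_abelian T.smult_T_closed])
      (intro direct_sum_left_module copies_left_module O.KG.ring V)
  have \<sigma>: "\<sigma> l \<in> I" if "l \<in> I" for l using bij_betw_apply[OF \<open>bij_betw \<sigma> I I\<close> that] .
  have comm: "module_iso H (tensor_module H (W n i) (W t j)) (tensor_module H (W t j) (W n i))"
    using T.tensor_commutes[OF P] by (simp add: HK nt W)
  have reg: "module_iso H (tensor_module H (W t j) (W n i)) (direct_sum (I \<times> T.region)
    (\<lambda>b. copies (N i j (fst b)) (W (T.strlen (fst (snd b)) (snd (snd b))) ((\<sigma> ^^ snd (snd b)) (fst b)))))"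
    using T.tensor_region[of I V "N i j" \<sigma>, OF P V mult \<sigma> _ \<chi>s] tw by (simp add: HK nt W)
  have F: "left_module H (copies (N i j l) (W m ((\<sigma> ^^ u) l)))" if "l \<in> I" for l m u
  proof -
    have "(\<sigma> ^^ u) l \<in> I" using that by (induction u) (simp_all add: \<sigma>)
    then interpret U: group_module G \<chi> a "V ((\<sigma> ^^ u) l)" by (intro O.group_moduleI V)
    show ?thesis using copies_left_module[OF O.H.ring U.truncated_verma_string(2)] by (simp add: HK W)
  qed
  have pieces: "module_iso H (tensor_module H (W t j) (W n i))
    (direct_sum I (\<lambda>l. direct_sum A1 (\<lambda>m. direct_sum B1 (\<lambda>u. copies (N i j l) (W (L1 m u) ((\<sigma> ^^ u) l))))) \<oplus>\<^sub>M
     direct_sum I (\<lambda>l. direct_sum A2 (\<lambda>m. direct_sum B2 (\<lambda>u. copies (N i j l) (W (L2 m u) ((\<sigma> ^^ u) l))))) \<oplus>\<^sub>M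
     direct_sum I (\<lambda>l. direct_sum A3 (\<lambda>m. direct_sum B3 (\<lambda>u. copies (N i j l) (W (L3 m u) ((\<sigma> ^^ u) l))))) \<oplus>\<^sub>M
     direct_sum I (\<lambda>l. direct_sum A4 (\<lambda>m. direct_sum B4 (\<lambda>u. copies (N i j l) (W (L4 m u) ((\<sigma> ^^ u) l))))))"
    if "\<And>m u. u \<in> B1 ==> L1 m u = T.strlen m u" "\<And>m u. u \<in> B2 ==> L2 m u = T.strlen m u"
      "\<And>m u. u \<in> B3 ==> L3 m u = T.strlen m u" "\<And>m u. u \<in> B4 ==> L4 m u = T.strlen m u"
      "B1 \<inter> B2 = {}" "B1 \<inter> B3 = {}" "B1 \<inter> B4 = {}" "B2 \<inter> B3 = {}" "B2 \<inter> B4 = {}" "B3 \<inter> B4 = {}"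
      "T.region = A1 \<times> B1 \<union> A2 \<times> B2 \<union> A3 \<times> B3 \<union> A4 \<times> B4"
    for A1 A2 A3 A4 B1 B2 B3 B4 :: "nat set" and L1 L2 L3 L4
    by (rule module_iso_trans[OF reg direct_sum_four_pieces[OF O.H.ring[unfolded HK] F]]) (simp_all only: that)
  note strlen = T.strlen_def[unfolded nt] and region = T.region_eq
  \<comment> \<open>What is left in each of the four cases is arithmetic: the stated lengths agree
    with \<open>strlen\<close> on their ranges of u, and the four rectangles partition
    \<open>region\<close>.\<close>
  show ?thesis
    unfolding Let_def
    by (intro conjI impI comm pieces) (use ps in \<open>auto simp: strlen region\<close>)
qed

end
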